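(* For every initial datum $X_0=(\zeta_0,U_0,\Gamma_0,R_0,H_0)\in\mathbb G$, the Lagrangian system $$\zeta_t=U,\quad U_t=-Q_1,\quad \Gamma_t=-Q_2-P_3,\quad R_t=-P_2-Q_3,\quad H_t=U^3-2P_1U-2P_2\Gamma-2Q_3\Gamma$$ has a unique global solution $X(t)=(\zeta(t),U(t),\Gamma(t),R(t),H(t))$ with $X(0)=X_0$, $X(t)\in\mathbb G$ for all $t>0$, and $X\in C^1(\mathbb R_+;E)$. Moreover, the mapping $S:\mathbb G\times\mathbb R_+\to\mathbb G$, $(X_0,t)\mapsto S_t(X_0):=X(t)$, is a continuous semigroup. Furthermore, for any $M,T>0$, setting $B_M=\{X\in\mathbb G : \|X\|_E\le M\}$, there exists a constant $C=C(M,T)>0$ such that $$\|S_t(X_\alpha)-S_t(X_\beta)\|_E\le C\,\|X_\alpha-X_\beta\|_E$$ for all $X_\alpha,X_\beta\in B_M$ and all $t\in[0,T]$.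
   Context: All function spaces are over $\mathbb R$ (variable $\xi$). $V=\{f\in C(\mathbb R)\cap L^\infty : f_\xi\in L^2\}$ with norm $\|f\|_V=\|f\|_{L^\infty}+\|f_\xi\|_{L^2}$. $E=V\times H^1\times H^1\times(L^\infty\cap L^2)\times V$, with norm $\|X\|_E=\|\zeta\|_V+\|U\|_{H^1}+\|\Gamma\|_{H^1}+\|R\|_{L^\infty}+\|R\|_{L^2}+\|H\|_V$ for $X=(\zeta,U,\Gamma,R,H)$. $\mathrm{Id}$ denotes the identity function of $\mathbb R$. For $X=(\zeta,U,\Gamma,R,H)\in E$ put $y=\zeta+\mathrm{Id}$, $s=\mathrm{sgn}(\xi-\eta)$, and define $P_1(\xi)=\frac14\int_{\mathbb R}e^{-s(y(\xi)-y(\eta))}(U^2y_\xi-2R^2y_\xi+H_\xi)(\eta)\,d\eta$, $P_2(\xi)=\frac12\int_{\mathbb R}e^{-s(y(\xi)-y(\eta))}(RU_\xi)(\eta)\,d\eta$, $P_3(\xi)=\frac12\int_{\mathbb R}e^{-s(y(\xi)-y(\eta))}(\Gamma U_\xi)(\eta)\,d\eta$, $Q_1(\xi)=-\frac14\int_{\mathbb R}s\,e^{-s(y(\xi)-y(\eta))}(U^2y_\xi-2R^2y_\xi+H_\xi)(\eta)\,d\eta$, $Q_2(\xi)=-\frac12\int_{\mathbb R}s\,e^{-s(y(\xi)-y(\eta))}(RU_\xi)(\eta)\,d\eta$, $Q_3(\xi)=-\frac12\int_{\mathbb R}s\,e^{-s(y(\xi)-y(\eta))}(\Gamma U_\xi)(\eta)\,d\eta$.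 The set $\mathbb G$ consists of all $(\zeta,U,\Gamma,R,H)\in E$ such that, with $y=\zeta+\mathrm{Id}$: (1) $(\zeta,U,\Gamma,H)\in(W^{1,\infty})^4$; (2) $y_\xi\ge0$, $H_\xi\ge0$, $y_\xi+H_\xi>0$ a.e. on $\mathbb R$, and $\lim_{\xi\to-\infty}H(\xi)=0$; (3) $Ry_\xi=\Gamma_\xi$ a.e. on $\mathbb R$; (4) $y_\xi H_\xi=y_\xi^2(U^2+\Gamma^2+R^2)+U_\xi^2$ a.e. on $\mathbb R$. $\mathbb G$ carries the metric induced by $\|\cdot\|_E$. "Continuous semigroup" means: $S_0=\mathrm{id}$, $S_{t+s}=S_t\circ S_s$ for $s,t\ge0$, and $(X,t)\mapsto S_t(X)$ is continuous. *)

theory Defs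
  imports "HOL-Analysis.Analysis" "HOL-Probability.Essential_Supremum"
begin

section \<open>Function spaces over the real line\<close>

definition locally_integrable :: "(real \<Rightarrow> real) \<Rightarrow> bool" where
  "locally_integrable f \<longleftrightarrow>
     f \<in> borel_measurable borel \<and> (\<forall>a b. set_integrable lborel {a..b} f)"

text \<open>Weak derivatives are tested against compactly supported, continuously differentiable
  functions, as is usual in one space dimension.\<close>

definition test_function :: "(real \<Rightarrow> real) \<Rightarrow> (real \<Rightarrow> real) \<Rightarrow> bool" where
  "test_function \<phi> \<phi>' \<longleftrightarrow>
     (\<forall>x. (\<phi> has_real_derivative \<phi>' x) (at x)) \<and> continuous_on UNIV \<phi>' \<and>
     (\<exists>K. compact K \<and> (\<forall>x. x \<notin> K \<longrightarrow> \<phi> x = 0))"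

definition has_weak_deriv :: "(real \<Rightarrow> real) \<Rightarrow> (real \<Rightarrow> real) \<Rightarrow> bool" where
  "has_weak_deriv f g \<longleftrightarrow> locally_integrable f \<and> locally_integrable g \<and>
     (\<forall>\<phi> \<phi>'. test_function \<phi> \<phi>' \<longrightarrow>
        (LINT x|lborel. f x * \<phi>' x) = - (LINT x|lborel. g x * \<phi> x))"

text \<open>A representative of the weak derivative, which is unique up to null sets
  (\<open>has_weak_deriv_unique\<close> below).\<close>

definition wderiv :: "(real \<Rightarrow> real) \<Rightarrow> real \<Rightarrow> real" where
  "wderiv f = (SOME g. has_weak_deriv f g)"

definition Linf :: "(real \<Rightarrow> real) set" where
  "Linf = {f \<in> borel_measurable borel. esssup lborel (\<lambda>x. ereal \<bar>f x\<bar>) < \<infinity>}"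

definition Linf_norm :: "(real \<Rightarrow> real) \<Rightarrow> real" where
  "Linf_norm f = real_of_ereal (esssup lborel (\<lambda>x. ereal \<bar>f x\<bar>))"

definition L2 :: "(real \<Rightarrow> real) set" where
  "L2 = {f \<in> borel_measurable borel. integrable lborel (\<lambda>x. (f x)\<^sup>2)}"

definition L2_norm :: "(real \<Rightarrow> real) \<Rightarrow> real" where
  "L2_norm f = sqrt (LINT x|lborel. (f x)\<^sup>2)"

definition W1inf :: "(real \<Rightarrow> real) set" where
  "W1inf = {f \<in> Linf. \<exists>g\<in>Linf. has_weak_deriv f g}"

definition V :: "(real \<Rightarrow> real) set" where
  "V = {f \<in> Linf. continuous_on UNIV f \<and> (\<exists>g\<in>L2. has_weak_deriv f g)}"

definition V_norm :: "(real \<Rightarrow> real) \<Rightarrow> real" where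
  "V_norm f = Linf_norm f + L2_norm (wderiv f)"

text \<open>Elements of \<open>H\<^sup>1\<close> are identified with their (unique) continuous representatives.\<close>

definition H1 :: "(real \<Rightarrow> real) set" where
  "H1 = {f \<in> L2. continuous_on UNIV f \<and> (\<exists>g\<in>L2. has_weak_deriv f g)}"

definition H1_norm :: "(real \<Rightarrow> real) \<Rightarrow> real" where
  "H1_norm f = sqrt ((L2_norm f)\<^sup>2 + (L2_norm (wderiv f))\<^sup>2)"

subsection \<open>Uniqueness of weak derivatives\<close>

lemma test_function_bump:
  fixes a b :: real and n :: nat
  assumes ab: "a \<le> b"
  defines "\<theta> \<equiv> \<lambda>x. (max 0 ((x - a) * (b - x)))\<^sup>2"
  shows "\<exists>\<phi>'. test_function (\<lambda>x. real n * \<theta> x / (1 + real n * \<theta> x)) \<phi>'"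
proof -
  define q where "q = (\<lambda>x::real. (x - a) * (b - x))"
  define \<theta>' where "\<theta>' = (\<lambda>x. 2 * max 0 (q x) * (b + a - 2 * x))"
  have m: "((\<lambda>u::real. (max 0 u)\<^sup>2) has_real_derivative 2 * max 0 u) (at u)" for u
  proof (cases "u = 0")
    case True
    have "((\<lambda>h::real. (max 0 h)\<^sup>2 / h) \<longlongrightarrow> 0) (at 0)"
    proof (rule tendsto_rabs_zero_cancel, rule tendsto_sandwich[of "\<lambda>_. 0" _ _ "\<lambda>h. \<bar>h\<bar>"])
      show "\<forall>\<^sub>F h in at 0. \<bar>(max 0 h)\<^sup>2 / h\<bar> \<le> \<bar>h::real\<bar>"
        by (rule always_eventually) (auto simp: max_def power2_eq_square)
      show "((\<lambda>h::real. \<bar>h\<bar>) \<longlongrightarrow> 0) (at 0)"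
        by (rule tendsto_rabs_zero) simp
    qed auto
    then show ?thesis using True by (simp add: DERIV_def)
  next
    case False
    then consider "u < 0" | "u > 0" by linarith
    then show ?thesis
    proof cases
      case 1
      have "((\<lambda>u::real. 0) has_real_derivative 2 * max 0 u) (at u)" using 1 by simp
      then show ?thesis
        by (rule has_field_derivative_transform_within_open[where S="{..<0}"]) (use 1 in auto)
    next
      case 2
      have "((\<lambda>u::real. u\<^sup>2) has_real_derivative 2 * max 0 u) (at u)"
        using 2 by (auto intro!: derivative_eq_intros)
      then show ?thesis
        by (rule has_field_derivative_transform_within_open[where S="{0<..}"]) (use 2 in auto)
    qed
  qed
  have q: "(q has_real_derivative (b + a - 2 * x)) (at x)" for x
    unfolding q_def by (auto intro!: derivative_eq_intros)
  have t: "(\<theta> has_real_derivative \<theta>' x) (at x)" for x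
    using DERIV_chain2[OF m q, of x] unfolding \<theta>_def \<theta>'_def q_def .
  have pos: "1 + real n * \<theta> x > 0" for x
    unfolding \<theta>_def by (intro add_pos_nonneg) auto
  have cq: "continuous_on UNIV q" unfolding q_def by (intro continuous_intros)
  have ct: "continuous_on UNIV \<theta>" unfolding \<theta>_def by (intro continuous_intros)
  have ct': "continuous_on UNIV \<theta>'" unfolding \<theta>'_def by (intro continuous_intros cq)
  have "test_function (\<lambda>x. real n * \<theta> x / (1 + real n * \<theta> x))
     (\<lambda>x. real n * \<theta>' x / (1 + real n * \<theta> x)\<^sup>2)"
    unfolding test_function_def
  proof (intro conjI allI exI)
    fix x
    show "((\<lambda>x. real n * \<theta> x / (1 + real n * \<theta> x)) has_real_derivative
             real n * \<theta>' x / (1 + real n * \<theta> x)\<^sup>2) (at x)"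
      using pos[of x]
      by (auto intro!: derivative_eq_intros t simp: field_simps power2_eq_square)
  next
    show "continuous_on UNIV (\<lambda>x. real n * \<theta>' x / (1 + real n * \<theta> x)\<^sup>2)"
      using pos by (intro continuous_intros ct ct') (auto simp: less_le)
  next
    show "compact {a..b}" by simp
  next
    fix x
    have "(x - a) * (b - x) \<le> 0" if "x \<notin> {a..b}"
      using that ab by (cases "x < a") (auto simp: mult_nonneg_nonpos mult_nonpos_nonneg)
    then show "x \<notin> {a..b} \<longrightarrow> real n * \<theta> x / (1 + real n * \<theta> x) = 0"
      unfolding \<theta>_def by (auto simp: max_def not_le)
  qed
  then show ?thesis by blast
qed

lemma test_function_bounded:
  assumes "test_function \<phi> \<phi>'"
  obtains a b C where "\<And>x. \<bar>\<phi> x\<bar> \<le> C * indicator {a..b} x" "C \<ge> 0"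
    "\<phi> \<in> borel_measurable borel"
    "\<And>x. \<bar>\<phi>' x\<bar> \<le> C * indicator {a..b} x" "\<phi>' \<in> borel_measurable borel"
proof -
  from assms obtain K where K: "compact K" "\<And>x. x \<notin> K \<Longrightarrow> \<phi> x = 0"
    and d: "\<And>x. (\<phi> has_real_derivative \<phi>' x) (at x)" and c': "continuous_on UNIV \<phi>'"
    unfolding test_function_def by blast
  obtain c where c: "K \<subseteq> cbox (-c) c"
    using bounded_subset_cbox_symmetric[OF compact_imp_bounded[OF K(1)]] by blast
  have cont: "continuous_on UNIV \<phi>"
    using d DERIV_continuous_on[of UNIV \<phi> \<phi>'] by simp
  have z': "\<phi>' x = 0" if "x \<notin> {-c..c}" for x
  proof (rule DERIV_unique[OF d])
    have "((\<lambda>x. 0) has_real_derivative 0) (at x)" by simp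
    then show "(\<phi> has_real_derivative 0) (at x)"
      by (rule has_field_derivative_transform_within_open[where S="- {-c..c}"])
         (use that K(2) c in \<open>force+\<close>)
  qed
  have "bounded (\<phi> ` {-c..c})" "bounded (\<phi>' ` {-c..c})"
    by (intro compact_imp_bounded compact_continuous_image continuous_on_subset[OF cont]
        continuous_on_subset[OF c']; simp)+
  then obtain C1 C2 where C: "\<And>x. x \<in> {-c..c} \<Longrightarrow> \<bar>\<phi> x\<bar> \<le> C1" "\<And>x. x \<in> {-c..c} \<Longrightarrow> \<bar>\<phi>' x\<bar> \<le> C2"
    unfolding bounded_iff by (metis imageI real_norm_def)
  show ?thesis
  proof (rule that[of "max 0 (max C1 C2)" "-c" c])
    show "\<phi> \<in> borel_measurable borel" "\<phi>' \<in> borel_measurable borel"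
      using cont c' by (auto intro: borel_measurable_continuous_onI)
    show "\<bar>\<phi> x\<bar> \<le> max 0 (max C1 C2) * indicator {- c..c} x" for x
    proof (cases "x \<in> {-c..c}")
      case False
      then have "x \<notin> K" using c by auto
      then show ?thesis using K(2) False by simp
    qed (use C(1)[of x] in auto)
    show "\<bar>\<phi>' x\<bar> \<le> max 0 (max C1 C2) * indicator {- c..c} x" for x
      using C(2)[of x] z'[of x] by (auto simp: indicator_def)
  qed simp
qed

lemma integrable_mult_bounded_support:
  assumes f: "locally_integrable f" and m: "\<phi> \<in> borel_measurable borel"
    and b: "\<And>x. \<bar>\<phi> x\<bar> \<le> C * indicator {a..b} x"
  shows "integrable lborel (\<lambda>x. f x * \<phi> x)"
proof (rule Bochner_Integration.integrable_bound)
  have "set_integrable lborel {a..b} f" using f unfolding locally_integrable_def by blast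
  then have "integrable lborel (\<lambda>x. indicator {a..b} x *\<^sub>R f x)"
    unfolding set_integrable_def .
  then show "integrable lborel (\<lambda>x. C * \<bar>indicator {a..b} x *\<^sub>R f x\<bar>)"
    by (intro integrable_mult_right integrable_abs)
  show "(\<lambda>x. f x * \<phi> x) \<in> borel_measurable lborel"
    using f m unfolding locally_integrable_def by (simp add: borel_measurable_times)
  show "AE x in lborel. norm (f x * \<phi> x) \<le> norm (C * \<bar>indicator {a..b} x *\<^sub>R f x\<bar>)"
  proof (rule AE_I2)
    fix x
    show "norm (f x * \<phi> x) \<le> norm (C * \<bar>indicator {a..b} x *\<^sub>R f x\<bar>)"
    proof (cases "x \<in> {a..b}")
      case True
      then have "\<bar>\<phi> x\<bar> \<le> \<bar>C\<bar>" using b[of x] by simp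
      then have "\<bar>\<phi> x\<bar> * \<bar>f x\<bar> \<le> \<bar>C\<bar> * \<bar>f x\<bar>" by (rule mult_right_mono) simp
      then show ?thesis using True by (simp add: abs_mult mult.commute)
    next
      case False
      then show ?thesis using b[of x] by simp
    qed
  qed
qed

lemma test_function_integrable:
  assumes "test_function \<phi> \<phi>'" "locally_integrable f"
  shows "integrable lborel (\<lambda>x. f x * \<phi> x)" "integrable lborel (\<lambda>x. f x * \<phi>' x)"
proof -
  obtain a b C where b: "\<And>x. \<bar>\<phi> x\<bar> \<le> C * indicator {a..b} x" "0 \<le> C"
    "\<phi> \<in> borel_measurable borel" "\<And>x. \<bar>\<phi>' x\<bar> \<le> C * indicator {a..b} x" "\<phi>' \<in> borel_measurable borel"
    by (rule test_function_bounded[OF assms(1)]) (rule that)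
  show "integrable lborel (\<lambda>x. f x * \<phi> x)"
    by (rule integrable_mult_bounded_support[OF assms(2) b(3) b(1)])
  show "integrable lborel (\<lambda>x. f x * \<phi>' x)"
    by (rule integrable_mult_bounded_support[OF assms(2) b(5) b(4)])
qed

lemma locally_integrable_add:
  assumes "locally_integrable f" "locally_integrable g"
  shows "locally_integrable (\<lambda>x. f x + g x)"
  unfolding locally_integrable_def
proof (intro conjI allI)
  show "(\<lambda>x. f x + g x) \<in> borel_measurable borel"
    using assms unfolding locally_integrable_def by (intro borel_measurable_add) blast+
  show "set_integrable lborel {a..b} (\<lambda>x. f x + g x)" for a b
    using assms unfolding locally_integrable_def by (intro set_integral_add(1)) blast+
qed

lemma locally_integrable_cmult:
  assumes "locally_integrable f"
  shows "locally_integrable (\<lambda>x. c * f x)"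
  unfolding locally_integrable_def
proof (intro conjI allI)
  show "(\<lambda>x. c * f x) \<in> borel_measurable borel"
    using assms unfolding locally_integrable_def
    by (intro borel_measurable_times borel_measurable_const) blast
  show "set_integrable lborel {a..b} (\<lambda>x. c * f x)" for a b
    using assms unfolding locally_integrable_def by (intro set_integrable_mult_right) blast
qed

lemma AE_zero_if_tests_zero:
  assumes h: "locally_integrable h"
    and z: "\<And>\<phi> \<phi>'. test_function \<phi> \<phi>' \<Longrightarrow> (LINT x|lborel. h x * \<phi> x) = 0"
  shows "AE x in lborel. h x = 0"
proof -
  have hm[measurable]: "h \<in> borel_measurable borel"
    using h unfolding locally_integrable_def by blast
  have hi: "integrable lborel (\<lambda>x. indicator {a..b} x *\<^sub>R h x)" for a b
    using h unfolding locally_integrable_def set_integrable_def by blast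
  have int0: "(LINT x|lborel. indicator {a<..<b} x * h x) = 0" if ab: "a \<le> b" for a b
  proof -
    define \<theta> where "\<theta> = (\<lambda>x. (max 0 ((x - a) * (b - x)))\<^sup>2 :: real)"
    define \<phi> where "\<phi> = (\<lambda>n x. real n * \<theta> x / (1 + real n * \<theta> x))"
    have t: "\<exists>\<phi>'. test_function (\<phi> n) \<phi>'" for n
      unfolding \<phi>_def \<theta>_def using test_function_bump[OF ab] .
    have \<theta>0: "\<theta> x \<ge> 0" for x unfolding \<theta>_def by simp
    have m[measurable]: "\<phi> n \<in> borel_measurable borel" for n
      using t[of n] test_function_bounded by blast
    have out: "\<theta> x = 0" if "x \<notin> {a<..<b}" for x
    proof -
      have "(x - a) * (b - x) \<le> 0"
        using that ab by (cases "x \<le> a") (auto simp: mult_nonneg_nonpos mult_nonpos_nonneg)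
      then show ?thesis unfolding \<theta>_def by (simp add: max_def)
    qed
    have ins: "\<theta> x > 0" if "x \<in> {a<..<b}" for x
      using that unfolding \<theta>_def by (auto simp: max_def not_le)
    have lim: "(\<lambda>n. \<phi> n x) \<longlonglongrightarrow> indicator {a<..<b} x" for x
    proof (cases "x \<in> {a<..<b}")
      case True
      have "(\<lambda>n. 1 - inverse (1 + real n * \<theta> x)) \<longlonglongrightarrow> 1 - 0"
      proof (intro tendsto_diff tendsto_const tendsto_inverse_0_at_top
          filterlim_tendsto_add_at_top[OF tendsto_const]
          filterlim_at_top_mult_tendsto_pos[OF tendsto_const])
        show "0 < \<theta> x" using ins[OF True] .
      qed (rule filterlim_real_sequentially)
      moreover have "\<phi> n x = 1 - inverse (1 + real n * \<theta> x)" for n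
      proof -
        have "1 + real n * \<theta> x > 0" using \<theta>0[of x] by (intro add_pos_nonneg) auto
        then show ?thesis unfolding \<phi>_def by (simp add: field_simps)
      qed
      ultimately show ?thesis using True by simp
    next
      case False
      then show ?thesis using out[OF False] unfolding \<phi>_def by simp
    qed
    have bd: "\<bar>\<phi> n x\<bar> \<le> indicator {a..b} x" for n x
    proof (cases "x \<in> {a<..<b}")
      case True
      have "real n * \<theta> x \<ge> 0" using \<theta>0[of x] by simp
      then have "\<bar>\<phi> n x\<bar> \<le> 1" unfolding \<phi>_def by (simp add: field_simps)
      then show ?thesis using True by (auto simp: indicator_def)
    next
      case False
      then show ?thesis using out[OF False] unfolding \<phi>_def by simp
    qed
    have "(\<lambda>n. LINT x|lborel. h x * \<phi> n x) \<longlonglongrightarrow> (LINT x|lborel. h x * indicator {a<..<b} x)"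
    proof (rule integral_dominated_convergence[where w="\<lambda>x. \<bar>indicator {a..b} x *\<^sub>R h x\<bar>"])
      show "AE x in lborel. (\<lambda>n. h x * \<phi> n x) \<longlonglongrightarrow> h x * indicator {a<..<b} x"
        by (intro AE_I2 tendsto_mult tendsto_const lim)
      show "AE x in lborel. norm (h x * \<phi> n x) \<le> \<bar>indicator {a..b} x *\<^sub>R h x\<bar>" for n
      proof (rule AE_I2)
        fix x
        show "norm (h x * \<phi> n x) \<le> \<bar>indicator {a..b} x *\<^sub>R h x\<bar>"
          using mult_left_mono[OF bd[of n x], of "\<bar>h x\<bar>"]
          by (simp add: abs_mult mult.commute)
      qed
    qed (use hi in \<open>auto intro: integrable_abs\<close>)
    moreover have "(LINT x|lborel. h x * \<phi> n x) = 0" for n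
      using t[of n] z by blast
    ultimately show ?thesis
      using LIMSEQ_unique tendsto_const by (simp add: mult.commute LIMSEQ_const_iff)
  qed
  have "AE x in lborel. x \<in> {-real N<..<real N} \<longrightarrow> h x = 0" for N :: nat
  proof -
    let ?k = "\<lambda>x. indicator {-real N<..<real N} x * h x"
    have ki: "integrable lborel ?k"
    proof (rule Bochner_Integration.integrable_bound[OF hi[of "- real N" "real N"]])
      show "AE x in lborel. norm (?k x) \<le> norm (indicator {- real N..real N} x *\<^sub>R h x)"
        by (auto simp: indicator_def)
    qed simp
    let ?p = "\<lambda>x. ennreal (?k x)" and ?n = "\<lambda>x. ennreal (- ?k x)"
    have eq: "(\<integral>\<^sup>+x\<in>{c<..}. ?p x \<partial>lborel) = (\<integral>\<^sup>+x\<in>{c<..}. ?n x \<partial>lborel)" 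
      and fin: "(\<integral>\<^sup>+x\<in>{c<..}. ?p x \<partial>lborel) < \<infinity>" for c
    proof -
      let ?kc = "\<lambda>x. indicator {max c (-real N)<..<real N} x * h x"
      have kc: "indicator {c<..} x * ?k x = ?kc x" for x by (auto simp: indicator_def)
      have kci: "integrable lborel ?kc"
        using integrable_real_mult_indicator[OF _ ki, of "{c<..}"]
        unfolding kc[symmetric] by (simp add: mult.commute)
      have "(LINT x|lborel. ?kc x) = 0"
      proof (cases "max c (-real N) \<le> real N")
        case False
        then have "?kc = (\<lambda>x. 0)" by (auto simp: indicator_def fun_eq_iff)
        then show ?thesis by simp
      qed (rule int0)
      then have e: "enn2real (\<integral>\<^sup>+x. ennreal (?kc x) \<partial>lborel)
          = enn2real (\<integral>\<^sup>+x. ennreal (- ?kc x) \<partial>lborel)"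
        using real_lebesgue_integral_def[OF kci] by simp
      have f1: "(\<integral>\<^sup>+x. ennreal (?kc x) \<partial>lborel) < top" and f2: "(\<integral>\<^sup>+x. ennreal (- ?kc x) \<partial>lborel) < top"
        using kci unfolding real_integrable_def less_top[symmetric] infinity_ennreal_def by blast+
      have p: "(\<integral>\<^sup>+x\<in>{c<..}. ?p x \<partial>lborel) = (\<integral>\<^sup>+x. ennreal (?kc x) \<partial>lborel)"
        by (intro nn_integral_cong) (auto simp: indicator_def)
      have n: "(\<integral>\<^sup>+x\<in>{c<..}. ?n x \<partial>lborel) = (\<integral>\<^sup>+x. ennreal (- ?kc x) \<partial>lborel)"
        by (intro nn_integral_cong) (auto simp: indicator_def)
      show "(\<integral>\<^sup>+x\<in>{c<..}. ?p x \<partial>lborel) < \<infinity>" unfolding p infinity_ennreal_def by (rule f1)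
      show "(\<integral>\<^sup>+x\<in>{c<..}. ?p x \<partial>lborel) = (\<integral>\<^sup>+x\<in>{c<..}. ?n x \<partial>lborel)"
        unfolding p n using arg_cong[OF e, of ennreal]
        unfolding ennreal_enn2real[OF f1] ennreal_enn2real[OF f2] .
    qed
    have "density lborel ?p = density lborel ?n"
      by (rule measure_eqI_lessThan) (use eq fin in \<open>auto simp: emeasure_density\<close>)
    then have "AE x in lborel. ?p x = ?n x"
      by (rule sigma_finite_measure.density_unique[OF lborel.sigma_finite_measure_axioms, rotated 2]) auto
    then show ?thesis
    proof eventually_elim
      case (elim x)
      then show ?case
        by (cases "h x" "0::real" rule: linorder_cases) (auto simp: ennreal_neg ennreal_eq_0_iff)
    qed
  qed
  then have "AE x in lborel. \<forall>N::nat. x \<in> {-real N<..<real N} \<longrightarrow> h x = 0"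
    unfolding AE_all_countable by blast
  then show ?thesis
  proof eventually_elim
    case (elim x)
    obtain N :: nat where "\<bar>x\<bar> < real N" using reals_Archimedean2 by blast
    then have "x \<in> {-real N<..<real N}" by auto
    then show ?case using elim by blast
  qed
qed

lemma has_weak_deriv_unique:
  assumes "has_weak_deriv f g" "has_weak_deriv f g'"
  shows "AE x in lborel. g x = g' x"
proof -
  have l: "locally_integrable g" "locally_integrable g'"
    using assms unfolding has_weak_deriv_def by auto
  have "AE x in lborel. g x + (-1) * g' x = 0"
  proof (rule AE_zero_if_tests_zero)
    show "locally_integrable (\<lambda>x. g x + (-1) * g' x)"
      by (intro locally_integrable_add locally_integrable_cmult l)
  next
    fix \<phi> \<phi>' assume t: "test_function \<phi> \<phi>'"
    have i: "integrable lborel (\<lambda>x. g x * \<phi> x)" "integrable lborel (\<lambda>x. g' x * \<phi> x)"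
      using test_function_integrable(1)[OF t] l by auto
    have "(LINT x|lborel. f x * \<phi>' x) = - (LINT x|lborel. g x * \<phi> x)"
        "(LINT x|lborel. f x * \<phi>' x) = - (LINT x|lborel. g' x * \<phi> x)"
      using assms t unfolding has_weak_deriv_def by blast+
    then have "(LINT x|lborel. g x * \<phi> x) = (LINT x|lborel. g' x * \<phi> x)" by simp
    then show "(LINT x|lborel. (g x + (-1) * g' x) * \<phi> x) = 0"
      using i by (simp add: algebra_simps)
  qed
  then show ?thesis by eventually_elim simp
qed

lemma has_weak_deriv_wderiv: "has_weak_deriv f g \<Longrightarrow> has_weak_deriv f (wderiv f)"
  unfolding wderiv_def by (rule someI[of "has_weak_deriv f"])

lemma wderiv_AE: "has_weak_deriv f g \<Longrightarrow> AE x in lborel. wderiv f x = g x"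
  using has_weak_deriv_unique has_weak_deriv_wderiv by blast

lemma has_weak_deriv_add:
  assumes "has_weak_deriv f f'" "has_weak_deriv g g'"
  shows "has_weak_deriv (\<lambda>x. f x + g x) (\<lambda>x. f' x + g' x)"
  unfolding has_weak_deriv_def
proof (intro conjI allI impI)
  show "locally_integrable (\<lambda>x. f x + g x)" "locally_integrable (\<lambda>x. f' x + g' x)"
    using assms unfolding has_weak_deriv_def by (auto intro: locally_integrable_add)
next
  fix \<phi> \<phi>' assume t: "test_function \<phi> \<phi>'"
  have l: "locally_integrable f" "locally_integrable g" "locally_integrable f'" "locally_integrable g'"
    and eq: "(LINT x|lborel. f x * \<phi>' x) = - (LINT x|lborel. f' x * \<phi> x)"
      "(LINT x|lborel. g x * \<phi>' x) = - (LINT x|lborel. g' x * \<phi> x)"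
    using assms t unfolding has_weak_deriv_def by blast+
  show "(LINT x|lborel. (f x + g x) * \<phi>' x) = - (LINT x|lborel. (f' x + g' x) * \<phi> x)"
    using test_function_integrable[OF t] l eq by (simp add: distrib_right)
qed

lemma has_weak_deriv_cmult:
  assumes "has_weak_deriv f f'"
  shows "has_weak_deriv (\<lambda>x. c * f x) (\<lambda>x. c * f' x)"
  using assms unfolding has_weak_deriv_def
  by (auto simp: mult.assoc intro: locally_integrable_cmult)


subsection \<open>Norm properties\<close>

lemma Linf_norm_leI:
  assumes "f \<in> borel_measurable borel" "AE x in lborel. \<bar>f x\<bar> \<le> c"
  shows "f \<in> Linf" "Linf_norm f \<le> c" "0 \<le> Linf_norm f"
proof -
  have le: "esssup lborel (\<lambda>x. ereal \<bar>f x\<bar>) \<le> ereal c"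
    using assms by (intro esssup_I) auto
  have "esssup lborel (\<lambda>x::real. 0::ereal) = 0" by (rule esssup_const) simp
  moreover have "esssup lborel (\<lambda>x::real. 0::ereal) \<le> esssup lborel (\<lambda>x. ereal \<bar>f x\<bar>)"
    by (rule esssup_mono) auto
  ultimately have ge: "0 \<le> esssup lborel (\<lambda>x. ereal \<bar>f x\<bar>)" by simp
  show "f \<in> Linf" unfolding Linf_def using assms(1) le by (auto intro: le_less_trans)
  show "Linf_norm f \<le> c" "0 \<le> Linf_norm f"
    unfolding Linf_norm_def using le ge
    by (cases "esssup lborel (\<lambda>x. ereal \<bar>f x\<bar>)"; simp)+
qed

lemma Linf_AE:
  assumes "f \<in> Linf"
  shows "AE x in lborel. \<bar>f x\<bar> \<le> Linf_norm f"
proof -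
  have "esssup lborel (\<lambda>x::real. 0::ereal) = 0" by (rule esssup_const) simp
  moreover have "esssup lborel (\<lambda>x::real. 0::ereal) \<le> esssup lborel (\<lambda>x. ereal \<bar>f x\<bar>)"
    by (rule esssup_mono) auto
  ultimately have "0 \<le> esssup lborel (\<lambda>x. ereal \<bar>f x\<bar>)" by simp
  then have e: "esssup lborel (\<lambda>x. ereal \<bar>f x\<bar>) = ereal (Linf_norm f)"
    using assms unfolding Linf_def Linf_norm_def
    by (cases "esssup lborel (\<lambda>x. ereal \<bar>f x\<bar>)") auto
  show ?thesis using esssup_AE[of "\<lambda>x. ereal \<bar>f x\<bar>" lborel] unfolding e by simp
qed

lemma Linf_measurable: "f \<in> Linf \<Longrightarrow> f \<in> borel_measurable borel"
  unfolding Linf_def by simp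

lemma Linf_norm_nonneg: "f \<in> Linf \<Longrightarrow> 0 \<le> Linf_norm f"
  using Linf_norm_leI(3)[OF Linf_measurable Linf_AE] .

lemma Linf_add:
  assumes "f \<in> Linf" "g \<in> Linf"
  shows "(\<lambda>x. f x + g x) \<in> Linf" "Linf_norm (\<lambda>x. f x + g x) \<le> Linf_norm f + Linf_norm g"
proof -
  have "(\<lambda>x. f x + g x) \<in> borel_measurable borel"
    using assms by (intro borel_measurable_add Linf_measurable)
  moreover have "AE x in lborel. \<bar>f x + g x\<bar> \<le> Linf_norm f + Linf_norm g"
    using Linf_AE[OF assms(1)] Linf_AE[OF assms(2)] by eventually_elim auto
  ultimately show "(\<lambda>x. f x + g x) \<in> Linf"
      "Linf_norm (\<lambda>x. f x + g x) \<le> Linf_norm f + Linf_norm g"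
    using Linf_norm_leI by blast+
qed

lemma Linf_cmult_le:
  assumes "f \<in> Linf"
  shows "(\<lambda>x. c * f x) \<in> Linf" "Linf_norm (\<lambda>x. c * f x) \<le> \<bar>c\<bar> * Linf_norm f"
proof -
  have "(\<lambda>x. c * f x) \<in> borel_measurable borel"
    using assms by (intro borel_measurable_times borel_measurable_const Linf_measurable)
  moreover have "AE x in lborel. \<bar>c * f x\<bar> \<le> \<bar>c\<bar> * Linf_norm f"
    using Linf_AE[OF assms] by eventually_elim (auto simp: abs_mult intro: mult_left_mono)
  ultimately show "(\<lambda>x. c * f x) \<in> Linf" "Linf_norm (\<lambda>x. c * f x) \<le> \<bar>c\<bar> * Linf_norm f"
    using Linf_norm_leI by blast+
qed

lemma Linf_norm_cmult:
  assumes "f \<in> Linf"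
  shows "Linf_norm (\<lambda>x. c * f x) = \<bar>c\<bar> * Linf_norm f"
proof (cases "c = 0")
  case True
  then show ?thesis
    using Linf_cmult_le[OF assms, of 0] Linf_norm_nonneg[OF Linf_cmult_le(1)[OF assms, of 0]] by simp
next
  case False
  have "Linf_norm (\<lambda>x. inverse c * (c * f x)) \<le> \<bar>inverse c\<bar> * Linf_norm (\<lambda>x. c * f x)"
    by (intro Linf_cmult_le assms)
  then have "\<bar>c\<bar> * Linf_norm f \<le> Linf_norm (\<lambda>x. c * f x)"
    using False by (simp add: field_simps)
  with Linf_cmult_le(2)[OF assms, of c] show ?thesis by simp
qed

lemma Linf_norm_cong_AE:
  assumes "f \<in> borel_measurable borel" "g \<in> borel_measurable borel" "AE x in lborel. f x = g x"
  shows "Linf_norm f = Linf_norm g"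
  unfolding Linf_norm_def
  by (rule arg_cong[where f=real_of_ereal], rule esssup_AE_cong)
     (use assms in \<open>auto elim: eventually_mono\<close>)

lemma L2_measurable: "f \<in> L2 \<Longrightarrow> f \<in> borel_measurable borel"
  unfolding L2_def by simp

lemma L2_norm_nonneg: "0 \<le> L2_norm f"
  unfolding L2_norm_def by simp

lemma L2_norm_sq: "(L2_norm f)\<^sup>2 = (LINT x|lborel. (f x)\<^sup>2)"
  unfolding L2_norm_def by simp

lemma L2_cong_AE:
  assumes "f \<in> borel_measurable borel" "g \<in> borel_measurable borel" "AE x in lborel. f x = g x"
  shows "f \<in> L2 \<longleftrightarrow> g \<in> L2" "L2_norm f = L2_norm g"
proof -
  have e: "AE x in lborel. (f x)\<^sup>2 = (g x)\<^sup>2" using assms(3) by eventually_elim simp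
  show "f \<in> L2 \<longleftrightarrow> g \<in> L2"
    unfolding L2_def using assms(1,2) integrable_cong_AE[OF _ _ e] by simp
  show "L2_norm f = L2_norm g"
    unfolding L2_norm_def using assms(1,2) integral_cong_AE[OF _ _ e] by simp
qed

lemma L2_cmult:
  assumes "f \<in> L2"
  shows "(\<lambda>x. c * f x) \<in> L2" "L2_norm (\<lambda>x. c * f x) = \<bar>c\<bar> * L2_norm f"
  using assms unfolding L2_def L2_norm_def by (auto simp: power_mult_distrib real_sqrt_mult)

lemma L2_add:
  assumes "f \<in> L2" "g \<in> L2"
  shows "(\<lambda>x. f x + g x) \<in> L2" "L2_norm (\<lambda>x. f x + g x) \<le> L2_norm f + L2_norm g"
proof -
  have [measurable]: "f \<in> borel_measurable borel" "g \<in> borel_measurable borel"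
    and i: "integrable lborel (\<lambda>x. (f x)\<^sup>2)" "integrable lborel (\<lambda>x. (g x)\<^sup>2)"
    using assms unfolding L2_def by auto
  have key: "(f x + g x)\<^sup>2 \<le> (a + b) * ((f x)\<^sup>2 / a + (g x)\<^sup>2 / b)" if "a > 0" "b > 0" for a b x
  proof -
    have "(a + b) * ((f x)\<^sup>2 / a + (g x)\<^sup>2 / b) - (f x + g x)\<^sup>2 = (b * f x - a * g x)\<^sup>2 / (a * b)"
      using that by (simp add: field_simps power2_eq_square)
    moreover have "\<dots> \<ge> 0" using that by simp
    ultimately show ?thesis by linarith
  qed
  have "integrable lborel (\<lambda>x. (f x + g x)\<^sup>2)"
  proof (rule Bochner_Integration.integrable_bound)
    show "integrable lborel (\<lambda>x. (1 + 1) * ((f x)\<^sup>2 / 1 + (g x)\<^sup>2 / 1))"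
      using i by auto
    show "AE x in lborel. norm ((f x + g x)\<^sup>2) \<le> norm ((1 + 1) * ((f x)\<^sup>2 / 1 + (g x)\<^sup>2 / 1))"
      using key[of 1 1] by (intro AE_I2) (simp add: abs_mult)
  qed simp
  then show L: "(\<lambda>x. f x + g x) \<in> L2" unfolding L2_def by simp
  show "L2_norm (\<lambda>x. f x + g x) \<le> L2_norm f + L2_norm g"
  proof (rule field_le_epsilon)
    fix e :: real assume e: "e > 0"
    define a where "a = L2_norm f + e / 2"
    define b where "b = L2_norm g + e / 2"
    have ab: "a > 0" "b > 0" "L2_norm f \<le> a" "L2_norm g \<le> b"
      using e L2_norm_nonneg[of f] L2_norm_nonneg[of g] unfolding a_def b_def by auto
    have "(L2_norm (\<lambda>x. f x + g x))\<^sup>2 \<le> (LINT x|lborel. (a + b) * ((f x)\<^sup>2 / a + (g x)\<^sup>2 / b))"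
      unfolding L2_norm_sq
      by (rule integral_mono) (use i L key[OF ab(1,2)] in \<open>auto simp: L2_def\<close>)
    also have "\<dots> = (a + b) * ((L2_norm f)\<^sup>2 / a + (L2_norm g)\<^sup>2 / b)"
      unfolding L2_norm_sq using i by simp
    also have "\<dots> \<le> (a + b) * (a\<^sup>2 / a + b\<^sup>2 / b)"
      using ab L2_norm_nonneg
      by (intro mult_left_mono add_mono divide_right_mono power_mono) auto
    also have "\<dots> = (a + b)\<^sup>2" using ab by (simp add: power2_eq_square)
    finally have "L2_norm (\<lambda>x. f x + g x) \<le> a + b"
      using ab by (auto intro: power2_le_imp_le)
    then show "L2_norm (\<lambda>x. f x + g x) \<le> L2_norm f + L2_norm g + e"
      unfolding a_def b_def by simp
  qed
qed

lemma L2_zero: "(\<lambda>x. 0) \<in> L2" "L2_norm (\<lambda>x. 0) = 0"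
  unfolding L2_def L2_norm_def by auto

lemma Linf_zero: "(\<lambda>x. 0) \<in> Linf" "Linf_norm (\<lambda>x. 0) = 0"
  using Linf_norm_leI[of "\<lambda>x. 0" 0] by auto

lemma Linf_norm_eq_0: "f \<in> Linf \<Longrightarrow> Linf_norm f = 0 \<Longrightarrow> AE x in lborel. f x = 0"
  using Linf_AE[of f] by (auto elim: eventually_mono)

lemma L2_norm_eq_0:
  assumes "f \<in> L2" "L2_norm f = 0"
  shows "AE x in lborel. f x = 0"
proof -
  have "integrable lborel (\<lambda>x. (f x)\<^sup>2)" "(LINT x|lborel. (f x)\<^sup>2) = 0"
    using assms unfolding L2_def L2_norm_def by auto
  then have "AE x in lborel. (f x)\<^sup>2 = 0"
    using integral_nonneg_eq_0_iff_AE[of lborel "\<lambda>x. (f x)\<^sup>2"] by simp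
  then show ?thesis by simp
qed

lemma continuous_AE_zero:
  fixes f :: "real \<Rightarrow> real"
  assumes c: "continuous_on UNIV f" and z: "AE x in lborel. f x = 0"
  shows "f = (\<lambda>x. 0)"
proof (rule ccontr)
  assume "f \<noteq> (\<lambda>x. 0)"
  then obtain x where x: "f x \<noteq> 0" by auto
  have o: "open {x. f x \<noteq> 0}"
    by (rule open_Collect_neq) (use c in auto)
  then obtain e where e: "e > 0" "ball x e \<subseteq> {x. f x \<noteq> 0}"
    using x open_contains_ball by blast
  have "{x. f x \<noteq> 0} \<in> null_sets lborel"
    using z AE_iff_null[of lborel "\<lambda>x. f x = 0"] o by (simp add: borel_open)
  then have "ball x e \<in> null_sets lborel"
    by (rule null_sets_subset) (use e in auto)
  then have "emeasure lborel {x - e <..< x + e} = 0"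
    by (auto simp: ball_eq_greaterThanLessThan)
  then show False using e(1) by simp
qed

lemma weak_deriv_L2_wderiv:
  assumes "has_weak_deriv f g" "g \<in> L2"
  shows "wderiv f \<in> L2" "L2_norm (wderiv f) = L2_norm g"
proof -
  have "wderiv f \<in> borel_measurable borel"
    using has_weak_deriv_wderiv[OF assms(1)] unfolding has_weak_deriv_def locally_integrable_def
    by blast
  then show "wderiv f \<in> L2" "L2_norm (wderiv f) = L2_norm g"
    using L2_cong_AE[OF _ L2_measurable[OF assms(2)] wderiv_AE[OF assms(1)]] assms(2) by auto
qed

lemma has_weak_deriv_zero: "has_weak_deriv (\<lambda>x. 0) (\<lambda>x. 0)"
  unfolding has_weak_deriv_def locally_integrable_def set_integrable_def by simp

lemma wderiv_L2_zero: "L2_norm (wderiv (\<lambda>x. 0)) = 0"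
  using weak_deriv_L2_wderiv[OF has_weak_deriv_zero L2_zero(1)] L2_zero by simp

lemma wderiv_L2_add:
  assumes "has_weak_deriv f f'" "f' \<in> L2" "has_weak_deriv g g'" "g' \<in> L2"
  shows "L2_norm (wderiv (\<lambda>x. f x + g x)) \<le> L2_norm (wderiv f) + L2_norm (wderiv g)"
proof -
  have "L2_norm (wderiv (\<lambda>x. f x + g x)) = L2_norm (\<lambda>x. f' x + g' x)"
    by (intro weak_deriv_L2_wderiv has_weak_deriv_add L2_add assms)
  then show ?thesis
    using L2_add(2)[OF assms(2,4)]
    by (simp add: weak_deriv_L2_wderiv(2)[OF assms(1,2)] weak_deriv_L2_wderiv(2)[OF assms(3,4)])
qed

lemma wderiv_L2_cmult:
  assumes "has_weak_deriv f f'" "f' \<in> L2"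
  shows "L2_norm (wderiv (\<lambda>x. c * f x)) = \<bar>c\<bar> * L2_norm (wderiv f)"
proof -
  have "L2_norm (wderiv (\<lambda>x. c * f x)) = L2_norm (\<lambda>x. c * f' x)"
    by (intro weak_deriv_L2_wderiv has_weak_deriv_cmult L2_cmult assms)
  then show ?thesis
    using L2_cmult(2)[OF assms(2)] by (simp add: weak_deriv_L2_wderiv(2)[OF assms])
qed

lemma V_closed:
  "(\<lambda>x. 0) \<in> V"
  "f \<in> V \<Longrightarrow> g \<in> V \<Longrightarrow> (\<lambda>x. f x + g x) \<in> V"
  "f \<in> V \<Longrightarrow> (\<lambda>x. c * f x) \<in> V"
proof -
  show "(\<lambda>x. 0) \<in> V"
    unfolding V_def using Linf_zero(1) L2_zero(1) has_weak_deriv_zero by auto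
  show "(\<lambda>x. f x + g x) \<in> V" if fg: "f \<in> V" "g \<in> V"
  proof -
    obtain f' g' where "f' \<in> L2" "g' \<in> L2" "has_weak_deriv f f'" "has_weak_deriv g g'"
      using fg unfolding V_def by blast
    then have "has_weak_deriv (\<lambda>x. f x + g x) (\<lambda>x. f' x + g' x)" "(\<lambda>x. f' x + g' x) \<in> L2"
      by (auto intro: has_weak_deriv_add L2_add)
    then show ?thesis
      using fg unfolding V_def by (auto intro: Linf_add continuous_on_add)
  qed
  show "(\<lambda>x. c * f x) \<in> V" if f: "f \<in> V"
  proof -
    obtain f' where "f' \<in> L2" "has_weak_deriv f f'"
      using f unfolding V_def by blast
    then have "has_weak_deriv (\<lambda>x. c * f x) (\<lambda>x. c * f' x)" "(\<lambda>x. c * f' x) \<in> L2"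
      by (auto intro: has_weak_deriv_cmult L2_cmult)
    then show ?thesis
      using f unfolding V_def by (auto intro: Linf_cmult_le continuous_on_mult_left)
  qed
qed

lemma V_norm_props:
  "f \<in> V \<Longrightarrow> 0 \<le> V_norm f"
  "V_norm (\<lambda>x. 0) = 0"
  "f \<in> V \<Longrightarrow> V_norm f = 0 \<Longrightarrow> f = (\<lambda>x. 0)"
  "f \<in> V \<Longrightarrow> g \<in> V \<Longrightarrow> V_norm (\<lambda>x. f x + g x) \<le> V_norm f + V_norm g"
  "f \<in> V \<Longrightarrow> V_norm (\<lambda>x. c * f x) = \<bar>c\<bar> * V_norm f"
proof -
  show "f \<in> V \<Longrightarrow> 0 \<le> V_norm f"
    unfolding V_def V_norm_def by (simp add: Linf_norm_nonneg L2_norm_nonneg)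
  show "V_norm (\<lambda>x. 0) = 0"
    unfolding V_norm_def by (simp add: Linf_zero wderiv_L2_zero)
  show "f = (\<lambda>x. 0)" if f: "f \<in> V" "V_norm f = 0"
  proof (rule continuous_AE_zero)
    show "continuous_on UNIV f" using f unfolding V_def by blast
    have "Linf_norm f = 0"
      using f Linf_norm_nonneg[of f] L2_norm_nonneg[of "wderiv f"] unfolding V_def V_norm_def by auto
    then show "AE x in lborel. f x = 0" using f Linf_norm_eq_0 unfolding V_def by blast
  qed
  show "V_norm (\<lambda>x. f x + g x) \<le> V_norm f + V_norm g" if fg: "f \<in> V" "g \<in> V"
  proof -
    have "Linf_norm (\<lambda>x. f x + g x) \<le> Linf_norm f + Linf_norm g"
      using fg unfolding V_def by (intro Linf_add(2)) auto
    moreover have "L2_norm (wderiv (\<lambda>x. f x + g x)) \<le> L2_norm (wderiv f) + L2_norm (wderiv g)"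
      using fg wderiv_L2_add unfolding V_def by blast
    ultimately show ?thesis unfolding V_norm_def by simp
  qed
  show "f \<in> V \<Longrightarrow> V_norm (\<lambda>x. c * f x) = \<bar>c\<bar> * V_norm f"
    unfolding V_norm_def V_def using Linf_norm_cmult[of f c] wderiv_L2_cmult[of f _ c]
    by (auto simp: distrib_left)
qed

lemma H1_closed:
  "(\<lambda>x. 0) \<in> H1"
  "f \<in> H1 \<Longrightarrow> g \<in> H1 \<Longrightarrow> (\<lambda>x. f x + g x) \<in> H1"
  "f \<in> H1 \<Longrightarrow> (\<lambda>x. c * f x) \<in> H1"
proof -
  show "(\<lambda>x. 0) \<in> H1"
    unfolding H1_def using L2_zero(1) has_weak_deriv_zero by auto
  show "(\<lambda>x. f x + g x) \<in> H1" if fg: "f \<in> H1" "g \<in> H1"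
  proof -
    obtain f' g' where "f' \<in> L2" "g' \<in> L2" "has_weak_deriv f f'" "has_weak_deriv g g'"
      using fg unfolding H1_def by blast
    then have "has_weak_deriv (\<lambda>x. f x + g x) (\<lambda>x. f' x + g' x)" "(\<lambda>x. f' x + g' x) \<in> L2"
      by (auto intro: has_weak_deriv_add L2_add)
    then show ?thesis
      using fg unfolding H1_def by (auto intro: L2_add continuous_on_add)
  qed
  show "(\<lambda>x. c * f x) \<in> H1" if f: "f \<in> H1"
  proof -
    obtain f' where "f' \<in> L2" "has_weak_deriv f f'"
      using f unfolding H1_def by blast
    then have "has_weak_deriv (\<lambda>x. c * f x) (\<lambda>x. c * f' x)" "(\<lambda>x. c * f' x) \<in> L2"
      by (auto intro: has_weak_deriv_cmult L2_cmult)
    then show ?thesis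
      using f unfolding H1_def by (auto intro: L2_cmult continuous_on_mult_left)
  qed
qed

lemma H1_norm_props:
  "0 \<le> H1_norm f"
  "H1_norm (\<lambda>x. 0) = 0"
  "f \<in> H1 \<Longrightarrow> H1_norm f = 0 \<Longrightarrow> f = (\<lambda>x. 0)"
  "f \<in> H1 \<Longrightarrow> g \<in> H1 \<Longrightarrow> H1_norm (\<lambda>x. f x + g x) \<le> H1_norm f + H1_norm g"
  "f \<in> H1 \<Longrightarrow> H1_norm (\<lambda>x. c * f x) = \<bar>c\<bar> * H1_norm f"
proof -
  show "0 \<le> H1_norm f" unfolding H1_norm_def by simp
  show "H1_norm (\<lambda>x. 0) = 0"
    unfolding H1_norm_def by (simp add: L2_zero wderiv_L2_zero)
  show "f = (\<lambda>x. 0)" if f: "f \<in> H1" "H1_norm f = 0"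
  proof (rule continuous_AE_zero)
    show "continuous_on UNIV f" using f unfolding H1_def by blast
    have "L2_norm f = 0" using f unfolding H1_norm_def by simp
    then show "AE x in lborel. f x = 0" using f L2_norm_eq_0 unfolding H1_def by blast
  qed
  show "H1_norm (\<lambda>x. f x + g x) \<le> H1_norm f + H1_norm g" if fg: "f \<in> H1" "g \<in> H1"
  proof -
    have "L2_norm (\<lambda>x. f x + g x) \<le> L2_norm f + L2_norm g"
        "L2_norm (wderiv (\<lambda>x. f x + g x)) \<le> L2_norm (wderiv f) + L2_norm (wderiv g)"
      using fg L2_add(2) wderiv_L2_add unfolding H1_def by blast+
    then have "H1_norm (\<lambda>x. f x + g x) \<le>
        sqrt ((L2_norm f + L2_norm g)\<^sup>2 + (L2_norm (wderiv f) + L2_norm (wderiv g))\<^sup>2)"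
      unfolding H1_norm_def
      by (intro real_sqrt_le_mono add_mono power_mono L2_norm_nonneg) auto
    also have "\<dots> \<le> H1_norm f + H1_norm g"
      unfolding H1_norm_def by (rule real_sqrt_sum_squares_triangle_ineq)
    finally show ?thesis .
  qed
  show "H1_norm (\<lambda>x. c * f x) = \<bar>c\<bar> * H1_norm f" if f: "f \<in> H1"
  proof -
    have "L2_norm (\<lambda>x. c * f x) = \<bar>c\<bar> * L2_norm f"
        "L2_norm (wderiv (\<lambda>x. c * f x)) = \<bar>c\<bar> * L2_norm (wderiv f)"
      using f L2_cmult(2) wderiv_L2_cmult unfolding H1_def by blast+
    then show ?thesis
      unfolding H1_norm_def
      by (simp add: power_mult_distrib flip: distrib_left) (simp add: real_sqrt_mult)
  qed
qed

section \<open>The space E\<close>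

text \<open>Tuples \<open>(\<zeta>, U, \<Gamma>, R, H)\<close>. Four components are continuous functions; the component \<open>R\<close> is
  an equivalence class modulo equality almost everywhere.\<close>

type_synonym tuple5 =
  "(real \<Rightarrow> real) \<times> (real \<Rightarrow> real) \<times> (real \<Rightarrow> real) \<times> (real \<Rightarrow> real) \<times> (real \<Rightarrow> real)"

fun E_rel :: "tuple5 \<Rightarrow> tuple5 \<Rightarrow> bool" where
  "E_rel (\<zeta>, U, \<Gamma>, R, H) (\<zeta>', U', \<Gamma>', R', H') \<longleftrightarrow>
     \<zeta> \<in> V \<and> U \<in> H1 \<and> \<Gamma> \<in> H1 \<and> R \<in> Linf \<inter> L2 \<and> R' \<in> Linf \<inter> L2 \<and> H \<in> V \<and>
     \<zeta>' = \<zeta> \<and> U' = U \<and> \<Gamma>' = \<Gamma> \<and> (AE x in lborel. R x = R' x) \<and> H' = H"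

quotient_type E = tuple5 / partial: E_rel
proof (rule part_equivpI)
  show "\<exists>x. E_rel x x"
    by (rule exI[of _ "(\<lambda>x. 0, \<lambda>x. 0, \<lambda>x. 0, \<lambda>x. 0, \<lambda>x. 0)"])
       (simp add: V_closed H1_closed Linf_zero L2_zero)
  show "symp E_rel"
    by (rule sympI) (auto elim: eventually_mono)
  show "transp E_rel"
  proof (rule transpI)
    fix x y z assume "E_rel x y" "E_rel y z"
    then show "E_rel x z"
      by (cases x; cases y; cases z) (auto elim: eventually_elim2)
  qed
qed

instantiation E :: real_normed_vector
begin

lift_definition zero_E :: E is "(\<lambda>x. 0, \<lambda>x. 0, \<lambda>x. 0, \<lambda>x. 0, \<lambda>x. 0)"
  by (simp add: V_closed H1_closed Linf_zero L2_zero)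

lift_definition plus_E :: "E \<Rightarrow> E \<Rightarrow> E" is
  "\<lambda>(\<zeta>, U, \<Gamma>, R, H) (\<zeta>', U', \<Gamma>', R', H').
     (\<lambda>x. \<zeta> x + \<zeta>' x, \<lambda>x. U x + U' x, \<lambda>x. \<Gamma> x + \<Gamma>' x, \<lambda>x. R x + R' x, \<lambda>x. H x + H' x)"
  by (auto simp: V_closed H1_closed Linf_add L2_add elim: eventually_elim2)

lift_definition scaleR_E :: "real \<Rightarrow> E \<Rightarrow> E" is
  "\<lambda>c (\<zeta>, U, \<Gamma>, R, H).
     (\<lambda>x. c * \<zeta> x, \<lambda>x. c * U x, \<lambda>x. c * \<Gamma> x, \<lambda>x. c * R x, \<lambda>x. c * H x)"
  by (auto simp: V_closed H1_closed Linf_cmult_le L2_cmult elim: eventually_mono)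

definition uminus_E :: "E \<Rightarrow> E" where "uminus_E X = (-1) *\<^sub>R X"

definition minus_E :: "E \<Rightarrow> E \<Rightarrow> E" where "minus_E X Y = X + (-1) *\<^sub>R Y"

lift_definition norm_E :: "E \<Rightarrow> real" is
  "\<lambda>(\<zeta>, U, \<Gamma>, R, H). V_norm \<zeta> + H1_norm U + H1_norm \<Gamma> + Linf_norm R + L2_norm R + V_norm H"
proof (clarsimp, goal_cases)
  case (1 z U G R H R')
  then show ?case
    using Linf_norm_cong_AE[of R R'] L2_cong_AE(2)[of R R'] by (simp add: Linf_measurable)
qed

definition dist_E :: "E \<Rightarrow> E \<Rightarrow> real" where "dist_E X Y = norm (X - Y)"

definition sgn_E :: "E \<Rightarrow> E" where "sgn_E X = inverse (norm X) *\<^sub>R X"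

definition uniformity_E :: "(E \<times> E) filter" where
  "uniformity_E = (INF e\<in>{0<..}. principal {(X, Y). dist X Y < e})"

definition open_E :: "E set \<Rightarrow> bool" where
  "open_E S \<longleftrightarrow> (\<forall>X\<in>S. \<forall>\<^sub>F (X', Y) in uniformity. X' = X \<longrightarrow> Y \<in> S)"

instance
proof
  fix X Y Z :: E and a b :: real
  show "X + Y + Z = X + (Y + Z)"
    by transfer (auto simp: V_closed H1_closed Linf_add L2_add add.assoc elim: eventually_mono)
  show "X + Y = Y + X"
    by transfer (auto simp: V_closed H1_closed Linf_add L2_add add.commute)
  show "0 + X = X"
    by transfer (auto simp: V_closed H1_closed Linf_add L2_add)
  show "a *\<^sub>R (X + Y) = a *\<^sub>R X + a *\<^sub>R Y"
    by transfer (auto simp: V_closed H1_closed Linf_add L2_add Linf_cmult_le L2_cmult distrib_left)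
  show "(a + b) *\<^sub>R X = a *\<^sub>R X + b *\<^sub>R X"
    by transfer (auto simp: V_closed H1_closed Linf_add L2_add Linf_cmult_le L2_cmult distrib_right)
  show "a *\<^sub>R b *\<^sub>R X = (a * b) *\<^sub>R X"
    by transfer (auto simp: V_closed H1_closed Linf_cmult_le L2_cmult mult.assoc)
  show "1 *\<^sub>R X = X"
    by transfer auto
  show "- X + X = 0"
    unfolding uminus_E_def
    by transfer (auto simp: V_closed H1_closed Linf_add L2_add Linf_cmult_le L2_cmult Linf_zero L2_zero)
  show "X - Y = X + - Y" unfolding minus_E_def uminus_E_def ..
  show "dist X Y = norm (X - Y)" by (rule dist_E_def)
  show "sgn X = inverse (norm X) *\<^sub>R X" by (rule sgn_E_def)
  show "(uniformity :: (E \<times> E) filter) = (INF e\<in>{0<..}. principal {(X, Y). dist X Y < e})"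
    by (rule uniformity_E_def)
  show "open S \<longleftrightarrow> (\<forall>X\<in>S. \<forall>\<^sub>F (X', Y) in uniformity. X' = X \<longrightarrow> Y \<in> S)" for S :: "E set"
    by (rule open_E_def)
  show "norm X = 0 \<longleftrightarrow> X = 0"
  proof (transfer, clarsimp, rule iffI, goal_cases)
    case (1 z U G R H)
    have "0 \<le> V_norm z" "0 \<le> H1_norm U" "0 \<le> H1_norm G" "0 \<le> Linf_norm R" "0 \<le> L2_norm R"
        "0 \<le> V_norm H"
      using 1 V_norm_props(1) H1_norm_props(1) Linf_norm_nonneg L2_norm_nonneg by auto
    then have "V_norm z = 0" "H1_norm U = 0" "H1_norm G = 0" "L2_norm R = 0" "V_norm H = 0"
      using 1 by linarith+
    then show ?case
      using 1 V_norm_props(3)[of z] V_norm_props(3)[of H] H1_norm_props(3)[of U] H1_norm_props(3)[of G]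
        L2_norm_eq_0[of R] by (auto simp: Linf_zero L2_zero)
  next
    case (2 z U G R H)
    then have "Linf_norm R = 0" "L2_norm R = 0"
      using Linf_norm_cong_AE[of R "\<lambda>x. 0"] L2_cong_AE(2)[of R "\<lambda>x. 0"]
      by (auto simp: Linf_measurable Linf_zero L2_zero)
    then show ?case using 2 by (auto simp: V_norm_props(2) H1_norm_props(2))
  qed
  show "norm (X + Y) \<le> norm X + norm Y"
  proof (transfer, clarsimp, goal_cases)
    case (1 z U G R H z' U' G' R' H')
    then show ?case
      using V_norm_props(4)[of z z'] V_norm_props(4)[of H H'] H1_norm_props(4)[of U U']
        H1_norm_props(4)[of G G'] Linf_add(2)[of R R'] L2_add(2)[of R R'] by linarith
  qed
  show "norm (a *\<^sub>R X) = \<bar>a\<bar> * norm X"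
    by transfer (auto simp: V_norm_props(5) H1_norm_props(5) Linf_norm_cmult L2_cmult(2) distrib_left)
qed

end

lift_definition zeta_of :: "E \<Rightarrow> real \<Rightarrow> real" is "\<lambda>(\<zeta>, U, \<Gamma>, R, H). \<zeta>" by auto
lift_definition U_of :: "E \<Rightarrow> real \<Rightarrow> real" is "\<lambda>(\<zeta>, U, \<Gamma>, R, H). U" by auto
lift_definition Gamma_of :: "E \<Rightarrow> real \<Rightarrow> real" is "\<lambda>(\<zeta>, U, \<Gamma>, R, H). \<Gamma>" by auto
lift_definition H_of :: "E \<Rightarrow> real \<Rightarrow> real" is "\<lambda>(\<zeta>, U, \<Gamma>, R, H). H" by auto

text \<open>An arbitrary representative of the class \<open>R\<close>. It is only used under integrals and in
  statements that hold almost everywhere, so the choice is irrelevant.\<close>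

definition R_of :: "E \<Rightarrow> real \<Rightarrow> real" where
  "R_of X = (case rep_E X of (\<zeta>, U, \<Gamma>, R, H) \<Rightarrow> R)"

definition y_of :: "E \<Rightarrow> real \<Rightarrow> real" where
  "y_of X \<xi> = zeta_of X \<xi> + \<xi>"

section \<open>The Lagrangian system\<close>

definition kernel :: "E \<Rightarrow> real \<Rightarrow> real \<Rightarrow> real" where
  "kernel X \<xi> \<eta> = exp (- sgn (\<xi> - \<eta>) * (y_of X \<xi> - y_of X \<eta>))"

definition source1 :: "E \<Rightarrow> real \<Rightarrow> real" where
  "source1 X \<eta> = (U_of X \<eta>)\<^sup>2 * wderiv (y_of X) \<eta> - 2 * (R_of X \<eta>)\<^sup>2 * wderiv (y_of X) \<eta>
     + wderiv (H_of X) \<eta>"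

definition P1 :: "E \<Rightarrow> real \<Rightarrow> real" where
  "P1 X \<xi> = 1/4 * (LINT \<eta>|lborel. kernel X \<xi> \<eta> * source1 X \<eta>)"

definition P2 :: "E \<Rightarrow> real \<Rightarrow> real" where
  "P2 X \<xi> = 1/2 * (LINT \<eta>|lborel. kernel X \<xi> \<eta> * (R_of X \<eta> * wderiv (U_of X) \<eta>))"

definition P3 :: "E \<Rightarrow> real \<Rightarrow> real" where
  "P3 X \<xi> = 1/2 * (LINT \<eta>|lborel. kernel X \<xi> \<eta> * (Gamma_of X \<eta> * wderiv (U_of X) \<eta>))"

definition Q1 :: "E \<Rightarrow> real \<Rightarrow> real" where
  "Q1 X \<xi> = - 1/4 * (LINT \<eta>|lborel. sgn (\<xi> - \<eta>) * kernel X \<xi> \<eta> * source1 X \<eta>)"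

definition Q2 :: "E \<Rightarrow> real \<Rightarrow> real" where
  "Q2 X \<xi> = - 1/2 * (LINT \<eta>|lborel. sgn (\<xi> - \<eta>) * kernel X \<xi> \<eta> * (R_of X \<eta> * wderiv (U_of X) \<eta>))"

definition Q3 :: "E \<Rightarrow> real \<Rightarrow> real" where
  "Q3 X \<xi> = - 1/2 * (LINT \<eta>|lborel. sgn (\<xi> - \<eta>) * kernel X \<xi> \<eta> * (Gamma_of X \<eta> * wderiv (U_of X) \<eta>))"

definition G_set :: "E set" where
  "G_set = {X.
     zeta_of X \<in> W1inf \<and> U_of X \<in> W1inf \<and> Gamma_of X \<in> W1inf \<and> H_of X \<in> W1inf \<and>
     (AE \<xi> in lborel. wderiv (y_of X) \<xi> \<ge> 0 \<and> wderiv (H_of X) \<xi> \<ge> 0 \<and>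
        wderiv (y_of X) \<xi> + wderiv (H_of X) \<xi> > 0) \<and>
     (H_of X \<longlongrightarrow> 0) at_bot \<and>
     (AE \<xi> in lborel. R_of X \<xi> * wderiv (y_of X) \<xi> = wderiv (Gamma_of X) \<xi>) \<and>
     (AE \<xi> in lborel. wderiv (y_of X) \<xi> * wderiv (H_of X) \<xi> =
        (wderiv (y_of X) \<xi>)\<^sup>2 * ((U_of X \<xi>)\<^sup>2 + (Gamma_of X \<xi>)\<^sup>2 + (R_of X \<xi>)\<^sup>2)
        + (wderiv (U_of X) \<xi>)\<^sup>2)}"

text \<open>\<open>lagrangian_rhs X D\<close>: the vector \<open>D = (\<zeta>\<^sub>t, U\<^sub>t, \<Gamma>\<^sub>t, R\<^sub>t, H\<^sub>t)\<close> of \<open>E\<close> is the right-hand side of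
  the Lagrangian system at \<open>X\<close>.\<close>

definition lagrangian_rhs :: "E \<Rightarrow> E \<Rightarrow> bool" where
  "lagrangian_rhs X D \<longleftrightarrow>
     (\<forall>\<xi>. zeta_of D \<xi> = U_of X \<xi>) \<and>
     (\<forall>\<xi>. U_of D \<xi> = - Q1 X \<xi>) \<and>
     (\<forall>\<xi>. Gamma_of D \<xi> = - Q2 X \<xi> - P3 X \<xi>) \<and>
     (AE \<xi> in lborel. R_of D \<xi> = - P2 X \<xi> - Q3 X \<xi>) \<and>
     (\<forall>\<xi>. H_of D \<xi> = (U_of X \<xi>) ^ 3 - 2 * P1 X \<xi> * U_of X \<xi>
        - 2 * P2 X \<xi> * Gamma_of X \<xi> - 2 * Q3 X \<xi> * Gamma_of X \<xi>)"

text \<open>Only the values of \<open>X\<close> at nonnegative times matter; the derivative at time \<open>0\<close> is one-sided.\<close>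

definition global_solution :: "E \<Rightarrow> (real \<Rightarrow> E) \<Rightarrow> bool" where
  "global_solution X\<^sub>0 X \<longleftrightarrow>
     X 0 = X\<^sub>0 \<and> (\<forall>t>0. X t \<in> G_set) \<and>
     (\<exists>X'. continuous_on {0..} X' \<and>
        (\<forall>t\<ge>0. (X has_vector_derivative X' t) (at t within {0..}) \<and> lagrangian_rhs (X t) (X' t)))"

definition flow :: "real \<Rightarrow> E \<Rightarrow> E" where
  "flow t X\<^sub>0 = (SOME X. global_solution X\<^sub>0 X) t"

definition G_ball :: "real \<Rightarrow> E set" where
  "G_ball M = {X \<in> G_set. norm X \<le> M}"

end

theory Submission
  imports Defs
begin

text \<open>Almost-everywhere constraints are awkward to propagate along a curve in \<open>E\<close>, so the system is
  first solved in a Banach space of pointwise representatives in which \<open>y\<^sub>\<xi>\<close>, \<open>U\<^sub>\<xi>\<close>, \<open>\<Gamma>\<^sub>\<xi>\<close>, \<open>H\<^sub>\<xi>\<close> and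
  \<open>R\<close> have values at every \<open>\<xi>\<close>. There the vector field is locally Lipschitz, the identities (3) and
  (4) are first integrals at each fixed \<open>\<xi>\<close>, and the signs in (2) follow from (4) together with a
  linear system for \<open>y\<^sub>\<xi>\<close>, \<open>U\<^sub>\<xi>\<close>, \<open>H\<^sub>\<xi>\<close>. The total energy \<open>H(\<infinity>)\<close> is conserved and controls
  \<open>U\<^sup>2\<close>, \<open>\<Gamma>\<^sup>2\<close> and the integrands of \<open>P\<^sub>i\<close>, \<open>Q\<^sub>i\<close>; hence the vector field grows at most linearly along
  solutions, with constants depending only on the size of the data, and Gronwall's lemma excludes
  blow-up. Choosing a representative of each element of \<open>G_set\<close>, the local Lipschitz estimate
  passes to \<open>E\<close>, where Gronwall's lemma yields uniqueness, the Lipschitz bound and continuity.\<close>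

section \<open>Ordinary differential equations in Banach spaces\<close>

text \<open>The obstacle is a mismatch of norms. The norm of \<open>E\<close> measures y_xi, U_xi,
  \<Gamma>_xi and H_xi only in L^2, whereas \<open>G_set\<close> asks for bounded derivatives and
  for identities between them, and an L^2 class cannot be followed in time at a fixed point.
  Pointwise representatives with genuine suprema cure this. But a ball of \<open>E\<close> contains
  data with arbitrarily large derivatives, so constants depending on those suprema would not be
  uniform on it. Hence the growth constants see the data only through sup bounds of zeta, H and R,
  and Gronwall is run twice on the constructed solution: in the norm of \<open>state\<close> to
  exclude blow-up, and in the norm of \<open>E\<close> to get a bound uniform on balls. The
  derivatives obey ordinary differential equations because the kernel is, up to a factor, the Green
  function of 1 - d^2/dy^2 pulled back by y: P_xi = Q y_xi, and Q_xi is P y_xi minus a multiple of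
  the source, a local term produced by the jump of sgn on the diagonal.\<close>

definition ode_on :: "('a::real_normed_vector \<Rightarrow> 'a) \<Rightarrow> (real \<Rightarrow> 'a) \<Rightarrow> real \<Rightarrow> bool" where
  "ode_on F x T \<longleftrightarrow> (\<forall>t\<in>{0..T}. (x has_vector_derivative F (x t)) (at t within {0..T}))"

text \<open>Three uses fix the form: K = 0 compares two solutions, L = 0 integrates a bounded rate,
  and L = K excludes blow-up under linear growth.\<close>

lemma gronwall_norm:
  fixes x :: "real \<Rightarrow> 'a::real_normed_vector"
  assumes d: "\<And>t. t \<in> {0..T} \<Longrightarrow> (x has_vector_derivative x' t) (at t within {0..T})"
    and b: "\<And>t. t \<in> {0..T} \<Longrightarrow> norm (x' t) \<le> L * norm (x t) + K"
    and L: "L \<ge> 0" and K: "K \<ge> 0" and t: "t \<in> {0..T}"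
  shows "norm (x t) \<le> (norm (x 0) + K * t) * exp (L * t)"
proof (cases "t = 0")
  case False
  with t have t0: "0 < t" "t \<le> T" by auto
  have cx: "continuous_on {0..T} x"
    using d has_vector_derivative_continuous continuous_on_eq_continuous_within by blast
  define f where "f = (\<lambda>s. L * norm (x s) + K)"
  have cf: "continuous_on {0..T} f" unfolding f_def by (intro continuous_intros cx)
  \<comment> \<open>The norm of x need not be differentiable, so the argument runs on this
    continuously differentiable majorant of it.\<close>
  define \<phi> where "\<phi> = (\<lambda>s. norm (x 0) + integral {0..s} f)"
  have d\<phi>: "(\<phi> has_real_derivative f s) (at s within {0..T})" if "s \<in> {0..T}" for s
    unfolding \<phi>_def using integral_has_real_derivative[OF cf that]
    by (auto intro!: derivative_eq_intros)
  have c\<phi>: "continuous_on {0..T} \<phi>"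
    using d\<phi> DERIV_continuous_on by blast
  have in_at: "at s within {0..T} = at s" if "0 < s" "s < T" for s
    using that by (intro at_within_Icc_at)
  have le: "norm (x s) \<le> \<phi> s" if s: "0 \<le> s" "s \<le> T" for s
  proof (cases "s = 0")
    case False
    have "norm (x s - x 0) \<le> \<phi> s - \<phi> 0"
    proof (rule differentiable_bound_general[where f'=x' and \<phi>'=f])
      show "0 < s" using False s by auto
      show "continuous_on {0..s} x" "continuous_on {0..s} \<phi>"
        by (rule continuous_on_subset[OF cx] continuous_on_subset[OF c\<phi>]; use s in auto)+
      fix u assume u: "0 < u" "u < s"
      then have "u \<in> {0..T}" using s by auto
      then show "(x has_vector_derivative x' u) (at u)" "(\<phi> has_vector_derivative f u) (at u)"
        "norm (x' u) \<le> f u"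
        using d[of u] d\<phi>[of u] b[of u] in_at[of u] u s
        by (auto simp: has_real_derivative_iff_has_vector_derivative f_def)
    qed
    moreover have "norm (x s) \<le> norm (x 0) + norm (x s - x 0)" by (rule norm_triangle_sub)
    ultimately show ?thesis unfolding \<phi>_def by simp
  qed (simp add: \<phi>_def)
  \<comment> \<open>Integrating factor: the derivative of \<psi> is at most K exp(-L s) - K, which
    is nonpositive because L s is nonnegative.\<close>
  define \<psi> where "\<psi> = (\<lambda>s. \<phi> s * exp (- L * s) - K * s)"
  have "\<psi> t \<le> \<psi> 0"
  proof (rule DERIV_nonpos_imp_decreasing_open[where f=\<psi> and a=0 and b=t])
    show "0 \<le> t" using t0 by simp
    show "continuous_on {0..t} \<psi>" unfolding \<psi>_def
      by (intro continuous_intros continuous_on_subset[OF c\<phi>]) (use t0 in auto)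
    fix s assume s: "0 < s" "s < t"
    have D: "(\<psi> has_real_derivative (f s - L * \<phi> s) * exp (- L * s) - K) (at s)"
    proof -
      have "(\<phi> has_real_derivative f s) (at s)" using d\<phi>[of s] in_at[of s] s t0 by simp
      then show ?thesis unfolding \<psi>_def
        by (auto intro!: derivative_eq_intros simp: algebra_simps)
    qed
    have "f s - L * \<phi> s \<le> K"
      using mult_left_mono[OF le[of s] L] s t0 unfolding f_def by auto
    then have "(f s - L * \<phi> s) * exp (- L * s) \<le> K * exp (- L * s)"
      by (rule mult_right_mono) simp
    also have "\<dots> \<le> K * 1"
      using s L by (intro mult_left_mono K) auto
    finally have "(f s - L * \<phi> s) * exp (- L * s) - K \<le> 0" by simp
    with D show "\<exists>y. (\<psi> has_real_derivative y) (at s) \<and> y \<le> 0" by blast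
  qed
  then have "\<phi> t * exp (- L * t) \<le> norm (x 0) + K * t"
    unfolding \<psi>_def \<phi>_def by simp
  then have "\<phi> t * exp (- L * t) * exp (L * t) \<le> (norm (x 0) + K * t) * exp (L * t)"
    by (rule mult_right_mono) simp
  then have "\<phi> t \<le> (norm (x 0) + K * t) * exp (L * t)"
    by (simp add: mult.assoc flip: exp_add)
  then show ?thesis using le[of t] t0 by auto
qed simp

lemma ode_on_subset: "ode_on F x T \<Longrightarrow> S \<le> T \<Longrightarrow> ode_on F x S"
  unfolding ode_on_def
proof
  fix t assume x: "\<forall>t\<in>{0..T}. (x has_vector_derivative F (x t)) (at t within {0..T})" "S \<le> T" "t \<in> {0..S}"
  then show "(x has_vector_derivative F (x t)) (at t within {0..S})"
    by (auto intro: has_vector_derivative_within_subset[of x "F (x t)" t "{0..T}" "{0..S}"])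
qed

lemma ode_on_continuous: "ode_on F x T \<Longrightarrow> continuous_on {0..T} x"
  unfolding ode_on_def
  using has_vector_derivative_continuous continuous_on_eq_continuous_within by blast

lemma ode_on_bounded:
  assumes "ode_on F x T"
  obtains N where "\<And>t. t \<in> {0..T} \<Longrightarrow> norm (x t) \<le> N"
proof -
  have "bounded (x ` {0..T})"
    by (intro compact_imp_bounded compact_continuous_image ode_on_continuous[OF assms]) simp
  then show ?thesis using that unfolding bounded_iff by blast
qed

lemma ode_on_unique:
  assumes lip: "\<And>N. \<exists>L. \<forall>x y. norm x \<le> N \<longrightarrow> norm y \<le> N \<longrightarrow> norm (F x - F y) \<le> L * norm (x - y)"
    and x: "ode_on F x T" and y: "ode_on F y T" and 0: "x 0 = y 0" and t: "t \<in> {0..T}"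
  shows "x t = y t"
proof -
  obtain N1 N2 where N: "\<And>t. t \<in> {0..T} \<Longrightarrow> norm (x t) \<le> N1" "\<And>t. t \<in> {0..T} \<Longrightarrow> norm (y t) \<le> N2"
    using ode_on_bounded[OF x] ode_on_bounded[OF y] by metis
  obtain L where L: "\<And>a b. norm a \<le> max N1 N2 \<Longrightarrow> norm b \<le> max N1 N2 \<Longrightarrow> norm (F a - F b) \<le> L * norm (a - b)"
    using lip by blast
  have "norm (x t - y t) \<le> (norm (x 0 - y 0) + 0 * t) * exp (max 0 L * t)"
  proof (rule gronwall_norm[where x = "\<lambda>t. x t - y t" and x' = "\<lambda>t. F (x t) - F (y t)"])
    fix s assume s: "s \<in> {0..T}"
    show "((\<lambda>t. x t - y t) has_vector_derivative F (x s) - F (y s)) (at s within {0..T})"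
      using x y s unfolding ode_on_def by (auto intro!: derivative_intros)
    have "norm (F (x s) - F (y s)) \<le> L * norm (x s - y s)"
      using N[OF s] by (intro L) auto
    also have "\<dots> \<le> max 0 L * norm (x s - y s)" by (intro mult_right_mono) auto
    finally show "norm (F (x s) - F (y s)) \<le> max 0 L * norm (x s - y s) + 0" by simp
  qed (use t in auto)
  then show ?thesis using 0 by simp
qed

text \<open>The iteration runs in the ball of radius N + 1: \<tau> K \<le> 1 keeps the iterates
  there and \<tau> L \<le> 1/2 makes the map a contraction. The step \<tau> is the same for all
  initial values in the ball of radius N, which is what continuation requires.\<close>

lemma picard_local:
  fixes F :: "'a::banach \<Rightarrow> 'a"
  assumes lip: "\<And>x y. norm x \<le> N + 1 \<Longrightarrow> norm y \<le> N + 1 \<Longrightarrow> norm (F x - F y) \<le> L * norm (x - y)"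
    and bd: "\<And>x. norm x \<le> N + 1 \<Longrightarrow> norm (F x) \<le> K"
    and \<tau>: "\<tau> > 0" "\<tau> * K \<le> 1" "\<tau> * L \<le> 1/2" and L: "L \<ge> 0"
    and x0: "norm x0 \<le> N"
  shows "\<exists>x. x 0 = x0 \<and> ode_on F x \<tau>"
proof -
  have N: "N \<ge> 0" using x0 norm_ge_zero order_trans by blast
  \<comment> \<open>Clamping time to [0, \<tau>] lets the fixed point be sought among bounded
    continuous functions on the whole line, a complete space; outside the interval the iterates are
    constant.\<close>
  define cl where "cl = (\<lambda>t::real. max 0 (min \<tau> t))"
  have cl: "cl t \<in> {0..\<tau>}" "t \<in> {0..\<tau>} \<Longrightarrow> cl t = t" for t
    using \<tau> unfolding cl_def by auto
  have ccl: "continuous_on UNIV cl" unfolding cl_def by (intro continuous_intros)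
  define S :: "(real \<Rightarrow>\<^sub>C 'a) set" where "S = {x. \<forall>t. norm (apply_bcontfun x t) \<le> N + 1}"
  define \<Phi> where "\<Phi> = (\<lambda>x t. x0 + integral {0..cl t} (\<lambda>s. F (apply_bcontfun x s)))"
  have contF: "continuous_on (cball 0 (N + 1)) F"
    by (rule lipschitz_on_continuous_on[where L=L], rule lipschitz_onI)
       (use lip L in \<open>auto simp: dist_norm\<close>)
  have cFx: "continuous_on A (\<lambda>s. F (apply_bcontfun x s))" if "x \<in> S" for x A
    by (rule continuous_on_compose2[OF contF]) (use that in \<open>auto simp: S_def\<close>)
  have intF: "(\<lambda>s. F (apply_bcontfun x s)) integrable_on {0..a}" if "x \<in> S" for x a
    by (intro integrable_continuous_real cFx that)
  have b1: "norm (\<Phi> x t) \<le> N + 1" if x: "x \<in> S" for x t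
  proof -
    have "norm (integral {0..cl t} (\<lambda>s. F (apply_bcontfun x s))) \<le> K * (cl t - 0)"
      by (rule integral_bound) (use cl[of t] cFx[OF x] bd x in \<open>auto simp: S_def\<close>)
    also have "\<dots> \<le> K * \<tau>"
    proof (rule mult_left_mono)
      show "0 \<le> K" using order_trans[OF norm_ge_zero bd[of 0]] N by simp
    qed (use cl[of t] in auto)
    finally show ?thesis using \<tau> x0 norm_triangle_ineq[of x0] unfolding \<Phi>_def
      by (smt (verit) mult.commute)
  qed
  have c1: "continuous_on UNIV (\<Phi> x)" if x: "x \<in> S" for x
  proof -
    have "continuous_on {0..\<tau>} (\<lambda>t. integral {0..t} (\<lambda>s. F (apply_bcontfun x s)))"
      by (rule indefinite_integral_continuous_1[OF intF[OF x]])
    then show ?thesis unfolding \<Phi>_def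
      by (intro continuous_intros continuous_on_compose2[OF _ ccl]) (use cl in auto)
  qed
  have in_b: "\<Phi> x \<in> bcontfun" if x: "x \<in> S" for x
    by (rule bcontfun_normI[OF c1[OF x] b1[OF x]])
  have app: "apply_bcontfun (Bcontfun (\<Phi> x)) = \<Phi> x" if x: "x \<in> S" for x
    using in_b[OF x] by (simp add: Bcontfun_inverse)
  have "\<exists>!x\<in>S. Bcontfun (\<Phi> x) = x"
  proof (rule Banach_fix[of S "1/2"])
    have "S = PiC UNIV (\<lambda>_. cball 0 (N + 1))"
      unfolding S_def by (rule set_eqI) (simp add: mem_PiC_iff Pi_iff)
    moreover have "closed (PiC (UNIV :: real set) (\<lambda>_. cball (0 :: 'a) (N + 1)))"
      by (rule closed_PiC) (rule closed_cball)
    ultimately have "closed S" by simp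
    then show "complete S" by (simp add: complete_eq_closed)
    have "0 \<in> S" unfolding S_def using N by simp
    then show "S \<noteq> {}" by blast
    show "(\<lambda>x. Bcontfun (\<Phi> x)) ` S \<subseteq> S"
      using app b1 unfolding S_def by auto
    fix x y assume xy: "x \<in> S" "y \<in> S"
    show "dist (Bcontfun (\<Phi> x)) (Bcontfun (\<Phi> y)) \<le> 1/2 * dist x y"
    proof (rule dist_bound)
      fix t
      have "norm (integral {0..cl t} (\<lambda>s. F (apply_bcontfun x s) - F (apply_bcontfun y s)))
          \<le> (L * dist x y) * (cl t - 0)"
      proof (rule integral_bound)
        show "0 \<le> cl t" using cl[of t] by auto
        show "continuous_on {0..cl t} (\<lambda>s. F (apply_bcontfun x s) - F (apply_bcontfun y s))"
          by (intro continuous_intros cFx xy)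
        fix s
        have "norm (F (apply_bcontfun x s) - F (apply_bcontfun y s))
            \<le> L * norm (apply_bcontfun x s - apply_bcontfun y s)"
          using xy by (intro lip) (auto simp: S_def)
        also have "\<dots> \<le> L * dist x y"
          using dist_bounded[of x s y] L by (intro mult_left_mono) (auto simp: dist_norm)
        finally show "norm (F (apply_bcontfun x s) - F (apply_bcontfun y s)) \<le> L * dist x y" .
      qed
      also have "\<dots> \<le> (L * dist x y) * \<tau>"
        using cl[of t] L by (intro mult_left_mono) auto
      also have "\<dots> = (\<tau> * L) * dist x y" by simp
      also have "\<dots> \<le> 1/2 * dist x y"
        using \<tau> by (intro mult_right_mono) auto
      finally show "dist (apply_bcontfun (Bcontfun (\<Phi> x)) t) (apply_bcontfun (Bcontfun (\<Phi> y)) t) \<le> 1/2 * dist x y"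
        unfolding app[OF xy(1)] app[OF xy(2)] unfolding \<Phi>_def dist_norm
        using Henstock_Kurzweil_Integration.integral_diff[OF intF[OF xy(1)] intF[OF xy(2)]] by simp
    qed
  qed auto
  then obtain x where x: "x \<in> S" "Bcontfun (\<Phi> x) = x" by (elim ex1E conjE)
  have fx: "apply_bcontfun x t = \<Phi> x t" for t using app[OF x(1)] unfolding x(2) by simp
  show ?thesis
  proof (intro exI conjI)
    show "apply_bcontfun x 0 = x0" using cl(2)[of 0] \<tau> unfolding fx[of 0] \<Phi>_def by simp
    show "ode_on F (apply_bcontfun x) \<tau>"
      unfolding ode_on_def
    proof
      fix t assume t: "t \<in> {0..\<tau>}"
      have "((\<lambda>t. x0 + integral {0..t} (\<lambda>s. F (apply_bcontfun x s))) has_vector_derivative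
          0 + F (apply_bcontfun x t)) (at t within {0..\<tau>})"
        by (intro derivative_intros integral_has_vector_derivative cFx x t)
      then have "((\<lambda>t. x0 + integral {0..t} (\<lambda>s. F (apply_bcontfun x s))) has_vector_derivative
          F (apply_bcontfun x t)) (at t within {0..\<tau>})" by simp
      then show "(apply_bcontfun x has_vector_derivative F (apply_bcontfun x t)) (at t within {0..\<tau>})"
      proof (rule has_vector_derivative_transform_within[OF _ zero_less_one t])
        fix s assume "s \<in> {0..\<tau>}"
        then show "x0 + integral {0..s} (\<lambda>s. F (apply_bcontfun x s)) = apply_bcontfun x s"
          unfolding fx[of s] unfolding \<Phi>_def by (simp add: cl(2))
      qed
    qed
  qed
qed

lemma ode_on_extend:
  assumes x: "ode_on F x a" and a: "0 \<le> a" and z: "ode_on F z \<tau>" "z 0 = x a" and \<tau>: "0 < \<tau>"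
  shows "\<exists>y. y 0 = x 0 \<and> ode_on F y (a + \<tau>)"
proof -
  define y where "y = (\<lambda>t. if t \<in> {0..a} then x t else z (t - a))"
  have "y 0 = x 0" unfolding y_def using a by simp
  moreover have "ode_on F y (a + \<tau>)"
    unfolding ode_on_def
  proof
    fix t assume t: "t \<in> {0..a + \<tau>}"
    have cl: "closure {0..a} \<inter> closure {a..a + \<tau>} = {a}" using a \<tau> by auto
    have "(y has_vector_derivative (if t \<in> {0..a} then F (x t) else F (z (t - a)))) (at t within {0..a + \<tau>})"
      unfolding y_def
    proof (rule has_vector_derivative_If_within_closures[where T="{a..a + \<tau>}"])
      show "t \<in> {0..a} \<union> {a..a + \<tau>}" "{0..a + \<tau>} = {0..a} \<union> {a..a + \<tau>}" using t a \<tau> by auto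
      show "(x has_vector_derivative F (x t)) (at t within {0..a} \<union> (closure {0..a} \<inter> closure {a..a + \<tau>}))"
        if "t \<in> {0..a} \<union> (closure {0..a} \<inter> closure {a..a + \<tau>})"
        using x that a unfolding cl ode_on_def by (auto simp: insert_absorb)
      show "((\<lambda>t. z (t - a)) has_vector_derivative F (z (t - a))) (at t within {a..a + \<tau>} \<union> (closure {0..a} \<inter> closure {a..a + \<tau>}))"
        if "t \<in> {a..a + \<tau>} \<union> (closure {0..a} \<inter> closure {a..a + \<tau>})"
      proof -
        have *: "{a..a + \<tau>} \<union> {a} = {a..a + \<tau>}" using \<tau> by auto
        have t: "t \<in> {a..a + \<tau>}" using that \<tau> unfolding cl by auto
        have im: "(\<lambda>t. t - a) ` {a..a + \<tau>} = {0..\<tau>}"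
          by (auto simp: image_iff intro!: bexI[of _ "_ + a"])
        have "(z has_vector_derivative F (z (t - a))) (at (t - a) within (\<lambda>t. t - a) ` {a..a + \<tau>})"
          using z(1) t unfolding ode_on_def im by auto
        moreover have "((\<lambda>t. t - a) has_vector_derivative 1) (at t within {a..a + \<tau>})"
          by (auto intro!: derivative_eq_intros)
        ultimately have "((z \<circ> (\<lambda>t. t - a)) has_vector_derivative 1 *\<^sub>R F (z (t - a))) (at t within {a..a + \<tau>})"
          by (intro vector_diff_chain_within)
        then show ?thesis unfolding cl * by (simp add: o_def)
      qed
      show "t \<in> closure {0..a} \<Longrightarrow> t \<in> closure {a..a + \<tau>} \<Longrightarrow> x t = z (t - a)"
           "t \<in> closure {0..a} \<Longrightarrow> t \<in> closure {a..a + \<tau>} \<Longrightarrow> F (x t) = F (z (t - a))"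
        using z by auto
    qed
    then show "(y has_vector_derivative F (y t)) (at t within {0..a + \<tau>})"
      by (simp add: y_def if_distrib)
  qed
  ultimately show ?thesis by blast
qed

theorem ode_global:
  fixes F :: "'a::banach \<Rightarrow> 'a"
  assumes lip: "\<And>N. \<exists>L. \<forall>x y. norm x \<le> N \<longrightarrow> norm y \<le> N \<longrightarrow> norm (F x - F y) \<le> L * norm (x - y)"
    and apriori: "\<And>T. \<exists>N. \<forall>\<tau>\<in>{0..T}. \<forall>x. x 0 = x0 \<longrightarrow> ode_on F x \<tau> \<longrightarrow> norm (x \<tau>) \<le> N"
  shows "\<exists>x. x 0 = x0 \<and> (\<forall>t\<ge>0. (x has_vector_derivative F (x t)) (at t within {0..}))"
proof -
  have fin: "\<exists>x. x 0 = x0 \<and> ode_on F x T" for T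
  proof -
    obtain N0 where N0: "\<And>\<tau> x. \<tau> \<in> {0..T} \<Longrightarrow> x 0 = x0 \<Longrightarrow> ode_on F x \<tau> \<Longrightarrow> norm (x \<tau>) \<le> N0"
      using apriori[of T] by blast
    define N where "N = max 0 N0"
    obtain L0 where L0: "\<And>x y. norm x \<le> N + 1 \<Longrightarrow> norm y \<le> N + 1 \<Longrightarrow> norm (F x - F y) \<le> L0 * norm (x - y)"
      using lip by blast
    define L where "L = max 0 L0"
    have L: "norm (F x - F y) \<le> L * norm (x - y)" if "norm x \<le> N + 1" "norm y \<le> N + 1" for x y
      using order_trans[OF L0[OF that] mult_right_mono[of L0 L "norm (x - y)"]] unfolding L_def by simp
    define K where "K = norm (F 0) + L * (N + 1)"
    have N_0: "N \<ge> 0" and L_0: "L \<ge> 0" unfolding N_def L_def by auto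
    then have K_0: "K \<ge> 0" unfolding K_def by simp
    have K: "norm (F x) \<le> K" if "norm x \<le> N + 1" for x
    proof -
      have "norm (F x) \<le> norm (F 0) + norm (F x - F 0)" by (rule norm_triangle_sub)
      also have "\<dots> \<le> norm (F 0) + L * norm (x - 0)" using that N_0 by (intro add_left_mono L) auto
      also have "\<dots> \<le> K" unfolding K_def using that L_0 by (intro add_left_mono mult_left_mono) auto
      finally show ?thesis .
    qed
    \<comment> \<open>One step length for the whole interval: the a priori bound N holds at every
      restart time, so L and K never change and T is reached after finitely many steps.\<close>
    define \<tau> where "\<tau> = 1 / (2 * (1 + K + L))"
    have \<tau>: "\<tau> > 0" "\<tau> * K \<le> 1" "\<tau> * L \<le> 1/2"
      using K_0 L_0 unfolding \<tau>_def by (auto simp: field_simps)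
    have "\<exists>x. x 0 = x0 \<and> ode_on F x (min T (real n * \<tau>))" for n
    proof (induction n)
      case 0
      have "ode_on F (\<lambda>_. x0) (min T 0)"
      proof (cases "T < 0")
        case False
        then have e: "min T 0 = 0" by simp
        \<comment> \<open>Within a singleton every linear map is a derivative, so the constant
          function solves the equation on the degenerate interval [0, 0].\<close>
        have "((\<lambda>_. x0) has_derivative (\<lambda>h. h *\<^sub>R F x0)) (at 0 within {0})"
          unfolding has_derivative_within_singleton_iff by (rule bounded_linear_scaleR_left)
        then show ?thesis unfolding ode_on_def e has_vector_derivative_def by simp
      qed (simp add: ode_on_def)
      then show ?case by auto
    next
      case (Suc n)
      then obtain x where x: "x 0 = x0" "ode_on F x (min T (real n * \<tau>))" by blast
      define a where "a = min T (real n * \<tau>)"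
      show ?case
      proof (cases "T \<ge> 0")
        case True
        have a: "0 \<le> a" "a \<le> T" using True \<tau> unfolding a_def by auto
        have "norm (x a) \<le> N" using N0[of a x] x a unfolding a_def N_def by auto
        then obtain z where z: "z 0 = x a" "ode_on F z \<tau>"
          using picard_local[OF L K \<tau> L_0] by blast
        then obtain y where y: "y 0 = x0" "ode_on F y (a + \<tau>)"
          using ode_on_extend[of F x a z \<tau>] x a \<tau> unfolding a_def by auto
        have "min T (real (Suc n) * \<tau>) \<le> a + \<tau>" using \<tau> unfolding a_def by (auto simp: algebra_simps)
        then show ?thesis using y ode_on_subset by blast
      next
        case False
        then show ?thesis using x by (intro exI[of _ x]) (auto simp: ode_on_def)
      qed
    qed
    moreover obtain n where "T / \<tau> < real n" using reals_Archimedean2 by blast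
    then have "min T (real n * \<tau>) = T" using \<tau> by (simp add: field_simps)
    ultimately show ?thesis by metis
  qed
  then obtain X where X: "\<And>T. X T 0 = x0" "\<And>T. ode_on F (X T) T" by metis
  have same: "X T t = X S t" if "0 \<le> t" "t \<le> T" "t \<le> S" for t T S
    by (rule ode_on_unique[OF lip ode_on_subset[OF X(2) that(2)] ode_on_subset[OF X(2) that(3)]])
       (use that X(1) in auto)
  \<comment> \<open>The solution on [0, t + 1] is read off at t because there the derivative within
    [0, t + 1] is also the derivative within the half-line.\<close>
  define x where "x = (\<lambda>t. X (t + 1) t)"
  show ?thesis
  proof (intro exI conjI allI impI)
    show "x 0 = x0" unfolding x_def using X by simp
    fix t :: real assume t: "t \<ge> 0"
    have "(X (t + 1) has_vector_derivative F (X (t + 1) t)) (at t within {0..t + 1})"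
      using X(2)[of "t + 1"] t unfolding ode_on_def by auto
    also have "at t within {0..t + 1} = at t within {0..}"
      by (rule at_within_nhd[of _ "{t - 1<..<t + 1}"]) auto
    finally have "(X (t + 1) has_vector_derivative F (x t)) (at t within {0..})"
      unfolding x_def .
    then show "(x has_vector_derivative F (x t)) (at t within {0..})"
    proof (rule has_vector_derivative_transform_within[where d=1])
      fix s assume "s \<in> {0..}" "dist s t < 1"
      then show "X (t + 1) s = x s"
        unfolding x_def by (intro same) (auto simp: dist_real_def)
    qed (use t in auto)
  qed
qed

section \<open>Lipschitz primitives\<close>

definition bounded_borel :: "(real \<Rightarrow> real) \<Rightarrow> bool" where
  "bounded_borel f \<longleftrightarrow> f \<in> borel_measurable borel \<and> (\<exists>C. \<forall>x. \<bar>f x\<bar> \<le> C)"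

text \<open>A Lipschitz function comes with one everywhere defined, bounded representative of its
  derivative, so that the derivative can later be a coordinate of an ODE at each point. Half-open
  intervals split without overlap.\<close>

definition primitive :: "(real \<Rightarrow> real) \<Rightarrow> (real \<Rightarrow> real) \<Rightarrow> bool" where
  "primitive F f \<longleftrightarrow> bounded_borel f \<and> (\<forall>a b. a \<le> b \<longrightarrow> F b - F a = (LINT x:{a<..b}|lborel. f x))"

lemma bounded_borelI: "f \<in> borel_measurable borel \<Longrightarrow> (\<And>x. \<bar>f x\<bar> \<le> C) \<Longrightarrow> bounded_borel f"
  unfolding bounded_borel_def by blast

lemma bounded_borel_measurable[measurable_dest]: "bounded_borel f \<Longrightarrow> f \<in> borel_measurable borel"
  unfolding bounded_borel_def by blast

lemma bounded_borelE:
  assumes "bounded_borel f"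
  obtains C where "C \<ge> 0" "\<And>x. \<bar>f x\<bar> \<le> C"
  using assms unfolding bounded_borel_def by (metis abs_ge_zero order_trans)

lemma bounded_borel_const: "bounded_borel (\<lambda>x. c)"
  by (rule bounded_borelI[of _ "\<bar>c\<bar>"]) auto

lemma bounded_borel_add:
  assumes "bounded_borel f" "bounded_borel g"
  shows "bounded_borel (\<lambda>x. f x + g x)"
proof -
  obtain C D where "\<And>x. \<bar>f x\<bar> \<le> C" "\<And>x. \<bar>g x\<bar> \<le> D"
    using assms unfolding bounded_borel_def by blast
  then have "\<bar>f x + g x\<bar> \<le> C + D" for x
    by (meson abs_triangle_ineq add_mono order_trans)
  moreover have "(\<lambda>x. f x + g x) \<in> borel_measurable borel"
    using assms[THEN bounded_borel_measurable] by (rule borel_measurable_add)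
  ultimately show ?thesis by (intro bounded_borelI)
qed

lemma bounded_borel_mult:
  assumes "bounded_borel f" "bounded_borel g"
  shows "bounded_borel (\<lambda>x. f x * g x)"
proof -
  obtain C D where "C \<ge> 0" "\<And>x. \<bar>f x\<bar> \<le> C" "\<And>x. \<bar>g x\<bar> \<le> D"
    using assms by (metis bounded_borelE)
  then have "\<bar>f x * g x\<bar> \<le> C * D" for x unfolding abs_mult by (intro mult_mono) auto
  moreover have "(\<lambda>x. f x * g x) \<in> borel_measurable borel"
    using assms[THEN bounded_borel_measurable] by (rule borel_measurable_times)
  ultimately show ?thesis by (intro bounded_borelI)
qed

lemma bounded_borel_uminus: "bounded_borel f \<Longrightarrow> bounded_borel (\<lambda>x. - f x)"
  using bounded_borel_mult[OF bounded_borel_const[of "-1"]] by simp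

lemma bounded_borel_diff: "bounded_borel f \<Longrightarrow> bounded_borel g \<Longrightarrow> bounded_borel (\<lambda>x. f x - g x)"
  using bounded_borel_add[OF _ bounded_borel_uminus] by simp

lemma bounded_borel_power: "bounded_borel f \<Longrightarrow> bounded_borel (\<lambda>x. f x ^ n)"
  by (induction n) (simp_all add: bounded_borel_const bounded_borel_mult)

lemmas bounded_borel_intros = bounded_borel_const bounded_borel_add bounded_borel_mult
  bounded_borel_uminus bounded_borel_diff bounded_borel_power

section \<open>Integrals over half-open intervals\<close>

lemma set_integrable_bounded:
  assumes f: "f \<in> borel_measurable borel" and b: "\<And>x. x \<in> {a<..b} \<Longrightarrow> \<bar>f x\<bar> \<le> C"
  shows "set_integrable lborel {a<..b} (f :: real \<Rightarrow> real)"
  unfolding set_integrable_def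
proof (rule Bochner_Integration.integrable_bound)
  show "integrable lborel (\<lambda>x. indicator {a<..b} x * \<bar>C\<bar> :: real)"
    by (cases "a \<le> b") auto
  show "AE x in lborel. norm (indicator {a<..b} x *\<^sub>R f x) \<le> norm (indicator {a<..b} x * \<bar>C\<bar>)"
    using b by (intro AE_I2) (force simp: indicator_def)
qed (use f in measurable)

lemma bounded_borel_set_integrable: "bounded_borel f \<Longrightarrow> set_integrable lborel {a<..b} f"
  unfolding bounded_borel_def using set_integrable_bounded by blast

lemma set_integral_bound:
  fixes f :: "real \<Rightarrow> real"
  assumes f: "f \<in> borel_measurable borel" and b: "\<And>x. x \<in> {a<..b} \<Longrightarrow> \<bar>f x\<bar> \<le> C" and ab: "a \<le> b"
  shows "\<bar>LINT x:{a<..b}|lborel. f x\<bar> \<le> C * (b - a)"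
proof -
  have "norm (LINT x|lborel. indicator {a<..b} x *\<^sub>R f x) \<le> (LINT x|lborel. norm (indicator {a<..b} x *\<^sub>R f x))"
    by (rule integral_norm_bound)
  also have "\<dots> \<le> (LINT x|lborel. indicator {a<..b} x *\<^sub>R C)"
  proof (rule integral_mono)
    show "integrable lborel (\<lambda>x. norm (indicator {a<..b} x *\<^sub>R f x))"
      using set_integrable_bounded[OF f b] unfolding set_integrable_def by (rule integrable_norm)
    show "integrable lborel (\<lambda>x. indicator {a<..b} x *\<^sub>R C)" using ab by auto
    show "norm (indicator {a<..b} x *\<^sub>R f x) \<le> indicator {a<..b} x *\<^sub>R C" for x
      using b[of x] by (auto simp: indicator_def)
  qed
  also have "\<dots> = C * (b - a)" using ab by simp
  finally show ?thesis unfolding set_lebesgue_integral_def by simp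
qed

lemma set_integral_Ioc_combine:
  fixes f :: "real \<Rightarrow> real"
  assumes "a \<le> b" "b \<le> c" "set_integrable lborel {a<..c} f"
  shows "(LINT x:{a<..c}|lborel. f x) = (LINT x:{a<..b}|lborel. f x) + (LINT x:{b<..c}|lborel. f x)"
proof -
  have e: "{a<..c} = {a<..b} \<union> {b<..c}" using assms by auto
  have i: "set_integrable lborel {a<..b} f" "set_integrable lborel {b<..c} f"
    by (rule set_integrable_subset[OF assms(3)]; use assms in auto)+
  show ?thesis unfolding e by (rule set_integral_Un[OF _ i]) auto
qed

lemma set_integral_Icc_Ioc:
  fixes f :: "real \<Rightarrow> real"
  assumes "f \<in> borel_measurable borel"
  shows "(LINT x:{a..b}|lborel. f x) = (LINT x:{a<..b}|lborel. f x)"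
  unfolding set_lebesgue_integral_def
proof (rule integral_cong_AE)
  have "AE x in lborel. x \<noteq> a" by (rule AE_lborel_singleton)
  then show "AE x in lborel. indicator {a..b} x *\<^sub>R f x = indicator {a<..b} x *\<^sub>R f x"
    by eventually_elim (auto simp: indicator_def)
qed (use assms in measurable)

lemma primitiveD:
  assumes "primitive F f"
  shows "bounded_borel f" "f \<in> borel_measurable borel"
    "a \<le> b \<Longrightarrow> F b - F a = (LINT x:{a<..b}|lborel. f x)"
  using assms unfolding primitive_def bounded_borel_def by auto

lemma primitive_lipschitz:
  assumes F: "primitive F f" and C: "\<And>x. \<bar>f x\<bar> \<le> C"
  shows "\<bar>F x - F y\<bar> \<le> C * \<bar>x - y\<bar>"
proof -
  have *: "\<bar>F x - F y\<bar> \<le> C * \<bar>x - y\<bar>" if "y \<le> x" for x y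
    using set_integral_bound[OF primitiveD(2)[OF F] C that] primitiveD(3)[OF F that] that by simp
  show ?thesis
    using *[of x y] *[of y x] by (cases "x \<le> y") (auto simp: abs_minus_commute)
qed

lemma primitive_continuous:
  assumes F: "primitive F f"
  shows "continuous_on A F"
proof -
  obtain C where C: "C \<ge> 0" "\<And>x. \<bar>f x\<bar> \<le> C"
    using primitiveD(1)[OF F] bounded_borelE by blast
  show ?thesis
    by (rule lipschitz_on_continuous_on[where L=C], rule lipschitz_onI)
       (use primitive_lipschitz[OF F C(2)] C in \<open>auto simp: dist_real_def\<close>)
qed

lemma primitive_measurable: "primitive F f \<Longrightarrow> F \<in> borel_measurable borel"
  by (rule borel_measurable_continuous_onI[OF primitive_continuous])

lemma primitive_const: "primitive (\<lambda>x. c) (\<lambda>x. 0)"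
  unfolding primitive_def by (simp add: bounded_borel_const)

lemma primitive_id: "primitive (\<lambda>x. x) (\<lambda>x. 1)"
  unfolding primitive_def by (auto simp: bounded_borel_const set_lebesgue_integral_def)

lemma primitive_add:
  assumes "primitive F f" "primitive G g"
  shows "primitive (\<lambda>x. F x + G x) (\<lambda>x. f x + g x)"
  using assms unfolding primitive_def
  by (auto simp: bounded_borel_add bounded_borel_set_integrable set_integral_add(2) algebra_simps)

lemma primitive_cmult:
  assumes "primitive F f"
  shows "primitive (\<lambda>x. c * F x) (\<lambda>x. c * f x)"
  using assms unfolding primitive_def
  by (auto simp: bounded_borel_mult bounded_borel_const simp flip: right_diff_distrib)

lemma primitive_diff:
  assumes "primitive F f" "primitive G g"
  shows "primitive (\<lambda>x. F x - G x) (\<lambda>x. f x - g x)"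
  using primitive_add[OF assms(1) primitive_cmult[OF assms(2), of "-1"]] by simp

lemma primitive_cong: "primitive F f \<Longrightarrow> (\<And>x. f x = g x) \<Longrightarrow> primitive F g"
  by (metis ext)

text \<open>A function whose increments are quadratically small is constant; this replaces
  differentiation almost everywhere in the product and chain rules.\<close>

lemma quadratic_increment_const:
  fixes \<Psi> :: "real \<Rightarrow> real"
  assumes q: "\<And>u v. a \<le> u \<Longrightarrow> u \<le> v \<Longrightarrow> v \<le> b \<Longrightarrow> \<bar>\<Psi> v - \<Psi> u\<bar> \<le> C * (v - u)\<^sup>2" and ab: "a \<le> b"
  shows "\<Psi> b = \<Psi> a"
proof -
  have q': "\<bar>\<Psi> v - \<Psi> u\<bar> \<le> C * (v - u)\<^sup>2" if "u \<in> {a..b}" "v \<in> {a..b}" for u v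
    using q[of u v] q[of v u] that by (cases "u \<le> v") (auto simp: abs_minus_commute power2_commute)
  have "(\<Psi> has_real_derivative 0) (at x within {a..b})" if x: "x \<in> {a..b}" for x
    unfolding has_field_derivative_iff
  proof (rule tendsto_rabs_zero_cancel, rule tendsto_sandwich[of "\<lambda>_. 0" _ _ "\<lambda>y. C * \<bar>y - x\<bar>"])
    show "\<forall>\<^sub>F y in at x within {a..b}. \<bar>(\<Psi> y - \<Psi> x) / (y - x)\<bar> \<le> C * \<bar>y - x\<bar>"
      unfolding eventually_at
    proof (intro exI conjI ballI impI)
      fix y assume y: "y \<in> {a..b}" "y \<noteq> x \<and> dist y x < 1"
      then have "\<bar>\<Psi> y - \<Psi> x\<bar> \<le> (C * \<bar>y - x\<bar>) * \<bar>y - x\<bar>"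
        using q'[OF x y(1)] by (simp add: power2_eq_square mult.assoc flip: abs_mult)
      then show "\<bar>(\<Psi> y - \<Psi> x) / (y - x)\<bar> \<le> C * \<bar>y - x\<bar>"
        using y by (simp add: abs_divide divide_le_eq)
    qed simp
    have "((\<lambda>y. C * \<bar>y - x\<bar>) \<longlongrightarrow> C * \<bar>x - x\<bar>) (at x within {a..b})"
      by (intro tendsto_intros)
    then show "((\<lambda>y. C * \<bar>y - x\<bar>) \<longlongrightarrow> 0) (at x within {a..b})" by simp
  qed auto
  then obtain c where "\<And>x. x \<in> {a..b} \<Longrightarrow> \<Psi> x = c"
    using has_field_derivative_zero_constant[of "{a..b}" \<Psi>] by auto
  then show ?thesis using ab by simp
qed

text \<open>Reduces a derivative formula to a local check: increments only have to match the
  candidate integral up to an error quadratic in the length of the interval.\<close>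

lemma increment_eq_integral:
  fixes F :: "real \<Rightarrow> real"
  assumes f: "f \<in> borel_measurable borel" "\<And>x. x \<in> {a<..b} \<Longrightarrow> \<bar>f x\<bar> \<le> D" and ab: "a \<le> b"
    and q: "\<And>u v. a \<le> u \<Longrightarrow> u \<le> v \<Longrightarrow> v \<le> b \<Longrightarrow> \<bar>F v - F u - (LINT x:{u<..v}|lborel. f x)\<bar> \<le> C * (v - u)\<^sup>2"
  shows "F b - F a = (LINT x:{a<..b}|lborel. f x)"
proof -
  define \<Psi> where "\<Psi> = (\<lambda>v. F v - (LINT x:{a<..v}|lborel. f x))"
  have "\<Psi> b = \<Psi> a"
  proof (rule quadratic_increment_const[OF _ ab])
    fix u v assume uv: "a \<le> u" "u \<le> v" "v \<le> b"
    have "set_integrable lborel {a<..v} f"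
      by (rule set_integrable_subset[OF set_integrable_bounded[OF f]]) (use uv in auto)
    then show "\<bar>\<Psi> v - \<Psi> u\<bar> \<le> C * (v - u)\<^sup>2"
      using q[OF uv] set_integral_Ioc_combine[OF uv(1,2)] unfolding \<Psi>_def by (simp add: algebra_simps)
  qed
  then show ?thesis unfolding \<Psi>_def by (simp add: set_lebesgue_integral_def)
qed

section \<open>Product and exponential rules for primitives\<close>

lemma continuous_Icc_bounded:
  fixes F :: "real \<Rightarrow> real"
  assumes "continuous_on {a..b} F"
  obtains C where "C \<ge> 0" "\<And>x. x \<in> {a..b} \<Longrightarrow> \<bar>F x\<bar> \<le> C"
proof -
  have "bounded (F ` {a..b})" by (intro compact_imp_bounded compact_continuous_image assms) simp
  then obtain C where "\<forall>y\<in>F ` {a..b}. norm y \<le> C" unfolding bounded_iff by (elim exE)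
  then have "\<And>x. x \<in> {a..b} \<Longrightarrow> \<bar>F x\<bar> \<le> C" by simp
  then show ?thesis by (intro that[of "max 0 C"]) (auto simp: le_max_iff_disj)
qed

text \<open>Continuity bounds both factors on [a, b], so the rule covers unbounded primitives such
  as y, which integration by parts against a test function requires.\<close>

lemma primitive_product:
  assumes F: "primitive F f" and G: "primitive G g" and ab: "a \<le> b"
  shows "F b * G b - F a * G a = (LINT x:{a<..b}|lborel. f x * G x + F x * g x)"
proof -
  obtain Cf Cg where C: "Cf \<ge> 0" "\<And>x. \<bar>f x\<bar> \<le> Cf" "Cg \<ge> 0" "\<And>x. \<bar>g x\<bar> \<le> Cg"
    using primitiveD(1)[OF F] primitiveD(1)[OF G] by (metis bounded_borelE)
  obtain BF BG where B: "BF \<ge> 0" "\<And>x. x \<in> {a..b} \<Longrightarrow> \<bar>F x\<bar> \<le> BF" "BG \<ge> 0" "\<And>x. x \<in> {a..b} \<Longrightarrow> \<bar>G x\<bar> \<le> BG"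
    using continuous_Icc_bounded[OF primitive_continuous[OF F, of "{a..b}"]]
      continuous_Icc_bounded[OF primitive_continuous[OF G, of "{a..b}"]] by metis
  have [measurable]: "f \<in> borel_measurable borel" "g \<in> borel_measurable borel"
      "F \<in> borel_measurable borel" "G \<in> borel_measurable borel"
    using primitiveD(2)[OF F] primitiveD(2)[OF G] primitive_measurable[OF F] primitive_measurable[OF G] by auto
  have bd: "\<bar>f x * G x + F x * g x\<bar> \<le> Cf * BG + BF * Cg" if "x \<in> {a<..b}" for x
  proof -
    have "\<bar>f x * G x\<bar> \<le> Cf * BG" "\<bar>F x * g x\<bar> \<le> BF * Cg"
      unfolding abs_mult using that C B by (intro mult_mono; force)+
    then show ?thesis by linarith
  qed
  show ?thesis
  proof (rule increment_eq_integral[OF _ bd ab])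
    fix u v assume uv: "a \<le> u" "u \<le> v" "v \<le> b"
    have s: "set_integrable lborel {u<..v} (\<lambda>x. f x * G x + F x * g x)"
      by (rule set_integrable_subset[OF set_integrable_bounded[OF _ bd]]) (use uv in auto)
    have sf: "set_integrable lborel {u<..v} f" "set_integrable lborel {u<..v} g"
      by (intro bounded_borel_set_integrable primitiveD[OF F] primitiveD[OF G])+
    \<comment> \<open>The product rule for differences freezes G at the right end and F at the left
      end; what remains is the Lipschitz oscillation of F and G over the interval, hence a quadratic
      error.\<close>
    have e: "F v * G v - F u * G u = (LINT x:{u<..v}|lborel. G v * f x + F u * g x)"
    proof -
      have "F v * G v - F u * G u = G v * (F v - F u) + F u * (G v - G u)" by (simp add: algebra_simps)
      also have "\<dots> = (LINT x:{u<..v}|lborel. G v * f x) + (LINT x:{u<..v}|lborel. F u * g x)"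
        unfolding primitiveD(3)[OF F uv(2)] primitiveD(3)[OF G uv(2)] by simp
      also have "\<dots> = (LINT x:{u<..v}|lborel. G v * f x + F u * g x)"
        by (rule set_integral_add(2)[symmetric]) (intro set_integrable_mult_right sf)+
      finally show ?thesis .
    qed
    have "F v * G v - F u * G u - (LINT x:{u<..v}|lborel. f x * G x + F x * g x)
        = (LINT x:{u<..v}|lborel. (G v * f x + F u * g x) - (f x * G x + F x * g x))"
      unfolding e using sf by (intro set_integral_diff(2)[symmetric] s set_integral_add(1) set_integrable_mult_right)
    also have "\<bar>\<dots>\<bar> \<le> (Cf * (Cg * (v - u)) + Cf * (v - u) * Cg) * (v - u)"
    proof (rule set_integral_bound[OF _ _ uv(2)])
      fix x assume x: "x \<in> {u<..v}"
      have "\<bar>f x * (G v - G x)\<bar> \<le> Cf * (Cg * (v - u))"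
        unfolding abs_mult
        by (intro mult_mono C(2) order_trans[OF primitive_lipschitz[OF G C(4)]] mult_left_mono)
           (use x C in auto)
      moreover have "\<bar>(F u - F x) * g x\<bar> \<le> Cf * (v - u) * Cg"
        unfolding abs_mult
        by (intro mult_mono C(4) order_trans[OF primitive_lipschitz[OF F C(2)]] mult_left_mono)
           (use x C in auto)
      ultimately show "\<bar>(G v * f x + F u * g x) - (f x * G x + F x * g x)\<bar> \<le> Cf * (Cg * (v - u)) + Cf * (v - u) * Cg"
        by (simp add: algebra_simps)
    qed measurable
    also have "\<dots> = (2 * Cf * Cg) * (v - u)\<^sup>2" by (simp add: power2_eq_square)
    finally show "\<bar>F v * G v - F u * G u - (LINT x:{u<..v}|lborel. f x * G x + F x * g x)\<bar>
        \<le> (2 * Cf * Cg) * (v - u)\<^sup>2" .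
  qed measurable
qed

lemma primitive_mult:
  assumes F: "primitive F f" and G: "primitive G g" and "bounded_borel F" "bounded_borel G"
  shows "primitive (\<lambda>x. F x * G x) (\<lambda>x. f x * G x + F x * g x)"
  unfolding primitive_def using primitive_product[OF F G] assms(3,4) primitiveD(1)[OF F] primitiveD(1)[OF G]
  by (auto intro!: bounded_borel_intros)

lemma exp_diff_le:
  fixes s t B :: real
  assumes "s \<le> B" "t \<le> B"
  shows "\<bar>exp s - exp t\<bar> \<le> exp B * \<bar>s - t\<bar>"
proof -
  have *: "\<bar>exp s - exp t\<bar> \<le> exp B * \<bar>s - t\<bar>" if "t \<le> s" "s \<le> B" for s t :: real
  proof -
    have "exp s * (1 + (t - s)) \<le> exp s * exp (t - s)" by (intro mult_left_mono exp_ge_add_one_self) auto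
    then have "exp s - exp t \<le> exp s * (s - t)" by (simp add: algebra_simps flip: exp_add)
    also have "\<dots> \<le> exp B * (s - t)" using that by (intro mult_right_mono) auto
    finally show ?thesis using that by simp
  qed
  show ?thesis using *[of t s] *[of s t] assms by (cases "s \<le> t") (auto simp: abs_minus_commute)
qed

lemma primitive_exp:
  assumes F: "primitive F f" and ab: "a \<le> b"
  shows "exp (F b) - exp (F a) = (LINT x:{a<..b}|lborel. f x * exp (F x))"
proof -
  obtain C where C: "C \<ge> 0" "\<And>x. \<bar>f x\<bar> \<le> C"
    using primitiveD(1)[OF F] by (metis bounded_borelE)
  obtain B where B: "B \<ge> 0" "\<And>x. x \<in> {a..b} \<Longrightarrow> \<bar>F x\<bar> \<le> B"
    using continuous_Icc_bounded[OF primitive_continuous[OF F, of "{a..b}"]] by metis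
  have [measurable]: "f \<in> borel_measurable borel" "F \<in> borel_measurable borel"
    using primitiveD(2)[OF F] primitive_measurable[OF F] by auto
  have le: "F x \<le> B" if "x \<in> {a..b}" for x using B(2)[OF that] by linarith
  have bd: "\<bar>f x * exp (F x)\<bar> \<le> C * exp B" if "x \<in> {a<..b}" for x
    unfolding abs_mult using that le[of x] C by (intro mult_mono) auto
  show ?thesis
  proof (rule increment_eq_integral[OF _ bd ab])
    fix u v assume uv: "a \<le> u" "u \<le> v" "v \<le> b"
    \<comment> \<open>s is a mean value point of exp between F u and F v. Being within C (v - u) of
      F u, it makes the error below quadratic.\<close>
    have "\<exists>s. \<bar>s - F u\<bar> \<le> C * (v - u) \<and> s \<le> B \<and> exp (F v) - exp (F u) = exp s * (F v - F u)"
    proof -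
      have L: "\<bar>F v - F u\<bar> \<le> C * (v - u)" using primitive_lipschitz[OF F C(2), of v u] uv by simp
      have le': "F u \<le> B" "F v \<le> B" using le uv by auto
      consider "F u = F v" | "F u < F v" | "F v < F u" by linarith
      then show ?thesis
      proof cases
        case 2
        obtain s where "F u < s" "s < F v" "exp (F v) - exp (F u) = (F v - F u) * exp s"
          using MVT2[OF 2, of exp exp] DERIV_exp by blast
        then show ?thesis using L le' by (intro exI[of _ s]) auto
      next
        case 3
        obtain s where "F v < s" "s < F u" "exp (F u) - exp (F v) = (F u - F v) * exp s"
          using MVT2[OF 3, of exp exp] DERIV_exp by blast
        then show ?thesis using L le' by (intro exI[of _ s]) (auto simp: algebra_simps)
      qed (use le' C uv in \<open>auto intro!: exI[of _ "F u"]\<close>)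
    qed
    then obtain s where s: "\<bar>s - F u\<bar> \<le> C * (v - u)" "s \<le> B" "exp (F v) - exp (F u) = exp s * (F v - F u)"
      by blast
    have si: "set_integrable lborel {u<..v} f" "set_integrable lborel {u<..v} (\<lambda>x. f x * exp (F x))"
      by (rule bounded_borel_set_integrable[OF primitiveD(1)[OF F]],
          rule set_integrable_subset[OF set_integrable_bounded[OF _ bd]]) (use uv in auto)
    have "exp (F v) - exp (F u) - (LINT x:{u<..v}|lborel. f x * exp (F x))
        = (LINT x:{u<..v}|lborel. exp s * f x - f x * exp (F x))"
      unfolding s(3) primitiveD(3)[OF F uv(2)]
      by (subst set_integral_diff(2)) (use si in \<open>auto intro: set_integrable_mult_right\<close>)
    also have "\<bar>\<dots>\<bar> \<le> (C * (exp B * (2 * C * (v - u)))) * (v - u)"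
    proof (rule set_integral_bound[OF _ _ uv(2)])
      fix x assume x: "x \<in> {u<..v}"
      have "\<bar>F u - F x\<bar> \<le> C * \<bar>u - x\<bar>" by (rule primitive_lipschitz[OF F C(2)])
      also have "\<dots> \<le> C * (v - u)" using x C by (intro mult_left_mono) auto
      finally have "\<bar>s - F x\<bar> \<le> 2 * C * (v - u)" using s(1) by (simp add: algebra_simps)
      then have "exp B * \<bar>s - F x\<bar> \<le> exp B * (2 * C * (v - u))" by (intro mult_left_mono) auto
      moreover have "\<bar>exp s - exp (F x)\<bar> \<le> exp B * \<bar>s - F x\<bar>"
        by (rule exp_diff_le[OF s(2) le]) (use x uv in auto)
      ultimately have "\<bar>exp s - exp (F x)\<bar> \<le> exp B * (2 * C * (v - u))" by (rule order_trans[rotated])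
      then have "\<bar>f x\<bar> * \<bar>exp s - exp (F x)\<bar> \<le> C * (exp B * (2 * C * (v - u)))"
        using C by (intro mult_mono) auto
      then show "\<bar>exp s * f x - f x * exp (F x)\<bar> \<le> C * (exp B * (2 * C * (v - u)))"
        unfolding abs_mult[symmetric] by (simp add: algebra_simps)
    qed measurable
    also have "\<dots> = (2 * C * C * exp B) * (v - u)\<^sup>2" by (simp add: power2_eq_square)
    finally show "\<bar>exp (F v) - exp (F u) - (LINT x:{u<..v}|lborel. f x * exp (F x))\<bar>
        \<le> (2 * C * C * exp B) * (v - u)\<^sup>2" .
  qed measurable
qed

section \<open>Primitives and weak derivatives\<close>

lemma primitive_of_C1:
  assumes d: "\<And>x. (F has_real_derivative f x) (at x)" and c: "continuous_on UNIV f"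
    and b: "\<And>x. \<bar>f x\<bar> \<le> C"
  shows "primitive F f"
  unfolding primitive_def
proof (intro conjI allI impI)
  have m: "f \<in> borel_measurable borel" by (rule borel_measurable_continuous_onI[OF c])
  then show "bounded_borel f" using b by (rule bounded_borelI)
  fix a b :: real assume ab: "a \<le> b"
  have "has_bochner_integral lborel (\<lambda>x. indicator {a..b} x *\<^sub>R f x) (F b - F a)"
  proof (rule has_bochner_integral_FTC_Icc[OF ab])
    show "(F has_vector_derivative f x) (at x within {a..b})" for x
      using d[of x] by (simp add: has_real_derivative_iff_has_vector_derivative has_vector_derivative_at_within)
  qed (rule continuous_on_subset[OF c], simp)
  then show "F b - F a = (LINT x:{a<..b}|lborel. f x)"
    unfolding set_integral_Icc_Ioc[OF m, symmetric] unfolding set_lebesgue_integral_def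
    by (simp add: has_bochner_integral_integral_eq)
qed

lemma test_function_primitive:
  assumes "test_function \<phi> \<phi>'"
  shows "primitive \<phi> \<phi>'"
proof -
  obtain a b C where "\<And>x. \<bar>\<phi>' x\<bar> \<le> C * indicator {a..b} x" "C \<ge> 0"
    using test_function_bounded[OF assms] by metis
  moreover from this have "C * indicator {a..b} x \<le> C" for x by (simp add: indicator_def)
  ultimately have "\<bar>\<phi>' x\<bar> \<le> C" for x by (meson order_trans)
  then show ?thesis
    using assms unfolding test_function_def by (intro primitive_of_C1) auto
qed

lemma primitive_exists:
  assumes "bounded_borel f"
  shows "\<exists>F. primitive F f"
proof -
  define F where "F = (\<lambda>x. if 0 \<le> x then (LINT u:{0<..x}|lborel. f u) else - (LINT u:{x<..0}|lborel. f u))"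
  have si: "set_integrable lborel {a<..b} f" for a b using assms by (rule bounded_borel_set_integrable)
  have "F b - F a = (LINT x:{a<..b}|lborel. f x)" if ab: "a \<le> b" for a b
  proof -
    consider "0 \<le> a" | "a < 0" "0 \<le> b" | "b < 0" using ab by linarith
    then show ?thesis
    proof cases
      case 1
      then show ?thesis using ab set_integral_Ioc_combine[OF 1 ab si] unfolding F_def by simp
    next
      case 2
      then show ?thesis using set_integral_Ioc_combine[of a 0 b f] si unfolding F_def by simp
    next
      case 3
      then show ?thesis using ab set_integral_Ioc_combine[of a b 0 f] si unfolding F_def by simp
    qed
  qed
  then show ?thesis using assms unfolding primitive_def by blast
qed

lemma primitive_has_derivative:
  assumes F: "primitive F f" and c: "continuous_on UNIV f"
  shows "(F has_real_derivative f x) (at x)"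
proof -
  have cf: "continuous_on {x-1..x+1} f" by (rule continuous_on_subset[OF c]) simp
  have e: "F u = F (x - 1) + integral {x-1..u} f" if "u \<in> {x-1..x+1}" for u
  proof -
    have "F u - F (x - 1) = (LINT t:{x-1..u}|lborel. f t)"
      using primitiveD(3)[OF F, of "x-1" u] that set_integral_Icc_Ioc[OF primitiveD(2)[OF F]] by simp
    also have "\<dots> = integral {x-1..u} f"
      by (rule set_borel_integral_eq_integral(2)) (rule borel_integrable_atLeastAtMost',
          rule continuous_on_subset[OF c], simp)
    finally show ?thesis by simp
  qed
  have "((\<lambda>u. F (x - 1) + integral {x-1..u} f) has_real_derivative 0 + f x) (at x within {x-1..x+1})"
    by (intro derivative_intros integral_has_real_derivative cf) simp
  then have "((\<lambda>u. F (x - 1) + integral {x-1..u} f) has_real_derivative f x) (at x)"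
    by (simp add: at_within_Icc_at)
  then show ?thesis
    by (rule has_field_derivative_transform_within_open[where S="{x-1<..<x+1}"]) (auto simp: e[symmetric])
qed

lemma continuous_locally_integrable:
  assumes "continuous_on UNIV f"
  shows "locally_integrable f"
  unfolding locally_integrable_def
proof (intro conjI allI)
  show "f \<in> borel_measurable borel" by (rule borel_measurable_continuous_onI[OF assms])
  show "set_integrable lborel {a..b} f" for a b
    by (rule borel_integrable_atLeastAtMost'[OF continuous_on_subset[OF assms subset_UNIV]])
qed

lemma bounded_borel_locally_integrable:
  assumes "bounded_borel f"
  shows "locally_integrable f"
  unfolding locally_integrable_def
proof (intro conjI allI)
  show "f \<in> borel_measurable borel" using assms by (rule bounded_borel_measurable)
  fix a b :: real
  have "{a..b} \<subseteq> {a-1<..b}" by auto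
  then show "set_integrable lborel {a..b} f"
    by (rule set_integrable_subset[OF bounded_borel_set_integrable[OF assms], rotated]) simp
qed

lemma primitive_has_weak_deriv:
  assumes F: "primitive F f"
  shows "has_weak_deriv F f"
  unfolding has_weak_deriv_def
proof (intro conjI allI impI)
  show lF: "locally_integrable F" by (rule continuous_locally_integrable[OF primitive_continuous[OF F]])
  show lf: "locally_integrable f" by (rule bounded_borel_locally_integrable[OF primitiveD(1)[OF F]])
  fix \<phi> \<phi>' assume t: "test_function \<phi> \<phi>'"
  obtain a b C where b: "\<And>x. \<bar>\<phi> x\<bar> \<le> C * indicator {a..b} x" "\<And>x. \<bar>\<phi>' x\<bar> \<le> C * indicator {a..b} x"
    using test_function_bounded[OF t] by metis
  \<comment> \<open>The interval from -M to M contains [a, b] with room to spare, so the test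
    function vanishes at both ends and the boundary terms drop out.\<close>
  define M where "M = max \<bar>a\<bar> \<bar>b\<bar> + 1"
  have M: "-M \<le> M" "\<And>x. x \<notin> {-M<..M} \<Longrightarrow> x \<notin> {a..b}" "-M \<notin> {a..b}" "M \<notin> {a..b}"
    unfolding M_def by (auto simp: max_def split: if_splits)
  have z: "\<phi> x = 0" "\<phi>' x = 0" if "x \<notin> {a..b}" for x using b[of x] that by auto
  have z0: "\<phi> (-M) = 0" "\<phi> M = 0"
    using z(1)[OF M(3)] z(1)[OF M(4)] by auto
  have "0 = F M * \<phi> M - F (-M) * \<phi> (-M)" using z0 by simp
  also have "\<dots> = (LINT x:{-M<..M}|lborel. f x * \<phi> x + F x * \<phi>' x)"
    by (rule primitive_product[OF F test_function_primitive[OF t] M(1)])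
  also have "\<dots> = (LINT x|lborel. f x * \<phi> x + F x * \<phi>' x)"
    unfolding set_lebesgue_integral_def
  proof (rule Bochner_Integration.integral_cong[OF refl])
    show "indicator {-M<..M} x *\<^sub>R (f x * \<phi> x + F x * \<phi>' x) = f x * \<phi> x + F x * \<phi>' x" for x
      using z[OF M(2)[of x]] by (cases "x \<in> {-M<..M}") auto
  qed
  also have "\<dots> = (LINT x|lborel. f x * \<phi> x) + (LINT x|lborel. F x * \<phi>' x)"
    by (rule Bochner_Integration.integral_add) (rule test_function_integrable[OF t] lF lf)+
  finally show "(LINT x|lborel. F x * \<phi>' x) = - (LINT x|lborel. f x * \<phi> x)" by simp
qed

text \<open>Translation invariance in place of the usual mean-value correction: testing D(x +
  \<tau>) - D(x) against \<phi> equals testing D against \<phi>(x - \<tau>) - \<phi>(x), which is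
  the derivative of a compactly supported function. So every translate of D agrees with D.\<close>

lemma zero_weak_deriv_const:
  assumes D: "has_weak_deriv D (\<lambda>x. 0)" and c: "continuous_on UNIV D"
  shows "D x = D y"
proof -
  have shift: "D (x + \<tau>) = D x" if \<tau>: "\<tau> \<ge> 0" for x \<tau>
  proof -
    define g where "g = (\<lambda>x. D (x + \<tau>) - D x)"
    have cg: "continuous_on UNIV g" unfolding g_def
      by (intro continuous_intros continuous_on_compose2[OF c]) auto
    have "AE x in lborel. g x = 0"
    proof (rule AE_zero_if_tests_zero[OF continuous_locally_integrable[OF cg]])
      fix \<phi> \<phi>' assume t: "test_function \<phi> \<phi>'"
      obtain a b C where b: "\<And>x. \<bar>\<phi> x\<bar> \<le> C * indicator {a..b} x" "C \<ge> 0" "\<phi> \<in> borel_measurable borel"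
        using test_function_bounded[OF t] by metis
      have zz: "\<phi> x = 0" if "x \<notin> {a..b}" for x using b(1)[of x] that by auto
      have bb: "bounded_borel \<phi>"
      proof (rule bounded_borelI[OF b(3)])
        show "\<bar>\<phi> x\<bar> \<le> C" for x using b(1)[of x] b(2) by (cases "x \<in> {a..b}") auto
      qed
      have c\<phi>: "continuous_on UNIV \<phi>"
        by (rule primitive_continuous[OF test_function_primitive[OF t]])
      obtain A where A: "primitive A \<phi>" using primitive_exists[OF bb] by blast
      have dA: "(A has_real_derivative \<phi> x) (at x)" for x by (rule primitive_has_derivative[OF A c\<phi>])
      \<comment> \<open>\<Phi> is minus the integral of \<phi> over (x - \<tau>, x], hence it
        vanishes outside [a, b + \<tau>] although A itself may tend to a nonzero constant.\<close>
      define \<Phi> where "\<Phi> = (\<lambda>x. A (x - \<tau>) - A x)"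
      have t2: "test_function \<Phi> (\<lambda>x. \<phi> (x - \<tau>) - \<phi> x)"
        unfolding test_function_def
      proof (intro conjI allI exI)
        fix x
        have "((\<lambda>x. A (x - \<tau>)) has_real_derivative \<phi> (x - \<tau>) * 1) (at x)"
          by (rule DERIV_chain2[OF dA]) (auto intro!: derivative_eq_intros)
        then show "(\<Phi> has_real_derivative \<phi> (x - \<tau>) - \<phi> x) (at x)"
          unfolding \<Phi>_def by (intro derivative_intros dA) simp
      next
        show "continuous_on UNIV (\<lambda>x. \<phi> (x - \<tau>) - \<phi> x)"
          by (intro continuous_intros continuous_on_compose2[OF c\<phi>]) auto
        show "compact {a..b + \<tau>}" by simp
        fix x
        show "x \<notin> {a..b + \<tau>} \<longrightarrow> \<Phi> x = 0"
        proof
          assume x: "x \<notin> {a..b + \<tau>}"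
          have "A x - A (x - \<tau>) = (LINT t:{x - \<tau><..x}|lborel. \<phi> t)"
            by (rule primitiveD(3)[OF A]) (use \<tau> in simp)
          also have "\<dots> = 0"
          proof -
            have "indicator {x - \<tau><..x} u *\<^sub>R \<phi> u = 0" for u
              using zz[of u] x \<tau> by (auto simp: indicator_def)
            then show ?thesis unfolding set_lebesgue_integral_def by (simp only: Bochner_Integration.integral_zero)
          qed
          finally show "\<Phi> x = 0" unfolding \<Phi>_def by simp
        qed
      qed
      have lD: "locally_integrable D" by (rule continuous_locally_integrable[OF c])
      have cs: "continuous_on UNIV (\<lambda>x. D (x + \<tau>))"
        by (intro continuous_intros continuous_on_compose2[OF c]) auto
      have i1: "integrable lborel (\<lambda>x. D (x + \<tau>) * \<phi> x)" "integrable lborel (\<lambda>x. D x * \<phi> x)"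
        by (rule test_function_integrable(1)[OF t continuous_locally_integrable[OF cs]])
           (rule test_function_integrable(1)[OF t lD])
      have i2: "integrable lborel (\<lambda>x. D x * \<phi> (x - \<tau>))"
        using lborel_integrable_real_affine[OF i1(1), of 1 "-\<tau>"] by (simp add: algebra_simps)
      have "(LINT x|lborel. g x * \<phi> x) = (LINT x|lborel. D (x + \<tau>) * \<phi> x) - (LINT x|lborel. D x * \<phi> x)"
        unfolding g_def left_diff_distrib by (rule Bochner_Integration.integral_diff[OF i1])
      also have "(LINT x|lborel. D (x + \<tau>) * \<phi> x) = (LINT x|lborel. D x * \<phi> (x - \<tau>))"
        using lborel_integral_real_affine[of 1 "\<lambda>x. D (x + \<tau>) * \<phi> x" "-\<tau>"] by (simp add: algebra_simps)
      also have "(LINT x|lborel. D x * \<phi> (x - \<tau>)) - (LINT x|lborel. D x * \<phi> x)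
          = (LINT x|lborel. D x * (\<phi> (x - \<tau>) - \<phi> x))"
        unfolding right_diff_distrib by (rule Bochner_Integration.integral_diff[OF i2 i1(2), symmetric])
      also have "\<dots> = 0"
      proof -
        have "(LINT x|lborel. D x * (\<phi> (x - \<tau>) - \<phi> x)) = - (LINT x|lborel. 0 * \<Phi> x)"
          using D t2 unfolding has_weak_deriv_def by blast
        then show ?thesis by simp
      qed
      finally show "(LINT x|lborel. g x * \<phi> x) = 0" .
    qed
    then have "g = (\<lambda>x. 0)" by (rule continuous_AE_zero[OF cg])
    then have "g x = 0" by simp
    then show ?thesis unfolding g_def by simp
  qed
  show ?thesis
    using shift[of "y - x" x] shift[of "x - y" y] by (cases "x \<le> y") auto
qed

text \<open>The difference from any primitive of f has zero weak derivative, so it is constant. This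
  lets an element of \<open>E\<close> with bounded derivatives be equipped with any convenient
  bounded representatives of them.\<close>

lemma has_weak_deriv_primitive:
  assumes F: "has_weak_deriv F g" "continuous_on UNIV F" and f: "bounded_borel f" "AE x in lborel. f x = g x"
  shows "primitive F f"
proof -
  obtain G where G: "primitive G f" using primitive_exists[OF f(1)] by blast
  have wG: "has_weak_deriv G f" by (rule primitive_has_weak_deriv[OF G])
  have wD: "has_weak_deriv (\<lambda>x. F x + (-1) * G x) (\<lambda>x. g x + (-1) * f x)"
    by (intro has_weak_deriv_add has_weak_deriv_cmult F wG)
  have "has_weak_deriv (\<lambda>x. F x + (-1) * G x) (\<lambda>x. 0)"
    unfolding has_weak_deriv_def
  proof (intro conjI allI impI)
    show "locally_integrable (\<lambda>x. F x + (-1) * G x)" using wD unfolding has_weak_deriv_def by blast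
    show "locally_integrable (\<lambda>x. 0)" by (rule bounded_borel_locally_integrable[OF bounded_borel_const])
    fix \<phi> \<phi>' assume t: "test_function \<phi> \<phi>'"
    have "(LINT x|lborel. (F x + (-1) * G x) * \<phi>' x) = - (LINT x|lborel. (g x + (-1) * f x) * \<phi> x)"
      using wD t unfolding has_weak_deriv_def by blast
    also have "(LINT x|lborel. (g x + (-1) * f x) * \<phi> x) = 0"
    proof (rule integral_eq_zero_AE)
      show "AE x in lborel. (g x + (-1) * f x) * \<phi> x = 0" using f(2) by eventually_elim simp
    qed
    finally show "(LINT x|lborel. (F x + (-1) * G x) * \<phi>' x) = - (LINT x|lborel. 0 * \<phi> x)" by simp
  qed
  then have "F x + (-1) * G x = F y + (-1) * G y" for x y
    by (rule zero_weak_deriv_const) (intro continuous_intros F(2) primitive_continuous[OF G])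
  then have "F x - F y = G x - G y" for x y by (simp add: algebra_simps)
  then show ?thesis using G unfolding primitive_def by simp
qed

lemma primitive_wderiv_AE: "primitive F f \<Longrightarrow> AE x in lborel. wderiv F x = f x"
  by (rule wderiv_AE[OF primitive_has_weak_deriv])

section \<open>The one-dimensional Sobolev inequality\<close>

lemma L2_bounded_intro: "f \<in> L2 \<Longrightarrow> integrable lborel (\<lambda>x. (f x)\<^sup>2)"
  unfolding L2_def by simp

text \<open>Averages F(x)^2 - F(a)^2 \<le> S over a in the unit window, where 2 F f \<le> F^2 + f^2
  defines S and contributes the second copy of the F^2 integral. The local form gives both the sup
  bound and the decay at infinity.\<close>

lemma primitive_sq_le_local:
  assumes F: "primitive F f"
  shows "(F x)\<^sup>2 \<le> 2 * (LINT t:{x-1<..x}|lborel. (F t)\<^sup>2) + (LINT t:{x-1<..x}|lborel. (f t)\<^sup>2)"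
proof -
  have [measurable]: "f \<in> borel_measurable borel" "F \<in> borel_measurable borel"
    using primitiveD(2)[OF F] primitive_measurable[OF F] by auto
  obtain C where C: "C \<ge> 0" "\<And>x. \<bar>f x\<bar> \<le> C" using primitiveD(1)[OF F] by (metis bounded_borelE)
  obtain B where B: "B \<ge> 0" "\<And>t. t \<in> {x-1..x} \<Longrightarrow> \<bar>F t\<bar> \<le> B"
    using continuous_Icc_bounded[OF primitive_continuous[OF F, of "{x-1..x}"]] by metis
  let ?A = "{x-1<..x}"
  have iF: "set_integrable lborel ?A (\<lambda>t. (F t)\<^sup>2)"
  proof (rule set_integrable_bounded[where C="B\<^sup>2"])
    show "\<bar>(F t)\<^sup>2\<bar> \<le> B\<^sup>2" if "t \<in> {x-1<..x}" for t
      using power_mono[OF B(2)[of t] abs_ge_zero, of 2] that by simp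
  qed measurable
  have if': "set_integrable lborel ?A (\<lambda>t. (f t)\<^sup>2)"
    by (intro bounded_borel_set_integrable bounded_borel_power primitiveD[OF F])
  define S where "S = (LINT t:?A|lborel. (F t)\<^sup>2 + (f t)\<^sup>2)"
  have isum: "set_integrable lborel ?A (\<lambda>t. (F t)\<^sup>2 + (f t)\<^sup>2)" by (intro set_integral_add(1) iF if')
  have le: "(F x)\<^sup>2 \<le> (F a)\<^sup>2 + S" if a: "a \<in> ?A" for a
  proof -
    have "(F x)\<^sup>2 - (F a)\<^sup>2 = (LINT t:{a<..x}|lborel. f t * F t + F t * f t)"
      using primitive_product[OF F F, of a x] a by (simp add: power2_eq_square)
    also have "\<dots> \<le> S"
      unfolding S_def set_lebesgue_integral_def
    proof (rule integral_mono')
      show "integrable lborel (\<lambda>t. indicator ?A t *\<^sub>R ((F t)\<^sup>2 + (f t)\<^sup>2))"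
        using isum unfolding set_integrable_def .
      show "indicator {a<..x} t *\<^sub>R (f t * F t + F t * f t) \<le> indicator ?A t *\<^sub>R ((F t)\<^sup>2 + (f t)\<^sup>2)" for t
        using a sum_squares_bound[of "F t" "f t"] by (auto simp: indicator_def algebra_simps)
      show "0 \<le> indicator ?A t *\<^sub>R ((F t)\<^sup>2 + (f t)\<^sup>2)" for t by simp
    qed
    finally show ?thesis by simp
  qed
  have "(F x)\<^sup>2 = (LINT t|lborel. indicator ?A t *\<^sub>R (F x)\<^sup>2)" by simp
  also have "\<dots> \<le> (LINT t|lborel. indicator ?A t *\<^sub>R ((F t)\<^sup>2 + S))"
  proof (rule integral_mono)
    show "integrable lborel (\<lambda>t. indicator ?A t *\<^sub>R (F x)\<^sup>2)" by simp
    have "integrable lborel (\<lambda>t. indicator ?A t *\<^sub>R (F t)\<^sup>2 + indicator ?A t *\<^sub>R S)"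
      using iF unfolding set_integrable_def by (intro Bochner_Integration.integrable_add) auto
    then show "integrable lborel (\<lambda>t. indicator ?A t *\<^sub>R ((F t)\<^sup>2 + S))" by (simp add: algebra_simps)
    show "indicator ?A t *\<^sub>R (F x)\<^sup>2 \<le> indicator ?A t *\<^sub>R ((F t)\<^sup>2 + S)" for t
      using le[of t] by (auto simp: indicator_def)
  qed
  also have "\<dots> = (LINT t:?A|lborel. (F t)\<^sup>2) + S"
  proof -
    have "(LINT t|lborel. indicator ?A t *\<^sub>R ((F t)\<^sup>2 + S)) = (LINT t:?A|lborel. (F t)\<^sup>2) + (LINT t:?A|lborel. S)"
      unfolding set_lebesgue_integral_def[of _ ?A "\<lambda>t. (F t)\<^sup>2 + S", symmetric]
      by (rule set_integral_add(2)[OF iF]) (simp add: set_integrable_def)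
    then show ?thesis by (simp add: set_lebesgue_integral_def)
  qed
  also have "S = (LINT t:?A|lborel. (F t)\<^sup>2) + (LINT t:?A|lborel. (f t)\<^sup>2)"
    unfolding S_def by (rule set_integral_add(2)[OF iF if'])
  finally show ?thesis by simp
qed

lemma set_integral_le_integral:
  fixes g :: "real \<Rightarrow> real"
  assumes "integrable lborel g" "\<And>x. 0 \<le> g x"
  shows "(LINT t:{a<..b}|lborel. g t) \<le> (LINT t|lborel. g t)"
  unfolding set_lebesgue_integral_def
  by (rule integral_mono'[OF assms(1)]) (use assms(2) in \<open>auto simp: indicator_def\<close>)

lemma primitive_sup_le:
  assumes F: "primitive F f" and L: "F \<in> L2" "f \<in> L2"
  shows "\<bar>F x\<bar> \<le> 2 * (L2_norm F + L2_norm f)"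
proof -
  have "(F x)\<^sup>2 \<le> 2 * (LINT t:{x-1<..x}|lborel. (F t)\<^sup>2) + (LINT t:{x-1<..x}|lborel. (f t)\<^sup>2)"
    by (rule primitive_sq_le_local[OF F])
  also have "\<dots> \<le> 2 * (LINT t|lborel. (F t)\<^sup>2) + (LINT t|lborel. (f t)\<^sup>2)"
    using L by (intro add_mono mult_left_mono set_integral_le_integral L2_bounded_intro) auto
  also have "\<dots> = 2 * (L2_norm F)\<^sup>2 + (L2_norm f)\<^sup>2" by (simp add: L2_norm_sq)
  also have "\<dots> \<le> (2 * (L2_norm F + L2_norm f))\<^sup>2"
    using L2_norm_nonneg[of F] L2_norm_nonneg[of f] by (simp add: power2_eq_square algebra_simps)
  finally have "\<bar>F x\<bar>\<^sup>2 \<le> (2 * (L2_norm F + L2_norm f))\<^sup>2" by simp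
  then show ?thesis
    by (rule power2_le_imp_le) (simp add: L2_norm_nonneg)
qed

lemma integral_window_tendsto_0:
  fixes g :: "real \<Rightarrow> real"
  assumes "integrable lborel g"
  shows "((\<lambda>x. LINT t:{x-1<..x}|lborel. g t) \<longlongrightarrow> 0) at_top"
    "((\<lambda>x. LINT t:{x-1<..x}|lborel. g t) \<longlongrightarrow> 0) at_bot"
proof -
  have [measurable]: "g \<in> borel_measurable borel" using assms by auto
  have "((\<lambda>x. LINT t|lborel. indicator {x-1<..x} t *\<^sub>R g t) \<longlongrightarrow> (LINT t::real|lborel. (0::real))) at_top"
  proof (rule integral_dominated_convergence_at_top[where w="\<lambda>t. norm (g t)" and f="\<lambda>_. 0"
        and s="\<lambda>x t. indicator {x-1<..x} t *\<^sub>R g t"])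
    show "AE t in lborel. ((\<lambda>x. indicator {x-1<..x} t *\<^sub>R g t) \<longlongrightarrow> 0) at_top"
    proof (rule AE_I2, rule tendsto_eventually)
      fix t :: real
      show "\<forall>\<^sub>F x in at_top. indicator {x-1<..x} t *\<^sub>R g t = 0"
        using eventually_gt_at_top[of "t + 1"] by eventually_elim (auto simp: indicator_def)
    qed
  qed (use assms in \<open>auto simp: indicator_def\<close>)
  then show "((\<lambda>x. LINT t:{x-1<..x}|lborel. g t) \<longlongrightarrow> 0) at_top"
    unfolding set_lebesgue_integral_def by simp
  have "((\<lambda>x. LINT t|lborel. indicator {-x-1<..-x} t *\<^sub>R g t) \<longlongrightarrow> (LINT t::real|lborel. (0::real))) at_top"
  proof (rule integral_dominated_convergence_at_top[where w="\<lambda>t. norm (g t)" and f="\<lambda>_. 0"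
        and s="\<lambda>x t. indicator {-x-1<..-x} t *\<^sub>R g t"])
    show "AE t in lborel. ((\<lambda>x. indicator {-x-1<..-x} t *\<^sub>R g t) \<longlongrightarrow> 0) at_top"
    proof (rule AE_I2, rule tendsto_eventually)
      fix t :: real
      show "\<forall>\<^sub>F x in at_top. indicator {-x-1<..-x} t *\<^sub>R g t = 0"
        using eventually_gt_at_top[of "-t"] by eventually_elim (auto simp: indicator_def)
    qed
  qed (use assms in \<open>auto simp: indicator_def\<close>)
  then show "((\<lambda>x. LINT t:{x-1<..x}|lborel. g t) \<longlongrightarrow> 0) at_bot"
    unfolding set_lebesgue_integral_def filterlim_at_bot_mirror by simp
qed

lemma primitive_L2_decay:
  assumes F: "primitive F f" and L: "F \<in> L2" "f \<in> L2" and A: "A = at_top \<or> A = at_bot"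
  shows "(F \<longlongrightarrow> 0) A"
proof -
  let ?b = "\<lambda>x. 2 * (LINT t:{x-1<..x}|lborel. (F t)\<^sup>2) + (LINT t:{x-1<..x}|lborel. (f t)\<^sup>2)"
  have w: "((\<lambda>x. LINT t:{x-1<..x}|lborel. (h t)\<^sup>2) \<longlongrightarrow> 0) A" if "h \<in> L2" for h
    using A integral_window_tendsto_0[OF L2_bounded_intro[OF that]] by (elim disjE) simp_all
  have "(?b \<longlongrightarrow> 2 * 0 + 0) A"
    by (intro tendsto_add tendsto_mult tendsto_const w L)
  then have b: "(?b \<longlongrightarrow> 0) A" by simp
  have "((\<lambda>x. (F x)\<^sup>2) \<longlongrightarrow> 0) A"
    by (rule tendsto_sandwich[OF _ _ tendsto_const b])
       (simp, rule always_eventually, rule allI, rule primitive_sq_le_local[OF F])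
  then have "((\<lambda>x. sqrt ((F x)\<^sup>2)) \<longlongrightarrow> sqrt 0) A" by (rule tendsto_real_sqrt)
  then have "((\<lambda>x. \<bar>F x\<bar>) \<longlongrightarrow> 0) A" by simp
  then show ?thesis by (rule tendsto_rabs_zero_cancel)
qed

section \<open>Square-integrable functions\<close>

lemma L2_mult_integrable:
  assumes "f \<in> L2" "g \<in> L2"
  shows "integrable lborel (\<lambda>x. f x * g x)"
proof (rule Bochner_Integration.integrable_bound)
  show "integrable lborel (\<lambda>x. (f x)\<^sup>2 + (g x)\<^sup>2)"
    using assms by (intro Bochner_Integration.integrable_add L2_bounded_intro)
  show "(\<lambda>x. f x * g x) \<in> borel_measurable lborel"
    using assms[THEN L2_measurable] by simp
  show "AE x in lborel. norm (f x * g x) \<le> norm ((f x)\<^sup>2 + (g x)\<^sup>2)"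
  proof (rule AE_I2)
    fix x
    have "2 * \<bar>f x\<bar> * \<bar>g x\<bar> \<le> (f x)\<^sup>2 + (g x)\<^sup>2"
      using sum_squares_bound[of "\<bar>f x\<bar>" "\<bar>g x\<bar>"] by simp
    moreover have "0 \<le> \<bar>f x\<bar> * \<bar>g x\<bar>" by simp
    ultimately have "\<bar>f x * g x\<bar> \<le> (f x)\<^sup>2 + (g x)\<^sup>2" unfolding abs_mult by linarith
    then show "norm (f x * g x) \<le> norm ((f x)\<^sup>2 + (g x)\<^sup>2)" by simp
  qed
qed

lemma L2_domI:
  assumes g: "g \<in> L2" and f: "f \<in> borel_measurable borel" and le: "AE x in lborel. \<bar>f x\<bar> \<le> c * \<bar>g x\<bar>" and c: "0 \<le> c"
  shows "f \<in> L2" "L2_norm f \<le> c * L2_norm g"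
proof -
  have sq: "AE x in lborel. (f x)\<^sup>2 \<le> c\<^sup>2 * (g x)\<^sup>2"
    using le
  proof eventually_elim
    case (elim x)
    then have "\<bar>f x\<bar>\<^sup>2 \<le> (c * \<bar>g x\<bar>)\<^sup>2" by (rule power_mono) simp
    then show ?case by (simp add: power_mult_distrib)
  qed
  have ig: "integrable lborel (\<lambda>x. c\<^sup>2 * (g x)\<^sup>2)" by (intro integrable_mult_right L2_bounded_intro g)
  have "integrable lborel (\<lambda>x. (f x)\<^sup>2)"
  proof (rule Bochner_Integration.integrable_bound[OF ig])
    show "(\<lambda>x. (f x)\<^sup>2) \<in> borel_measurable lborel" using f by simp
    show "AE x in lborel. norm ((f x)\<^sup>2) \<le> norm (c\<^sup>2 * (g x)\<^sup>2)" using sq by eventually_elim simp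
  qed
  then show L: "f \<in> L2" using f unfolding L2_def by simp
  have "(L2_norm f)\<^sup>2 \<le> (LINT x|lborel. c\<^sup>2 * (g x)\<^sup>2)"
    unfolding L2_norm_sq by (rule integral_mono_AE[OF L2_bounded_intro[OF L] ig sq])
  also have "\<dots> = (c * L2_norm g)\<^sup>2" by (simp add: power_mult_distrib L2_norm_sq)
  finally show "L2_norm f \<le> c * L2_norm g"
    by (rule power2_le_imp_le) (simp add: c L2_norm_nonneg)
qed

lemma L2_abs: "f \<in> L2 \<Longrightarrow> (\<lambda>x. \<bar>f x\<bar>) \<in> L2" "L2_norm (\<lambda>x. \<bar>f x\<bar>) = L2_norm f"
  unfolding L2_def L2_norm_def by auto

lemma L2_Cauchy_Schwarz:
  assumes f: "f \<in> L2" and g: "g \<in> L2"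
  shows "(LINT x|lborel. f x * g x)\<^sup>2 \<le> (L2_norm f)\<^sup>2 * (L2_norm g)\<^sup>2"
proof -
  define A B D where "A = (L2_norm f)\<^sup>2" and "B = (LINT x|lborel. f x * g x)" and "D = (L2_norm g)\<^sup>2"
  have q: "0 \<le> A + 2 * t * B + t\<^sup>2 * D" for t
  proof -
    have "0 \<le> (LINT x|lborel. (f x + t * g x)\<^sup>2)" by simp
    also have "\<dots> = (LINT x|lborel. (f x)\<^sup>2 + (2 * t * (f x * g x) + t\<^sup>2 * (g x)\<^sup>2))"
      by (rule Bochner_Integration.integral_cong) (simp_all add: power2_eq_square algebra_simps)
    also have "\<dots> = A + (2 * t * B + t\<^sup>2 * D)"
      unfolding A_def B_def D_def L2_norm_sq
      using L2_bounded_intro[OF f] L2_bounded_intro[OF g] L2_mult_integrable[OF f g] by simp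
    finally show ?thesis by simp
  qed
  have "B\<^sup>2 \<le> A * D"
  proof (cases "D = 0")
    case True
    have "B = 0"
    proof (rule ccontr)
      assume "B \<noteq> 0"
      \<comment> \<open>For D = 0 the quadratic is affine in t, and this t gives it the value
        -1.\<close>
      then show False using q[of "- (A + 1) / (2 * B)"] True by (simp add: field_simps)
    qed
    then show ?thesis using True by simp
  next
    case False
    then have D: "D > 0" unfolding D_def by (simp add: less_le)
    have "0 \<le> A - B\<^sup>2 / D" using q[of "- B / D"] D by (simp add: field_simps power2_eq_square)
    then show ?thesis using D by (simp add: field_simps)
  qed
  then show ?thesis unfolding A_def B_def D_def .
qed

section \<open>Integral operators with exponentially decaying kernels\<close>

lemma integrable_exp_neg_abs: "integrable lborel (\<lambda>x::real. exp (- \<bar>x\<bar>))"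
proof -
  have m: "integrable lborel (\<lambda>x::real. indicator {0..} x * exp (- x))"
  proof (rule integrableI_bounded)
    have "(\<integral>\<^sup>+ x. ennreal (exp (- x)) * indicator {0..} x \<partial>lborel) = ennreal (0 - (- exp (- 0)))"
    proof (rule nn_integral_FTC_atLeast)
      show "((\<lambda>x::real. - exp (- x)) has_real_derivative exp (- x)) (at x)" for x
        by (auto intro!: derivative_eq_intros)
      have "((\<lambda>x::real. - exp (- x)) \<longlongrightarrow> - 0) at_top"
        by (intro tendsto_minus filterlim_compose[OF exp_at_bot] filterlim_uminus_at_bot_at_top)
      then show "((\<lambda>x::real. - exp (- x)) \<longlongrightarrow> 0) at_top" by simp
    qed auto
    moreover have "(\<integral>\<^sup>+ x. ennreal (norm (indicator {0..} x * exp (- x) :: real)) \<partial>lborel)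
        = (\<integral>\<^sup>+ x. ennreal (exp (- x)) * indicator {0..} x \<partial>lborel)"
      by (rule nn_integral_cong) (simp add: indicator_def)
    ultimately show "(\<integral>\<^sup>+ x. ennreal (norm (indicator {0..} x * exp (- x) :: real)) \<partial>lborel) < \<infinity>" by simp
  qed measurable
  have m': "integrable lborel (\<lambda>x::real. indicator {0..} (- x) * exp (- (- x)))"
    using lborel_integrable_real_affine[OF m, of "-1" 0] by simp
  show ?thesis
  proof (rule Bochner_Integration.integrable_bound[OF Bochner_Integration.integrable_add[OF m m']])
    show "AE x::real in lborel. norm (exp (- \<bar>x\<bar>)) \<le> norm (indicator {0..} x * exp (- x) + indicator {0..} (- x) * exp (- (- x)))"
      by (rule AE_I2) (auto simp: indicator_def)
  qed measurable
qed

definition exp_mass :: real where "exp_mass = (LINT x|lborel. exp (- \<bar>x\<bar>))"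

lemma exp_mass_nonneg: "0 \<le> exp_mass" unfolding exp_mass_def by simp

lemma exp_dist_integral:
  "integrable lborel (\<lambda>y::real. exp (- \<bar>x - y\<bar>))" "(LINT y|lborel. exp (- \<bar>x - y\<bar>)) = exp_mass"
proof -
  show "integrable lborel (\<lambda>y::real. exp (- \<bar>x - y\<bar>))"
    using lborel_integrable_real_affine[OF integrable_exp_neg_abs, of "-1" x] by simp
  show "(LINT y|lborel. exp (- \<bar>x - y\<bar>)) = exp_mass"
    using lborel_integral_real_affine[of "-1" "\<lambda>y. exp (- \<bar>y\<bar>)" x] unfolding exp_mass_def by simp
qed

lemma exp_dist_L2: "(\<lambda>y. exp (- \<bar>x - y\<bar>)) \<in> L2" "(L2_norm (\<lambda>y. exp (- \<bar>x - y\<bar>)))\<^sup>2 \<le> exp_mass"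
proof -
  have le: "(exp (- \<bar>x - y\<bar>))\<^sup>2 \<le> exp (- \<bar>x - y\<bar>)" for y :: real
    by (simp add: power2_eq_square flip: exp_add)
  have i: "integrable lborel (\<lambda>y. (exp (- \<bar>x - y\<bar>))\<^sup>2)"
    by (rule Bochner_Integration.integrable_bound[OF exp_dist_integral(1)[of x]]) (use le in auto)
  then show "(\<lambda>y. exp (- \<bar>x - y\<bar>)) \<in> L2" unfolding L2_def by simp
  show "(L2_norm (\<lambda>y. exp (- \<bar>x - y\<bar>)))\<^sup>2 \<le> exp_mass"
    unfolding L2_norm_sq exp_dist_integral(2)[of x, symmetric]
    by (rule integral_mono[OF i exp_dist_integral(1) le])
qed

text \<open>The constant c enters every operator bound below linearly. Applied to a difference of
  two kernels, it turns closeness of the kernels into closeness of the operators.\<close>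

definition exp_kernel :: "real \<Rightarrow> (real \<Rightarrow> real \<Rightarrow> real) \<Rightarrow> bool" where
  "exp_kernel c k \<longleftrightarrow> 0 \<le> c \<and> case_prod k \<in> borel_measurable (borel \<Otimes>\<^sub>M borel) \<and>
     (\<forall>x y. \<bar>k x y\<bar> \<le> c * exp (- \<bar>x - y\<bar>))"

definition kernel_op :: "(real \<Rightarrow> real \<Rightarrow> real) \<Rightarrow> (real \<Rightarrow> real) \<Rightarrow> real \<Rightarrow> real" where
  "kernel_op k f x = (LINT y|lborel. k x y * f y)"

lemma exp_kernelD:
  assumes "exp_kernel c k"
  shows "0 \<le> c" "case_prod k \<in> borel_measurable (borel \<Otimes>\<^sub>M borel)" "\<bar>k x y\<bar> \<le> c * exp (- \<bar>x - y\<bar>)"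
    "k x \<in> borel_measurable borel"
proof -
  show "0 \<le> c" and m: "case_prod k \<in> borel_measurable (borel \<Otimes>\<^sub>M borel)" and "\<bar>k x y\<bar> \<le> c * exp (- \<bar>x - y\<bar>)"
    using assms unfolding exp_kernel_def by auto
  have "(\<lambda>y. case_prod k (x, y)) \<in> borel_measurable borel"
    by (rule measurable_compose[OF _ m]) measurable
  then show "k x \<in> borel_measurable borel" by simp
qed

lemma exp_kernel_L2: "exp_kernel c k \<Longrightarrow> k x \<in> L2"
  by (rule L2_domI(1)[OF exp_dist_L2(1)[of x], of _ c]) (auto simp: exp_kernelD intro!: AE_I2)

lemma kernel_op_integrable: "exp_kernel c k \<Longrightarrow> f \<in> L2 \<Longrightarrow> integrable lborel (\<lambda>y. k x y * f y)"
  by (rule L2_mult_integrable[OF exp_kernel_L2])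

lemma exp_kernel_prod_measurable:
  assumes "exp_kernel c k" and [measurable]: "f \<in> borel_measurable borel"
  shows "(\<lambda>(x, y). k x y * f y) \<in> borel_measurable (borel \<Otimes>\<^sub>M lborel)"
proof -
  have [measurable]: "case_prod k \<in> borel_measurable (borel \<Otimes>\<^sub>M borel)" using exp_kernelD(2)[OF assms(1)] .
  have "(\<lambda>p. case_prod k p * f (snd p)) \<in> borel_measurable (borel \<Otimes>\<^sub>M borel)" by measurable
  then show ?thesis by (simp add: split_beta' cong: measurable_cong_sets)
qed

lemma kernel_op_measurable:
  assumes "exp_kernel c k" "f \<in> borel_measurable borel"
  shows "kernel_op k f \<in> borel_measurable borel"
  unfolding kernel_op_def
  by (rule lborel.borel_measurable_lebesgue_integral) (rule exp_kernel_prod_measurable[OF assms])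

lemma kernel_op_sup_le:
  assumes k: "exp_kernel c k" and f: "f \<in> L2"
  shows "\<bar>kernel_op k f x\<bar> \<le> c * (1 + exp_mass) * L2_norm f"
proof -
  have "L2_norm (k x) \<le> c * L2_norm (\<lambda>y. exp (- \<bar>x - y\<bar>))"
    by (rule L2_domI(2)[OF exp_dist_L2(1)]) (auto simp: exp_kernelD[OF k] intro!: AE_I2)
  also have "\<dots> \<le> c * (1 + exp_mass)"
  proof (rule mult_left_mono[OF _ exp_kernelD(1)[OF k]])
    \<comment> \<open>The square root of \<open>exp_mass\<close> is replaced by the larger
      \<open>1 + exp_mass\<close>, which keeps square roots out of the constants.\<close>
    have "(L2_norm (\<lambda>y. exp (- \<bar>x - y\<bar>)))\<^sup>2 \<le> (1 + exp_mass)\<^sup>2"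
    proof -
      have "(1 + exp_mass)\<^sup>2 = 1 + exp_mass\<^sup>2 + 2 * exp_mass" by (simp add: power2_sum)
      then show ?thesis
        using exp_dist_L2(2)[of x] exp_mass_nonneg zero_le_power2[of exp_mass] by linarith
    qed
    then show "L2_norm (\<lambda>y. exp (- \<bar>x - y\<bar>)) \<le> 1 + exp_mass"
      by (rule power2_le_imp_le) (use exp_mass_nonneg in simp)
  qed
  finally have kx: "L2_norm (k x) \<le> c * (1 + exp_mass)" .
  have "\<bar>kernel_op k f x\<bar>\<^sup>2 \<le> (L2_norm (k x) * L2_norm f)\<^sup>2"
    using L2_Cauchy_Schwarz[OF exp_kernel_L2[OF k] f] unfolding kernel_op_def by (simp add: power_mult_distrib)
  then have "\<bar>kernel_op k f x\<bar> \<le> L2_norm (k x) * L2_norm f"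
    by (rule power2_le_imp_le) (simp add: L2_norm_nonneg)
  also have "\<dots> \<le> c * (1 + exp_mass) * L2_norm f" by (rule mult_right_mono[OF kx L2_norm_nonneg])
  finally show ?thesis .
qed

text \<open>Meant for the a priori bounds: the sources are dominated by H_xi, whose integral is
  controlled by the conserved energy, while its L^2 norm has no uniform bound at that stage.\<close>

lemma kernel_op_sup_le_L1:
  assumes k: "exp_kernel c k" and g: "integrable lborel g" and le: "AE y in lborel. \<bar>f y\<bar> \<le> g y"
  shows "\<bar>kernel_op k f x\<bar> \<le> c * (LINT y|lborel. g y)"
proof -
  have "\<bar>kernel_op k f x\<bar> \<le> (LINT y|lborel. \<bar>k x y * f y\<bar>)"
    unfolding kernel_op_def by (rule integral_abs_bound)
  also have "\<dots> \<le> (LINT y|lborel. c * g y)"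
  proof (rule integral_mono_AE')
    show "integrable lborel (\<lambda>y. c * g y)" by (rule integrable_mult_right[OF g])
    show "AE y in lborel. \<bar>k x y * f y\<bar> \<le> c * g y"
      using le
    proof eventually_elim
      case (elim y)
      have "\<bar>k x y\<bar> \<le> c * exp (- \<bar>x - y\<bar>)" by (rule exp_kernelD(3)[OF k])
      also have "\<dots> \<le> c * 1" by (rule mult_left_mono) (use exp_kernelD(1)[OF k] in auto)
      finally have "\<bar>k x y\<bar> \<le> c" by simp
      then show ?case unfolding abs_mult using elim exp_kernelD(1)[OF k] by (intro mult_mono) auto
    qed
    show "AE y in lborel. 0 \<le> c * g y"
      using le
    proof eventually_elim
      case (elim y)
      then have "0 \<le> g y" by linarith
      then show ?case using exp_kernelD(1)[OF k] by simp
    qed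
  qed
  finally show ?thesis by simp
qed

text \<open>Schur test: split exp(-|x - y|) into two equal factors, apply Cauchy-Schwarz in y, then
  integrate in x by Tonelli.\<close>

lemma kernel_op_L2:
  assumes k: "exp_kernel c k" and f: "f \<in> L2"
  shows "kernel_op k f \<in> L2" "L2_norm (kernel_op k f) \<le> c * exp_mass * L2_norm f"
proof -
  have [measurable]: "f \<in> borel_measurable borel" using f by (rule L2_measurable)
  note m = kernel_op_measurable[OF k L2_measurable[OF f]]
  have c: "0 \<le> c" using exp_kernelD(1)[OF k] .
  define h where "h = (\<lambda>x y. exp (- \<bar>x - y\<bar>) * (f y)\<^sup>2)"
  have hi: "integrable lborel (h x)" for x
  proof (rule Bochner_Integration.integrable_bound[OF L2_bounded_intro[OF f]])
    show "AE y in lborel. norm (h x y) \<le> norm ((f y)\<^sup>2)"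
      unfolding h_def by (intro AE_I2) (simp add: mult_left_le_one_le)
  qed (simp add: h_def)
  have pt: "(kernel_op k f x)\<^sup>2 \<le> c\<^sup>2 * exp_mass * (LINT y|lborel. h x y)" for x
  proof -
    let ?e = "\<lambda>y. exp (- (\<bar>x - y\<bar> / 2))"
    have e2: "(?e y)\<^sup>2 = exp (- \<bar>x - y\<bar>)" for y by (simp add: power2_eq_square flip: exp_add)
    have eL: "?e \<in> L2" "(L2_norm ?e)\<^sup>2 = exp_mass"
      unfolding L2_norm_sq L2_def using exp_dist_integral[of x] by (simp_all add: e2)
    have gL: "(\<lambda>y. ?e y * \<bar>f y\<bar>) \<in> L2" "(L2_norm (\<lambda>y. ?e y * \<bar>f y\<bar>))\<^sup>2 = (LINT y|lborel. h x y)"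
      unfolding L2_norm_sq L2_def using hi[of x] by (simp_all add: power_mult_distrib e2 h_def[abs_def])
    have "\<bar>kernel_op k f x\<bar> \<le> (LINT y|lborel. \<bar>k x y * f y\<bar>)"
      unfolding kernel_op_def by (rule integral_abs_bound)
    also have "\<dots> \<le> (LINT y|lborel. c * (?e y * (?e y * \<bar>f y\<bar>)))"
    proof (rule integral_mono)
      show "integrable lborel (\<lambda>y. \<bar>k x y * f y\<bar>)" by (intro integrable_abs kernel_op_integrable[OF k f])
      show "integrable lborel (\<lambda>y. c * (?e y * (?e y * \<bar>f y\<bar>)))"
        by (intro integrable_mult_right L2_mult_integrable eL gL)
      fix y
      have "\<bar>k x y * f y\<bar> \<le> (c * (?e y)\<^sup>2) * \<bar>f y\<bar>"
        unfolding abs_mult e2 by (intro mult_right_mono exp_kernelD(3)[OF k]) auto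
      then show "\<bar>k x y * f y\<bar> \<le> c * (?e y * (?e y * \<bar>f y\<bar>))" by (simp add: power2_eq_square algebra_simps)
    qed
    also have "\<dots> = c * (LINT y|lborel. ?e y * (?e y * \<bar>f y\<bar>))" by simp
    finally have "\<bar>kernel_op k f x\<bar>\<^sup>2 \<le> (c * (LINT y|lborel. ?e y * (?e y * \<bar>f y\<bar>)))\<^sup>2"
      by (rule power_mono) simp
    also have "\<dots> = c\<^sup>2 * (LINT y|lborel. ?e y * (?e y * \<bar>f y\<bar>))\<^sup>2" by (rule power_mult_distrib)
    also have "\<dots> \<le> c\<^sup>2 * (exp_mass * (LINT y|lborel. h x y))"
      using L2_Cauchy_Schwarz[OF eL(1) gL(1)] unfolding eL(2) gL(2) by (rule mult_left_mono) simp
    finally show ?thesis by (simp add: mult.assoc)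
  qed
  have h0: "0 \<le> h x y" for x y unfolding h_def by simp
  have "(\<integral>\<^sup>+x. ennreal (LINT y|lborel. h x y) \<partial>lborel) = (\<integral>\<^sup>+x. (\<integral>\<^sup>+y. ennreal (h x y) \<partial>lborel) \<partial>lborel)"
    by (intro nn_integral_cong nn_integral_eq_integral[symmetric] hi) (simp add: h0)
  also have "\<dots> = (\<integral>\<^sup>+y. (\<integral>\<^sup>+x. ennreal (h x y) \<partial>lborel) \<partial>lborel)"
    by (rule lborel_pair.Fubini'[symmetric]) (simp add: h_def)
  also have "\<dots> = (\<integral>\<^sup>+y. ennreal (exp_mass * (f y)\<^sup>2) \<partial>lborel)"
  proof (rule nn_integral_cong)
    fix y :: real
    have e: "exp (- \<bar>x - y\<bar>) = exp (- \<bar>y - x\<bar>)" for x by (simp add: abs_minus_commute)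
    have "(\<integral>\<^sup>+x. ennreal (h x y) \<partial>lborel) = ennreal (LINT x|lborel. h x y)"
      unfolding h_def e by (rule nn_integral_eq_integral) (simp_all add: exp_dist_integral)
    also have "(LINT x|lborel. h x y) = exp_mass * (f y)\<^sup>2"
      unfolding h_def e by (simp add: exp_dist_integral)
    finally show "(\<integral>\<^sup>+x. ennreal (h x y) \<partial>lborel) = ennreal (exp_mass * (f y)\<^sup>2)" .
  qed
  also have "\<dots> = ennreal (LINT y|lborel. exp_mass * (f y)\<^sup>2)"
    by (rule nn_integral_eq_integral) (simp_all add: L2_bounded_intro f exp_mass_nonneg)
  also have "\<dots> = ennreal (exp_mass * (L2_norm f)\<^sup>2)" by (simp add: L2_norm_sq)
  finally have H: "(\<integral>\<^sup>+x. ennreal (LINT y|lborel. h x y) \<partial>lborel) = ennreal (exp_mass * (L2_norm f)\<^sup>2)" .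
  have mh: "(\<lambda>x. LINT y|lborel. h x y) \<in> borel_measurable borel"
    by (rule lborel.borel_measurable_lebesgue_integral) (simp add: h_def)
  have N: "(\<integral>\<^sup>+x. ennreal ((kernel_op k f x)\<^sup>2) \<partial>lborel) \<le> ennreal (c\<^sup>2 * exp_mass * (exp_mass * (L2_norm f)\<^sup>2))"
  proof -
    have "(\<integral>\<^sup>+x. ennreal ((kernel_op k f x)\<^sup>2) \<partial>lborel)
        \<le> (\<integral>\<^sup>+x. ennreal (c\<^sup>2 * exp_mass) * ennreal (LINT y|lborel. h x y) \<partial>lborel)"
    proof (rule nn_integral_mono)
      fix x
      have "ennreal ((kernel_op k f x)\<^sup>2) \<le> ennreal (c\<^sup>2 * exp_mass * (LINT y|lborel. h x y))"
        by (rule ennreal_leI[OF pt])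
      also have "\<dots> = ennreal (c\<^sup>2 * exp_mass) * ennreal (LINT y|lborel. h x y)"
        by (rule ennreal_mult) (simp_all add: exp_mass_nonneg h0)
      finally show "ennreal ((kernel_op k f x)\<^sup>2) \<le> ennreal (c\<^sup>2 * exp_mass) * ennreal (LINT y|lborel. h x y)" .
    qed
    also have "\<dots> = ennreal (c\<^sup>2 * exp_mass) * (\<integral>\<^sup>+x. ennreal (LINT y|lborel. h x y) \<partial>lborel)"
      by (rule nn_integral_cmult) (use mh in simp)
    also have "\<dots> = ennreal (c\<^sup>2 * exp_mass * (exp_mass * (L2_norm f)\<^sup>2))"
      unfolding H by (rule ennreal_mult[symmetric]) (simp_all add: exp_mass_nonneg)
    finally show ?thesis .
  qed
  have i: "integrable lborel (\<lambda>x. (kernel_op k f x)\<^sup>2)"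
  proof (rule integrableI_bounded)
    show "(\<integral>\<^sup>+ x. ennreal (norm ((kernel_op k f x)\<^sup>2)) \<partial>lborel) < \<infinity>"
      using order.strict_trans1[OF N ennreal_less_top] by simp
  qed (use m in simp)
  then show L: "kernel_op k f \<in> L2" unfolding L2_def using m by simp
  have "ennreal (LINT x|lborel. (kernel_op k f x)\<^sup>2) \<le> ennreal (c\<^sup>2 * exp_mass * (exp_mass * (L2_norm f)\<^sup>2))"
    using N by (subst nn_integral_eq_integral[OF i, symmetric]) simp_all
  then have "(L2_norm (kernel_op k f))\<^sup>2 \<le> c\<^sup>2 * exp_mass * (exp_mass * (L2_norm f)\<^sup>2)"
    unfolding L2_norm_sq by (simp add: exp_mass_nonneg)
  also have "\<dots> = (c * exp_mass * L2_norm f)\<^sup>2" by (simp add: power2_eq_square)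
  finally show "L2_norm (kernel_op k f) \<le> c * exp_mass * L2_norm f"
    by (rule power2_le_imp_le) (simp add: c exp_mass_nonneg L2_norm_nonneg)
qed

lemma kernel_op_cong_AE:
  assumes k: "exp_kernel c k" and f: "f \<in> borel_measurable borel" "g \<in> borel_measurable borel"
    and e: "AE y in lborel. f y = g y"
  shows "kernel_op k f = kernel_op k g"
proof
  fix x
  note [measurable] = exp_kernelD(4)[OF k] f
  show "kernel_op k f x = kernel_op k g x"
    unfolding kernel_op_def
    by (rule integral_cong_AE) (use e in \<open>measurable, eventually_elim, simp\<close>)
qed

lemma kernel_op_diff:
  assumes k: "exp_kernel c k" "exp_kernel c' k'" and f: "f \<in> L2" "f' \<in> L2"
  shows "kernel_op k f x - kernel_op k' f' x
    = kernel_op k (\<lambda>y. f y - f' y) x + kernel_op (\<lambda>x y. k x y - k' x y) f' x"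
  unfolding kernel_op_def
  using kernel_op_integrable[OF k(1) f(1), of x] kernel_op_integrable[OF k(1) f(2), of x]
    kernel_op_integrable[OF k(2) f(2), of x]
  by (simp add: left_diff_distrib right_diff_distrib)

text \<open>Fubini; absolute integrability over the bounded interval comes from the sup bound
  applied to |k| and |f|. It carries increments of a kernel in its first variable over to the
  operator.\<close>

lemma kernel_op_set_integral:
  assumes k: "exp_kernel c k" and f: "f \<in> L2" and w: "bounded_borel w"
  shows "(LINT y|lborel. (LINT x:{a<..b}|lborel. w x * k x y) * f y)
      = (LINT x:{a<..b}|lborel. w x * kernel_op k f x)"
proof -
  note [measurable] = L2_measurable[OF f] bounded_borel_measurable[OF w] exp_kernelD(2)[OF k]
  have fk[measurable]: "(\<lambda>(x, y). k x y * f y) \<in> borel_measurable (borel \<Otimes>\<^sub>M lborel)"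
    by (rule exp_kernel_prod_measurable[OF k L2_measurable[OF f]])
  define F where "F = (\<lambda>x y. (indicator {a<..b} x * w x) * (k x y * f y))"
  have mF: "case_prod F \<in> borel_measurable (lborel \<Otimes>\<^sub>M lborel)"
  proof -
    have "(\<lambda>p. (indicator {a<..b} (fst p) * w (fst p)) * (case_prod (\<lambda>x y. k x y * f y) p))
        \<in> borel_measurable (borel \<Otimes>\<^sub>M lborel)" by measurable
    then show ?thesis unfolding F_def by (simp add: split_beta' cong: measurable_cong_sets)
  qed
  have Fi: "integrable lborel (F x)" for x
    unfolding F_def by (intro integrable_mult_right kernel_op_integrable[OF k f])
  obtain W where W: "W \<ge> 0" "\<And>x. \<bar>w x\<bar> \<le> W" using bounded_borelE[OF w] by metis
  let ?ka = "\<lambda>x y. \<bar>k x y\<bar>"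
  have ka: "exp_kernel c ?ka"
    using k unfolding exp_kernel_def by (auto simp: split_beta')
  have nF: "(LINT y|lborel. \<bar>F x y\<bar>) = \<bar>indicator {a<..b} x * w x\<bar> * kernel_op ?ka (\<lambda>y. \<bar>f y\<bar>) x" for x
    unfolding F_def kernel_op_def by (simp add: abs_mult)
  have int: "integrable (lborel \<Otimes>\<^sub>M lborel) (case_prod F)"
  proof (rule lborel_pair.Fubini_integrable[OF mF])
    have "integrable lborel (\<lambda>x. \<bar>indicator {a<..b} x * w x\<bar> * kernel_op ?ka (\<lambda>y. \<bar>f y\<bar>) x)"
    proof (rule Bochner_Integration.integrable_bound)
      show "integrable lborel (\<lambda>x. indicator {a<..b} x * (W * (c * (1 + exp_mass) * L2_norm f)) :: real)"
        by (cases "a \<le> b") auto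
      show "(\<lambda>x. \<bar>indicator {a<..b} x * w x\<bar> * kernel_op ?ka (\<lambda>y. \<bar>f y\<bar>) x) \<in> borel_measurable lborel"
        using kernel_op_measurable[OF ka L2_measurable[OF L2_abs(1)[OF f]]] by simp
      have "\<bar>w x\<bar> * \<bar>kernel_op ?ka (\<lambda>y. \<bar>f y\<bar>) x\<bar> \<le> W * (c * (1 + exp_mass) * L2_norm f)" for x
        using kernel_op_sup_le[OF ka L2_abs(1)[OF f], of x] W
        by (intro mult_mono) (auto simp: L2_abs(2) f)
      moreover have "\<bar>W\<bar> = W" "\<bar>c\<bar> = c" "\<bar>1 + exp_mass\<bar> = 1 + exp_mass" "\<bar>L2_norm f\<bar> = L2_norm f"
        using W exp_kernelD(1)[OF k] exp_mass_nonneg L2_norm_nonneg by auto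
      ultimately show "AE x in lborel. norm (\<bar>indicator {a<..b} x * w x\<bar> * kernel_op ?ka (\<lambda>y. \<bar>f y\<bar>) x)
          \<le> norm (indicator {a<..b} x * (W * (c * (1 + exp_mass) * L2_norm f)))"
        by (intro AE_I2) (auto simp: indicator_def abs_mult)
    qed
    then show "integrable lborel (\<lambda>x. LINT y|lborel. norm (case_prod F (x, y)))" by (simp add: nF)
    show "AE x in lborel. integrable lborel (\<lambda>y. case_prod F (x, y))" using Fi by simp
  qed
  have "(LINT y|lborel. (LINT x:{a<..b}|lborel. w x * k x y) * f y) = (LINT y|lborel. (LINT x|lborel. F x y))"
    unfolding F_def set_lebesgue_integral_def
    by (rule Bochner_Integration.integral_cong[OF refl])
       (simp flip: integral_mult_left_zero add: mult.assoc)
  also have "\<dots> = (LINT x|lborel. (LINT y|lborel. F x y))" by (rule lborel_pair.Fubini_integral[OF int])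
  also have "\<dots> = (LINT x:{a<..b}|lborel. w x * kernel_op k f x)"
    unfolding F_def set_lebesgue_integral_def kernel_op_def
    by (rule Bochner_Integration.integral_cong[OF refl]) (simp add: mult.assoc)
  finally show ?thesis .
qed

section \<open>The Green kernel in Lagrangian coordinates\<close>

definition ker :: "(real \<Rightarrow> real) \<Rightarrow> real \<Rightarrow> real \<Rightarrow> real" where
  "ker z x y = exp (- sgn (x - y) * ((z x + x) - (z y + y)))"

definition sker :: "(real \<Rightarrow> real) \<Rightarrow> real \<Rightarrow> real \<Rightarrow> real" where
  "sker z x y = sgn (x - y) * ker z x y"

text \<open>Since y is the identity plus zeta, the identity contributes exactly exp(-|x - y|) and a
  bounded zeta only a bounded factor. The decay therefore holds on whole balls of the Banach space,
  also where y_xi is negative.\<close>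

lemma ker_eq: "ker z x y = exp (- sgn (x - y) * (z x - z y)) * exp (- \<bar>x - y\<bar>)"
proof -
  have "- sgn (x - y) * ((z x + x) - (z y + y)) = - sgn (x - y) * (z x - z y) + - (sgn (x - y) * (x - y))"
    by (simp add: algebra_simps)
  also have "sgn (x - y) * (x - y) = \<bar>x - y\<bar>" by (simp add: sgn_if abs_if)
  finally show ?thesis unfolding ker_def by (simp flip: exp_add)
qed

lemma sgn_mult_diff_le:
  fixes s z w Z :: real
  assumes "\<bar>z\<bar> \<le> Z" "\<bar>w\<bar> \<le> Z"
  shows "- sgn s * (z - w) \<le> 2 * Z"
  using assms by (auto simp: sgn_if)

lemma ker_measurable:
  assumes [measurable]: "z \<in> borel_measurable borel"
  shows "case_prod (ker z) \<in> borel_measurable (borel \<Otimes>\<^sub>M borel)"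
    "case_prod (sker z) \<in> borel_measurable (borel \<Otimes>\<^sub>M borel)"
proof -
  have [measurable]: "(\<lambda>x::real. sgn x) \<in> borel_measurable borel"
    unfolding sgn_if by measurable
  show "case_prod (ker z) \<in> borel_measurable (borel \<Otimes>\<^sub>M borel)"
    unfolding ker_def by measurable
  show "case_prod (sker z) \<in> borel_measurable (borel \<Otimes>\<^sub>M borel)"
    unfolding sker_def ker_def by measurable
qed

lemma exp_kernel_ker:
  assumes m: "z \<in> borel_measurable borel" and b: "\<And>x. \<bar>z x\<bar> \<le> Z"
  shows "exp_kernel (exp (2 * Z)) (ker z)" "exp_kernel (exp (2 * Z)) (sker z)"
proof -
  have k: "\<bar>ker z x y\<bar> \<le> exp (2 * Z) * exp (- \<bar>x - y\<bar>)" for x y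
    using sgn_mult_diff_le[OF b b, of "x - y" x y] unfolding ker_eq by simp
  then show "exp_kernel (exp (2 * Z)) (ker z)"
    unfolding exp_kernel_def using ker_measurable[OF m] by simp
  have "\<bar>sker z x y\<bar> \<le> \<bar>ker z x y\<bar>" for x y
    unfolding sker_def by (simp add: abs_mult abs_sgn_eq)
  then show "exp_kernel (exp (2 * Z)) (sker z)"
    unfolding exp_kernel_def using ker_measurable[OF m] order_trans[OF _ k] by simp
qed

text \<open>The exponents stay below 2 Z, where exp is Lipschitz with constant exp(2 Z), and they
  differ by at most 2 \<delta>.\<close>

lemma exp_kernel_ker_diff:
  assumes m: "z \<in> borel_measurable borel" "w \<in> borel_measurable borel"
    and b: "\<And>x. \<bar>z x\<bar> \<le> Z" "\<And>x. \<bar>w x\<bar> \<le> Z" and d: "\<And>x. \<bar>z x - w x\<bar> \<le> \<delta>"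
  shows "exp_kernel (exp (2 * Z) * (2 * \<delta>)) (\<lambda>x y. ker z x y - ker w x y)"
    "exp_kernel (exp (2 * Z) * (2 * \<delta>)) (\<lambda>x y. sker z x y - sker w x y)"
proof -
  have d0: "0 \<le> \<delta>" using d[of 0] by linarith
  have k: "\<bar>ker z x y - ker w x y\<bar> \<le> exp (2 * Z) * (2 * \<delta>) * exp (- \<bar>x - y\<bar>)" for x y
  proof -
    let ?s = "\<lambda>z. - sgn (x - y) * (z x - z y)"
    have "\<bar>exp (?s z) - exp (?s w)\<bar> \<le> exp (2 * Z) * \<bar>?s z - ?s w\<bar>"
      by (rule exp_diff_le) (rule sgn_mult_diff_le[OF b(1) b(1)] sgn_mult_diff_le[OF b(2) b(2)])+
    also have "\<dots> \<le> exp (2 * Z) * (2 * \<delta>)"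
    proof (rule mult_left_mono)
      show "\<bar>?s z - ?s w\<bar> \<le> 2 * \<delta>" using d[of x] d[of y] by (auto simp: sgn_if)
    qed simp
    finally have "\<bar>exp (?s z) - exp (?s w)\<bar> * exp (- \<bar>x - y\<bar>) \<le> exp (2 * Z) * (2 * \<delta>) * exp (- \<bar>x - y\<bar>)"
      by (rule mult_right_mono) simp
    moreover have "\<bar>ker z x y - ker w x y\<bar> = \<bar>exp (?s z) - exp (?s w)\<bar> * exp (- \<bar>x - y\<bar>)"
      unfolding ker_eq by (simp add: abs_mult flip: left_diff_distrib)
    ultimately show ?thesis by simp
  qed
  note [measurable] = ker_measurable[OF m(1)] ker_measurable[OF m(2)]
  have "(\<lambda>p. case_prod (ker z) p - case_prod (ker w) p) \<in> borel_measurable (borel \<Otimes>\<^sub>M borel)" by measurable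
  then show "exp_kernel (exp (2 * Z) * (2 * \<delta>)) (\<lambda>x y. ker z x y - ker w x y)"
    unfolding exp_kernel_def using k d0 by (simp add: split_beta')
  have "\<bar>sker z x y - sker w x y\<bar> \<le> \<bar>ker z x y - ker w x y\<bar>" for x y
    unfolding sker_def by (simp add: abs_mult abs_sgn_eq flip: right_diff_distrib)
  moreover have "(\<lambda>p. case_prod (sker z) p - case_prod (sker w) p) \<in> borel_measurable (borel \<Otimes>\<^sub>M borel)" by measurable
  ultimately show "exp_kernel (exp (2 * Z) * (2 * \<delta>)) (\<lambda>x y. sker z x y - sker w x y)"
    unfolding exp_kernel_def using order_trans[OF _ k] d0 by (simp add: split_beta')
qed

lemma ker_increment_left:
  assumes z: "primitive z p" and ab: "a \<le> b" "b \<le> y"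
  shows "ker z b y - ker z a y = (LINT x:{a<..b}|lborel. (1 + p x) * ker z x y)"
    "ker z b y - ker z a y = (LINT x:{a<..b}|lborel. - (1 + p x) * sker z x y)"
proof -
  have F: "primitive (\<lambda>x. (z x + x) + - (z y + y)) (\<lambda>x. (p x + 1) + 0)"
    by (intro primitive_add z primitive_id primitive_const)
  have e: "ker z x y = exp ((z x + x) + - (z y + y))" if "x \<le> y" for x
    using that unfolding ker_def by (auto simp: sgn_if)
  note [measurable] = primitive_measurable[OF z] primitiveD(2)[OF z]
  have mk[measurable]: "(\<lambda>x. ker z x y) \<in> borel_measurable borel"  "(\<lambda>x. sker z x y) \<in> borel_measurable borel"
    using measurable_compose[OF _ ker_measurable(1)[OF primitive_measurable[OF z]], of "\<lambda>x. (x, y)" borel]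
      measurable_compose[OF _ ker_measurable(2)[OF primitive_measurable[OF z]], of "\<lambda>x. (x, y)" borel] by simp_all
  have "ker z b y - ker z a y = (LINT x:{a<..b}|lborel. ((p x + 1) + 0) * exp ((z x + x) + - (z y + y)))"
    using primitive_exp[OF F ab(1)] ab by (simp add: e)
  also have "\<dots> = (LINT x:{a<..b}|lborel. (1 + p x) * ker z x y)"
    by (rule set_lebesgue_integral_cong_AE) (use ab in \<open>auto simp: e add.commute\<close>)
  finally show 1: "ker z b y - ker z a y = (LINT x:{a<..b}|lborel. (1 + p x) * ker z x y)" .
  also have "\<dots> = (LINT x:{a<..b}|lborel. - (1 + p x) * sker z x y)"
  proof (rule set_lebesgue_integral_cong_AE)
    have "AE x in lborel. x \<noteq> y" by (rule AE_lborel_singleton)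
    then show "AE x\<in>{a<..b} in lborel. (1 + p x) * ker z x y = - (1 + p x) * sker z x y"
      by eventually_elim (use ab in \<open>auto simp: sker_def sgn_if algebra_simps\<close>)
  qed measurable
  finally show "ker z b y - ker z a y = (LINT x:{a<..b}|lborel. - (1 + p x) * sker z x y)" .
qed

lemma ker_increment_right:
  assumes z: "primitive z p" and ab: "a \<le> b" "y \<le> a"
  shows "ker z b y - ker z a y = (LINT x:{a<..b}|lborel. - (1 + p x) * ker z x y)"
    "ker z b y - ker z a y = (LINT x:{a<..b}|lborel. - (1 + p x) * sker z x y)"
proof -
  have F: "primitive (\<lambda>x. (-1) * ((z x + x) + - (z y + y))) (\<lambda>x. (-1) * ((p x + 1) + 0))"
    by (intro primitive_cmult primitive_add z primitive_id primitive_const)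
  have e: "ker z x y = exp ((-1) * ((z x + x) + - (z y + y)))" if "y \<le> x" for x
    using that unfolding ker_def by (auto simp: sgn_if)
  note [measurable] = primitive_measurable[OF z] primitiveD(2)[OF z]
  have mk[measurable]: "(\<lambda>x. ker z x y) \<in> borel_measurable borel"  "(\<lambda>x. sker z x y) \<in> borel_measurable borel"
    using measurable_compose[OF _ ker_measurable(1)[OF primitive_measurable[OF z]], of "\<lambda>x. (x, y)" borel]
      measurable_compose[OF _ ker_measurable(2)[OF primitive_measurable[OF z]], of "\<lambda>x. (x, y)" borel] by simp_all
  have "ker z b y - ker z a y = (LINT x:{a<..b}|lborel. ((-1) * ((p x + 1) + 0)) * exp ((-1) * ((z x + x) + - (z y + y))))"
    using primitive_exp[OF F ab(1)] ab by (simp only: e order_trans[OF ab(2,1)])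
  also have "\<dots> = (LINT x:{a<..b}|lborel. - (1 + p x) * ker z x y)"
  proof (rule set_lebesgue_integral_cong_AE)
    show "AE x\<in>{a<..b} in lborel. ((-1) * ((p x + 1) + 0)) * exp ((-1) * ((z x + x) + - (z y + y))) = - (1 + p x) * ker z x y"
    proof (rule AE_I2, rule impI)
      fix x assume "x \<in> {a<..b}"
      then have "y \<le> x" using ab by simp
      then show "((-1) * ((p x + 1) + 0)) * exp ((-1) * ((z x + x) + - (z y + y))) = - (1 + p x) * ker z x y"
        unfolding e[OF \<open>y \<le> x\<close>] by (simp add: algebra_simps)
    qed
  qed measurable
  finally show 1: "ker z b y - ker z a y = (LINT x:{a<..b}|lborel. - (1 + p x) * ker z x y)" .
  also have "\<dots> = (LINT x:{a<..b}|lborel. - (1 + p x) * sker z x y)"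
    by (rule set_lebesgue_integral_cong_AE) (use ab in \<open>auto simp: sker_def sgn_if\<close>)
  finally show "ker z b y - ker z a y = (LINT x:{a<..b}|lborel. - (1 + p x) * sker z x y)" .
qed

lemma ker_slice_integrable:
  assumes z: "primitive z p" and b: "\<And>x. \<bar>z x\<bar> \<le> Z"
  shows "set_integrable lborel {a<..b} (\<lambda>x. - (1 + p x) * sker z x y)"
    "set_integrable lborel {a<..b} (\<lambda>x. - (1 + p x) * ker z x y)"
proof -
  note k = exp_kernel_ker[OF primitive_measurable[OF z] b]
  have mk: "(\<lambda>x. ker z x y) \<in> borel_measurable borel"  "(\<lambda>x. sker z x y) \<in> borel_measurable borel"
    using measurable_compose[OF _ ker_measurable(1)[OF primitive_measurable[OF z]], of "\<lambda>x. (x, y)" borel]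
      measurable_compose[OF _ ker_measurable(2)[OF primitive_measurable[OF z]], of "\<lambda>x. (x, y)" borel] by simp_all
  have le: "exp (2 * Z) * exp (- \<bar>x - y\<bar>) \<le> exp (2 * Z)" for x by simp
  have bk: "bounded_borel (\<lambda>x. ker z x y)" "bounded_borel (\<lambda>x. sker z x y)"
    by (rule bounded_borelI[OF mk(1) order_trans[OF exp_kernelD(3)[OF k(1)] le]])
       (rule bounded_borelI[OF mk(2) order_trans[OF exp_kernelD(3)[OF k(2)] le]])
  show "set_integrable lborel {a<..b} (\<lambda>x. - (1 + p x) * sker z x y)"
    "set_integrable lborel {a<..b} (\<lambda>x. - (1 + p x) * ker z x y)"
    by (intro bounded_borel_set_integrable bounded_borel_intros bk primitiveD[OF z])+
qed

lemma ker_self: "ker z y y = 1" unfolding ker_def by simp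

lemma ker_increment:
  assumes z: "primitive z p" and b: "\<And>x. \<bar>z x\<bar> \<le> Z" and ab: "a \<le> b"
  shows "ker z b y - ker z a y = (LINT x:{a<..b}|lborel. - (1 + p x) * sker z x y)"
proof -
  consider "b \<le> y" | "y \<le> a" | "a < y" "y < b" by linarith
  then show ?thesis
  proof cases
    case 3
    \<comment> \<open>\<open>ker\<close> is continuous across the diagonal, so the increments on its
      two sides simply add.\<close>
    have "ker z b y - ker z a y = (ker z y y - ker z a y) + (ker z b y - ker z y y)" by simp
    also have "\<dots> = (LINT x:{a<..y}|lborel. - (1 + p x) * sker z x y) + (LINT x:{y<..b}|lborel. - (1 + p x) * sker z x y)"
      using 3 ker_increment_left(2)[OF z, of a y y] ker_increment_right(2)[OF z, of y b y] by simp
    also have "\<dots> = (LINT x:{a<..b}|lborel. - (1 + p x) * sker z x y)"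
      by (rule set_integral_Ioc_combine[symmetric]) (use 3 ker_slice_integrable[OF z b] in auto)
    finally show ?thesis .
  qed (use ker_increment_left(2)[OF z ab] ker_increment_right(2)[OF z ab] in auto)
qed

lemma set_integral_neg_mult:
  "(LINT x:A|lborel. - f x * g x) = - (LINT x:A|lborel. f x * g x :: real)"
  unfolding set_lebesgue_integral_def
  by (subst Bochner_Integration.integral_minus[symmetric], rule Bochner_Integration.integral_cong) auto

text \<open>Crossing x = y, \<open>sker\<close> jumps from -1 to 1, hence the weight 2. On the
  diagonal itself it is 0, so both end points must differ from y; for given a and b this excludes
  only a null set of y.\<close>

lemma sker_increment:
  assumes z: "primitive z p" and b: "\<And>x. \<bar>z x\<bar> \<le> Z" and ab: "a \<le> b" and y: "y \<noteq> a" "y \<noteq> b"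
  shows "sker z b y - sker z a y = (LINT x:{a<..b}|lborel. - (1 + p x) * ker z x y) + 2 * indicator {a<..b} y"
proof -
  consider "b < y" | "y < a" | "a < y" "y < b" using y by linarith
  then show ?thesis
  proof cases
    case 1
    have "(LINT x:{a<..b}|lborel. - (1 + p x) * ker z x y) = - (LINT x:{a<..b}|lborel. (1 + p x) * ker z x y)"
      by (rule set_integral_neg_mult)
    then show ?thesis using 1 ab ker_increment_left(1)[OF z ab, of y] unfolding sker_def by simp
  next
    case 2
    then show ?thesis using ab ker_increment_right(1)[OF z ab, of y] unfolding sker_def by simp
  next
    case 3
    have "(LINT x:{a<..y}|lborel. - (1 + p x) * ker z x y) = - (LINT x:{a<..y}|lborel. (1 + p x) * ker z x y)"
      by (rule set_integral_neg_mult)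
    moreover have "(LINT x:{a<..b}|lborel. - (1 + p x) * ker z x y)
       = (LINT x:{a<..y}|lborel. - (1 + p x) * ker z x y) + (LINT x:{y<..b}|lborel. - (1 + p x) * ker z x y)"
      by (rule set_integral_Ioc_combine) (use 3 ker_slice_integrable[OF z b] in auto)
    ultimately show ?thesis
      using 3 ker_increment_left(1)[OF z, of a y y] ker_increment_right(1)[OF z, of y b y]
      unfolding sker_def by (simp add: ker_self)
  qed
qed

lemma L2_set_integrable:
  assumes f: "f \<in> L2"
  shows "integrable lborel (\<lambda>y. indicator {a<..b} y * f y)"
proof (rule L2_mult_integrable[OF _ f])
  have "(\<lambda>y::real. (indicator {a<..b} y :: real)\<^sup>2) = (\<lambda>y. indicator {a<..b} y)"
    by (auto simp: indicator_def)
  then show "(\<lambda>y. indicator {a<..b} y) \<in> L2" unfolding L2_def by (cases "a \<le> b") simp_all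
qed

text \<open>With the prefactors of P_i and Q_i this reads P_xi = Q y_xi.\<close>

theorem kernel_op_ker_primitive:
  assumes z: "primitive z p" and b: "\<And>x. \<bar>z x\<bar> \<le> Z" and f: "f \<in> L2"
  shows "primitive (kernel_op (ker z) f) (\<lambda>x. - (1 + p x) * kernel_op (sker z) f x)"
  unfolding primitive_def
proof (intro conjI allI impI)
  note k = exp_kernel_ker[OF primitive_measurable[OF z] b]
  have bs: "bounded_borel (kernel_op (sker z) f)"
    by (rule bounded_borelI[OF kernel_op_measurable[OF k(2) L2_measurable[OF f]] kernel_op_sup_le[OF k(2) f]])
  have w: "bounded_borel (\<lambda>x. - (1 + p x))" by (intro bounded_borel_intros primitiveD[OF z])
  show "bounded_borel (\<lambda>x. - (1 + p x) * kernel_op (sker z) f x)" by (rule bounded_borel_mult[OF w bs])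
  fix a b' :: real assume ab: "a \<le> b'"
  have "kernel_op (ker z) f b' - kernel_op (ker z) f a = (LINT y|lborel. ker z b' y * f y - ker z a y * f y)"
    unfolding kernel_op_def
    by (rule Bochner_Integration.integral_diff[symmetric]) (rule kernel_op_integrable[OF k(1) f])+
  also have "\<dots> = (LINT y|lborel. (LINT x:{a<..b'}|lborel. - (1 + p x) * sker z x y) * f y)"
    by (rule Bochner_Integration.integral_cong[OF refl]) (simp only: ker_increment[OF z b ab, symmetric] left_diff_distrib)
  also have "\<dots> = (LINT x:{a<..b'}|lborel. - (1 + p x) * kernel_op (sker z) f x)"
    by (rule kernel_op_set_integral[OF k(2) f w])
  finally show "kernel_op (ker z) f b' - kernel_op (ker z) f a = (LINT x:{a<..b'}|lborel. - (1 + p x) * kernel_op (sker z) f x)" .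
qed

text \<open>The jump on the diagonal acts as twice a Dirac mass and leaves the local term 2 f, which
  must be bounded for the result to be a primitive. With the prefactors this becomes Q_xi = P y_xi
  minus a multiple of the source.\<close>

theorem kernel_op_sker_primitive:
  assumes z: "primitive z p" and b: "\<And>x. \<bar>z x\<bar> \<le> Z" and f: "f \<in> L2" "bounded_borel f"
  shows "primitive (kernel_op (sker z) f) (\<lambda>x. - (1 + p x) * kernel_op (ker z) f x + 2 * f x)"
  unfolding primitive_def
proof (intro conjI allI impI)
  note k = exp_kernel_ker[OF primitive_measurable[OF z] b]
  note [measurable] = L2_measurable[OF f(1)]
  have bs: "bounded_borel (kernel_op (ker z) f)"
    by (rule bounded_borelI[OF kernel_op_measurable[OF k(1) L2_measurable[OF f(1)]] kernel_op_sup_le[OF k(1) f(1)]])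
  have w: "bounded_borel (\<lambda>x. - (1 + p x))" by (intro bounded_borel_intros primitiveD[OF z])
  have wb: "bounded_borel (\<lambda>x. - (1 + p x) * kernel_op (ker z) f x)" by (rule bounded_borel_mult[OF w bs])
  show "bounded_borel (\<lambda>x. - (1 + p x) * kernel_op (ker z) f x + 2 * f x)"
    by (intro bounded_borel_add wb bounded_borel_mult bounded_borel_const f)
  fix a b' :: real assume ab: "a \<le> b'"
  have i: "integrable lborel (\<lambda>y. sker z x y * f y)" for x by (rule kernel_op_integrable[OF k(2) f(1)])
  have i2: "integrable lborel (\<lambda>y. 2 * (indicator {a<..b'} y * f y))"
    by (rule integrable_mult_right[OF L2_set_integrable[OF f(1)]])
  have e: "(\<lambda>y. sker z b' y * f y - sker z a y * f y) \<in> borel_measurable lborel" using i by measurable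
  have ae: "AE y in lborel. (sker z b' y * f y - sker z a y * f y) - 2 * (indicator {a<..b'} y * f y)
      = (LINT x:{a<..b'}|lborel. - (1 + p x) * ker z x y) * f y"
  proof -
    have "AE y in lborel. y \<noteq> a" "AE y in lborel. y \<noteq> b'" by (rule AE_lborel_singleton)+
    then show ?thesis
    proof eventually_elim
      case (elim y)
      have "(sker z b' y * f y - sker z a y * f y) - 2 * (indicator {a<..b'} y * f y)
         = ((sker z b' y - sker z a y) - 2 * indicator {a<..b'} y) * f y" by (simp add: algebra_simps)
      then show ?case unfolding sker_increment[OF z b ab elim] by simp
    qed
  qed
  have "kernel_op (sker z) f b' - kernel_op (sker z) f a
      = (LINT y|lborel. (sker z b' y * f y - sker z a y * f y) - 2 * (indicator {a<..b'} y * f y))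
        + (LINT y|lborel. 2 * (indicator {a<..b'} y * f y))"
    unfolding kernel_op_def using i i2 by simp
  also have "(LINT y|lborel. (sker z b' y * f y - sker z a y * f y) - 2 * (indicator {a<..b'} y * f y))
      = (LINT y|lborel. (LINT x:{a<..b'}|lborel. - (1 + p x) * ker z x y) * f y)"
  proof (rule integral_cong_AE[OF _ _ ae])
    show "(\<lambda>y. (sker z b' y * f y - sker z a y * f y) - 2 * (indicator {a<..b'} y * f y)) \<in> borel_measurable lborel"
      using e by measurable
    have "(\<lambda>y. LINT x|lborel. indicator {a<..b'} x *\<^sub>R (- (1 + p x) * ker z x y)) \<in> borel_measurable borel"
    proof (rule lborel.borel_measurable_lebesgue_integral)
      note [measurable] = ker_measurable(1)[OF primitive_measurable[OF z]] primitiveD(2)[OF z]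
      have "(\<lambda>q. indicator {a<..b'} (snd q) *\<^sub>R (- (1 + p (snd q)) * case_prod (ker z) (snd q, fst q)))
         \<in> borel_measurable (borel \<Otimes>\<^sub>M lborel)" by measurable
      then show "(\<lambda>(y, x). indicator {a<..b'} x *\<^sub>R (- (1 + p x) * ker z x y)) \<in> borel_measurable (borel \<Otimes>\<^sub>M lborel)"
        by (simp add: split_beta')
    qed
    then show "(\<lambda>y. (LINT x:{a<..b'}|lborel. - (1 + p x) * ker z x y) * f y) \<in> borel_measurable lborel"
      unfolding set_lebesgue_integral_def by simp
  qed
  also have "\<dots> = (LINT x:{a<..b'}|lborel. - (1 + p x) * kernel_op (ker z) f x)"
    by (rule kernel_op_set_integral[OF k(1) f(1) w])
  also have "(LINT y|lborel. 2 * (indicator {a<..b'} y * f y)) = (LINT x:{a<..b'}|lborel. 2 * f x)"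
    unfolding set_lebesgue_integral_def by (simp add: algebra_simps)
  also have "(LINT x:{a<..b'}|lborel. - (1 + p x) * kernel_op (ker z) f x) + (LINT x:{a<..b'}|lborel. 2 * f x)
     = (LINT x:{a<..b'}|lborel. - (1 + p x) * kernel_op (ker z) f x + 2 * f x)"
    by (rule set_integral_add(2)[symmetric]; intro bounded_borel_set_integrable wb bounded_borel_mult bounded_borel_const f)
  finally show "kernel_op (sker z) f b' - kernel_op (sker z) f a
      = (LINT x:{a<..b'}|lborel. - (1 + p x) * kernel_op (ker z) f x + 2 * f x)" .
qed

section \<open>The vector field on profiles\<close>

text \<open>A profile lists pointwise representatives: \<open>0 = \<zeta>\<close>, \<open>1 = H\<close>, \<open>2 = U\<close>, \<open>3 = \<Gamma>\<close>, the derivatives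
  \<open>4 = \<zeta>\<^sub>\<xi>\<close>, \<open>5 = H\<^sub>\<xi>\<close>, \<open>6 = U\<^sub>\<xi>\<close>, \<open>7 = \<Gamma>\<^sub>\<xi>\<close> of these (so that \<open>i + 4\<close> is the derivative of \<open>i < 4\<close>), and
  \<open>8 = R\<close>. The components from \<open>2\<close> on are square integrable.\<close>

type_synonym profile = "nat \<Rightarrow> real \<Rightarrow> real"

definition src1 :: "profile \<Rightarrow> real \<Rightarrow> real" where
  "src1 a x = (a 2 x)\<^sup>2 * (1 + a 4 x) - 2 * (a 8 x)\<^sup>2 * (1 + a 4 x) + a 5 x"

definition src2 :: "profile \<Rightarrow> real \<Rightarrow> real" where "src2 a x = a 8 x * a 6 x"

definition src3 :: "profile \<Rightarrow> real \<Rightarrow> real" where "src3 a x = a 3 x * a 6 x"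

definition pP1 :: "profile \<Rightarrow> real \<Rightarrow> real" where "pP1 a x = 1/4 * kernel_op (ker (a 0)) (src1 a) x"
definition pP2 :: "profile \<Rightarrow> real \<Rightarrow> real" where "pP2 a x = 1/2 * kernel_op (ker (a 0)) (src2 a) x"
definition pP3 :: "profile \<Rightarrow> real \<Rightarrow> real" where "pP3 a x = 1/2 * kernel_op (ker (a 0)) (src3 a) x"
definition pQ1 :: "profile \<Rightarrow> real \<Rightarrow> real" where "pQ1 a x = - 1/4 * kernel_op (sker (a 0)) (src1 a) x"
definition pQ2 :: "profile \<Rightarrow> real \<Rightarrow> real" where "pQ2 a x = - 1/2 * kernel_op (sker (a 0)) (src2 a) x"
definition pQ3 :: "profile \<Rightarrow> real \<Rightarrow> real" where "pQ3 a x = - 1/2 * kernel_op (sker (a 0)) (src3 a) x"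

text \<open>Rows 4 to 7 are the derivatives in \<xi> of rows 0 to 3, with P_xi and Q_xi eliminated
  by the two kernel identities. So no row differentiates a component, and the system is an ODE at
  each \<xi> coupled only through P_i and Q_i.\<close>

fun rhs :: "profile \<Rightarrow> profile" where
  "rhs a i x =
    (if i = 0 then a 2 x
     else if i = 1 then (a 2 x) ^ 3 - 2 * pP1 a x * a 2 x - 2 * pP2 a x * a 3 x - 2 * pQ3 a x * a 3 x
     else if i = 2 then - pQ1 a x
     else if i = 3 then - pQ2 a x - pP3 a x
     else if i = 4 then a 6 x
     else if i = 5 then 3 * (a 2 x)\<^sup>2 * a 6 x - 2 * (pQ1 a x * (1 + a 4 x) * a 2 x + pP1 a x * a 6 x)
        - 2 * (pQ2 a x * (1 + a 4 x) * a 3 x + pP2 a x * a 7 x)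
        - 2 * ((pP3 a x * (1 + a 4 x) - src3 a x) * a 3 x + pQ3 a x * a 7 x)
     else if i = 6 then 1/2 * src1 a x - pP1 a x * (1 + a 4 x)
     else if i = 7 then - (pP2 a x * (1 + a 4 x) - src2 a x) - pQ3 a x * (1 + a 4 x)
     else if i = 8 then - pP2 a x - pQ3 a x
     else 0)"

declare rhs.simps [simp del]

lemma rhs_simps:
  "rhs a 0 = a 2"
  "rhs a 1 = (\<lambda>x. (a 2 x) ^ 3 - 2 * pP1 a x * a 2 x - 2 * pP2 a x * a 3 x - 2 * pQ3 a x * a 3 x)"
  "rhs a 2 = (\<lambda>x. - pQ1 a x)"
  "rhs a 3 = (\<lambda>x. - pQ2 a x - pP3 a x)"
  "rhs a 4 = a 6"
  "rhs a 5 = (\<lambda>x. 3 * (a 2 x)\<^sup>2 * a 6 x - 2 * (pQ1 a x * (1 + a 4 x) * a 2 x + pP1 a x * a 6 x)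
        - 2 * (pQ2 a x * (1 + a 4 x) * a 3 x + pP2 a x * a 7 x)
        - 2 * ((pP3 a x * (1 + a 4 x) - src3 a x) * a 3 x + pQ3 a x * a 7 x))"
  "rhs a 6 = (\<lambda>x. 1/2 * src1 a x - pP1 a x * (1 + a 4 x))"
  "rhs a 7 = (\<lambda>x. - (pP2 a x * (1 + a 4 x) - src2 a x) - pQ3 a x * (1 + a 4 x))"
  "rhs a 8 = (\<lambda>x. - pP2 a x - pQ3 a x)"
  "9 \<le> i \<Longrightarrow> rhs a i = (\<lambda>x. 0)"
  by (simp_all add: rhs.simps fun_eq_iff)

section \<open>Calculus of locally Lipschitz families\<close>

text \<open>Lipschitz bounds for the vector field are to be read off its formula by closure rules.
  \<open>D\<close> and \<open>d\<close> stay abstract because the calculus is used twice: on balls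
  of \<open>state\<close>, and on balls of \<open>G_set\<close> in \<open>E\<close> through chosen
  representatives.\<close>

locale lip_space =
  fixes D :: "'s set" and d :: "'s \<Rightarrow> 's \<Rightarrow> real"
  assumes d_nonneg: "0 \<le> d X Y"
begin

text \<open>The filter is \<open>top\<close> for bounds at every point and
  \<open>ae_filter lborel\<close> for bounds that hold almost everywhere only, as those for R in
  \<open>E\<close>.\<close>

definition LB :: "real filter \<Rightarrow> ('s \<Rightarrow> real \<Rightarrow> real) \<Rightarrow> bool" where
  "LB A f \<longleftrightarrow> (\<forall>X\<in>D. f X \<in> borel_measurable borel) \<and>
     (\<exists>C\<ge>0. \<forall>X\<in>D. \<forall>Y\<in>D. (\<forall>\<^sub>F x in A. \<bar>f X x\<bar> \<le> C) \<and> (\<forall>\<^sub>F x in A. \<bar>f X x - f Y x\<bar> \<le> C * d X Y))"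

definition LS :: "('s \<Rightarrow> real \<Rightarrow> real) \<Rightarrow> bool" where
  "LS f \<longleftrightarrow> (\<forall>X\<in>D. f X \<in> L2) \<and>
     (\<exists>C\<ge>0. \<forall>X\<in>D. \<forall>Y\<in>D. L2_norm (f X) \<le> C \<and> L2_norm (\<lambda>x. f X x - f Y x) \<le> C * d X Y)"

lemma LB_E:
  assumes "LB A f"
  obtains C where "0 \<le> C" "\<And>X. X \<in> D \<Longrightarrow> \<forall>\<^sub>F x in A. \<bar>f X x\<bar> \<le> C"
    "\<And>X Y. X \<in> D \<Longrightarrow> Y \<in> D \<Longrightarrow> \<forall>\<^sub>F x in A. \<bar>f X x - f Y x\<bar> \<le> C * d X Y"
  using assms unfolding LB_def by blast

lemma LB_measurable: "LB A f \<Longrightarrow> X \<in> D \<Longrightarrow> f X \<in> borel_measurable borel"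
  unfolding LB_def by blast

lemma LB_I:
  assumes "\<And>X. X \<in> D \<Longrightarrow> f X \<in> borel_measurable borel" "0 \<le> C1" "0 \<le> C2"
    "\<And>X. X \<in> D \<Longrightarrow> \<forall>\<^sub>F x in A. \<bar>f X x\<bar> \<le> C1"
    "\<And>X Y. X \<in> D \<Longrightarrow> Y \<in> D \<Longrightarrow> \<forall>\<^sub>F x in A. \<bar>f X x - f Y x\<bar> \<le> C2 * d X Y"
  shows "LB A f"
  unfolding LB_def
proof (intro conjI ballI exI[of _ "max C1 C2"])
  fix X Y assume XY: "X \<in> D" "Y \<in> D"
  show "f X \<in> borel_measurable borel" by (rule assms(1)[OF XY(1)])
  show "\<forall>\<^sub>F x in A. \<bar>f X x\<bar> \<le> max C1 C2"
    using assms(4)[OF XY(1)] by eventually_elim simp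
  have "C2 * d X Y \<le> max C1 C2 * d X Y" by (rule mult_right_mono) (simp_all add: d_nonneg)
  then show "\<forall>\<^sub>F x in A. \<bar>f X x - f Y x\<bar> \<le> max C1 C2 * d X Y"
    using assms(5)[OF XY] by (auto elim!: eventually_mono)
qed (use assms in auto)

lemma LS_E:
  assumes "LS f"
  obtains C where "0 \<le> C" "\<And>X. X \<in> D \<Longrightarrow> L2_norm (f X) \<le> C"
    "\<And>X Y. X \<in> D \<Longrightarrow> Y \<in> D \<Longrightarrow> L2_norm (\<lambda>x. f X x - f Y x) \<le> C * d X Y"
  using assms unfolding LS_def by blast

lemma LS_L2: "LS f \<Longrightarrow> X \<in> D \<Longrightarrow> f X \<in> L2"
  unfolding LS_def by blast

lemma LS_I:
  assumes "\<And>X. X \<in> D \<Longrightarrow> f X \<in> L2" "0 \<le> C1" "0 \<le> C2"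
    "\<And>X. X \<in> D \<Longrightarrow> L2_norm (f X) \<le> C1"
    "\<And>X Y. X \<in> D \<Longrightarrow> Y \<in> D \<Longrightarrow> L2_norm (\<lambda>x. f X x - f Y x) \<le> C2 * d X Y"
  shows "LS f"
  unfolding LS_def
proof (intro conjI ballI exI[of _ "max C1 C2"])
  fix X Y assume XY: "X \<in> D" "Y \<in> D"
  show "f X \<in> L2" by (rule assms(1)[OF XY(1)])
  show "L2_norm (f X) \<le> max C1 C2" using assms(4)[OF XY(1)] by simp
  have "C2 * d X Y \<le> max C1 C2 * d X Y" by (rule mult_right_mono) (simp_all add: d_nonneg)
  then show "L2_norm (\<lambda>x. f X x - f Y x) \<le> max C1 C2 * d X Y"
    using assms(5)[OF XY] by simp
qed (use assms in auto)

lemma LB_AE: "LB top f \<Longrightarrow> LB A f"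
  by (rule LB_E, assumption, rule LB_I) (auto intro: always_eventually LB_measurable[of top f])

lemma LB_const: "LB A (\<lambda>X x. c)"
  by (rule LB_I[of _ "\<bar>c\<bar>" 0]) auto

lemma LB_add:
  assumes "LB A f" "LB A g"
  shows "LB A (\<lambda>X x. f X x + g X x)"
proof -
  obtain C where C: "0 \<le> C" "\<And>X. X \<in> D \<Longrightarrow> \<forall>\<^sub>F x in A. \<bar>f X x\<bar> \<le> C"
    "\<And>X Y. X \<in> D \<Longrightarrow> Y \<in> D \<Longrightarrow> \<forall>\<^sub>F x in A. \<bar>f X x - f Y x\<bar> \<le> C * d X Y"
    using LB_E[OF assms(1)] by metis
  obtain C' where C': "0 \<le> C'" "\<And>X. X \<in> D \<Longrightarrow> \<forall>\<^sub>F x in A. \<bar>g X x\<bar> \<le> C'"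
    "\<And>X Y. X \<in> D \<Longrightarrow> Y \<in> D \<Longrightarrow> \<forall>\<^sub>F x in A. \<bar>g X x - g Y x\<bar> \<le> C' * d X Y"
    using LB_E[OF assms(2)] by metis
  show ?thesis
  proof (rule LB_I[of _ "C + C'" "C + C'"])
    fix X assume X: "X \<in> D"
    show "(\<lambda>x. f X x + g X x) \<in> borel_measurable borel"
      by (intro borel_measurable_add LB_measurable[OF assms(1) X] LB_measurable[OF assms(2) X])
    show "\<forall>\<^sub>F x in A. \<bar>f X x + g X x\<bar> \<le> C + C'"
      using C(2)[OF X] C'(2)[OF X] by eventually_elim linarith
    fix Y assume Y: "Y \<in> D"
    show "\<forall>\<^sub>F x in A. \<bar>f X x + g X x - (f Y x + g Y x)\<bar> \<le> (C + C') * d X Y"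
      using C(3)[OF X Y] C'(3)[OF X Y]
    proof eventually_elim
      case (elim x)
      then show ?case unfolding distrib_right by linarith
    qed
  qed (use C C' in auto)
qed

lemma LB_mult:
  assumes "LB A f" "LB A g"
  shows "LB A (\<lambda>X x. f X x * g X x)"
proof -
  obtain C where C: "0 \<le> C" "\<And>X. X \<in> D \<Longrightarrow> \<forall>\<^sub>F x in A. \<bar>f X x\<bar> \<le> C"
    "\<And>X Y. X \<in> D \<Longrightarrow> Y \<in> D \<Longrightarrow> \<forall>\<^sub>F x in A. \<bar>f X x - f Y x\<bar> \<le> C * d X Y"
    using LB_E[OF assms(1)] by metis
  obtain C' where C': "0 \<le> C'" "\<And>X. X \<in> D \<Longrightarrow> \<forall>\<^sub>F x in A. \<bar>g X x\<bar> \<le> C'"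
    "\<And>X Y. X \<in> D \<Longrightarrow> Y \<in> D \<Longrightarrow> \<forall>\<^sub>F x in A. \<bar>g X x - g Y x\<bar> \<le> C' * d X Y"
    using LB_E[OF assms(2)] by metis
  show ?thesis
  proof (rule LB_I[of _ "C * C'" "2 * C * C'"])
    fix X assume X: "X \<in> D"
    show "(\<lambda>x. f X x * g X x) \<in> borel_measurable borel"
      by (intro borel_measurable_times LB_measurable[OF assms(1) X] LB_measurable[OF assms(2) X])
    show "\<forall>\<^sub>F x in A. \<bar>f X x * g X x\<bar> \<le> C * C'"
      using C(2)[OF X] C'(2)[OF X] by eventually_elim (simp add: abs_mult mult_mono)
    fix Y assume Y: "Y \<in> D"
    show "\<forall>\<^sub>F x in A. \<bar>f X x * g X x - f Y x * g Y x\<bar> \<le> 2 * C * C' * d X Y"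
      using C(3)[OF X Y] C'(3)[OF X Y] C(2)[OF X] C'(2)[OF Y]
    proof eventually_elim
      case (elim x)
      have "\<bar>f X x * (g X x - g Y x)\<bar> \<le> C * (C' * d X Y)"
        unfolding abs_mult using elim C(1) by (intro mult_mono) auto
      moreover have "\<bar>(f X x - f Y x) * g Y x\<bar> \<le> (C * d X Y) * C'"
        unfolding abs_mult using elim C(1) d_nonneg[of X Y] by (intro mult_mono) auto
      ultimately show ?case by (simp add: algebra_simps)
    qed
  qed (use C C' in auto)
qed

lemma LB_cmult: "LB A f \<Longrightarrow> LB A (\<lambda>X x. c * f X x)"
  by (rule LB_mult[OF LB_const])

lemma LB_uminus: "LB A f \<Longrightarrow> LB A (\<lambda>X x. - f X x)"
  using LB_cmult[of A f "-1"] by simp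

lemma LB_diff: "LB A f \<Longrightarrow> LB A g \<Longrightarrow> LB A (\<lambda>X x. f X x - g X x)"
  using LB_add[OF _ LB_uminus] by simp

lemma LB_power: "LB A f \<Longrightarrow> LB A (\<lambda>X x. f X x ^ n)"
  by (induction n) (simp_all add: LB_const LB_mult)

lemmas LB_intros = LB_const LB_add LB_mult LB_uminus LB_diff LB_power

lemma LS_add:
  assumes "LS f" "LS g"
  shows "LS (\<lambda>X x. f X x + g X x)"
proof -
  obtain C where C: "0 \<le> C" "\<And>X. X \<in> D \<Longrightarrow> L2_norm (f X) \<le> C"
    "\<And>X Y. X \<in> D \<Longrightarrow> Y \<in> D \<Longrightarrow> L2_norm (\<lambda>x. f X x - f Y x) \<le> C * d X Y"
    using LS_E[OF assms(1)] by metis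
  obtain C' where C': "0 \<le> C'" "\<And>X. X \<in> D \<Longrightarrow> L2_norm (g X) \<le> C'"
    "\<And>X Y. X \<in> D \<Longrightarrow> Y \<in> D \<Longrightarrow> L2_norm (\<lambda>x. g X x - g Y x) \<le> C' * d X Y"
    using LS_E[OF assms(2)] by metis
  show ?thesis
  proof (rule LS_I[of _ "C + C'" "C + C'"])
    fix X assume X: "X \<in> D"
    show "(\<lambda>x. f X x + g X x) \<in> L2"
      by (intro L2_add(1) LS_L2[OF assms(1) X] LS_L2[OF assms(2) X])
    show "L2_norm (\<lambda>x. f X x + g X x) \<le> C + C'"
      using L2_add(2)[OF LS_L2[OF assms(1) X] LS_L2[OF assms(2) X]] C(2)[OF X] C'(2)[OF X] by linarith
    fix Y assume Y: "Y \<in> D"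
    have df: "(\<lambda>x. f X x - f Y x) \<in> L2"
      using L2_add(1)[OF LS_L2[OF assms(1) X] L2_cmult(1)[OF LS_L2[OF assms(1) Y], of "-1"]] by simp
    have dg: "(\<lambda>x. g X x - g Y x) \<in> L2"
      using L2_add(1)[OF LS_L2[OF assms(2) X] L2_cmult(1)[OF LS_L2[OF assms(2) Y], of "-1"]] by simp
    have e: "(\<lambda>x. f X x + g X x - (f Y x + g Y x)) = (\<lambda>x. (f X x - f Y x) + (g X x - g Y x))"
      by (simp add: algebra_simps)
    show "L2_norm (\<lambda>x. f X x + g X x - (f Y x + g Y x)) \<le> (C + C') * d X Y"
      using L2_add(2)[OF df dg] C(3)[OF X Y] C'(3)[OF X Y] unfolding e distrib_right by linarith
  qed (use C C' in auto)
qed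

lemma L2_mult_le:
  assumes "f \<in> borel_measurable borel" "AE x in lborel. \<bar>f x\<bar> \<le> C" "g \<in> L2" "0 \<le> C"
  shows "(\<lambda>x. f x * g x) \<in> L2" "L2_norm (\<lambda>x. f x * g x) \<le> C * L2_norm g"
proof -
  have m: "(\<lambda>x. f x * g x) \<in> borel_measurable borel"
    by (intro borel_measurable_times assms L2_measurable)
  have e: "AE x in lborel. \<bar>f x * g x\<bar> \<le> C * \<bar>g x\<bar>"
    using assms(2) by eventually_elim (simp add: abs_mult mult_right_mono)
  show "(\<lambda>x. f x * g x) \<in> L2" "L2_norm (\<lambda>x. f x * g x) \<le> C * L2_norm g"
    by (rule L2_domI[OF assms(3) m e assms(4)])+
qed

lemma LS_mult:
  assumes "LB (ae_filter lborel) f" "LS g"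
  shows "LS (\<lambda>X x. f X x * g X x)"
proof -
  obtain C where C: "0 \<le> C" "\<And>X. X \<in> D \<Longrightarrow> AE x in lborel. \<bar>f X x\<bar> \<le> C"
    "\<And>X Y. X \<in> D \<Longrightarrow> Y \<in> D \<Longrightarrow> AE x in lborel. \<bar>f X x - f Y x\<bar> \<le> C * d X Y"
    using LB_E[OF assms(1)] by metis
  obtain C' where C': "0 \<le> C'" "\<And>X. X \<in> D \<Longrightarrow> L2_norm (g X) \<le> C'"
    "\<And>X Y. X \<in> D \<Longrightarrow> Y \<in> D \<Longrightarrow> L2_norm (\<lambda>x. g X x - g Y x) \<le> C' * d X Y"
    using LS_E[OF assms(2)] by metis
  show ?thesis
  proof (rule LS_I[of _ "C * C'" "2 * C * C'"])
    fix X assume X: "X \<in> D"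
    note mX = LB_measurable[OF assms(1) X] and gX = LS_L2[OF assms(2) X]
    show "(\<lambda>x. f X x * g X x) \<in> L2" by (rule L2_mult_le(1)[OF mX C(2)[OF X] gX C(1)])
    show "L2_norm (\<lambda>x. f X x * g X x) \<le> C * C'"
      by (rule order_trans[OF L2_mult_le(2)[OF mX C(2)[OF X] gX C(1)] mult_left_mono[OF C'(2)[OF X] C(1)]])
    fix Y assume Y: "Y \<in> D"
    note mY = LB_measurable[OF assms(1) Y] and gY = LS_L2[OF assms(2) Y]
    have dg: "(\<lambda>x. g X x - g Y x) \<in> L2"
      using L2_add(1)[OF gX L2_cmult(1)[OF gY, of "-1"]] by simp
    have dm: "(\<lambda>x. f X x - f Y x) \<in> borel_measurable borel" by (intro borel_measurable_diff mX mY)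
    have cd: "0 \<le> C * d X Y" using C(1) d_nonneg by simp
    note 1 = L2_mult_le[OF mX C(2)[OF X] dg C(1)] and 2 = L2_mult_le[OF dm C(3)[OF X Y] gY cd]
    have "(\<lambda>x. f X x * g X x - f Y x * g Y x) = (\<lambda>x. f X x * (g X x - g Y x) + (f X x - f Y x) * g Y x)"
      by (simp add: algebra_simps)
    then have "L2_norm (\<lambda>x. f X x * g X x - f Y x * g Y x)
        \<le> C * L2_norm (\<lambda>x. g X x - g Y x) + C * d X Y * L2_norm (g Y)"
      using L2_add(2)[OF 1(1) 2(1)] 1(2) 2(2) by simp
    also have "\<dots> \<le> C * (C' * d X Y) + C * d X Y * C'"
      by (intro add_mono mult_left_mono C'(3)[OF X Y] C'(2)[OF Y] C(1) cd)
    finally show "L2_norm (\<lambda>x. f X x * g X x - f Y x * g Y x) \<le> 2 * C * C' * d X Y" by (simp add: mult.commute mult.left_commute)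
  qed (use C C' in auto)
qed

lemma LS_cmult: "LS f \<Longrightarrow> LS (\<lambda>X x. c * f X x)"
  by (rule LS_mult[OF LB_const])

lemma LS_uminus: "LS f \<Longrightarrow> LS (\<lambda>X x. - f X x)"
  using LS_cmult[of f "-1"] by simp

lemma LS_diff: "LS f \<Longrightarrow> LS g \<Longrightarrow> LS (\<lambda>X x. f X x - g X x)"
  using LS_add[OF _ LS_uminus] by simp

text \<open>y_xi = 1 + zeta_xi is not square integrable, so the product is treated as f + f zeta_xi;
  this is why f has to be both bounded and square integrable.\<close>

lemma LS_mult_1p:
  assumes "LS f" "LS p" "LB (ae_filter lborel) f"
  shows "LS (\<lambda>X x. f X x * (1 + p X x))"
  using LS_add[OF assms(1) LS_mult[OF assms(3,2)]] by (simp add: distrib_left)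

text \<open>A change of data and a change of kernel are separated by \<open>kernel_op_diff\<close>;
  in the second part the kernel constant itself is proportional to the distance.\<close>

lemma LS_kernel_gen:
  assumes z: "LB top z" and f: "LS f" and k: "k = ker \<or> k = sker"
  shows "LB top (\<lambda>X. kernel_op (k (z X)) (f X))" "LS (\<lambda>X. kernel_op (k (z X)) (f X))"
proof -
  obtain Z where Z: "0 \<le> Z" "\<And>X x. X \<in> D \<Longrightarrow> \<bar>z X x\<bar> \<le> Z"
    "\<And>X Y x. X \<in> D \<Longrightarrow> Y \<in> D \<Longrightarrow> \<bar>z X x - z Y x\<bar> \<le> Z * d X Y"
    by (rule LB_E[OF z]) (simp only: eventually_top)
  obtain C where C: "0 \<le> C" "\<And>X. X \<in> D \<Longrightarrow> L2_norm (f X) \<le> C"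
    "\<And>X Y. X \<in> D \<Longrightarrow> Y \<in> D \<Longrightarrow> L2_norm (\<lambda>x. f X x - f Y x) \<le> C * d X Y"
    using LS_E[OF f] by metis
  define c where "c = exp (2 * Z)"
  have c: "0 \<le> c" unfolding c_def by simp
  have K: "exp_kernel c (k (z X))" if "X \<in> D" for X
    using exp_kernel_ker[OF LB_measurable[OF z that] Z(2)[OF that]] k unfolding c_def by auto
  have KD: "exp_kernel (c * (2 * (Z * d X Y))) (\<lambda>x y. k (z X) x y - k (z Y) x y)" if "X \<in> D" "Y \<in> D" for X Y
    using exp_kernel_ker_diff[OF LB_measurable[OF z that(1)] LB_measurable[OF z that(2)] Z(2)[OF that(1)] Z(2)[OF that(2)] Z(3)[OF that]] k
    unfolding c_def by auto
  have df: "(\<lambda>x. f X x - f Y x) \<in> L2" if "X \<in> D" "Y \<in> D" for X Y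
    using L2_add(1)[OF LS_L2[OF f that(1)] L2_cmult(1)[OF LS_L2[OF f that(2)], of "-1"]] by simp
  have eq: "kernel_op (k (z X)) (f X) x - kernel_op (k (z Y)) (f Y) x
     = kernel_op (k (z X)) (\<lambda>y. f X y - f Y y) x + kernel_op (\<lambda>x y. k (z X) x y - k (z Y) x y) (f Y) x"
    if "X \<in> D" "Y \<in> D" for X Y x
    by (rule kernel_op_diff[OF K[OF that(1)] K[OF that(2)] LS_L2[OF f that(1)] LS_L2[OF f that(2)]])
  let ?e = "1 + exp_mass"
  have e: "0 \<le> ?e" "0 \<le> exp_mass" using exp_mass_nonneg by simp_all
  have cZ: "0 \<le> c * (2 * (Z * d X Y))" for X Y using c Z(1) d_nonneg by simp
  show "LB top (\<lambda>X. kernel_op (k (z X)) (f X))"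
  proof (rule LB_I[of _ "c * ?e * C" "c * ?e * C + c * (2 * Z) * ?e * C"])
    fix X assume X: "X \<in> D"
    show "kernel_op (k (z X)) (f X) \<in> borel_measurable borel"
      by (rule kernel_op_measurable[OF K[OF X] L2_measurable[OF LS_L2[OF f X]]])
    have b: "c * ?e * L2_norm (f Y) \<le> c * ?e * C" if "Y \<in> D" for Y
      by (intro mult_left_mono C(2) that mult_nonneg_nonneg c e)
    show "\<forall>\<^sub>F x in top. \<bar>kernel_op (k (z X)) (f X) x\<bar> \<le> c * ?e * C"
      using order_trans[OF kernel_op_sup_le[OF K[OF X] LS_L2[OF f X]] b[OF X]] by simp
    fix Y assume Y: "Y \<in> D"
    have "\<bar>kernel_op (k (z X)) (f X) x - kernel_op (k (z Y)) (f Y) x\<bar> \<le> (c * ?e * C + c * (2 * Z) * ?e * C) * d X Y" for x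
    proof -
      have "\<bar>kernel_op (k (z X)) (\<lambda>y. f X y - f Y y) x\<bar> \<le> c * ?e * (C * d X Y)"
        by (rule order_trans[OF kernel_op_sup_le[OF K[OF X] df[OF X Y]]])
           (intro mult_left_mono C(3)[OF X Y] mult_nonneg_nonneg c e)
      moreover have "\<bar>kernel_op (\<lambda>x y. k (z X) x y - k (z Y) x y) (f Y) x\<bar> \<le> c * (2 * (Z * d X Y)) * ?e * C"
        by (rule order_trans[OF kernel_op_sup_le[OF KD[OF X Y] LS_L2[OF f Y]]])
           (intro mult_left_mono C(2)[OF Y] mult_nonneg_nonneg[OF cZ e(1)])
      ultimately show ?thesis unfolding eq[OF X Y] by (simp add: algebra_simps)
    qed
    then show "\<forall>\<^sub>F x in top. \<bar>kernel_op (k (z X)) (f X) x - kernel_op (k (z Y)) (f Y) x\<bar>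
        \<le> (c * ?e * C + c * (2 * Z) * ?e * C) * d X Y" by simp
  qed (use c e C Z in auto)
  show "LS (\<lambda>X. kernel_op (k (z X)) (f X))"
  proof (rule LS_I[of _ "c * exp_mass * C" "c * exp_mass * C + c * (2 * Z) * exp_mass * C"])
    fix X assume X: "X \<in> D"
    note 1 = kernel_op_L2[OF K[OF X] LS_L2[OF f X]]
    show "kernel_op (k (z X)) (f X) \<in> L2" by (rule 1(1))
    show "L2_norm (kernel_op (k (z X)) (f X)) \<le> c * exp_mass * C"
      by (rule order_trans[OF 1(2)]) (intro mult_left_mono C(2) X mult_nonneg_nonneg c e)
    fix Y assume Y: "Y \<in> D"
    note 2 = kernel_op_L2[OF K[OF X] df[OF X Y]] and 3 = kernel_op_L2[OF KD[OF X Y] LS_L2[OF f Y]]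
    have "L2_norm (\<lambda>x. kernel_op (k (z X)) (f X) x - kernel_op (k (z Y)) (f Y) x)
        \<le> L2_norm (kernel_op (k (z X)) (\<lambda>y. f X y - f Y y)) + L2_norm (kernel_op (\<lambda>x y. k (z X) x y - k (z Y) x y) (f Y))"
      unfolding eq[OF X Y] by (rule L2_add(2)[OF 2(1) 3(1)])
    also have "\<dots> \<le> c * exp_mass * (C * d X Y) + c * (2 * (Z * d X Y)) * exp_mass * C"
      by (intro add_mono order_trans[OF 2(2)] order_trans[OF 3(2)] mult_left_mono C(2)[OF Y] C(3)[OF X Y]
            mult_nonneg_nonneg[OF cZ e(2)] mult_nonneg_nonneg[OF c e(2)])
    finally show "L2_norm (\<lambda>x. kernel_op (k (z X)) (f X) x - kernel_op (k (z Y)) (f Y) x)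
        \<le> (c * exp_mass * C + c * (2 * Z) * exp_mass * C) * d X Y" by (simp add: algebra_simps)
  qed (use c e C Z in auto)
qed

lemmas LB_kernel = LS_kernel_gen(1)[OF _ _ disjI1[OF refl]] LS_kernel_gen(1)[OF _ _ disjI2[OF refl]]
lemmas LS_kernel = LS_kernel_gen(2)[OF _ _ disjI1[OF refl]] LS_kernel_gen(2)[OF _ _ disjI2[OF refl]]

end

text \<open>The hypotheses match what the norm of \<open>E\<close> controls: components 4 to 7 in
  L^2 alone, R in L^2 and almost everywhere. The norm of \<open>state\<close> controls more, so both
  settings are instances.\<close>

locale lip_profiles = lip_space D d for D :: "'s set" and d +
  fixes prof :: "'s \<Rightarrow> profile"
  assumes prof_LB: "i < 4 \<Longrightarrow> LB top (\<lambda>X. prof X i)" and prof_R: "LB (ae_filter lborel) (\<lambda>X. prof X 8)"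
    and prof_LS: "2 \<le> i \<Longrightarrow> i < 9 \<Longrightarrow> LS (\<lambda>X. prof X i)"
begin

abbreviation "LBe \<equiv> LB (ae_filter lborel)"

lemma prof_LBe: "i < 4 \<Longrightarrow> LBe (\<lambda>X. prof X i)" by (rule LB_AE[OF prof_LB])

lemma LS_src: "LS (\<lambda>X. src1 (prof X))" "LS (\<lambda>X. src2 (prof X))" "LS (\<lambda>X. src3 (prof X))"
proof -
  have "LS (\<lambda>X x. (prof X 2 x * prof X 2 x) * (1 + prof X 4 x) + (-2) * ((prof X 8 x * prof X 8 x) * (1 + prof X 4 x)) + prof X 5 x)"
    by (intro LS_add LS_cmult LS_mult_1p LS_mult LB_mult prof_LS prof_LBe prof_R) simp_all
  then show "LS (\<lambda>X. src1 (prof X))" by (simp add: src1_def[abs_def] power2_eq_square algebra_simps)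
  show "LS (\<lambda>X. src2 (prof X))" unfolding src2_def[abs_def] by (intro LS_mult prof_R prof_LS) simp_all
  show "LS (\<lambda>X. src3 (prof X))" unfolding src3_def[abs_def] by (intro LS_mult prof_LBe prof_LS) simp_all
qed

lemma z_LB: "LB top (\<lambda>X. prof X 0)" by (rule prof_LB) simp

lemma LB_PQ:
  "LB top (\<lambda>X. pP1 (prof X))" "LB top (\<lambda>X. pP2 (prof X))" "LB top (\<lambda>X. pP3 (prof X))"
  "LB top (\<lambda>X. pQ1 (prof X))" "LB top (\<lambda>X. pQ2 (prof X))" "LB top (\<lambda>X. pQ3 (prof X))"
  unfolding pP1_def[abs_def] pP2_def[abs_def] pP3_def[abs_def] pQ1_def[abs_def] pQ2_def[abs_def] pQ3_def[abs_def]
  by (intro LB_cmult LB_kernel z_LB LS_src)+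

lemma LS_PQ:
  "LS (\<lambda>X. pP1 (prof X))" "LS (\<lambda>X. pP2 (prof X))" "LS (\<lambda>X. pP3 (prof X))"
  "LS (\<lambda>X. pQ1 (prof X))" "LS (\<lambda>X. pQ2 (prof X))" "LS (\<lambda>X. pQ3 (prof X))"
  unfolding pP1_def[abs_def] pP2_def[abs_def] pP3_def[abs_def] pQ1_def[abs_def] pQ2_def[abs_def] pQ3_def[abs_def]
  by (intro LS_cmult LS_kernel z_LB LS_src)+

lemmas LBe_PQ = LB_PQ[THEN LB_AE]

lemma rhs_LB:
  assumes "i < 4 \<or> i = 8"
  shows "LB top (\<lambda>X. rhs (prof X) i)"
proof -
  consider "i = 0" | "i = 1" | "i = 2" | "i = 3" | "i = 8" using assms by linarith
  then show ?thesis
    by cases (simp_all only: rhs_simps, (intro LB_intros LB_PQ prof_LB; simp)+)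
qed

lemma rhs_LS:
  assumes "2 \<le> i" "i < 9"
  shows "LS (\<lambda>X. rhs (prof X) i)"
proof -
  \<comment> \<open>H_xi,t regrouped so that each summand is a bounded factor times a
    square-integrable one, with y_xi occurring only next to a square-integrable factor.\<close>
  have 5: "LS (\<lambda>X x. 3 * ((prof X 2 x * prof X 2 x) * prof X 6 x)
        + (-2) * ((pQ1 (prof X) x * prof X 2 x) * (1 + prof X 4 x) + pP1 (prof X) x * prof X 6 x)
        + (-2) * ((pQ2 (prof X) x * prof X 3 x) * (1 + prof X 4 x) + pP2 (prof X) x * prof X 7 x)
        + (-2) * ((pP3 (prof X) x * prof X 3 x) * (1 + prof X 4 x) + (- 1) * (prof X 3 x * src3 (prof X) x)
            + pQ3 (prof X) x * prof X 7 x))"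
    by (intro LS_add LS_cmult LS_mult_1p LS_mult LB_mult LBe_PQ LS_src prof_LS prof_LBe) simp_all
  consider "i = 2" | "i = 3" | "i = 4" | "i = 5" | "i = 6" | "i = 7" | "i = 8" using assms by linarith
  then show ?thesis
  proof cases
    case 4
    show ?thesis using 5 unfolding 4 rhs_simps by (simp add: power2_eq_square algebra_simps)
  next
    case 5
    show ?thesis unfolding 5 rhs_simps
      by (intro LS_diff LS_cmult LS_src LS_mult_1p LS_PQ LBe_PQ prof_LS) simp_all
  next
    case 6
    show ?thesis unfolding 6 rhs_simps
      by (intro LS_diff LS_uminus LS_src LS_mult_1p LS_PQ LBe_PQ prof_LS) simp_all
  qed (simp_all only: rhs_simps, (intro LS_diff LS_uminus LS_PQ prof_LS; simp)+)
qed

lemma rhs_LB_strong: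
  assumes s: "\<And>i. i < 9 \<Longrightarrow> LB top (\<lambda>X. prof X i)" and i: "i < 9"
  shows "LB top (\<lambda>X. rhs (prof X) i)"
proof -
  have src: "LB top (\<lambda>X. src1 (prof X))" "LB top (\<lambda>X. src2 (prof X))" "LB top (\<lambda>X. src3 (prof X))"
    unfolding src1_def[abs_def] src2_def[abs_def] src3_def[abs_def] by (intro LB_intros s; simp)+
  consider "i < 4 \<or> i = 8" | "i = 4" | "i = 5" | "i = 6" | "i = 7" using i by linarith
  then show ?thesis
    by cases (rule rhs_LB, assumption, simp_all only: rhs_simps, (intro LB_intros LB_PQ src s; simp)+)
qed

end

section \<open>A Banach space of pointwise states\<close>

text \<open>A genuine supremum, not an essential one: evaluation at a point has to be a bounded
  linear map for the ODE in \<open>state\<close> to restrict to each point.\<close>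

definition sup_norm :: "(real \<Rightarrow> real) \<Rightarrow> real" where
  "sup_norm f = (SUP x. \<bar>f x\<bar>)"

lemma sup_norm_upper:
  assumes "bounded_borel f"
  shows "\<bar>f x\<bar> \<le> sup_norm f"
proof -
  obtain C where "\<And>x. \<bar>f x\<bar> \<le> C" using assms bounded_borelE by metis
  then have "bdd_above (range (\<lambda>x. \<bar>f x\<bar>))" by (intro bdd_aboveI2)
  then show ?thesis unfolding sup_norm_def by (rule cSUP_upper[OF UNIV_I])
qed

lemma sup_norm_least: "(\<And>x. \<bar>f x\<bar> \<le> C) \<Longrightarrow> sup_norm f \<le> C"
  unfolding sup_norm_def by (rule cSUP_least) auto

lemma sup_norm_nonneg: "bounded_borel f \<Longrightarrow> 0 \<le> sup_norm f"
  using sup_norm_upper[of f 0] by linarith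

lemma sup_norm_add:
  assumes "bounded_borel f" "bounded_borel g"
  shows "sup_norm (\<lambda>x. f x + g x) \<le> sup_norm f + sup_norm g"
  by (rule sup_norm_least)
     (use sup_norm_upper[OF assms(1)] sup_norm_upper[OF assms(2)] in \<open>meson abs_triangle_ineq add_mono order_trans\<close>)

lemma sup_norm_cmult_le:
  assumes "bounded_borel f"
  shows "sup_norm (\<lambda>x. c * f x) \<le> \<bar>c\<bar> * sup_norm f"
  by (rule sup_norm_least) (simp add: abs_mult mult_left_mono sup_norm_upper[OF assms])

lemma sup_norm_cmult:
  assumes "bounded_borel f"
  shows "sup_norm (\<lambda>x. c * f x) = \<bar>c\<bar> * sup_norm f"
proof (cases "c = 0")
  case True
  then show ?thesis by (simp add: sup_norm_def)
next
  case False
  have "sup_norm (\<lambda>x. inverse c * (c * f x)) \<le> \<bar>inverse c\<bar> * sup_norm (\<lambda>x. c * f x)"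
    by (intro sup_norm_cmult_le bounded_borel_intros assms)
  then have "\<bar>c\<bar> * sup_norm f \<le> sup_norm (\<lambda>x. c * f x)"
    using False by (simp add: field_simps)
  with sup_norm_cmult_le[OF assms, of c] show ?thesis by simp
qed

text \<open>The link between components 0 to 3 and their derivatives is linear, so it is built into
  the space and cannot be lost along the ODE. Vanishing from index 9 on makes the norm
  definite.\<close>

definition admissible :: "profile \<Rightarrow> bool" where
  "admissible a \<longleftrightarrow> (\<forall>i. bounded_borel (a i)) \<and> (\<forall>i. 2 \<le> i \<and> i < 9 \<longrightarrow> a i \<in> L2) \<and>
     (\<forall>i<4. primitive (a i) (a (i + 4))) \<and> (\<forall>i\<ge>9. a i = (\<lambda>x. 0))"

lemma admissibleD:
  assumes "admissible a"
  shows "bounded_borel (a i)" "2 \<le> i \<Longrightarrow> i < 9 \<Longrightarrow> a i \<in> L2" "i < 4 \<Longrightarrow> primitive (a i) (a (i + 4))"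
    "9 \<le> i \<Longrightarrow> a i = (\<lambda>x. 0)"
  using assms unfolding admissible_def by auto

lemma admissible_zero: "admissible (\<lambda>i x. 0)"
  unfolding admissible_def using L2_zero(1) by (auto simp: bounded_borel_const primitive_const)

lemma admissible_add: "admissible a \<Longrightarrow> admissible b \<Longrightarrow> admissible (\<lambda>i x. a i x + b i x)"
  unfolding admissible_def by (auto simp: bounded_borel_add primitive_add L2_add)

lemma admissible_cmult: "admissible a \<Longrightarrow> admissible (\<lambda>i x. c * a i x)"
  unfolding admissible_def
  by (auto simp: bounded_borel_mult bounded_borel_const primitive_cmult L2_cmult)

typedef state = "Collect admissible" morphisms pr Abs_state
  using admissible_zero by blast

lemma admissible_pr: "admissible (pr x)" using pr[of x] by simp

lemma pr_Abs: "admissible a \<Longrightarrow> pr (Abs_state a) = a" by (rule Abs_state_inverse) simp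

lemmas prD = admissibleD[OF admissible_pr]

definition profile_norm :: "profile \<Rightarrow> real" where
  "profile_norm a = (\<Sum>i<9. sup_norm (a i)) + (\<Sum>i=2..<9. L2_norm (a i))"

instantiation state :: real_normed_vector
begin

definition zero_state :: state where "0 = Abs_state (\<lambda>i x. 0)"
definition plus_state :: "state \<Rightarrow> state \<Rightarrow> state" where "x + y = Abs_state (\<lambda>i t. pr x i t + pr y i t)"
definition scaleR_state :: "real \<Rightarrow> state \<Rightarrow> state" where "c *\<^sub>R x = Abs_state (\<lambda>i t. c * pr x i t)"
definition uminus_state :: "state \<Rightarrow> state" where "- x = (-1) *\<^sub>R (x::state)"
definition minus_state :: "state \<Rightarrow> state \<Rightarrow> state" where "x - y = x + (-1) *\<^sub>R (y::state)"
definition norm_state :: "state \<Rightarrow> real" where "norm x = profile_norm (pr x)"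
definition dist_state :: "state \<Rightarrow> state \<Rightarrow> real" where "dist x y = norm (x - y :: state)"
definition sgn_state :: "state \<Rightarrow> state" where "sgn x = inverse (norm x) *\<^sub>R (x::state)"
definition uniformity_state :: "(state \<times> state) filter" where
  "uniformity = (INF e\<in>{0<..}. principal {(x::state, y). dist x y < e})"
definition open_state :: "state set \<Rightarrow> bool" where
  "open S = (\<forall>x\<in>S. \<forall>\<^sub>F (x', y) in uniformity. x' = (x::state) \<longrightarrow> y \<in> S)"

lemma pr_ops: "pr 0 = (\<lambda>i x. 0)" "pr (x + y) = (\<lambda>i t. pr x i t + pr y i t)" "pr (c *\<^sub>R x) = (\<lambda>i t. c * pr x i t)"
  unfolding zero_state_def plus_state_def scaleR_state_def
  by (simp_all add: pr_Abs admissible_zero admissible_add admissible_cmult admissible_pr)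

instance
proof
  fix x y z :: state and a b :: real
  show "x + y + z = x + (y + z)" "x + y = y + x" "0 + x = x" "a *\<^sub>R (x + y) = a *\<^sub>R x + a *\<^sub>R y"
    "(a + b) *\<^sub>R x = a *\<^sub>R x + b *\<^sub>R x" "a *\<^sub>R b *\<^sub>R x = (a * b) *\<^sub>R x" "1 *\<^sub>R x = x"
    by (simp_all add: pr_inject[symmetric] pr_ops fun_eq_iff algebra_simps)
  show "- x + x = 0" unfolding uminus_state_def
    by (simp add: pr_inject[symmetric] pr_ops fun_eq_iff)
  show "x - y = x + - y" unfolding minus_state_def uminus_state_def ..
  show "dist x y = norm (x - y)" by (rule dist_state_def)
  show "sgn x = inverse (norm x) *\<^sub>R x" by (rule sgn_state_def)
  show "(uniformity :: (state \<times> state) filter) = (INF e\<in>{0<..}. principal {(x, y). dist x y < e})"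
    by (rule uniformity_state_def)
  show "open S \<longleftrightarrow> (\<forall>x\<in>S. \<forall>\<^sub>F (x', y) in uniformity. x' = x \<longrightarrow> y \<in> S)" for S :: "state set"
    by (rule open_state_def)
  show "norm x = 0 \<longleftrightarrow> x = 0"
  proof
    assume "norm x = 0"
    moreover have "0 \<le> (\<Sum>i=2..<9. L2_norm (pr x i))" by (intro sum_nonneg L2_norm_nonneg)
    moreover have "0 \<le> (\<Sum>i<9. sup_norm (pr x i))" by (intro sum_nonneg sup_norm_nonneg prD)
    ultimately have "(\<Sum>i<9. sup_norm (pr x i)) = 0"
      unfolding norm_state_def profile_norm_def by linarith
    then have s: "sup_norm (pr x i) = 0" if "i < 9" for i
      using that by (subst (asm) sum_nonneg_eq_0_iff) (auto intro: sup_norm_nonneg prD)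
    have "pr x i t = 0" for i t
    proof (cases "i < 9")
      case True
      then show ?thesis using sup_norm_upper[OF prD(1)[of x i], of t] s[OF True] by simp
    qed (simp add: prD(4))
    then show "x = 0" by (simp add: pr_inject[symmetric] pr_ops fun_eq_iff)
  qed (simp add: norm_state_def profile_norm_def pr_ops sup_norm_def L2_zero)
  have "(\<Sum>i<9. sup_norm (\<lambda>t. pr x i t + pr y i t)) \<le> (\<Sum>i<9. sup_norm (pr x i) + sup_norm (pr y i))"
    by (intro sum_mono sup_norm_add prD)
  moreover have "(\<Sum>i=2..<9. L2_norm (\<lambda>t. pr x i t + pr y i t)) \<le> (\<Sum>i=2..<9. L2_norm (pr x i) + L2_norm (pr y i))"
    by (intro sum_mono L2_add(2) prD) auto
  ultimately show "norm (x + y) \<le> norm x + norm y"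
    unfolding norm_state_def profile_norm_def pr_ops sum.distrib by linarith
  have "(\<Sum>i<9. sup_norm (\<lambda>t. a * pr x i t)) = \<bar>a\<bar> * (\<Sum>i<9. sup_norm (pr x i))"
    unfolding sum_distrib_left by (intro sum.cong refl sup_norm_cmult prD)
  moreover have "(\<Sum>i=2..<9. L2_norm (\<lambda>t. a * pr x i t)) = \<bar>a\<bar> * (\<Sum>i=2..<9. L2_norm (pr x i))"
    unfolding sum_distrib_left by (intro sum.cong refl L2_cmult(2) prD) auto
  ultimately show "norm (a *\<^sub>R x) = \<bar>a\<bar> * norm x"
    unfolding norm_state_def profile_norm_def pr_ops by (simp add: distrib_left)
qed

end

lemma pr_diff: "pr (x - y) = (\<lambda>i t. pr x i t - pr y i t)"
  by (simp only: minus_state_def pr_ops) simp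

lemma L2_diff: "f \<in> L2 \<Longrightarrow> g \<in> L2 \<Longrightarrow> (\<lambda>x. f x - g x) \<in> L2"
  using L2_add(1)[OF _ L2_cmult(1)[of g "-1"]] by simp

lemma state_sup_le: "\<bar>pr x i t\<bar> \<le> norm x"
proof (cases "i < 9")
  case True
  have "\<bar>pr x i t\<bar> \<le> sup_norm (pr x i)" by (rule sup_norm_upper[OF prD(1)])
  also have "\<dots> \<le> (\<Sum>i<9. sup_norm (pr x i))"
    using True by (intro member_le_sum) (auto intro: sup_norm_nonneg prD)
  also have "\<dots> \<le> norm x" unfolding norm_state_def profile_norm_def by (simp add: sum_nonneg L2_norm_nonneg)
  finally show ?thesis .
qed (simp add: prD(4))

lemma state_L2_le:
  assumes "2 \<le> i" "i < 9"
  shows "L2_norm (pr x i) \<le> norm x"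
proof -
  have "L2_norm (pr x i) \<le> (\<Sum>i=2..<9. L2_norm (pr x i))"
    using assms by (intro member_le_sum) (auto intro: L2_norm_nonneg)
  also have "\<dots> \<le> norm x"
    unfolding norm_state_def profile_norm_def by (simp add: sum_nonneg sup_norm_nonneg prD)
  finally show ?thesis .
qed

text \<open>16 = 9 + 7: nine suprema and seven L^2 norms.\<close>

lemma profile_norm_le:
  assumes "\<And>i t. i < 9 \<Longrightarrow> \<bar>a i t\<bar> \<le> C" "\<And>i. 2 \<le> i \<Longrightarrow> i < 9 \<Longrightarrow> L2_norm (a i) \<le> C"
  shows "profile_norm a \<le> 16 * C"
proof -
  have "(\<Sum>i<9. sup_norm (a i)) \<le> (\<Sum>i<(9::nat). C)" by (intro sum_mono sup_norm_least assms(1)) simp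
  moreover have "(\<Sum>i=2..<9. L2_norm (a i)) \<le> (\<Sum>i=2..<(9::nat). C)" by (intro sum_mono assms(2)) auto
  ultimately show ?thesis unfolding profile_norm_def by simp
qed

lemma state_norm_le:
  assumes "\<And>i t. i < 9 \<Longrightarrow> \<bar>pr x i t\<bar> \<le> C" "\<And>i. 2 \<le> i \<Longrightarrow> i < 9 \<Longrightarrow> L2_norm (pr x i) \<le> C"
  shows "norm x \<le> 16 * C"
  unfolding norm_state_def by (rule profile_norm_le) (use assms in auto)

lemma bounded_linear_eval: "bounded_linear (\<lambda>x. pr x i t)"
  by (rule bounded_linear_intro[where K=1]) (simp_all add: pr_ops state_sup_le)

section \<open>Completeness of the space of states\<close>

lemma L2_Fatou:
  assumes f: "\<And>n. f n \<in> L2" and lim: "\<And>x. (\<lambda>n. f n x) \<longlonglongrightarrow> g x" and b: "\<And>n. L2_norm (f n) \<le> C"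
  shows "g \<in> L2" "L2_norm g \<le> C"
proof -
  have C: "0 \<le> C" using L2_norm_nonneg[of "f 0"] b[of 0] by linarith
  have mg[measurable]: "g \<in> borel_measurable borel"
    by (rule borel_measurable_LIMSEQ_real[OF lim L2_measurable[OF f]])
  have [measurable]: "f n \<in> borel_measurable borel" for n by (rule L2_measurable[OF f])
  have "(\<integral>\<^sup>+x. ennreal ((g x)\<^sup>2) \<partial>lborel) = (\<integral>\<^sup>+x. liminf (\<lambda>n. ennreal ((f n x)\<^sup>2)) \<partial>lborel)"
  proof (rule nn_integral_cong)
    fix x
    have "(\<lambda>n. ennreal ((f n x)\<^sup>2)) \<longlonglongrightarrow> ennreal ((g x)\<^sup>2)" by (intro tendsto_ennrealI tendsto_power lim)
    then show "ennreal ((g x)\<^sup>2) = liminf (\<lambda>n. ennreal ((f n x)\<^sup>2))"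
      by (rule lim_imp_Liminf[OF trivial_limit_sequentially, symmetric])
  qed
  also have "\<dots> \<le> liminf (\<lambda>n. \<integral>\<^sup>+x. ennreal ((f n x)\<^sup>2) \<partial>lborel)"
    by (rule nn_integral_liminf) simp
  also have "\<dots> \<le> ennreal (C\<^sup>2)"
  proof -
    have "(\<integral>\<^sup>+x. ennreal ((f n x)\<^sup>2) \<partial>lborel) = ennreal ((L2_norm (f n))\<^sup>2)" for n
      unfolding L2_norm_sq by (rule nn_integral_eq_integral) (simp_all add: L2_bounded_intro f)
    moreover have "ennreal ((L2_norm (f n))\<^sup>2) \<le> ennreal (C\<^sup>2)" for n
      by (intro ennreal_leI power_mono b L2_norm_nonneg)
    ultimately have "liminf (\<lambda>n. \<integral>\<^sup>+x. ennreal ((f n x)\<^sup>2) \<partial>lborel) \<le> liminf (\<lambda>n. ennreal (C\<^sup>2))"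
      by (intro Liminf_mono always_eventually) simp
    then show ?thesis by (simp add: Liminf_const)
  qed
  finally have N: "(\<integral>\<^sup>+x. ennreal ((g x)\<^sup>2) \<partial>lborel) \<le> ennreal (C\<^sup>2)" .
  have i: "integrable lborel (\<lambda>x. (g x)\<^sup>2)"
  proof (rule integrableI_bounded)
    show "(\<integral>\<^sup>+ x. ennreal (norm ((g x)\<^sup>2)) \<partial>lborel) < \<infinity>"
      using order.strict_trans1[OF N ennreal_less_top] by simp
  qed simp
  then show "g \<in> L2" unfolding L2_def by simp
  have "ennreal (LINT x|lborel. (g x)\<^sup>2) \<le> ennreal (C\<^sup>2)"
    using N by (subst nn_integral_eq_integral[OF i, symmetric]) simp_all
  then have "(L2_norm g)\<^sup>2 \<le> C\<^sup>2" unfolding L2_norm_sq by simp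
  then show "L2_norm g \<le> C" by (rule power2_le_imp_le) (rule C)
qed

lemma primitive_limit:
  assumes P: "\<And>n. primitive (F n) (f n)" and F: "\<And>x. (\<lambda>n. F n x) \<longlonglongrightarrow> G x"
    and u: "\<And>e. e > 0 \<Longrightarrow> \<exists>N. \<forall>n\<ge>N. \<forall>x. \<bar>f n x - g x\<bar> \<le> e" and g: "bounded_borel g"
  shows "primitive G g"
  unfolding primitive_def
proof (intro conjI allI impI g)
  fix a b :: real assume ab: "a \<le> b"
  have "(\<lambda>n. (LINT x:{a<..b}|lborel. f n x)) \<longlonglongrightarrow> (LINT x:{a<..b}|lborel. g x)"
  proof (rule LIMSEQ_I)
    fix r :: real assume r: "r > 0"
    define e where "e = r / (2 * (b - a + 1))"
    have e: "e > 0" using r ab unfolding e_def by simp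
    obtain N where N: "\<And>n x. n \<ge> N \<Longrightarrow> \<bar>f n x - g x\<bar> \<le> e" using u[OF e] by blast
    show "\<exists>N. \<forall>n\<ge>N. norm ((LINT x:{a<..b}|lborel. f n x) - (LINT x:{a<..b}|lborel. g x)) < r"
    proof (intro exI[of _ N] allI impI)
      fix n assume n: "n \<ge> N"
      have "(LINT x:{a<..b}|lborel. f n x) - (LINT x:{a<..b}|lborel. g x) = (LINT x:{a<..b}|lborel. f n x - g x)"
        by (rule set_integral_diff(2)[symmetric]) (intro bounded_borel_set_integrable g primitiveD(1)[OF P])+
      also have "\<bar>\<dots>\<bar> \<le> e * (b - a)"
        by (rule set_integral_bound[OF _ N[OF n] ab])
           (intro borel_measurable_diff primitiveD(2)[OF P] bounded_borel_measurable g)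
      also have "\<dots> \<le> e * (b - a + 1)" using e by (intro mult_left_mono) auto
      also have "\<dots> = r / 2" using ab unfolding e_def by (simp add: field_simps)
      also have "\<dots> < r" using r by simp
      finally show "norm ((LINT x:{a<..b}|lborel. f n x) - (LINT x:{a<..b}|lborel. g x)) < r" by simp
    qed
  qed
  moreover have "(\<lambda>n. F n b - F n a) \<longlonglongrightarrow> G b - G a" by (intro tendsto_diff F)
  ultimately show "G b - G a = (LINT x:{a<..b}|lborel. g x)"
    unfolding primitiveD(3)[OF P ab] by (rule LIMSEQ_unique[rotated])
qed

instance state :: banach
proof
  fix X :: "nat \<Rightarrow> state" assume X: "Cauchy X"
  define a where "a = (\<lambda>i t. lim (\<lambda>n. pr (X n) i t))"
  have conv: "(\<lambda>n. pr (X n) i t) \<longlonglongrightarrow> a i t" for i t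
    unfolding a_def using bounded_linear.Cauchy[OF bounded_linear_eval X]
    by (simp add: convergent_LIMSEQ_iff[symmetric] Cauchy_convergent_iff)
  have close: "\<exists>N. \<forall>n\<ge>N. (\<forall>i t. \<bar>pr (X n) i t - a i t\<bar> \<le> e) \<and>
      (\<forall>i. 2 \<le> i \<and> i < 9 \<longrightarrow> (\<lambda>t. pr (X n) i t - a i t) \<in> L2 \<and> L2_norm (\<lambda>t. pr (X n) i t - a i t) \<le> e)"
    if e: "e > 0" for e
  proof -
    obtain N where N: "\<And>m n. m \<ge> N \<Longrightarrow> n \<ge> N \<Longrightarrow> norm (X m - X n) < e"
      using X e unfolding Cauchy_iff by blast
    show ?thesis
    proof (intro exI[of _ N] allI impI conjI)
      fix n i t assume n: "n \<ge> N"
      have "(\<lambda>m. \<bar>pr (X n) i t - pr (X m) i t\<bar>) \<longlonglongrightarrow> \<bar>pr (X n) i t - a i t\<bar>"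
        by (intro tendsto_intros conv)
      moreover have "\<forall>m\<ge>N. \<bar>pr (X n) i t - pr (X m) i t\<bar> \<le> e"
        using state_sup_le[of "X n - X _" i t] N[OF n] unfolding pr_diff by (meson less_imp_le order_trans)
      ultimately show "\<bar>pr (X n) i t - a i t\<bar> \<le> e" by (intro LIMSEQ_le_const2) auto
    next
      fix n i assume n: "n \<ge> N" and i: "2 \<le> i \<and> i < (9::nat)"
      \<comment> \<open>The shift by N makes the bound e valid for every member of the sequence, as
        \<open>L2_Fatou\<close> asks.\<close>
      have lim: "(\<lambda>m. pr (X n) i t - pr (X (m + N)) i t) \<longlonglongrightarrow> pr (X n) i t - a i t" for t
        by (intro tendsto_intros LIMSEQ_ignore_initial_segment conv)
      have L: "(\<lambda>t. pr (X n) i t - pr (X (m + N)) i t) \<in> L2" for m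
        using i by (intro L2_diff prD) auto
      have le: "L2_norm (\<lambda>t. pr (X n) i t - pr (X (m + N)) i t) \<le> e" for m
        using state_L2_le[of i "X n - X (m + N)"] N[OF n, of "m + N"] i unfolding pr_diff by simp
      show "(\<lambda>t. pr (X n) i t - a i t) \<in> L2" by (rule L2_Fatou(1)[OF L lim le])
      show "L2_norm (\<lambda>t. pr (X n) i t - a i t) \<le> e" by (rule L2_Fatou(2)[OF L lim le])
    qed
  qed
  have ba: "bounded_borel (a i)" for i
  proof -
    obtain N where N: "\<And>n i t. n \<ge> N \<Longrightarrow> \<bar>pr (X n) i t - a i t\<bar> \<le> 1" using close[OF zero_less_one] by blast
    have "\<bar>a i t\<bar> \<le> norm (X N) + 1" for t
      using N[OF order_refl, of i t] state_sup_le[of "X N" i t] by linarith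
    moreover have "a i \<in> borel_measurable borel"
      by (rule borel_measurable_LIMSEQ_real[OF conv bounded_borel_measurable[OF prD(1)]])
    ultimately show ?thesis by (intro bounded_borelI)
  qed
  have adm: "admissible a"
    unfolding admissible_def
  proof (intro conjI allI impI ba)
    fix i assume i: "2 \<le> i \<and> i < (9::nat)"
    obtain N where N: "(\<lambda>t. pr (X N) i t - a i t) \<in> L2" using close[OF zero_less_one] i by blast
    have "(\<lambda>t. pr (X N) i t - (pr (X N) i t - a i t)) \<in> L2"
      by (rule L2_diff[OF prD(2) N]) (use i in auto)
    then show "a i \<in> L2" by simp
  next
    fix i assume i: "i < (4::nat)"
    show "primitive (a i) (a (i + 4))"
    proof (rule primitive_limit[OF prD(3)[OF i] conv _ ba])
      show "\<exists>N. \<forall>n\<ge>N. \<forall>x. \<bar>pr (X n) (i + 4) x - a (i + 4) x\<bar> \<le> e" if "e > 0" for e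
        using close[OF that] by blast
    qed
  next
    fix i assume "(9::nat) \<le> i"
    then have "(\<lambda>n. 0) \<longlonglongrightarrow> a i t" for t using conv[of i t] by (simp add: prD(4))
    then show "a i = (\<lambda>x. 0)" by (auto simp: LIMSEQ_const_iff)
  qed
  have "X \<longlonglongrightarrow> Abs_state a"
  proof (rule LIMSEQ_I)
    fix r :: real assume r: "r > 0"
    \<comment> \<open>The factor 16 of \<open>state_norm_le\<close> turns r / 32 into r / 2, which
      is below r.\<close>
    obtain N where N: "\<And>n i t. n \<ge> N \<Longrightarrow> \<bar>pr (X n) i t - a i t\<bar> \<le> r / 32"
      "\<And>n i. n \<ge> N \<Longrightarrow> 2 \<le> i \<Longrightarrow> i < 9 \<Longrightarrow> L2_norm (\<lambda>t. pr (X n) i t - a i t) \<le> r / 32"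
    proof -
      have "r / 32 > 0" using r by simp
      from close[OF this] show ?thesis using that by blast
    qed
    have "norm (X n - Abs_state a) \<le> 16 * (r / 32)" if "n \<ge> N" for n
      by (rule state_norm_le) (use N that in \<open>auto simp: pr_diff pr_Abs[OF adm]\<close>)
    then show "\<exists>N. \<forall>n\<ge>N. norm (X n - Abs_state a) < r"
      using r by (intro exI[of _ N]) fastforce
  qed
  then show "convergent X" by (rule convergentI)
qed

section \<open>The vector field on states\<close>

lemma lip_profiles_state: "lip_profiles {x. norm x \<le> M} dist pr"
proof -
  interpret lip_space "{x::state. norm x \<le> M}" dist by unfold_locales simp
  have LB': "LB top (\<lambda>X. pr X i)" for i
  proof (rule LB_I[of _ "\<bar>M\<bar>" 1])
    show "\<forall>\<^sub>F t in top. \<bar>pr x i t\<bar> \<le> \<bar>M\<bar>" if "x \<in> {x. norm x \<le> M}" for x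
      using order_trans[OF state_sup_le[of x i]] that by auto
    show "\<forall>\<^sub>F t in top. \<bar>pr x i t - pr y i t\<bar> \<le> 1 * dist x y" for x y
      using state_sup_le[of "x - y" i] by (simp add: pr_diff dist_norm)
  qed (auto intro: bounded_borel_measurable prD)
  show ?thesis
  proof
    show "LB top (\<lambda>X. pr X i)" "LB (ae_filter lborel) (\<lambda>X. pr X 8)" for i using LB' LB_AE by auto
    show "LS (\<lambda>X. pr X i)" if i: "2 \<le> i" "i < 9" for i
    proof (rule LS_I[of _ "\<bar>M\<bar>" 1])
      show "L2_norm (pr x i) \<le> \<bar>M\<bar>" if "x \<in> {x. norm x \<le> M}" for x
        using order_trans[OF state_L2_le[OF i, of x]] that by auto
      show "L2_norm (\<lambda>t. pr x i t - pr y i t) \<le> 1 * dist x y" for x y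
        using state_L2_le[OF i, of "x - y"] by (simp add: pr_diff dist_norm)
    qed (use i prD in auto)
  qed
qed

lemma lip_profiles_state_strong: "lip_space.LB {x. norm x \<le> M} dist top (\<lambda>X. pr X i)"
proof -
  interpret lip_space "{x::state. norm x \<le> M}" dist by unfold_locales simp
  show ?thesis
  proof (rule LB_I[of _ "\<bar>M\<bar>" 1])
    show "\<forall>\<^sub>F t in top. \<bar>pr x i t\<bar> \<le> \<bar>M\<bar>" if "x \<in> {x. norm x \<le> M}" for x
      using order_trans[OF state_sup_le[of x i]] that by auto
    show "\<forall>\<^sub>F t in top. \<bar>pr x i t - pr y i t\<bar> \<le> 1 * dist x y" for x y
      using state_sup_le[of "x - y" i] by (simp add: pr_diff dist_norm)
  qed (auto intro: bounded_borel_measurable prD)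
qed

lemma src_admissible:
  assumes "admissible a"
  shows "src1 a \<in> L2" "src2 a \<in> L2" "src3 a \<in> L2" "bounded_borel (src1 a)" "bounded_borel (src2 a)" "bounded_borel (src3 a)"
proof -
  \<comment> \<open>The radius is taken so that the state of \<open>a\<close> itself lies in the
    ball.\<close>
  interpret lip_profiles "{x. norm x \<le> norm (Abs_state a)}" dist pr by (rule lip_profiles_state)
  show "src1 a \<in> L2" "src2 a \<in> L2" "src3 a \<in> L2"
    using LS_src[THEN LS_L2, of "Abs_state a"] by (simp_all add: pr_Abs assms)
  show "bounded_borel (src1 a)" "bounded_borel (src2 a)" "bounded_borel (src3 a)"
    unfolding src1_def[abs_def] src2_def[abs_def] src3_def[abs_def]
    by (intro bounded_borel_intros admissibleD[OF assms])+
qed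

lemma PQ_primitive:
  assumes a: "admissible a"
  shows "primitive (pP1 a) (\<lambda>x. pQ1 a x * (1 + a 4 x))" "primitive (pP2 a) (\<lambda>x. pQ2 a x * (1 + a 4 x))"
    "primitive (pP3 a) (\<lambda>x. pQ3 a x * (1 + a 4 x))"
    "primitive (pQ1 a) (\<lambda>x. pP1 a x * (1 + a 4 x) - 1/2 * src1 a x)"
    "primitive (pQ2 a) (\<lambda>x. pP2 a x * (1 + a 4 x) - src2 a x)"
    "primitive (pQ3 a) (\<lambda>x. pP3 a x * (1 + a 4 x) - src3 a x)"
proof -
  have z: "primitive (a 0) (a 4)" using admissibleD(3)[OF a, of 0] by simp
  note b = sup_norm_upper[OF admissibleD(1)[OF a, of 0]]
  note s = src_admissible[OF a]
  note P = kernel_op_ker_primitive[OF z b] and Q = kernel_op_sker_primitive[OF z b]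
  show "primitive (pP1 a) (\<lambda>x. pQ1 a x * (1 + a 4 x))"
    unfolding pP1_def[abs_def] by (rule primitive_cong[OF primitive_cmult[OF P[OF s(1)], of "1/4"]]) (simp add: pQ1_def algebra_simps)
  show "primitive (pP2 a) (\<lambda>x. pQ2 a x * (1 + a 4 x))"
    unfolding pP2_def[abs_def] by (rule primitive_cong[OF primitive_cmult[OF P[OF s(2)], of "1/2"]]) (simp add: pQ2_def algebra_simps)
  show "primitive (pP3 a) (\<lambda>x. pQ3 a x * (1 + a 4 x))"
    unfolding pP3_def[abs_def] by (rule primitive_cong[OF primitive_cmult[OF P[OF s(3)], of "1/2"]]) (simp add: pQ3_def algebra_simps)
  show "primitive (pQ1 a) (\<lambda>x. pP1 a x * (1 + a 4 x) - 1/2 * src1 a x)"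
    unfolding pQ1_def[abs_def]
    by (rule primitive_cong[OF primitive_cmult[OF Q[OF s(1) s(4)], of "- 1/4"]]) (simp add: pP1_def algebra_simps)
  show "primitive (pQ2 a) (\<lambda>x. pP2 a x * (1 + a 4 x) - src2 a x)"
    unfolding pQ2_def[abs_def]
    by (rule primitive_cong[OF primitive_cmult[OF Q[OF s(2) s(5)], of "- 1/2"]]) (simp add: pP2_def algebra_simps)
  show "primitive (pQ3 a) (\<lambda>x. pP3 a x * (1 + a 4 x) - src3 a x)"
    unfolding pQ3_def[abs_def]
    by (rule primitive_cong[OF primitive_cmult[OF Q[OF s(3) s(6)], of "- 1/2"]]) (simp add: pP3_def algebra_simps)
qed

lemma primitive_cube:
  assumes F: "primitive F f" and b: "bounded_borel F"
  shows "primitive (\<lambda>x. (F x) ^ 3) (\<lambda>x. 3 * (F x)\<^sup>2 * f x)"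
proof -
  have "primitive (\<lambda>x. F x * (F x * F x)) (\<lambda>x. f x * (F x * F x) + F x * (f x * F x + F x * f x))"
    by (intro primitive_mult F b bounded_borel_mult)
  moreover have "(\<lambda>x. F x * (F x * F x)) = (\<lambda>x. (F x) ^ 3)" by (simp add: power3_eq_cube mult.assoc)
  ultimately have "primitive (\<lambda>x. (F x) ^ 3) (\<lambda>x. f x * (F x * F x) + F x * (f x * F x + F x * f x))" by simp
  then show ?thesis by (rule primitive_cong) (simp add: power2_eq_square algebra_simps)
qed

lemma PQ_bounded:
  assumes a: "admissible a"
  shows "bounded_borel (pP1 a)" "bounded_borel (pP2 a)" "bounded_borel (pP3 a)"
    "bounded_borel (pQ1 a)" "bounded_borel (pQ2 a)" "bounded_borel (pQ3 a)"
proof -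
  note b = sup_norm_upper[OF admissibleD(1)[OF a, of 0]]
  note k = exp_kernel_ker[OF bounded_borel_measurable[OF admissibleD(1)[OF a, of 0]] b]
  have *: "bounded_borel (kernel_op (ker (a 0)) f)" "bounded_borel (kernel_op (sker (a 0)) f)" if "f \<in> L2" for f
    by (rule bounded_borelI[OF kernel_op_measurable[OF k(1) L2_measurable[OF that]] kernel_op_sup_le[OF k(1) that]])
       (rule bounded_borelI[OF kernel_op_measurable[OF k(2) L2_measurable[OF that]] kernel_op_sup_le[OF k(2) that]])
  show "bounded_borel (pP1 a)" "bounded_borel (pP2 a)" "bounded_borel (pP3 a)"
    "bounded_borel (pQ1 a)" "bounded_borel (pQ2 a)" "bounded_borel (pQ3 a)"
    unfolding pP1_def[abs_def] pP2_def[abs_def] pP3_def[abs_def] pQ1_def[abs_def] pQ2_def[abs_def] pQ3_def[abs_def]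
    by (intro bounded_borel_mult bounded_borel_const * src_admissible[OF a])+
qed

text \<open>Confirms the formulas of rows 4 to 7: the relation between a function and its derivative
  survives the vector field, which therefore maps \<open>state\<close> into itself.\<close>

lemma rhs_primitive:
  assumes a: "admissible a" and i: "i < 4"
  shows "primitive (rhs a i) (rhs a (i + 4))"
proof -
  have U: "primitive (a 2) (a 6)" and G: "primitive (a 3) (a 7)"
    using admissibleD(3)[OF a, of 2] admissibleD(3)[OF a, of 3] by simp_all
  note b = admissibleD(1)[OF a] PQ_bounded[OF a]
  note P = PQ_primitive[OF a]
  consider "i = 0" | "i = 1" | "i = 2" | "i = 3" using i by linarith
  then show ?thesis
  proof cases
    case 1
    then show ?thesis using U by (simp add: rhs_simps)
  next
    case 2
    have "primitive (\<lambda>x. (a 2 x) ^ 3 - 2 * (pP1 a x * a 2 x) - 2 * (pP2 a x * a 3 x) - 2 * (pQ3 a x * a 3 x))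
      (\<lambda>x. 3 * (a 2 x)\<^sup>2 * a 6 x - 2 * (pQ1 a x * (1 + a 4 x) * a 2 x + pP1 a x * a 6 x)
        - 2 * (pQ2 a x * (1 + a 4 x) * a 3 x + pP2 a x * a 7 x)
        - 2 * ((pP3 a x * (1 + a 4 x) - src3 a x) * a 3 x + pQ3 a x * a 7 x))"
      by (intro primitive_diff primitive_cmult primitive_cube primitive_mult U G b P)
    then show ?thesis unfolding 2 by (simp add: rhs_simps mult.assoc del: One_nat_def)
  next
    case 3
    show ?thesis unfolding 3 using primitive_cong[OF primitive_cmult[OF P(4), of "-1"], of "rhs a 6"]
      by (simp add: rhs_simps)
  next
    case 4
    show ?thesis unfolding 4 using primitive_cong[OF primitive_diff[OF primitive_cmult[OF P(5), of "-1"] P(3)], of "rhs a 7"]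
      by (simp add: rhs_simps)
  qed
qed

lemma rhs_admissible:
  assumes a: "admissible a"
  shows "admissible (rhs a)"
proof -
  define x where "x = Abs_state a"
  have px: "pr x = a" unfolding x_def by (rule pr_Abs[OF a])
  interpret lip_profiles "{y. norm y \<le> norm x}" dist pr by (rule lip_profiles_state)
  have b: "bounded_borel (rhs a i)" for i
  proof (cases "i < 9")
    case True
    have "LB top (\<lambda>X. rhs (pr X) i)"
      by (rule rhs_LB_strong[OF lip_profiles_state_strong True])
    note L = this
    obtain C where "\<And>X. X \<in> {y. norm y \<le> norm x} \<Longrightarrow> \<forall>\<^sub>F t in top. \<bar>rhs (pr X) i t\<bar> \<le> C"
      by (rule LB_E[OF L], rule that)
    from this[of x] LB_measurable[OF L, of x] show ?thesis
      unfolding px by (intro bounded_borelI[of _ C]) auto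
  qed (simp add: rhs_simps bounded_borel_const)
  have "rhs a i \<in> L2" if "2 \<le> i" "i < 9" for i
    using LS_L2[OF rhs_LS[OF that], of x] px by simp
  then show ?thesis
    unfolding admissible_def using b rhs_primitive[OF a] by (auto simp: rhs_simps)
qed

definition vf :: "state \<Rightarrow> state" where "vf x = Abs_state (rhs (pr x))"

lemma pr_vf: "pr (vf x) = rhs (pr x)"
  unfolding vf_def by (rule pr_Abs[OF rhs_admissible[OF admissible_pr]])

lemma vf_lipschitz: "\<exists>L. \<forall>x y. norm x \<le> M \<longrightarrow> norm y \<le> M \<longrightarrow> norm (vf x - vf y) \<le> L * norm (x - y)"
proof -
  interpret lip_profiles "{y. norm y \<le> M}" dist pr by (rule lip_profiles_state)
  have "\<exists>C\<ge>0. \<forall>x y t. norm x \<le> M \<longrightarrow> norm y \<le> M \<longrightarrow> \<bar>rhs (pr x) i t - rhs (pr y) i t\<bar> \<le> C * dist x y" if "i < 9" for i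
    using rhs_LB_strong[OF lip_profiles_state_strong that] unfolding LB_def by auto
  then obtain C where C: "\<And>i. i < 9 \<Longrightarrow> 0 \<le> C i"
    "\<And>i x y t. i < 9 \<Longrightarrow> norm x \<le> M \<Longrightarrow> norm y \<le> M \<Longrightarrow> \<bar>rhs (pr x) i t - rhs (pr y) i t\<bar> \<le> C i * dist x y"
    by metis
  have "\<exists>C\<ge>0. \<forall>x y. norm x \<le> M \<longrightarrow> norm y \<le> M \<longrightarrow> L2_norm (\<lambda>t. rhs (pr x) i t - rhs (pr y) i t) \<le> C * dist x y"
    if "2 \<le> i" "i < 9" for i
    using rhs_LS[OF that] unfolding LS_def by auto
  then obtain C' where C': "\<And>i. 2 \<le> i \<Longrightarrow> i < 9 \<Longrightarrow> 0 \<le> C' i"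
    "\<And>i x y. 2 \<le> i \<Longrightarrow> i < 9 \<Longrightarrow> norm x \<le> M \<Longrightarrow> norm y \<le> M \<Longrightarrow>
       L2_norm (\<lambda>t. rhs (pr x) i t - rhs (pr y) i t) \<le> C' i * dist x y"
    by metis
  define K where "K = (\<Sum>i<9. C i) + (\<Sum>i=2..<9. C' i)"
  have K1: "C i \<le> K" if "i < 9" for i
  proof -
    have "C i \<le> (\<Sum>i<9. C i)" using that C(1) by (intro member_le_sum) auto
    moreover have "0 \<le> (\<Sum>i=2..<9. C' i)" using C'(1) by (intro sum_nonneg) auto
    ultimately show ?thesis unfolding K_def by linarith
  qed
  have K2: "C' i \<le> K" if "2 \<le> i" "i < 9" for i
  proof -
    have "C' i \<le> (\<Sum>i=2..<9. C' i)" using that C'(1) by (intro member_le_sum) auto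
    moreover have "0 \<le> (\<Sum>i<9. C i)" using C(1) by (intro sum_nonneg) auto
    ultimately show ?thesis unfolding K_def by linarith
  qed
  have "norm (vf x - vf y) \<le> (16 * K) * norm (x - y)" if xy: "norm x \<le> M" "norm y \<le> M" for x y
  proof -
    have "norm (vf x - vf y) \<le> 16 * (K * dist x y)"
    proof (rule state_norm_le)
      show "\<bar>pr (vf x - vf y) i t\<bar> \<le> K * dist x y" if "i < 9" for i t
        using order_trans[OF C(2)[OF that xy] mult_right_mono[OF K1[OF that] zero_le_dist]] by (simp add: pr_diff pr_vf)
      show "L2_norm (pr (vf x - vf y) i) \<le> K * dist x y" if "2 \<le> i" "i < 9" for i
        using order_trans[OF C'(2)[OF that xy] mult_right_mono[OF K2[OF that] zero_le_dist]] by (simp add: pr_diff pr_vf)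
    qed
    then show ?thesis by (simp add: dist_norm)
  qed
  then show ?thesis by blast
qed

section \<open>Conserved constraints along solutions\<close>

text \<open>Conditions (2) to (4) of \<open>G_set\<close> at every point instead of almost every
  point; condition (1) is already contained in admissibility.\<close>

definition good :: "profile \<Rightarrow> bool" where
  "good a \<longleftrightarrow>
     (\<forall>t. 0 \<le> 1 + a 4 t \<and> 0 \<le> a 5 t \<and> 0 < 1 + a 4 t + a 5 t) \<and> (a 1 \<longlongrightarrow> 0) at_bot \<and>
     (\<forall>t. a 8 t * (1 + a 4 t) = a 7 t) \<and>
     (\<forall>t. (1 + a 4 t) * a 5 t = (1 + a 4 t)\<^sup>2 * ((a 2 t)\<^sup>2 + (a 3 t)\<^sup>2 + (a 8 t)\<^sup>2) + (a 6 t)\<^sup>2)"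

lemma bounded_PQ_state:
  "\<exists>B. \<forall>x t. norm x \<le> N \<longrightarrow> \<bar>pP1 (pr x) t\<bar> \<le> B \<and> \<bar>pP2 (pr x) t\<bar> \<le> B \<and> \<bar>pP3 (pr x) t\<bar> \<le> B \<and>
     \<bar>pQ1 (pr x) t\<bar> \<le> B \<and> \<bar>pQ2 (pr x) t\<bar> \<le> B \<and> \<bar>pQ3 (pr x) t\<bar> \<le> B"
proof -
  interpret lip_profiles "{x. norm x \<le> N}" dist pr by (rule lip_profiles_state)
  have *: "\<exists>C. \<forall>x t. norm x \<le> N \<longrightarrow> \<bar>f x t\<bar> \<le> C" if L: "LB top f" for f :: "state \<Rightarrow> real \<Rightarrow> real"
  proof -
    obtain C where "\<And>X. X \<in> {x. norm x \<le> N} \<Longrightarrow> \<forall>\<^sub>F t in top. \<bar>f X t\<bar> \<le> C" by (rule LB_E[OF L], rule that)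
    then show ?thesis by (intro exI[of _ C]) simp
  qed
  obtain B1 B2 B3 B4 B5 B6 where B: "\<And>x t. norm x \<le> N \<Longrightarrow> \<bar>pP1 (pr x) t\<bar> \<le> B1"
    "\<And>x t. norm x \<le> N \<Longrightarrow> \<bar>pP2 (pr x) t\<bar> \<le> B2" "\<And>x t. norm x \<le> N \<Longrightarrow> \<bar>pP3 (pr x) t\<bar> \<le> B3"
    "\<And>x t. norm x \<le> N \<Longrightarrow> \<bar>pQ1 (pr x) t\<bar> \<le> B4" "\<And>x t. norm x \<le> N \<Longrightarrow> \<bar>pQ2 (pr x) t\<bar> \<le> B5"
    "\<And>x t. norm x \<le> N \<Longrightarrow> \<bar>pQ3 (pr x) t\<bar> \<le> B6"
    using *[OF LB_PQ(1)] *[OF LB_PQ(2)] *[OF LB_PQ(3)] *[OF LB_PQ(4)] *[OF LB_PQ(5)] *[OF LB_PQ(6)] by blast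
  define B where "B = max B1 (max B2 (max B3 (max B4 (max B5 B6))))"
  have "B1 \<le> B" "B2 \<le> B" "B3 \<le> B" "B4 \<le> B" "B5 \<le> B" "B6 \<le> B" unfolding B_def by auto
  then show ?thesis using B by (meson order_trans)
qed

lemma L2_bounded_mult:
  assumes "bounded_borel f" "g \<in> L2"
  shows "(\<lambda>x. f x * g x) \<in> L2"
proof -
  obtain C where C: "C \<ge> 0" "\<And>x. \<bar>f x\<bar> \<le> C" using bounded_borelE[OF assms(1)] by metis
  show ?thesis
    by (rule L2_domI(1)[OF assms(2) _ _ C(1)])
       (auto intro!: AE_I2 mult_right_mono C borel_measurable_times bounded_borel_measurable[OF assms(1)]
         L2_measurable[OF assms(2)] simp: abs_mult)
qed

lemma rhs_H_L2:
  assumes a: "admissible a"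
  shows "rhs a 1 \<in> L2"
proof -
  note b = admissibleD(1)[OF a] PQ_bounded[OF a]
  have L: "a 2 \<in> L2" "a 3 \<in> L2" using admissibleD(2)[OF a] by simp_all
  have "(\<lambda>x. (a 2 x)\<^sup>2 * a 2 x - (2 * pP1 a x) * a 2 x - (2 * pP2 a x) * a 3 x - (2 * pQ3 a x) * a 3 x) \<in> L2"
    by (intro L2_diff L2_bounded_mult bounded_borel_intros b L)
  then show ?thesis by (simp add: rhs_simps power2_eq_square power3_eq_cube del: One_nat_def)
qed

text \<open>Every term of H_t carries a factor U or \<Gamma>, so H_t and its derivative are square
  integrable. Vanishing at both ends preserves the limit 0 at -infinity and conserves the total
  energy at +infinity.\<close>

lemma rhs_H_decay:
  assumes a: "admissible a" and A: "A = at_top \<or> A = at_bot"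
  shows "(rhs a 1 \<longlongrightarrow> 0) A"
  using primitive_L2_decay[OF rhs_primitive[OF a, of 1] rhs_H_L2[OF a] _ A]
    admissibleD(2)[OF rhs_admissible[OF a], of 5] by simp

lemma primitive_mono:
  assumes F: "primitive F f" and f: "\<And>x. 0 \<le> f x" and ab: "a \<le> b"
  shows "F a \<le> F b"
proof -
  have "0 \<le> (LINT x:{a<..b}|lborel. f x)"
    unfolding set_lebesgue_integral_def by (rule Bochner_Integration.integral_nonneg) (simp add: f)
  then show ?thesis using primitiveD(3)[OF F ab] by simp
qed

locale good_solution =
  fixes x :: "real \<Rightarrow> state" and T :: real
  assumes sol: "ode_on vf x T" and T: "0 \<le> T" and init: "good (pr (x 0))"
begin

abbreviation "a \<equiv> \<lambda>t. pr (x t)"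

lemma comp_deriv:
  assumes "t \<in> {0..T}"
  shows "((\<lambda>s. a s i \<xi>) has_real_derivative rhs (a t) i \<xi>) (at t within {0..T})"
proof -
  have "(x has_vector_derivative vf (x t)) (at t within {0..T})" using sol assms unfolding ode_on_def by blast
  then have "((\<lambda>s. a s i \<xi>) has_vector_derivative pr (vf (x t)) i \<xi>) (at t within {0..T})"
    by (rule bounded_linear.has_vector_derivative[OF bounded_linear_eval])
  then show ?thesis by (simp add: pr_vf has_real_derivative_iff_has_vector_derivative)
qed

lemma comp_cont: "continuous_on {0..T} (\<lambda>s. a s i \<xi>)"
  by (rule DERIV_continuous_on[OF comp_deriv])

lemma const_if_deriv_zero:
  assumes "\<And>t. t \<in> {0..T} \<Longrightarrow> (f has_real_derivative 0) (at t within {0..T})" and t: "t \<in> {0..T}"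
  shows "f t = f 0"
proof -
  obtain c where "\<And>t. t \<in> {0..T} \<Longrightarrow> f t = c"
    using has_field_derivative_zero_constant[of "{0..T}" f] assms(1) by auto
  then show ?thesis using t T by simp
qed

text \<open>In (R y_xi)_t and \<Gamma>_xi,t the terms with P_2 and Q_3 coincide, and the remaining R
  U_xi is precisely the source of Q_2. The difference is thus constant in time at each
  \<xi>.\<close>

lemma Gamma_constraint:
  assumes t: "t \<in> {0..T}"
  shows "a t 8 \<xi> * (1 + a t 4 \<xi>) = a t 7 \<xi>"
proof -
  define f where "f = (\<lambda>s. a s 8 \<xi> * (1 + a s 4 \<xi>) - a s 7 \<xi>)"
  have "(f has_real_derivative 0) (at s within {0..T})" if s: "s \<in> {0..T}" for s
  proof -
    have "(f has_real_derivative (rhs (a s) 8 \<xi> * (1 + a s 4 \<xi>) + a s 8 \<xi> * rhs (a s) 4 \<xi> - rhs (a s) 7 \<xi>)) (at s within {0..T})"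
      unfolding f_def by (rule derivative_eq_intros comp_deriv[OF s] refl | simp)+
    moreover have "rhs (a s) 8 \<xi> * (1 + a s 4 \<xi>) + a s 8 \<xi> * rhs (a s) 4 \<xi> - rhs (a s) 7 \<xi> = 0"
      by (simp add: rhs_simps src2_def algebra_simps)
    ultimately show ?thesis by simp
  qed
  then have "f t = f 0" by (rule const_if_deriv_zero[OF _ t])
  moreover have "f 0 = 0" using init unfolding f_def good_def by simp
  ultimately show ?thesis unfolding f_def by simp
qed

lemma energy_constraint:
  assumes t: "t \<in> {0..T}"
  shows "(1 + a t 4 \<xi>) * a t 5 \<xi> = (1 + a t 4 \<xi>)\<^sup>2 * ((a t 2 \<xi>)\<^sup>2 + (a t 3 \<xi>)\<^sup>2 + (a t 8 \<xi>)\<^sup>2) + (a t 6 \<xi>)\<^sup>2"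
proof -
  define f where "f = (\<lambda>s. (1 + a s 4 \<xi>) * a s 5 \<xi> - (1 + a s 4 \<xi>)\<^sup>2 * ((a s 2 \<xi>)\<^sup>2 + (a s 3 \<xi>)\<^sup>2 + (a s 8 \<xi>)\<^sup>2) - (a s 6 \<xi>)\<^sup>2)"
  have "(f has_real_derivative 0) (at s within {0..T})" if s: "s \<in> {0..T}" for s
  proof -
    have "(f has_real_derivative (rhs (a s) 4 \<xi> * a s 5 \<xi> + (1 + a s 4 \<xi>) * rhs (a s) 5 \<xi>
       - (2 * (1 + a s 4 \<xi>) * rhs (a s) 4 \<xi> * ((a s 2 \<xi>)\<^sup>2 + (a s 3 \<xi>)\<^sup>2 + (a s 8 \<xi>)\<^sup>2)
          + (1 + a s 4 \<xi>)\<^sup>2 * (2 * a s 2 \<xi> * rhs (a s) 2 \<xi> + 2 * a s 3 \<xi> * rhs (a s) 3 \<xi> + 2 * a s 8 \<xi> * rhs (a s) 8 \<xi>))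
       - 2 * a s 6 \<xi> * rhs (a s) 6 \<xi>)) (at s within {0..T})"
      unfolding f_def by (rule derivative_eq_intros comp_deriv[OF s] refl | simp add: algebra_simps)+
    moreover have "rhs (a s) 4 \<xi> * a s 5 \<xi> + (1 + a s 4 \<xi>) * rhs (a s) 5 \<xi>
       - (2 * (1 + a s 4 \<xi>) * rhs (a s) 4 \<xi> * ((a s 2 \<xi>)\<^sup>2 + (a s 3 \<xi>)\<^sup>2 + (a s 8 \<xi>)\<^sup>2)
          + (1 + a s 4 \<xi>)\<^sup>2 * (2 * a s 2 \<xi> * rhs (a s) 2 \<xi> + 2 * a s 3 \<xi> * rhs (a s) 3 \<xi> + 2 * a s 8 \<xi> * rhs (a s) 8 \<xi>))
       - 2 * a s 6 \<xi> * rhs (a s) 6 \<xi> = 0"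
      \<comment> \<open>Writing \<Gamma>_xi as R y_xi makes the terms with P_2 and Q_3 cancel
        against those from R R_t; the rest is a polynomial identity.\<close>
      using Gamma_constraint[OF s, of \<xi>, symmetric]
      by (simp add: rhs_simps src1_def src2_def src3_def power2_eq_square algebra_simps)
    ultimately show ?thesis by simp
  qed
  then have "f t = f 0" by (rule const_if_deriv_zero[OF _ t])
  moreover have "f 0 = 0" using init unfolding f_def good_def by simp
  ultimately show ?thesis unfolding f_def by simp
qed

text \<open>By \<open>r5\<close> and \<open>r6\<close> the triple (y_xi, U_xi, H_xi) solves a
  homogeneous linear ODE in time with bounded coefficients, and a solution that is nonzero at time 0
  cannot reach 0. Quantitatively, e(s) exp(K s) is nondecreasing.\<close>

lemma energy_pos:
  assumes t: "t \<in> {0..T}"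
  shows "0 < (1 + a t 4 \<xi>)\<^sup>2 + (a t 6 \<xi>)\<^sup>2 + (a t 5 \<xi>)\<^sup>2"
proof -
  define Y q h where "Y = (\<lambda>s. 1 + a s 4 \<xi>)" and "q = (\<lambda>s. a s 6 \<xi>)" and "h = (\<lambda>s. a s 5 \<xi>)"
  define e where "e = (\<lambda>s. (Y s)\<^sup>2 + (q s)\<^sup>2 + (h s)\<^sup>2)"
  obtain N where N: "\<And>s. s \<in> {0..T} \<Longrightarrow> norm (x s) \<le> N" using ode_on_bounded[OF sol] by metis
  obtain B0 where B0: "\<And>s \<xi>. s \<in> {0..T} \<Longrightarrow> \<bar>pP1 (a s) \<xi>\<bar> \<le> B0 \<and> \<bar>pP2 (a s) \<xi>\<bar> \<le> B0 \<and> \<bar>pP3 (a s) \<xi>\<bar> \<le> B0 \<and>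
     \<bar>pQ1 (a s) \<xi>\<bar> \<le> B0 \<and> \<bar>pQ2 (a s) \<xi>\<bar> \<le> B0 \<and> \<bar>pQ3 (a s) \<xi>\<bar> \<le> B0"
    using bounded_PQ_state[of N] N by blast
  define B where "B = max 1 (max N B0)"
  have B: "1 \<le> B" "\<And>s i. s \<in> {0..T} \<Longrightarrow> \<bar>a s i \<xi>\<bar> \<le> B"
    "\<And>s. s \<in> {0..T} \<Longrightarrow> \<bar>pP1 (a s) \<xi>\<bar> \<le> B" "\<And>s. s \<in> {0..T} \<Longrightarrow> \<bar>pP2 (a s) \<xi>\<bar> \<le> B"
    "\<And>s. s \<in> {0..T} \<Longrightarrow> \<bar>pP3 (a s) \<xi>\<bar> \<le> B" "\<And>s. s \<in> {0..T} \<Longrightarrow> \<bar>pQ1 (a s) \<xi>\<bar> \<le> B"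
    "\<And>s. s \<in> {0..T} \<Longrightarrow> \<bar>pQ2 (a s) \<xi>\<bar> \<le> B" "\<And>s. s \<in> {0..T} \<Longrightarrow> \<bar>pQ3 (a s) \<xi>\<bar> \<le> B"
    using order_trans[OF state_sup_le N] B0 unfolding B_def by (fastforce simp: le_max_iff_disj)+
  \<comment> \<open>In (e)_t two cross terms have total weight 3/2 and three have weights \<alpha>,
    \<beta>, \<gamma>, each at most 10 B^2 in size; the 10 is the five products with factor 2 in
    \<beta>. K leaves some slack.\<close>
  define K where "K = 2 + 40 * B\<^sup>2"
  have d: "(Y has_real_derivative q s) (at s within {0..T})"
    "(q has_real_derivative rhs (a s) 6 \<xi>) (at s within {0..T})"
    "(h has_real_derivative rhs (a s) 5 \<xi>) (at s within {0..T})" if s: "s \<in> {0..T}" for s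
    using comp_deriv[OF s, of 4 \<xi>] comp_deriv[OF s, of 5 \<xi>] comp_deriv[OF s, of 6 \<xi>]
    unfolding Y_def q_def h_def by (auto intro!: derivative_eq_intros simp: rhs_simps)
  have bound: "- K * e s \<le> 2 * Y s * q s + 2 * q s * rhs (a s) 6 \<xi> + 2 * h s * rhs (a s) 5 \<xi>" if s: "s \<in> {0..T}" for s
  proof -
    have pb: "\<bar>u * v\<bar> \<le> B\<^sup>2" if "\<bar>u\<bar> \<le> B" "\<bar>v\<bar> \<le> B" for u v
      unfolding abs_mult power2_eq_square using that B(1) by (intro mult_mono) auto
    have BB: "B \<le> B\<^sup>2" using B(1) by (simp add: power2_eq_square)
    define \<alpha> where "\<alpha> = 1/2 * (a s 2 \<xi> * a s 2 \<xi>) - a s 8 \<xi> * a s 8 \<xi> - pP1 (a s) \<xi>"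
    define \<beta> where "\<beta> = - 2 * (pQ1 (a s) \<xi> * a s 2 \<xi>) - 2 * (pQ2 (a s) \<xi> * a s 3 \<xi>) - 2 * (pP2 (a s) \<xi> * a s 8 \<xi>)
       - 2 * (pP3 (a s) \<xi> * a s 3 \<xi>) - 2 * (pQ3 (a s) \<xi> * a s 8 \<xi>)"
    define \<gamma> where "\<gamma> = 3 * (a s 2 \<xi> * a s 2 \<xi>) - 2 * pP1 (a s) \<xi> + 2 * (a s 3 \<xi> * a s 3 \<xi>)"
    have abc: "\<bar>\<alpha>\<bar> \<le> 10 * B\<^sup>2" "\<bar>\<beta>\<bar> \<le> 10 * B\<^sup>2" "\<bar>\<gamma>\<bar> \<le> 10 * B\<^sup>2"
      unfolding \<alpha>_def \<beta>_def \<gamma>_def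
      using pb[OF B(2)[OF s, of 2] B(2)[OF s, of 2]] pb[OF B(2)[OF s, of 8] B(2)[OF s, of 8]]
        pb[OF B(2)[OF s, of 3] B(2)[OF s, of 3]] B(3)[OF s] BB
        pb[OF B(6)[OF s] B(2)[OF s, of 2]] pb[OF B(7)[OF s] B(2)[OF s, of 3]] pb[OF B(4)[OF s] B(2)[OF s, of 8]]
        pb[OF B(5)[OF s] B(2)[OF s, of 3]] pb[OF B(8)[OF s] B(2)[OF s, of 8]]
      by (simp_all only: abs_le_iff) linarith+
    have r6: "rhs (a s) 6 \<xi> = \<alpha> * Y s + 1/2 * h s"
      unfolding \<alpha>_def Y_def h_def by (simp add: rhs_simps src1_def power2_eq_square algebra_simps)
    have r5: "rhs (a s) 5 \<xi> = \<beta> * Y s + \<gamma> * q s"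
      unfolding \<beta>_def \<gamma>_def Y_def q_def using Gamma_constraint[OF s, of \<xi>, symmetric]
      by (simp add: rhs_simps src3_def power2_eq_square algebra_simps)
    have two: "\<bar>2 * u * v\<bar> \<le> e s" if "u\<^sup>2 + v\<^sup>2 \<le> e s" for u v
      using sum_squares_bound[of "\<bar>u\<bar>" "\<bar>v\<bar>"] that by (simp add: abs_mult)
    have t1: "\<bar>2 * Y s * q s\<bar> \<le> e s" "\<bar>2 * q s * Y s\<bar> \<le> e s" "\<bar>2 * q s * h s\<bar> \<le> e s"
        "\<bar>2 * h s * Y s\<bar> \<le> e s" "\<bar>2 * h s * q s\<bar> \<le> e s"
      by (rule two, simp add: e_def)+
    have m: "\<bar>c * u\<bar> \<le> 10 * B\<^sup>2 * e s" if "\<bar>c\<bar> \<le> 10 * B\<^sup>2" "\<bar>u\<bar> \<le> e s" for c u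
      unfolding abs_mult using that by (intro mult_mono) auto
    have "2 * Y s * q s + 2 * q s * rhs (a s) 6 \<xi> + 2 * h s * rhs (a s) 5 \<xi>
      = 2 * Y s * q s + \<alpha> * (2 * q s * Y s) + 1/2 * (2 * q s * h s) + \<beta> * (2 * h s * Y s) + \<gamma> * (2 * h s * q s)"
      unfolding r5 r6 by (simp add: algebra_simps)
    moreover have "K * e s = 2 * e s + 4 * (10 * B\<^sup>2 * e s)" unfolding K_def by (simp add: algebra_simps)
    moreover have "0 \<le> e s" "0 \<le> 10 * B\<^sup>2 * e s" unfolding e_def by simp_all
    ultimately show ?thesis
      using t1(1) t1(3) m[OF abc(1) t1(2)] m[OF abc(2) t1(4)] m[OF abc(3) t1(5)] unfolding abs_le_iff by linarith
  qed
  define E where "E = (\<lambda>s. e s * exp (K * s))"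
  have dE: "(E has_real_derivative ((2 * Y s * q s + 2 * q s * rhs (a s) 6 \<xi> + 2 * h s * rhs (a s) 5 \<xi>) + K * e s) * exp (K * s)) (at s within {0..T})"
    if s: "s \<in> {0..T}" for s
    unfolding E_def e_def
    by (rule derivative_eq_intros d[OF s] refl | simp add: algebra_simps)+
  have "E 0 \<le> E t"
  proof (rule DERIV_nonneg_imp_increasing_open[where f=E and a=0 and b=t])
    show "0 \<le> t" using t by simp
    show "continuous_on {0..t} E"
      by (rule continuous_on_subset[OF DERIV_continuous_on[OF dE]]) (use t in auto)
    fix s assume s: "0 < s" "s < t"
    then have sT: "s \<in> {0..T}" "at s within {0..T} = at s" using t by (auto intro: at_within_Icc_at)
    have "0 \<le> ((2 * Y s * q s + 2 * q s * rhs (a s) 6 \<xi> + 2 * h s * rhs (a s) 5 \<xi>) + K * e s) * exp (K * s)"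
      using bound[OF sT(1)] by (intro mult_nonneg_nonneg) auto
    then show "\<exists>y. (E has_real_derivative y) (at s) \<and> 0 \<le> y" using dE[OF sT(1)] unfolding sT(2) by blast
  qed
  moreover have "0 < E 0"
  proof -
    have "0 < Y 0 + h 0" using init unfolding good_def Y_def h_def by simp
    then have "Y 0 \<noteq> 0 \<or> h 0 \<noteq> 0" by auto
    then have "0 < (Y 0)\<^sup>2 \<or> 0 < (h 0)\<^sup>2" by simp
    then have "0 < e 0"
      using zero_le_power2[of "Y 0"] zero_le_power2[of "q 0"] zero_le_power2[of "h 0"] unfolding e_def by linarith
    then show ?thesis unfolding E_def by simp
  qed
  ultimately have "0 < E t" by linarith
  then show ?thesis unfolding E_def e_def Y_def q_def h_def by (simp add: zero_less_mult_iff)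
qed

text \<open>The energy constraint makes \<open>y\<^sub>\<xi> H\<^sub>\<xi>\<close> nonnegative, so \<open>y\<^sub>\<xi> + H\<^sub>\<xi>\<close> could only change sign at a
  common zero of \<open>y\<^sub>\<xi>\<close>, \<open>H\<^sub>\<xi>\<close> and \<open>U\<^sub>\<xi>\<close>, which the linear system for these three excludes.\<close>

lemma signs:
  assumes t: "t \<in> {0..T}"
  shows "0 \<le> 1 + a t 4 \<xi>" "0 \<le> a t 5 \<xi>" "0 < 1 + a t 4 \<xi> + a t 5 \<xi>"
proof -
  have prod: "0 \<le> (1 + a s 4 \<xi>) * a s 5 \<xi>" if "s \<in> {0..T}" for s
    unfolding energy_constraint[OF that] by simp
  have nz: "1 + a s 4 \<xi> + a s 5 \<xi> \<noteq> 0" if s: "s \<in> {0..T}" for s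
  proof
    assume z: "1 + a s 4 \<xi> + a s 5 \<xi> = 0"
    then have h: "a s 5 \<xi> = - (1 + a s 4 \<xi>)" by linarith
    have "(1 + a s 4 \<xi>) * a s 5 \<xi> = - (1 + a s 4 \<xi>)\<^sup>2"
      unfolding h power2_eq_square by (rule mult_minus_right)
    then have "(1 + a s 4 \<xi>)\<^sup>2 \<le> 0" using prod[OF s] by linarith
    then have y: "1 + a s 4 \<xi> = 0" by simp
    then have "a s 5 \<xi> = 0" "a s 6 \<xi> = 0" using h energy_constraint[OF s, of \<xi>] by simp_all
    then show False using energy_pos[OF s, of \<xi>] y by simp
  qed
  show pos: "0 < 1 + a t 4 \<xi> + a t 5 \<xi>"
  proof (rule ccontr)
    assume "\<not> 0 < 1 + a t 4 \<xi> + a t 5 \<xi>"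
    then have "1 + a t 4 \<xi> + a t 5 \<xi> \<le> 0" by simp
    moreover have "0 \<le> 1 + a 0 4 \<xi> + a 0 5 \<xi>" using init unfolding good_def by (simp add: less_imp_le)
    moreover have "continuous_on {0..t} (\<lambda>s. 1 + a s 4 \<xi> + a s 5 \<xi>)"
      by (rule continuous_on_subset[of "{0..T}"]) (intro continuous_intros comp_cont, use t in auto)
    ultimately obtain s where "0 \<le> s" "s \<le> t" "1 + a s 4 \<xi> + a s 5 \<xi> = 0"
      using IVT2'[of "\<lambda>s. 1 + a s 4 \<xi> + a s 5 \<xi>" t 0 0] t by auto
    then show False using nz[of s] t by auto
  qed
  show "0 \<le> 1 + a t 4 \<xi>"
  proof (rule ccontr)
    assume "\<not> 0 \<le> 1 + a t 4 \<xi>"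
    then have "1 + a t 4 \<xi> < 0" "0 < a t 5 \<xi>" using pos by auto
    then show False using prod[OF t] by (simp add: zero_le_mult_iff)
  qed
  show "0 \<le> a t 5 \<xi>"
  proof (rule ccontr)
    assume "\<not> 0 \<le> a t 5 \<xi>"
    then have "a t 5 \<xi> < 0" "0 < 1 + a t 4 \<xi>" using pos by auto
    then show False using prod[OF t] by (simp add: zero_le_mult_iff)
  qed
qed

text \<open>Integrates H_t over [0, t] and lets \<xi> tend to infinity by dominated convergence in
  time, H_t being bounded uniformly along the solution. The sign \<sigma> covers both ends at
  once.\<close>

lemma H_variation_decay:
  assumes t: "t \<in> {0..T}" and \<sigma>: "\<sigma> = 1 \<or> \<sigma> = - 1"
  shows "((\<lambda>\<xi>. a t 1 (\<sigma> * \<xi>) - a 0 1 (\<sigma> * \<xi>)) \<longlongrightarrow> 0) at_top"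
proof -
  obtain N where N: "\<And>s. s \<in> {0..T} \<Longrightarrow> norm (x s) \<le> N" using ode_on_bounded[OF sol] by metis
  interpret lip_profiles "{x. norm x \<le> N}" dist pr by (rule lip_profiles_state)
  obtain C where C: "\<And>s \<xi>. s \<in> {0..T} \<Longrightarrow> \<bar>rhs (a s) 1 \<xi>\<bar> \<le> C"
  proof -
    have L: "LB top (\<lambda>X. rhs (pr X) 1)" by (rule rhs_LB) simp
    obtain C where "\<And>X. X \<in> {x. norm x \<le> N} \<Longrightarrow> \<forall>\<^sub>F t in top. \<bar>rhs (pr X) 1 t\<bar> \<le> C" by (rule LB_E[OF L], rule that)
    then show ?thesis using N that[of C] by simp
  qed
  have cx: "continuous_on {0..T} x" by (rule ode_on_continuous[OF sol])
  have cvf: "continuous_on {0..T} (\<lambda>s. rhs (a s) 1 \<xi>)" for \<xi>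
  proof -
    obtain L where L: "\<And>y z. norm y \<le> N \<Longrightarrow> norm z \<le> N \<Longrightarrow> norm (vf y - vf z) \<le> L * norm (y - z)"
      using vf_lipschitz[of N] by blast
    have "continuous_on (cball 0 N) vf"
    proof (rule lipschitz_on_continuous_on[where L="max 0 L"], rule lipschitz_onI)
      fix y z :: state assume "y \<in> cball 0 N" "z \<in> cball 0 N"
      then have "norm (vf y - vf z) \<le> L * norm (y - z)" by (intro L) auto
      also have "\<dots> \<le> max 0 L * norm (y - z)" by (rule mult_right_mono) auto
      finally show "dist (vf y) (vf z) \<le> max 0 L * dist y z" by (simp add: dist_norm)
    qed simp
    then have "continuous_on {0..T} (\<lambda>s. vf (x s))"
      by (rule continuous_on_compose2[OF _ cx]) (use N in auto)
    then have "continuous_on {0..T} (\<lambda>s. pr (vf (x s)) 1 \<xi>)"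
      by (rule bounded_linear.continuous_on[OF bounded_linear_eval])
    then show ?thesis by (simp add: pr_vf)
  qed
  have t0: "0 \<le> t" "{0..t} \<subseteq> {0..T}" using t by auto
  have eq: "a t 1 \<xi> - a 0 1 \<xi> = (LINT s|lborel. indicator {0..t} s *\<^sub>R rhs (a s) 1 \<xi>)" for \<xi>
  proof (rule has_bochner_integral_integral_eq[symmetric], rule has_bochner_integral_FTC_Icc[OF t0(1)])
    show "((\<lambda>s. a s 1 \<xi>) has_vector_derivative rhs (a s) 1 \<xi>) (at s within {0..t})" if "0 \<le> s" "s \<le> t" for s
      using DERIV_subset[OF comp_deriv t0(2), of s 1 \<xi>] that t by (simp add: has_real_derivative_iff_has_vector_derivative)
    show "continuous_on {0..t} (\<lambda>s. rhs (a s) 1 \<xi>)" by (rule continuous_on_subset[OF cvf t0(2)])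
  qed
  have "((\<lambda>\<xi>. LINT s|lborel. indicator {0..t} s *\<^sub>R rhs (a s) 1 (\<sigma> * \<xi>)) \<longlongrightarrow> (LINT s::real|lborel. (0::real))) at_top"
  proof (rule integral_dominated_convergence_at_top[where w="\<lambda>s. indicator {0..t} s *\<^sub>R C" and f="\<lambda>_. 0"
        and s="\<lambda>\<xi> s. indicator {0..t} s *\<^sub>R rhs (a s) 1 (\<sigma> * \<xi>)"])
    show "(\<lambda>s. indicator {0..t} s *\<^sub>R rhs (a s) 1 (\<sigma> * \<xi>)) \<in> borel_measurable lborel" for \<xi>
      using borel_measurable_continuous_on_indicator[OF _ continuous_on_subset[OF cvf t0(2)], of "\<sigma> * \<xi>"] by simp
    show "integrable lborel (\<lambda>s. indicator {0..t} s *\<^sub>R C)" using t0(1) by simp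
    show "AE s in lborel. ((\<lambda>\<xi>. indicator {0..t} s *\<^sub>R rhs (a s) 1 (\<sigma> * \<xi>)) \<longlongrightarrow> 0) at_top"
    proof (rule AE_I2)
      fix s
      have "((\<lambda>\<xi>. rhs (a s) 1 (\<sigma> * \<xi>)) \<longlongrightarrow> 0) at_top"
        using \<sigma> rhs_H_decay[OF admissible_pr[of "x s"], of at_top] rhs_H_decay[OF admissible_pr[of "x s"], of at_bot]
        by (auto simp: filterlim_at_bot_mirror)
      then have "((\<lambda>\<xi>. indicator {0..t} s *\<^sub>R rhs (a s) 1 (\<sigma> * \<xi>)) \<longlongrightarrow> indicator {0..t} s *\<^sub>R 0) at_top"
        by (rule tendsto_scaleR[OF tendsto_const])
      then show "((\<lambda>\<xi>. indicator {0..t} s *\<^sub>R rhs (a s) 1 (\<sigma> * \<xi>)) \<longlongrightarrow> 0) at_top" by simp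
    qed
    show "\<forall>\<^sub>F \<xi> in at_top. AE s in lborel. norm (indicator {0..t} s *\<^sub>R rhs (a s) 1 (\<sigma> * \<xi>)) \<le> indicator {0..t} s *\<^sub>R C"
      by (intro always_eventually allI AE_I2) (use C t in \<open>auto simp: indicator_def\<close>)
  qed simp
  then show ?thesis unfolding eq by simp
qed

lemma H_limit_bot:
  assumes t: "t \<in> {0..T}"
  shows "(a t 1 \<longlongrightarrow> 0) at_bot"
proof -
  have "((\<lambda>\<xi>. a 0 1 (- \<xi>)) \<longlongrightarrow> 0) at_top" using init unfolding good_def filterlim_at_bot_mirror by simp
  from tendsto_add[OF H_variation_decay[OF t, of "- 1"] this]
  show ?thesis unfolding filterlim_at_bot_mirror by simp
qed

theorem good_preserved:
  assumes t: "t \<in> {0..T}"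
  shows "good (a t)"
  unfolding good_def using signs[OF t] H_limit_bot[OF t] Gamma_constraint[OF t] energy_constraint[OF t] by simp

text \<open>H(t) is nondecreasing in \<xi>. From below it is compared with its limit at -infinity;
  from above, H(t, \<xi>) \<le> M + (H(t, \<eta>) - H(0, \<eta>)) for \<eta> \<ge> \<xi>, and the
  bracket tends to 0.\<close>

lemma H_range:
  assumes t: "t \<in> {0..T}" and h: "\<And>\<xi>. a 0 1 \<xi> \<le> M"
  shows "0 \<le> a t 1 \<xi>" "a t 1 \<xi> \<le> M"
proof -
  have P: "primitive (a t 1) (a t 5)" using prD(3)[of 1 "x t"] by simp
  have mono: "a t 1 \<eta> \<le> a t 1 \<eta>'" if "\<eta> \<le> \<eta>'" for \<eta> \<eta>'
    by (rule primitive_mono[OF P signs(2)[OF t] that])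
  show "0 \<le> a t 1 \<xi>"
  proof (rule tendsto_upperbound[OF H_limit_bot[OF t]])
    show "\<forall>\<^sub>F \<eta> in at_bot. a t 1 \<eta> \<le> a t 1 \<xi>"
      using eventually_le_at_bot[of \<xi>] by eventually_elim (rule mono)
  qed simp
  have "((\<lambda>\<eta>. a t 1 \<eta> - a 0 1 \<eta>) \<longlongrightarrow> 0) at_top" using H_variation_decay[OF t, of 1] by simp
  then have "((\<lambda>\<eta>. (a t 1 \<eta> - a 0 1 \<eta>) + M) \<longlongrightarrow> 0 + M) at_top" by (intro tendsto_intros)
  then have "((\<lambda>\<eta>. (a t 1 \<eta> - a 0 1 \<eta>) + M) \<longlongrightarrow> M) at_top" by simp
  then show "a t 1 \<xi> \<le> M"
  proof (rule tendsto_lowerbound)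
    show "\<forall>\<^sub>F \<eta> in at_top. a t 1 \<xi> \<le> (a t 1 \<eta> - a 0 1 \<eta>) + M"
      using eventually_ge_at_top[of \<xi>]
    proof eventually_elim
      case (elim \<eta>)
      then show ?case using mono[OF elim] h[of \<eta>] by linarith
    qed
  qed simp
qed

end

section \<open>Linear growth of the vector field\<close>

definition pq :: "profile \<Rightarrow> nat \<Rightarrow> real \<Rightarrow> real" where
  "pq a j = [pP1 a, pP2 a, pP3 a, pQ1 a, pQ2 a, pQ3 a] ! j"

text \<open>The nonlocal terms are included because P_i y_xi = P_i + P_i zeta_xi: its first summand
  must be dominated by something square integrable, which the constant 1 is not.\<close>

definition size_sum :: "profile \<Rightarrow> real \<Rightarrow> real" where
  "size_sum a t = (\<Sum>i=2..<9. \<bar>a i t\<bar>) + (\<Sum>j<6. \<bar>pq a j t\<bar>)"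

text \<open>Bounds exactly the quantities that the energy controls. Components 4 to 7 are left free
  because the vector field is affine in them once these quantities are given.\<close>

definition tame :: "real \<Rightarrow> profile set" where
  "tame B = {a. \<forall>t. \<bar>a 2 t\<bar> \<le> B \<and> \<bar>a 3 t\<bar> \<le> B \<and> \<bar>a 8 t\<bar> \<le> B \<and> (\<forall>j<6. \<bar>pq a j t\<bar> \<le> B)}"

definition bounded_on_tame :: "real \<Rightarrow> (profile \<Rightarrow> real \<Rightarrow> real) \<Rightarrow> bool" where
  "bounded_on_tame B f \<longleftrightarrow> (\<exists>c\<ge>0. \<forall>a\<in>tame B. \<forall>t. \<bar>f a t\<bar> \<le> c)"

text \<open>A linear bound without additive constant, so that it can be integrated over the line and
  yields L^2 estimates too.\<close>

definition dominated_on_tame :: "real \<Rightarrow> (profile \<Rightarrow> real \<Rightarrow> real) \<Rightarrow> bool" where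
  "dominated_on_tame B f \<longleftrightarrow> (\<exists>c\<ge>0. \<forall>a\<in>tame B. \<forall>t. \<bar>f a t\<bar> \<le> c * size_sum a t)"

lemma size_sum_nonneg: "0 \<le> size_sum a t"
  unfolding size_sum_def by (intro add_nonneg_nonneg sum_nonneg) auto

lemma bounded_on_tame_const: "bounded_on_tame B (\<lambda>a t. k)"
  unfolding bounded_on_tame_def by (intro exI[of _ "\<bar>k\<bar>"]) simp

lemma bounded_on_tame_add:
  assumes "bounded_on_tame B f" "bounded_on_tame B g"
  shows "bounded_on_tame B (\<lambda>a t. f a t + g a t)"
proof -
  obtain c d where c: "c \<ge> 0" "\<And>a t. a \<in> tame B \<Longrightarrow> \<bar>f a t\<bar> \<le> c" and d: "d \<ge> 0" "\<And>a t. a \<in> tame B \<Longrightarrow> \<bar>g a t\<bar> \<le> d"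
    using assms unfolding bounded_on_tame_def by blast
  have "\<bar>f a t + g a t\<bar> \<le> c + d" if "a \<in> tame B" for a t using c(2)[OF that, of t] d(2)[OF that, of t] by linarith
  then show ?thesis unfolding bounded_on_tame_def using c d by (intro exI[of _ "c + d"]) auto
qed

lemma bounded_on_tame_mult:
  assumes "bounded_on_tame B f" "bounded_on_tame B g"
  shows "bounded_on_tame B (\<lambda>a t. f a t * g a t)"
proof -
  obtain c d where c: "c \<ge> 0" "\<And>a t. a \<in> tame B \<Longrightarrow> \<bar>f a t\<bar> \<le> c" and d: "d \<ge> 0" "\<And>a t. a \<in> tame B \<Longrightarrow> \<bar>g a t\<bar> \<le> d"
    using assms unfolding bounded_on_tame_def by blast
  have "\<bar>f a t * g a t\<bar> \<le> c * d" if "a \<in> tame B" for a t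
    unfolding abs_mult using c d that by (intro mult_mono) auto
  then show ?thesis unfolding bounded_on_tame_def using c d by (intro exI[of _ "c * d"]) auto
qed

lemma dominated_on_tame_add:
  assumes "dominated_on_tame B f" "dominated_on_tame B g"
  shows "dominated_on_tame B (\<lambda>a t. f a t + g a t)"
proof -
  obtain c d where c: "c \<ge> 0" "\<And>a t. a \<in> tame B \<Longrightarrow> \<bar>f a t\<bar> \<le> c * size_sum a t"
    and d: "d \<ge> 0" "\<And>a t. a \<in> tame B \<Longrightarrow> \<bar>g a t\<bar> \<le> d * size_sum a t"
    using assms unfolding dominated_on_tame_def by blast
  have "\<bar>f a t + g a t\<bar> \<le> (c + d) * size_sum a t" if "a \<in> tame B" for a t
    using c(2)[OF that, of t] d(2)[OF that, of t] unfolding distrib_right by linarith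
  then show ?thesis unfolding dominated_on_tame_def using c d by (intro exI[of _ "c + d"]) auto
qed

lemma dominated_on_tame_mult:
  assumes "bounded_on_tame B f" "dominated_on_tame B g"
  shows "dominated_on_tame B (\<lambda>a t. f a t * g a t)"
proof -
  obtain c d where c: "c \<ge> 0" "\<And>a t. a \<in> tame B \<Longrightarrow> \<bar>f a t\<bar> \<le> c"
    and d: "d \<ge> 0" "\<And>a t. a \<in> tame B \<Longrightarrow> \<bar>g a t\<bar> \<le> d * size_sum a t"
    using assms unfolding bounded_on_tame_def dominated_on_tame_def by blast
  have "\<bar>f a t * g a t\<bar> \<le> c * (d * size_sum a t)" if "a \<in> tame B" for a t
    unfolding abs_mult using c d that by (intro mult_mono) auto
  then show ?thesis unfolding dominated_on_tame_def using c d
    by (intro exI[of _ "c * d"]) (auto simp: mult.assoc)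
qed

lemma dominated_on_tame_comp:
  assumes "2 \<le> i" "i < 9"
  shows "dominated_on_tame B (\<lambda>a. a i)"
  unfolding dominated_on_tame_def
proof (intro exI[of _ 1] conjI ballI allI)
  fix a :: profile and t
  have "\<bar>a i t\<bar> \<le> (\<Sum>i=2..<9. \<bar>a i t\<bar>)" using assms by (intro member_le_sum[of i _ "\<lambda>i. \<bar>a i t\<bar>"]) auto
  moreover have "0 \<le> (\<Sum>j<6. \<bar>pq a j t\<bar>)" by (intro sum_nonneg) simp
  ultimately show "\<bar>a i t\<bar> \<le> 1 * size_sum a t" unfolding size_sum_def mult_1_left by linarith
qed simp

lemma dominated_on_tame_pq:
  assumes "j < 6"
  shows "dominated_on_tame B (\<lambda>a. pq a j)"
  unfolding dominated_on_tame_def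
proof (intro exI[of _ 1] conjI ballI allI)
  fix a :: profile and t
  have "\<bar>pq a j t\<bar> \<le> (\<Sum>j<6. \<bar>pq a j t\<bar>)" using assms by (intro member_le_sum[of j _ "\<lambda>j. \<bar>pq a j t\<bar>"]) auto
  moreover have "0 \<le> (\<Sum>i=2..<9. \<bar>a i t\<bar>)" by (intro sum_nonneg) simp
  ultimately show "\<bar>pq a j t\<bar> \<le> 1 * size_sum a t" unfolding size_sum_def mult_1_left by linarith
qed simp

lemma pq_nth: "pq a 0 = pP1 a" "pq a 1 = pP2 a" "pq a 2 = pP3 a" "pq a 3 = pQ1 a" "pq a 4 = pQ2 a" "pq a 5 = pQ3 a"
  unfolding pq_def by simp_all

lemma dominated_PQ:
  "dominated_on_tame B pP1" "dominated_on_tame B pP2" "dominated_on_tame B pP3"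
  "dominated_on_tame B pQ1" "dominated_on_tame B pQ2" "dominated_on_tame B pQ3"
  using dominated_on_tame_pq[of 0 B] dominated_on_tame_pq[of 1 B] dominated_on_tame_pq[of 2 B]
    dominated_on_tame_pq[of 3 B] dominated_on_tame_pq[of 4 B] dominated_on_tame_pq[of 5 B]
  unfolding pq_nth by simp_all

lemma bounded_tame_comp:
  assumes "0 \<le> B"
  shows "bounded_on_tame B (\<lambda>a. a 2)" "bounded_on_tame B (\<lambda>a. a 3)" "bounded_on_tame B (\<lambda>a. a 8)"
  unfolding bounded_on_tame_def tame_def using assms by (auto intro!: exI[of _ B])

lemma bounded_tame_PQ:
  assumes "0 \<le> B"
  shows "bounded_on_tame B pP1" "bounded_on_tame B pP2" "bounded_on_tame B pP3"
    "bounded_on_tame B pQ1" "bounded_on_tame B pQ2" "bounded_on_tame B pQ3"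
proof -
  have *: "bounded_on_tame B (\<lambda>a. pq a j)" if "j < 6" for j
    unfolding bounded_on_tame_def tame_def using assms that by (auto intro!: exI[of _ B])
  show "bounded_on_tame B pP1" "bounded_on_tame B pP2" "bounded_on_tame B pP3"
    "bounded_on_tame B pQ1" "bounded_on_tame B pQ2" "bounded_on_tame B pQ3"
    using *[of 0] *[of 1] *[of 2] *[of 3] *[of 4] *[of 5] unfolding pq_nth by simp_all
qed

lemma bounded_rhs:
  assumes "0 \<le> B"
  shows "bounded_on_tame B (\<lambda>a. rhs a 1)"
proof -
  have "bounded_on_tame B (\<lambda>a t. a 2 t * (a 2 t * a 2 t) + (-2) * (pP1 a t * a 2 t) + (-2) * (pP2 a t * a 3 t) + (-2) * (pQ3 a t * a 3 t))"
    by (intro bounded_on_tame_add bounded_on_tame_mult bounded_on_tame_const bounded_tame_comp bounded_tame_PQ assms)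
  then show ?thesis unfolding rhs_simps by (simp add: power3_eq_cube algebra_simps)
qed

lemma dominated_rhs:
  assumes B: "0 \<le> B" and i: "2 \<le> i" "i < 9"
  shows "dominated_on_tame B (\<lambda>a. rhs a i)"
proof -
  note I = dominated_on_tame_add dominated_on_tame_mult bounded_on_tame_mult bounded_on_tame_const
    bounded_tame_comp[OF B] bounded_tame_PQ[OF B] dominated_PQ dominated_on_tame_comp
  have 5: "dominated_on_tame B (\<lambda>a t. (3 * (a 2 t * a 2 t)) * a 6 t
        + (-2) * (a 2 t * pQ1 a t + (pQ1 a t * a 2 t) * a 4 t + pP1 a t * a 6 t)
        + (-2) * (a 3 t * pQ2 a t + (pQ2 a t * a 3 t) * a 4 t + pP2 a t * a 7 t)
        + (-2) * (a 3 t * pP3 a t + (pP3 a t * a 3 t) * a 4 t + (- 1 * (a 3 t * a 3 t)) * a 6 t + pQ3 a t * a 7 t))"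
    by (intro I; simp)
  have 6: "dominated_on_tame B (\<lambda>a t. 1/2 * (a 2 t * a 2 t + (a 2 t * a 2 t) * a 4 t + (-2) * (a 8 t * a 8 t) + (-2 * (a 8 t * a 8 t)) * a 4 t + a 5 t)
       + (-1) * (pP1 a t + pP1 a t * a 4 t))"
    by (intro I; simp)
  have 7: "dominated_on_tame B (\<lambda>a t. (-1) * (pP2 a t + pP2 a t * a 4 t) + a 8 t * a 6 t + (-1) * (pQ3 a t + pQ3 a t * a 4 t))"
    by (intro I; simp)
  have 2: "dominated_on_tame B (\<lambda>a t. (-1) * pQ1 a t)" "dominated_on_tame B (\<lambda>a t. (-1) * pQ2 a t + (-1) * pP3 a t)"
     "dominated_on_tame B (\<lambda>a t. (-1) * pP2 a t + (-1) * pQ3 a t)" "dominated_on_tame B (\<lambda>a. a 6)"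
    by (intro I; simp)+
  consider "i = 2" | "i = 3" | "i = 4" | "i = 5" | "i = 6" | "i = 7" | "i = 8" using i by linarith
  then show ?thesis
  proof cases
    case 4 then show ?thesis using 5 by (simp add: rhs_simps src3_def power2_eq_square algebra_simps)
  next
    case 5 then show ?thesis using 6 by (simp add: rhs_simps src1_def power2_eq_square algebra_simps)
  next
    case 6 then show ?thesis using 7 by (simp add: rhs_simps src2_def algebra_simps)
  qed (use 2 in \<open>simp_all add: rhs_simps\<close>)
qed

lemma growth_on_tame:
  assumes B: "0 \<le> B"
  obtains K where "0 \<le> K" "\<And>a t. a \<in> tame B \<Longrightarrow> \<bar>rhs a 1 t\<bar> \<le> K"
    "\<And>a t i. a \<in> tame B \<Longrightarrow> 2 \<le> i \<Longrightarrow> i < 9 \<Longrightarrow> \<bar>rhs a i t\<bar> \<le> K * size_sum a t"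
proof -
  obtain K1 where K1: "0 \<le> K1" "\<And>a t. a \<in> tame B \<Longrightarrow> \<bar>rhs a 1 t\<bar> \<le> K1"
    using bounded_rhs[OF B] unfolding bounded_on_tame_def by blast
  have "\<exists>c. i < 9 \<longrightarrow> 2 \<le> i \<longrightarrow> 0 \<le> c \<and> (\<forall>a\<in>tame B. \<forall>t. \<bar>rhs a i t\<bar> \<le> c * size_sum a t)" for i
    using dominated_rhs[OF B, of i] unfolding dominated_on_tame_def by blast
  then obtain c where c: "\<And>i. i < 9 \<Longrightarrow> 2 \<le> i \<Longrightarrow> 0 \<le> c i"
    "\<And>i a t. i < 9 \<Longrightarrow> 2 \<le> i \<Longrightarrow> a \<in> tame B \<Longrightarrow> \<bar>rhs a i t\<bar> \<le> c i * size_sum a t"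
    by metis
  define K where "K = K1 + (\<Sum>i=2..<9. c i)"
  have cs: "0 \<le> (\<Sum>i=2..<9. c i)" by (intro sum_nonneg c) auto
  show ?thesis
  proof (rule that[of K])
    show "0 \<le> K" unfolding K_def using K1 cs by simp
    show "\<bar>rhs a 1 t\<bar> \<le> K" if "a \<in> tame B" for a t using K1(2)[OF that, of t] cs unfolding K_def by simp
    show "\<bar>rhs a i t\<bar> \<le> K * size_sum a t" if "a \<in> tame B" "2 \<le> i" "i < 9" for a t i
    proof -
      have "c i \<le> (\<Sum>i=2..<9. c i)" using that c(1) by (intro member_le_sum) auto
      then have "c i \<le> K" unfolding K_def using K1 by simp
      then have "c i * size_sum a t \<le> K * size_sum a t" by (rule mult_right_mono[OF _ size_sum_nonneg])
      then show ?thesis using c(2)[OF that(3,2,1), of t] by linarith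
    qed
  qed
qed

lemma L2_sum:
  assumes "\<And>j. j \<in> J \<Longrightarrow> f j \<in> L2" and J: "finite J"
  shows "(\<lambda>x. \<Sum>j\<in>J. f j x) \<in> L2 \<and> L2_norm (\<lambda>x. \<Sum>j\<in>J. f j x) \<le> (\<Sum>j\<in>J. L2_norm (f j))"
  using J assms
proof (induction J)
  case empty
  then show ?case by (simp add: L2_zero)
next
  case (insert j J)
  have IH: "(\<lambda>x. \<Sum>j\<in>J. f j x) \<in> L2" "L2_norm (\<lambda>x. \<Sum>j\<in>J. f j x) \<le> (\<Sum>j\<in>J. L2_norm (f j))"
    using insert by auto
  have fj: "f j \<in> L2" using insert by auto
  have "L2_norm (\<lambda>x. f j x + (\<Sum>j\<in>J. f j x)) \<le> L2_norm (f j) + L2_norm (\<lambda>x. \<Sum>j\<in>J. f j x)"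
    by (rule L2_add(2)[OF fj IH(1)])
  then show ?case using insert(1,2) L2_add(1)[OF fj IH(1)] IH(2) by simp
qed

lemma size_sum_L2:
  assumes a: "\<And>i. 2 \<le> i \<Longrightarrow> i < 9 \<Longrightarrow> a i \<in> L2" and p: "\<And>j. j < 6 \<Longrightarrow> pq a j \<in> L2 \<and> L2_norm (pq a j) \<le> D"
  shows "size_sum a \<in> L2" "L2_norm (size_sum a) \<le> (\<Sum>i=2..<9. L2_norm (a i)) + 6 * D"
proof -
  have 1: "(\<lambda>x. \<Sum>i=2..<9. \<bar>a i x\<bar>) \<in> L2" "L2_norm (\<lambda>x. \<Sum>i=2..<9. \<bar>a i x\<bar>) \<le> (\<Sum>i=2..<9. L2_norm (a i))"
    using L2_sum[of "{2..<9}" "\<lambda>i x. \<bar>a i x\<bar>"] a by (simp_all add: L2_abs)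
  have 2: "(\<lambda>x. \<Sum>j<6. \<bar>pq a j x\<bar>) \<in> L2" "L2_norm (\<lambda>x. \<Sum>j<6. \<bar>pq a j x\<bar>) \<le> (\<Sum>j<6. L2_norm (pq a j))"
    using L2_sum[of "{..<6}" "\<lambda>j x. \<bar>pq a j x\<bar>"] p by (simp_all add: L2_abs)
  have "(\<Sum>j<6. L2_norm (pq a j)) \<le> (\<Sum>j<(6::nat). D)" using p by (intro sum_mono) auto
  then have 3: "(\<Sum>j<6. L2_norm (pq a j)) \<le> 6 * D" by simp
  show "size_sum a \<in> L2" unfolding size_sum_def[abs_def] by (rule L2_add(1)[OF 1(1) 2(1)])
  show "L2_norm (size_sum a) \<le> (\<Sum>i=2..<9. L2_norm (a i)) + 6 * D"
    using L2_add(2)[OF 1(1) 2(1)] 1(2) 2(2) 3 unfolding size_sum_def[abs_def] by linarith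
qed

section \<open>A priori bounds\<close>

text \<open>Truncated integrals of f are increments of F, hence at most M; Fatou passes to the whole
  line.\<close>

lemma primitive_nonneg_integrable:
  assumes F: "primitive F f" and f: "\<And>x. 0 \<le> f x" and b: "\<And>x. 0 \<le> F x" "\<And>x. F x \<le> M"
  shows "integrable lborel f" "(LINT x|lborel. f x) \<le> M"
proof -
  have M: "0 \<le> M" using b(1)[of 0] b(2)[of 0] by linarith
  have [measurable]: "f \<in> borel_measurable borel" by (rule primitiveD(2)[OF F])
  let ?I = "\<lambda>n::nat. {- real n<..real n}"
  have "(\<integral>\<^sup>+x. ennreal (f x) \<partial>lborel) = (\<integral>\<^sup>+x. liminf (\<lambda>n. ennreal (indicator (?I n) x *\<^sub>R f x)) \<partial>lborel)"
  proof (rule nn_integral_cong)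
    fix x :: real
    obtain N where N: "\<bar>x\<bar> < real N" using reals_Archimedean2 by blast
    have "\<forall>\<^sub>F n in sequentially. ennreal (indicator (?I n) x *\<^sub>R f x) = ennreal (f x)"
      using eventually_ge_at_top[of N]
    proof eventually_elim
      case (elim n)
      then have "x \<in> ?I n" using N by auto
      then show ?case by simp
    qed
    then have "(\<lambda>n. ennreal (indicator (?I n) x *\<^sub>R f x)) \<longlonglongrightarrow> ennreal (f x)" by (rule tendsto_eventually)
    then show "ennreal (f x) = liminf (\<lambda>n. ennreal (indicator (?I n) x *\<^sub>R f x))"
      by (rule lim_imp_Liminf[OF trivial_limit_sequentially, symmetric])
  qed
  also have "\<dots> \<le> liminf (\<lambda>n. \<integral>\<^sup>+x. ennreal (indicator (?I n) x *\<^sub>R f x) \<partial>lborel)"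
    by (rule nn_integral_liminf) measurable
  also have "\<dots> \<le> ennreal M"
  proof -
    have "(\<integral>\<^sup>+x. ennreal (indicator (?I n) x *\<^sub>R f x) \<partial>lborel) \<le> ennreal M" for n
    proof -
      have i: "integrable lborel (\<lambda>x. indicator (?I n) x *\<^sub>R f x)"
        using bounded_borel_set_integrable[OF primitiveD(1)[OF F]] unfolding set_integrable_def by blast
      have "(\<integral>\<^sup>+x. ennreal (indicator (?I n) x *\<^sub>R f x) \<partial>lborel) = ennreal (LINT x|lborel. indicator (?I n) x *\<^sub>R f x)"
        by (rule nn_integral_eq_integral[OF i]) (simp add: f)
      also have "(LINT x|lborel. indicator (?I n) x *\<^sub>R f x) = F (real n) - F (- real n)"
        using primitiveD(3)[OF F, of "- real n" "real n"] unfolding set_lebesgue_integral_def by simp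
      also have "ennreal (F (real n) - F (- real n)) \<le> ennreal M"
        using b(1)[of "- real n"] b(2)[of "real n"] by (intro ennreal_leI) linarith
      finally show ?thesis .
    qed
    then have "liminf (\<lambda>n. \<integral>\<^sup>+x. ennreal (indicator (?I n) x *\<^sub>R f x) \<partial>lborel) \<le> liminf (\<lambda>n. ennreal M)"
      by (intro Liminf_mono always_eventually) simp
    then show ?thesis by (simp add: Liminf_const)
  qed
  finally have N: "(\<integral>\<^sup>+x. ennreal (f x) \<partial>lborel) \<le> ennreal M" .
  show i: "integrable lborel f"
  proof (rule integrableI_bounded)
    show "(\<integral>\<^sup>+ x. ennreal (norm (f x)) \<partial>lborel) < \<infinity>"
      using order.strict_trans1[OF N ennreal_less_top] by (simp add: f)
  qed simp
  have "ennreal (LINT x|lborel. f x) \<le> ennreal M"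
    using N by (subst nn_integral_eq_integral[OF i, symmetric]) (simp_all add: f)
  then show "(LINT x|lborel. f x) \<le> M" using M by simp
qed

text \<open>Identity (4), divided by y_xi, bounds y_xi (U^2 + \<Gamma>^2 + R^2) by H_xi and, through
  2 |u v| \<le> u^2 + v^2, the products with U_xi as well. Where y_xi = 0 it forces U_xi = 0. So the
  energy density dominates all sources.\<close>

lemma good_source_bounds:
  assumes g: "good a"
  shows "\<bar>src1 a t\<bar> \<le> 3 * a 5 t" "\<bar>src2 a t\<bar> \<le> a 5 t" "\<bar>src3 a t\<bar> \<le> a 5 t" "2 * \<bar>a 2 t * a 6 t\<bar> \<le> a 5 t"
    "2 * \<bar>a 3 t * a 7 t\<bar> \<le> a 5 t"
proof -
  define Y h U G R q where "Y = 1 + a 4 t" and "h = a 5 t" and "U = a 2 t" and "G = a 3 t" and "R = a 8 t" and "q = a 6 t"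
  have Y: "0 \<le> Y" "0 \<le> h" and E: "Y * h = Y\<^sup>2 * (U\<^sup>2 + G\<^sup>2 + R\<^sup>2) + q\<^sup>2"
    using g unfolding good_def Y_def h_def U_def G_def R_def q_def by blast+
  have gR: "a 7 t = R * Y" using g unfolding good_def Y_def R_def by simp
  have "Y * (U\<^sup>2 + G\<^sup>2 + R\<^sup>2) \<le> h \<and> 2 * \<bar>U * q\<bar> \<le> h \<and> 2 * \<bar>G * q\<bar> \<le> h \<and> 2 * \<bar>R * q\<bar> \<le> h"
  proof (cases "Y = 0")
    case True
    then have "q = 0" using E by simp
    then show ?thesis using True Y by simp
  next
    case False
    then have Yp: "0 < Y" using Y by simp
    have "Y * (Y * (U\<^sup>2 + G\<^sup>2 + R\<^sup>2)) \<le> Y * h" unfolding E by (simp add: power2_eq_square)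
    then have 1: "Y * (U\<^sup>2 + G\<^sup>2 + R\<^sup>2) \<le> h" using Yp by simp
    have 2: "2 * \<bar>V * q\<bar> \<le> h" if "V\<^sup>2 \<le> U\<^sup>2 + G\<^sup>2 + R\<^sup>2" for V
    proof -
      have "Y * (2 * \<bar>V * q\<bar>) = 2 * \<bar>Y * V\<bar> * \<bar>q\<bar>" using Yp by (simp add: abs_mult)
      also have "\<dots> \<le> (Y * V)\<^sup>2 + q\<^sup>2" using sum_squares_bound[of "\<bar>Y * V\<bar>" "\<bar>q\<bar>"] by simp
      also have "\<dots> \<le> Y\<^sup>2 * (U\<^sup>2 + G\<^sup>2 + R\<^sup>2) + q\<^sup>2"
        unfolding power_mult_distrib by (intro add_right_mono mult_left_mono that) simp
      also have "\<dots> = Y * h" using E by simp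
      finally show ?thesis using Yp by simp
    qed
    show ?thesis using 1 by (intro conjI 2) simp_all
  qed
  then have 1: "Y * (U\<^sup>2 + G\<^sup>2 + R\<^sup>2) \<le> h" and 2: "2 * \<bar>U * q\<bar> \<le> h" "2 * \<bar>G * q\<bar> \<le> h" "2 * \<bar>R * q\<bar> \<le> h" by auto
  have p: "0 \<le> Y * U\<^sup>2" "0 \<le> Y * G\<^sup>2" "0 \<le> Y * R\<^sup>2" using Y by simp_all
  have sq: "Y * U\<^sup>2 + Y * G\<^sup>2 + Y * R\<^sup>2 \<le> h" using 1 by (simp add: distrib_left)
  have "src1 a t = Y * U\<^sup>2 - 2 * (Y * R\<^sup>2) + h"
    unfolding src1_def Y_def U_def R_def h_def by (simp add: algebra_simps)
  then show "\<bar>src1 a t\<bar> \<le> 3 * a 5 t" using p sq unfolding h_def[symmetric] by linarith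
  show "\<bar>src2 a t\<bar> \<le> a 5 t" "\<bar>src3 a t\<bar> \<le> a 5 t" "2 * \<bar>a 2 t * a 6 t\<bar> \<le> a 5 t"
    using 2 Y unfolding src2_def src3_def U_def G_def R_def q_def h_def by linarith+
  have "2 * \<bar>G * R\<bar> \<le> G\<^sup>2 + R\<^sup>2" using sum_squares_bound[of "\<bar>G\<bar>" "\<bar>R\<bar>"] by (simp add: abs_mult)
  then have "Y * (2 * \<bar>G * R\<bar>) \<le> Y * (G\<^sup>2 + R\<^sup>2)" using Y by (intro mult_left_mono)
  moreover have "Y * (2 * \<bar>G * R\<bar>) = 2 * \<bar>G * (R * Y)\<bar>" using Y by (simp add: abs_mult)
  moreover have "Y * (G\<^sup>2 + R\<^sup>2) = Y * G\<^sup>2 + Y * R\<^sup>2" by (rule distrib_left)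
  ultimately show "2 * \<bar>a 3 t * a 7 t\<bar> \<le> a 5 t"
    using p sq unfolding gR G_def[symmetric] h_def[symmetric] by linarith
qed

text \<open>Integrates (F^2)_x \<le> h from -infinity, where F and H both vanish. Applied to U and
  \<Gamma> with H the energy.\<close>

lemma square_le_potential:
  assumes F: "primitive F f" "F \<in> L2" "f \<in> L2" and H: "primitive H h" "(H \<longlongrightarrow> 0) at_bot"
    and le: "\<And>x. 2 * \<bar>F x * f x\<bar> \<le> h x"
  shows "(F x)\<^sup>2 \<le> H x"
proof -
  have ineq: "(F x)\<^sup>2 \<le> (F y)\<^sup>2 + (H x - H y)" if y: "y \<le> x" for y
  proof -
    have bF: "bounded_borel F"
      by (rule bounded_borelI[OF primitive_measurable[OF F(1)] primitive_sup_le[OF F]])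
    have "F x * F x - F y * F y = (LINT t:{y<..x}|lborel. f t * F t + F t * f t)"
      by (rule primitive_product[OF F(1) F(1) y])
    also have "\<dots> \<le> (LINT t:{y<..x}|lborel. h t)"
    proof (rule set_integral_mono)
      show "set_integrable lborel {y<..x} (\<lambda>t. f t * F t + F t * f t)" "set_integrable lborel {y<..x} h"
        by (intro bounded_borel_set_integrable bounded_borel_intros primitiveD[OF F(1)] primitiveD[OF H(1)] bF)+
      show "f t * F t + F t * f t \<le> h t" for t using le[of t] by (simp add: mult.commute)
    qed
    also have "\<dots> = H x - H y" using primitiveD(3)[OF H(1) y] by simp
    finally show ?thesis by (simp add: power2_eq_square)
  qed
  have "((\<lambda>y. (F y)\<^sup>2 + (H x - H y)) \<longlongrightarrow> 0\<^sup>2 + (H x - 0)) at_bot"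
    by (intro tendsto_intros H primitive_L2_decay[OF F]) simp
  then have "((\<lambda>y. (F y)\<^sup>2 + (H x - H y)) \<longlongrightarrow> H x) at_bot" by simp
  then show ?thesis
  proof (rule tendsto_lowerbound)
    show "\<forall>\<^sub>F y in at_bot. (F x)\<^sup>2 \<le> (F y)\<^sup>2 + (H x - H y)"
      using eventually_le_at_bot[of x] by eventually_elim (rule ineq)
  qed simp
qed

lemma abs_le_1_plus:
  fixes u M :: real
  assumes "u\<^sup>2 \<le> M" shows "\<bar>u\<bar> \<le> 1 + M"
proof (rule power2_le_imp_le)
  have M: "0 \<le> M" using order_trans[OF zero_le_power2 assms] .
  have "M \<le> 1 + 2 * M + M\<^sup>2" using M zero_le_power2[of M] by linarith
  then show "\<bar>u\<bar>\<^sup>2 \<le> (1 + M)\<^sup>2" using assms by (simp add: power2_sum)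
  show "0 \<le> 1 + M" using M by simp
qed

context good_solution
begin

lemma comp_increment_le:
  assumes t: "t \<in> {0..T}" and b: "\<And>s. s \<in> {0..T} \<Longrightarrow> \<bar>rhs (a s) i \<xi>\<bar> \<le> K"
  shows "\<bar>a t i \<xi>\<bar> \<le> \<bar>a 0 i \<xi>\<bar> + K * T"
proof -
  have K: "0 \<le> K" using b[OF t] by linarith
  have "norm (a t i \<xi>) \<le> (norm (a 0 i \<xi>) + K * t) * exp (0 * t)"
    by (rule gronwall_norm[where x="\<lambda>s. a s i \<xi>" and x'="\<lambda>s. rhs (a s) i \<xi>"])
       (use comp_deriv b K t in \<open>auto simp: has_real_derivative_iff_has_vector_derivative\<close>)
  moreover have "K * t \<le> K * T" using K t by (intro mult_left_mono) auto
  ultimately show ?thesis by simp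
qed

text \<open>Each bound feeds the next: H \<le> M gives |U| \<le> 1 + M; integrating zeta_t = U gives
  Z; Z bounds the kernels by exp(2 Z); the sources have L^1 norm at most 3 M, whence P; and R_t =
  -P_2 - Q_3 then bounds R. The constants see the data only through sup bounds for zeta, H and
  R.\<close>

lemma apriori:
  assumes M: "\<And>\<xi>. \<bar>a 0 0 \<xi>\<bar> \<le> M" "\<And>\<xi>. a 0 1 \<xi> \<le> M" "\<And>\<xi>. \<bar>a 0 8 \<xi>\<bar> \<le> M"
    and Z: "Z = M + (1 + M) * T" and P: "P = exp (2 * Z) * (3 * M)" and t: "t \<in> {0..T}"
  shows "\<bar>a t 0 \<xi>\<bar> \<le> Z" "0 \<le> a t 1 \<xi>" "a t 1 \<xi> \<le> M" "\<bar>a t 2 \<xi>\<bar> \<le> 1 + M" "\<bar>a t 3 \<xi>\<bar> \<le> 1 + M" "\<bar>a t 8 \<xi>\<bar> \<le> M + 2 * P * T"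
    "j < 6 \<Longrightarrow> \<bar>pq (a t) j \<xi>\<bar> \<le> P"
    "j < 6 \<Longrightarrow> pq (a t) j \<in> L2 \<and> L2_norm (pq (a t) j) \<le> 3 * exp (2 * Z) * exp_mass * L2_norm (a t 5)"
proof -
  have H: "0 \<le> a s 1 \<xi>" "a s 1 \<xi> \<le> M" if "s \<in> {0..T}" for s \<xi> using H_range[OF that M(2)] by auto
  show "0 \<le> a t 1 \<xi>" "a t 1 \<xi> \<le> M" using H[OF t] by auto
  have M0: "0 \<le> M" using M(1)[of 0] by linarith
  have prim: "primitive (a s i) (a s (i + 4))" if "i < 4" for s i using prD(3)[OF that] .
  have prim': "primitive (a s 1) (a s 5)" "primitive (a s 2) (a s 6)" "primitive (a s 3) (a s 7)" for s
    using prim[of 1 s] prim[of 2 s] prim[of 3 s] by simp_all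
  have U: "\<bar>a s 2 \<xi>\<bar> \<le> 1 + M" and G: "\<bar>a s 3 \<xi>\<bar> \<le> 1 + M" if s: "s \<in> {0..T}" for s \<xi>
  proof -
    have "(a s 2 \<xi>)\<^sup>2 \<le> a s 1 \<xi>"
      by (rule square_le_potential[OF prim'(2) _ _ prim'(1) H_limit_bot[OF s]])
         (simp_all add: prD good_source_bounds[OF good_preserved[OF s]])
    then show "\<bar>a s 2 \<xi>\<bar> \<le> 1 + M" using H(2)[OF s, of \<xi>] by (intro abs_le_1_plus) linarith
    have "(a s 3 \<xi>)\<^sup>2 \<le> a s 1 \<xi>"
      by (rule square_le_potential[OF prim'(3) _ _ prim'(1) H_limit_bot[OF s]])
         (simp_all add: prD good_source_bounds[OF good_preserved[OF s]])
    then show "\<bar>a s 3 \<xi>\<bar> \<le> 1 + M" using H(2)[OF s, of \<xi>] by (intro abs_le_1_plus) linarith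
  qed
  show "\<bar>a t 2 \<xi>\<bar> \<le> 1 + M" "\<bar>a t 3 \<xi>\<bar> \<le> 1 + M" using U[OF t] G[OF t] by auto
  have z: "\<bar>a s 0 \<xi>\<bar> \<le> Z" if s: "s \<in> {0..T}" for s \<xi>
    using comp_increment_le[OF s, of 0 \<xi> "1 + M"] U M(1)[of \<xi>] unfolding Z rhs_simps by force
  show "\<bar>a t 0 \<xi>\<bar> \<le> Z" by (rule z[OF t])
  have ker: "exp_kernel (exp (2 * Z)) (ker (a s 0))" "exp_kernel (exp (2 * Z)) (sker (a s 0))" if s: "s \<in> {0..T}" for s
    by (rule exp_kernel_ker[OF bounded_borel_measurable[OF prD(1)] z[OF s]])+
  have hi: "integrable lborel (a s 5)" "(LINT x|lborel. a s 5 x) \<le> M" if s: "s \<in> {0..T}" for s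
    using primitive_nonneg_integrable[OF prim'(1) signs(2)[OF s] H[OF s]] by auto
  have h3: "integrable lborel (\<lambda>x. 3 * a s 5 x)" "(LINT x|lborel. 3 * a s 5 x) \<le> 3 * M" if s: "s \<in> {0..T}" for s
    using hi[OF s] by simp_all
  have sb: "\<bar>f x\<bar> \<le> 3 * a s 5 x" if s: "s \<in> {0..T}" and f: "f = src1 (a s) \<or> f = src2 (a s) \<or> f = src3 (a s)" for s f x
  proof -
    note g = good_source_bounds[OF good_preserved[OF s], of x] and h = signs(2)[OF s, of x]
    show ?thesis using f g(1-3) h by (elim disjE; hypsubst; linarith)
  qed
  have kop: "\<bar>kernel_op k f \<xi>\<bar> \<le> P" "kernel_op k f \<in> L2"
      "L2_norm (kernel_op k f) \<le> 3 * exp (2 * Z) * exp_mass * L2_norm (a s 5)"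
    if s: "s \<in> {0..T}" and f: "f = src1 (a s) \<or> f = src2 (a s) \<or> f = src3 (a s)" and k: "k = ker (a s 0) \<or> k = sker (a s 0)"
    for s f k \<xi>
  proof -
    have K: "exp_kernel (exp (2 * Z)) k" using k ker[OF s] by auto
    have "\<bar>kernel_op k f \<xi>\<bar> \<le> exp (2 * Z) * (LINT x|lborel. 3 * a s 5 x)"
      by (rule kernel_op_sup_le_L1[OF K h3(1)[OF s]]) (rule AE_I2, rule sb[OF s f])
    also have "\<dots> \<le> P" unfolding P by (rule mult_left_mono[OF h3(2)[OF s]]) simp
    finally show "\<bar>kernel_op k f \<xi>\<bar> \<le> P" .
    have fL: "f \<in> L2" using f src_admissible[OF admissible_pr] by auto
    have "L2_norm f \<le> 3 * L2_norm (a s 5)"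
      by (rule L2_domI(2)[OF prD(2)[of 5] L2_measurable[OF fL]])
         (use sb[OF s f] signs(2)[OF s] in \<open>auto intro!: AE_I2\<close>)
    then have "exp (2 * Z) * exp_mass * L2_norm f \<le> exp (2 * Z) * exp_mass * (3 * L2_norm (a s 5))"
      using exp_mass_nonneg by (intro mult_left_mono) auto
    then show "L2_norm (kernel_op k f) \<le> 3 * exp (2 * Z) * exp_mass * L2_norm (a s 5)"
      using kernel_op_L2(2)[OF K fL] by linarith
    show "kernel_op k f \<in> L2" by (rule kernel_op_L2(1)[OF K fL])
  qed
  have pqb: "\<bar>pq (a s) j \<xi>\<bar> \<le> P" "pq (a s) j \<in> L2 \<and> L2_norm (pq (a s) j) \<le> 3 * exp (2 * Z) * exp_mass * L2_norm (a s 5)"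
    if s: "s \<in> {0..T}" and j: "j < 6" for s j \<xi>
  proof -
    have "\<exists>c k f. \<bar>c\<bar> \<le> 1 \<and> (f = src1 (a s) \<or> f = src2 (a s) \<or> f = src3 (a s)) \<and> (k = ker (a s 0) \<or> k = sker (a s 0)) \<and>
       pq (a s) j = (\<lambda>\<xi>. c * kernel_op k f \<xi>)"
    proof -
      consider "j = 0" | "j = 1" | "j = 2" | "j = 3" | "j = 4" | "j = 5" using j by linarith
      then show ?thesis
      proof cases
        case 1 show ?thesis unfolding 1 pq_nth pP1_def[abs_def]
          by (rule exI[of _ "1/4"], rule exI[of _ "ker (a s 0)"], rule exI[of _ "src1 (a s)"]) auto
      next
        case 2 show ?thesis unfolding 2 pq_nth pP2_def[abs_def]
          by (rule exI[of _ "1/2"], rule exI[of _ "ker (a s 0)"], rule exI[of _ "src2 (a s)"]) auto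
      next
        case 3 show ?thesis unfolding 3 pq_nth pP3_def[abs_def]
          by (rule exI[of _ "1/2"], rule exI[of _ "ker (a s 0)"], rule exI[of _ "src3 (a s)"]) auto
      next
        case 4 show ?thesis unfolding 4 pq_nth pQ1_def[abs_def]
          by (rule exI[of _ "- 1/4"], rule exI[of _ "sker (a s 0)"], rule exI[of _ "src1 (a s)"]) auto
      next
        case 5 show ?thesis unfolding 5 pq_nth pQ2_def[abs_def]
          by (rule exI[of _ "- 1/2"], rule exI[of _ "sker (a s 0)"], rule exI[of _ "src2 (a s)"]) auto
      next
        case 6 show ?thesis unfolding 6 pq_nth pQ3_def[abs_def]
          by (rule exI[of _ "- 1/2"], rule exI[of _ "sker (a s 0)"], rule exI[of _ "src3 (a s)"]) auto
      qed
    qed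
    then obtain c k f where c: "\<bar>c\<bar> \<le> 1" and f: "f = src1 (a s) \<or> f = src2 (a s) \<or> f = src3 (a s)"
      and k: "k = ker (a s 0) \<or> k = sker (a s 0)" and e: "pq (a s) j = (\<lambda>\<xi>. c * kernel_op k f \<xi>)" by blast
    have "\<bar>c\<bar> * \<bar>kernel_op k f \<xi>\<bar> \<le> 1 * \<bar>kernel_op k f \<xi>\<bar>" by (rule mult_right_mono[OF c]) simp
    then show "\<bar>pq (a s) j \<xi>\<bar> \<le> P" unfolding e abs_mult using kop(1)[OF s f k, of \<xi>] by linarith
    have "\<bar>c\<bar> * L2_norm (kernel_op k f) \<le> 1 * L2_norm (kernel_op k f)" by (rule mult_right_mono[OF c L2_norm_nonneg])
    then show "pq (a s) j \<in> L2 \<and> L2_norm (pq (a s) j) \<le> 3 * exp (2 * Z) * exp_mass * L2_norm (a s 5)"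
      unfolding e using L2_cmult[OF kop(2)[OF s f k], of c] kop(3)[OF s f k] by auto
  qed
  show "j < 6 \<Longrightarrow> \<bar>pq (a t) j \<xi>\<bar> \<le> P"
    "j < 6 \<Longrightarrow> pq (a t) j \<in> L2 \<and> L2_norm (pq (a t) j) \<le> 3 * exp (2 * Z) * exp_mass * L2_norm (a t 5)"
    using pqb[OF t] by auto
  have "\<bar>rhs (a s) 8 \<xi>\<bar> \<le> 2 * P" if s: "s \<in> {0..T}" for s \<xi>
    using pqb(1)[OF s, of 1 \<xi>] pqb(1)[OF s, of 5 \<xi>] unfolding pq_nth rhs_simps by simp
  then show "\<bar>a t 8 \<xi>\<bar> \<le> M + 2 * P * T" using comp_increment_le[OF t, of 8 \<xi> "2 * P"] M(3)[of \<xi>] by fastforce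
qed

end

text \<open>The constant below depends only on the bound \<open>M\<close> for the data and on the time horizon; this is what
  makes the Lipschitz constant of the flow uniform on bounded sets.\<close>

definition growth_bound :: "real \<Rightarrow> real \<Rightarrow> real \<Rightarrow> bool" where
  "growth_bound M T B \<longleftrightarrow> 0 \<le> B \<and>
     (\<forall>x \<tau> t. good_solution x \<tau> \<longrightarrow> \<tau> \<le> T \<longrightarrow>
       (\<forall>\<xi>. \<bar>pr (x 0) 0 \<xi>\<bar> \<le> M \<and> pr (x 0) 1 \<xi> \<le> M \<and> \<bar>pr (x 0) 8 \<xi>\<bar> \<le> M) \<longrightarrow> t \<in> {0..\<tau>} \<longrightarrow>
       (\<forall>i \<xi>. (i < 4 \<or> i = 8 \<longrightarrow> \<bar>pr (x t) i \<xi>\<bar> \<le> B \<and> \<bar>rhs (pr (x t)) i \<xi>\<bar> \<le> B) \<and>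
          (2 \<le> i \<longrightarrow> i < 9 \<longrightarrow> \<bar>rhs (pr (x t)) i \<xi>\<bar> \<le> B * (1 + norm (x t)) \<and>
             L2_norm (rhs (pr (x t)) i) \<le> B * (\<Sum>j=2..<9. L2_norm (pr (x t) j)))))"

lemma growth_boundD:
  assumes "growth_bound M T B" "good_solution x \<tau>" "\<tau> \<le> T"
    "\<And>\<xi>. \<bar>pr (x 0) 0 \<xi>\<bar> \<le> M" "\<And>\<xi>. pr (x 0) 1 \<xi> \<le> M" "\<And>\<xi>. \<bar>pr (x 0) 8 \<xi>\<bar> \<le> M" "t \<in> {0..\<tau>}"
  shows "i < 4 \<or> i = 8 \<Longrightarrow> \<bar>pr (x t) i \<xi>\<bar> \<le> B" "i < 4 \<or> i = 8 \<Longrightarrow> \<bar>rhs (pr (x t)) i \<xi>\<bar> \<le> B"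
    "2 \<le> i \<Longrightarrow> i < 9 \<Longrightarrow> \<bar>rhs (pr (x t)) i \<xi>\<bar> \<le> B * (1 + norm (x t))"
    "2 \<le> i \<Longrightarrow> i < 9 \<Longrightarrow> L2_norm (rhs (pr (x t)) i) \<le> B * (\<Sum>j=2..<9. L2_norm (pr (x t) j))"
  using assms unfolding growth_bound_def by blast+

theorem growth_bound_exists:
  assumes M: "0 \<le> M" and T: "0 \<le> T"
  shows "\<exists>B. growth_bound M T B"
proof -
  define Z where "Z = M + (1 + M) * T"
  define P where "P = exp (2 * Z) * (3 * M)"
  \<comment> \<open>C exceeds every bound of \<open>apriori\<close>, so the solution stays in
    \<open>tame C\<close>.\<close>
  define C where "C = 1 + M + Z + P + 2 * P * T"
  have pos: "0 \<le> Z" "0 \<le> P" "0 \<le> 2 * P * T" using M T unfolding Z_def P_def by simp_all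
  have C: "0 \<le> C" "Z \<le> C" "P \<le> C" "1 + M \<le> C" "M + 2 * P * T \<le> C" using pos M unfolding C_def by simp_all
  obtain K where K: "0 \<le> K" "\<And>a t. a \<in> tame C \<Longrightarrow> \<bar>rhs a 1 t\<bar> \<le> K"
    "\<And>a t i. a \<in> tame C \<Longrightarrow> 2 \<le> i \<Longrightarrow> i < 9 \<Longrightarrow> \<bar>rhs a i t\<bar> \<le> K * size_sum a t"
    using growth_on_tame[OF C(1)] by metis
  define D where "D = 3 * exp (2 * Z) * exp_mass"
  have D: "0 \<le> D" unfolding D_def using exp_mass_nonneg by simp
  \<comment> \<open>\<open>size_sum\<close> has 7 components and 6 nonlocal terms: 7 and 6 C come
    from their suprema, 6 D from the L^2 norms of the nonlocal terms. The other summands cover the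
    components bounded outright.\<close>
  define B where "B = K * (7 + 6 * C + 6 * D) + K + 2 * C"
  have nn: "0 \<le> K * 7" "0 \<le> K * (6 * C)" "0 \<le> K * (6 * D)" using K C D by simp_all
  have B: "K \<le> B" "2 * C \<le> B" "C \<le> B" "K * (7 + 6 * C) \<le> B" "K * (1 + 6 * D) \<le> B"
    using nn K(1) C(1) unfolding B_def by (simp_all add: distrib_left)
  have main: "(i < 4 \<or> i = 8 \<longrightarrow> \<bar>pr (x t) i \<xi>\<bar> \<le> B \<and> \<bar>rhs (pr (x t)) i \<xi>\<bar> \<le> B) \<and>
      (2 \<le> i \<longrightarrow> i < 9 \<longrightarrow> \<bar>rhs (pr (x t)) i \<xi>\<bar> \<le> B * (1 + norm (x t)) \<and>
        L2_norm (rhs (pr (x t)) i) \<le> B * (\<Sum>j=2..<9. L2_norm (pr (x t) j)))"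
    if gs: "good_solution x \<tau>" and \<tau>: "\<tau> \<le> T"
      and d: "\<forall>\<xi>. \<bar>pr (x 0) 0 \<xi>\<bar> \<le> M \<and> pr (x 0) 1 \<xi> \<le> M \<and> \<bar>pr (x 0) 8 \<xi>\<bar> \<le> M" and t: "t \<in> {0..\<tau>}"
    for x \<tau> t i \<xi>
  proof -
    interpret good_solution x \<tau> by (rule gs)
    interpret t: good_solution x t
      by unfold_locales (use t ode_on_subset[OF sol] init in auto)
    have tt: "t \<in> {0..t}" "t \<le> T" using t \<tau> by auto
    have d': "\<And>\<xi>. \<bar>pr (x 0) 0 \<xi>\<bar> \<le> M" "\<And>\<xi>. pr (x 0) 1 \<xi> \<le> M" "\<And>\<xi>. \<bar>pr (x 0) 8 \<xi>\<bar> \<le> M" using d by auto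
    note ap = t.apriori[OF d' refl refl tt(1)]
    have Zt: "M + (1 + M) * t \<le> Z" unfolding Z_def using tt M by (intro add_left_mono mult_left_mono) auto
    have Et: "exp (2 * (M + (1 + M) * t)) \<le> exp (2 * Z)" using Zt by simp
    have Pt: "exp (2 * (M + (1 + M) * t)) * (3 * M) \<le> P" unfolding P_def using M by (intro mult_right_mono[OF Et]) simp
    have PTt: "2 * (exp (2 * (M + (1 + M) * t)) * (3 * M)) * t \<le> 2 * P * T"
      using Pt tt t pos M by (intro mult_mono) auto
    have sup: "\<bar>pr (x t) 0 \<xi>\<bar> \<le> C" "\<bar>pr (x t) 1 \<xi>\<bar> \<le> C" "\<bar>pr (x t) 2 \<xi>\<bar> \<le> C" "\<bar>pr (x t) 3 \<xi>\<bar> \<le> C"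
       "\<bar>pr (x t) 8 \<xi>\<bar> \<le> C" for \<xi>
      using ap(1)[of \<xi>] ap(2,3)[of \<xi>] ap(4,5,6)[of \<xi>] Zt PTt C by linarith+
    have pqb: "\<bar>pq (pr (x t)) j \<xi>\<bar> \<le> C" if "j < 6" for j \<xi>
      using ap(7)[OF that, of \<xi>] Pt C(3) by linarith
    have pq2: "pq (pr (x t)) j \<in> L2 \<and> L2_norm (pq (pr (x t)) j) \<le> D * L2_norm (pr (x t) 5)" if "j < 6" for j
    proof -
      have "3 * exp (2 * (M + (1 + M) * t)) * exp_mass * L2_norm (pr (x t) 5) \<le> D * L2_norm (pr (x t) 5)"
        unfolding D_def using exp_mass_nonneg Et by (intro mult_right_mono L2_norm_nonneg) auto
      then show ?thesis using ap(8)[OF that] by linarith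
    qed
    have ta: "pr (x t) \<in> tame C" unfolding tame_def using sup pqb by simp
    have ss: "size_sum (pr (x t)) \<xi> \<le> 7 * norm (x t) + 6 * C" for \<xi>
    proof -
      have "(\<Sum>i=2..<9. \<bar>pr (x t) i \<xi>\<bar>) \<le> (\<Sum>i=2..<(9::nat). norm (x t))" by (intro sum_mono state_sup_le)
      moreover have "(\<Sum>j<6. \<bar>pq (pr (x t)) j \<xi>\<bar>) \<le> (\<Sum>j<(6::nat). C)" by (intro sum_mono pqb) simp
      ultimately show ?thesis unfolding size_sum_def by simp
    qed
    have S: "size_sum (pr (x t)) \<in> L2"
        "L2_norm (size_sum (pr (x t))) \<le> (\<Sum>j=2..<9. L2_norm (pr (x t) j)) + 6 * (D * L2_norm (pr (x t) 5))"
      by (rule size_sum_L2[OF prD(2) pq2]; simp)+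
    have h5: "L2_norm (pr (x t) 5) \<le> (\<Sum>j=2..<9. L2_norm (pr (x t) j))"
      by (rule member_le_sum[of 5 "{2..<9}" "\<lambda>j. L2_norm (pr (x t) j)"]) (auto intro: L2_norm_nonneg)
    have r8: "\<bar>rhs (pr (x t)) i \<xi>\<bar> \<le> 2 * C" if "i = 0 \<or> i = 2 \<or> i = 3 \<or> i = 8"
      using that sup(3)[of \<xi>] pqb[of 0 \<xi>] pqb[of 1 \<xi>] pqb[of 2 \<xi>] pqb[of 3 \<xi>] pqb[of 4 \<xi>] pqb[of 5 \<xi>] C(1)
      unfolding pq_nth by (elim disjE) (simp_all add: rhs_simps)
    show ?thesis
    proof (intro conjI impI)
      assume "i < 4 \<or> i = 8"
      then consider "i = 0" | "i = 1" | "i = 2" | "i = 3" | "i = 8" by linarith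
      then show "\<bar>pr (x t) i \<xi>\<bar> \<le> B" using sup[of \<xi>] B(3) by (cases; hypsubst; linarith)
      show "\<bar>rhs (pr (x t)) i \<xi>\<bar> \<le> B"
      proof (cases "i = 1")
        case True
        then show ?thesis using K(2)[OF ta, of \<xi>] B(1) by simp
      next
        case False
        then have "i = 0 \<or> i = 2 \<or> i = 3 \<or> i = 8" using \<open>i < 4 \<or> i = 8\<close> by linarith
        then show ?thesis using r8 B(2) by linarith
      qed
    next
      assume i: "2 \<le> i" "i < 9"
      have "\<bar>rhs (pr (x t)) i \<xi>\<bar> \<le> K * size_sum (pr (x t)) \<xi>" by (rule K(3)[OF ta i])
      also have "\<dots> \<le> K * (7 * norm (x t) + 6 * C)" by (rule mult_left_mono[OF ss K(1)])
      also have "\<dots> \<le> K * ((7 + 6 * C) * (1 + norm (x t)))"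
        using K(1) C(1) by (intro mult_left_mono) (simp_all add: algebra_simps)
      also have "\<dots> = (K * (7 + 6 * C)) * (1 + norm (x t))" by (rule mult.assoc[symmetric])
      also have "\<dots> \<le> B * (1 + norm (x t))" by (rule mult_right_mono[OF B(4)]) simp
      finally show "\<bar>rhs (pr (x t)) i \<xi>\<bar> \<le> B * (1 + norm (x t))" .
      have "L2_norm (rhs (pr (x t)) i) \<le> K * L2_norm (size_sum (pr (x t)))"
        by (rule L2_domI(2)[OF S(1) bounded_borel_measurable[OF admissibleD(1)[OF rhs_admissible[OF admissible_pr]]]])
           (use K(1) K(3)[OF ta i] size_sum_nonneg in \<open>auto intro!: AE_I2 simp: abs_of_nonneg\<close>)
      also have "\<dots> \<le> K * ((\<Sum>j=2..<9. L2_norm (pr (x t) j)) + 6 * (D * (\<Sum>j=2..<9. L2_norm (pr (x t) j))))"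
        by (intro mult_left_mono K(1) order_trans[OF S(2)] add_left_mono h5 D) simp
      also have "\<dots> = (K * (1 + 6 * D)) * (\<Sum>j=2..<9. L2_norm (pr (x t) j))" by (simp add: algebra_simps)
      also have "\<dots> \<le> B * (\<Sum>j=2..<9. L2_norm (pr (x t) j))"
        by (intro mult_right_mono[OF B(5)] sum_nonneg L2_norm_nonneg)
      finally show "L2_norm (rhs (pr (x t)) i) \<le> B * (\<Sum>j=2..<9. L2_norm (pr (x t) j))" .
    qed
  qed
  have "0 \<le> B" using B(3) C(1) by linarith
  then show ?thesis unfolding growth_bound_def using main by (intro exI[of _ B]) blast
qed

theorem state_global_solution:
  assumes g: "good (pr x0)"
  shows "\<exists>x. x 0 = x0 \<and> (\<forall>t\<ge>0. (x has_vector_derivative vf (x t)) (at t within {0..}))"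
proof (rule ode_global[OF vf_lipschitz])
  fix T :: real
  define M where "M = norm x0"
  have M: "0 \<le> M" "\<And>i \<xi>. \<bar>pr x0 i \<xi>\<bar> \<le> M" unfolding M_def using state_sup_le by auto
  have M1: "pr x0 1 \<xi> \<le> M" for \<xi> using M(2)[of 1 \<xi>] by linarith
  \<comment> \<open>\<open>ode_global\<close> asks for a bound for every real T, so a negative
    horizon is replaced by 0.\<close>
  have T0: "0 \<le> max 0 T" by simp
  obtain B where gb: "growth_bound M (max 0 T) B" using growth_bound_exists[OF M(1) T0] by blast
  then have B0: "0 \<le> B" unfolding growth_bound_def by blast
  \<comment> \<open>16 passes from componentwise bounds to the norm; 7 counts the L^2 norms in the
    sum bounded by \<open>growth_bound\<close>.\<close>
  define L where "L = 16 * (7 * B)"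
  have "norm (x \<tau>) \<le> (norm x0 + L * max 0 T) * exp (L * max 0 T)"
    if \<tau>: "\<tau> \<in> {0..T}" and x: "x 0 = x0" "ode_on vf x \<tau>" for \<tau> x
  proof -
    interpret good_solution x \<tau> using \<tau> x g by unfold_locales auto
    have d: "\<bar>pr (x 0) 0 \<xi>\<bar> \<le> M" "pr (x 0) 1 \<xi> \<le> M" "\<bar>pr (x 0) 8 \<xi>\<bar> \<le> M" for \<xi>
      using x(1) M(2) M1 by simp_all
    have \<tau>T: "\<tau> \<le> max 0 T" using \<tau> by simp
    note gbD = growth_boundD[OF gb good_solution_axioms \<tau>T d]
    have growth: "norm (vf (x t)) \<le> L * norm (x t) + L" if t: "t \<in> {0..\<tau>}" for t
    proof -
      have one: "B \<le> 7 * B * (1 + norm (x t))" "B * (1 + norm (x t)) \<le> 7 * B * (1 + norm (x t))"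
        using B0 mult_nonneg_nonneg[OF B0 norm_ge_zero[of "x t"]] by (simp_all add: distrib_left)
      have "norm (vf (x t)) \<le> 16 * (7 * B * (1 + norm (x t)))"
      proof (rule state_norm_le)
        show "\<bar>pr (vf (x t)) i \<xi>\<bar> \<le> 7 * B * (1 + norm (x t))" if "i < 9" for i \<xi>
        proof (cases "i < 4")
          case True
          then show ?thesis using gbD(2)[OF t, of i \<xi>] one(1) unfolding pr_vf by linarith
        next
          case False
          then show ?thesis using gbD(3)[OF t, of i \<xi>] that one(2) unfolding pr_vf by force
        qed
        show "L2_norm (pr (vf (x t)) i) \<le> 7 * B * (1 + norm (x t))" if i: "2 \<le> i" "i < 9" for i
        proof -
          have "L2_norm (pr (vf (x t)) i) \<le> B * (\<Sum>j=2..<9. L2_norm (pr (x t) j))"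
            using gbD(4)[OF t i] unfolding pr_vf .
          also have "\<dots> \<le> B * (\<Sum>j=2..<(9::nat). norm (x t))"
            by (intro mult_left_mono[OF _ B0] sum_mono state_L2_le) auto
          also have "\<dots> \<le> 7 * B * (1 + norm (x t))" using B0 by (simp add: algebra_simps)
          finally show ?thesis .
        qed
      qed
      then show ?thesis unfolding L_def by (simp add: algebra_simps)
    qed
    have L0: "0 \<le> L" unfolding L_def using B0 by simp
    have "norm (x \<tau>) \<le> (norm (x 0) + L * \<tau>) * exp (L * \<tau>)"
      by (rule gronwall_norm[where x=x and x'="\<lambda>t. vf (x t)"])
         (use x(2) growth L0 \<tau> in \<open>auto simp: ode_on_def\<close>)
    also have "\<dots> \<le> (norm x0 + L * max 0 T) * exp (L * max 0 T)"
    proof (rule mult_mono)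
      have LT: "L * \<tau> \<le> L * max 0 T" by (rule mult_left_mono[OF \<tau>T L0])
      then show "norm (x 0) + L * \<tau> \<le> norm x0 + L * max 0 T" unfolding x(1) by (rule add_left_mono)
      show "exp (L * \<tau>) \<le> exp (L * max 0 T)" using LT by (simp only: exp_le_cancel_iff)
      show "0 \<le> norm x0 + L * max 0 T" using L0 by (intro add_nonneg_nonneg mult_nonneg_nonneg) auto
    qed simp
    finally show ?thesis .
  qed
  then show "\<exists>N. \<forall>\<tau>\<in>{0..T}. \<forall>x. x 0 = x0 \<longrightarrow> ode_on vf x \<tau> \<longrightarrow> norm (x \<tau>) \<le> N" by blast
qed

section \<open>From pointwise states to the space E\<close>

definition J_tuple :: "profile \<Rightarrow> tuple5" where "J_tuple a = (a 0, a 2, a 3, a 8, a 1)"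

definition J :: "state \<Rightarrow> E" where "J x = abs_E (J_tuple (pr x))"

lemma bounded_borel_Linf:
  assumes "bounded_borel f"
  shows "f \<in> Linf"
proof -
  obtain C where C: "\<And>x. \<bar>f x\<bar> \<le> C" using bounded_borelE[OF assms] by metis
  show ?thesis by (rule Linf_norm_leI(1)[OF bounded_borel_measurable[OF assms]]) (rule AE_I2, rule C)
qed

lemma E_rel_J: "E_rel (J_tuple (pr x)) (J_tuple (pr x))"
proof -
  have V': "pr x i \<in> V" if "i < 2" for i
  proof -
    have P: "primitive (pr x i) (pr x (i + 4))" using that by (intro prD) simp
    have "pr x (i + 4) \<in> L2" using that by (intro prD) simp_all
    then show ?thesis unfolding V_def
      using primitive_has_weak_deriv[OF P] primitive_continuous[OF P] bounded_borel_Linf[OF prD(1)] by blast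
  qed
  have H': "pr x i \<in> H1" if "i = 2 \<or> i = 3" for i
  proof -
    have P: "primitive (pr x i) (pr x (i + 4))" using that by (intro prD) auto
    have "pr x (i + 4) \<in> L2" "pr x i \<in> L2" using that by (auto intro: prD)
    then show ?thesis unfolding H1_def
      using primitive_has_weak_deriv[OF P] primitive_continuous[OF P] by blast
  qed
  show ?thesis unfolding J_tuple_def
    using V'[of 0] V'[of 1] H'[of 2] H'[of 3] prD(2)[of 8 x] bounded_borel_Linf[OF prD(1)[of x 8]] by simp
qed

lemma abs_E_eqI: "E_rel s t \<Longrightarrow> abs_E s = abs_E t"
  using Quotient3_rel[OF Quotient3_E] by blast

lemma rep_abs_E: "E_rel s s \<Longrightarrow> E_rel s (rep_E (abs_E s))"
  by (rule rep_abs_rsp[OF Quotient3_E])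

lemma abs_E_accessors:
  assumes "E_rel (\<zeta>, U, \<Gamma>, R, H) (\<zeta>, U, \<Gamma>, R, H)"
  shows "zeta_of (abs_E (\<zeta>, U, \<Gamma>, R, H)) = \<zeta>" "U_of (abs_E (\<zeta>, U, \<Gamma>, R, H)) = U"
    "Gamma_of (abs_E (\<zeta>, U, \<Gamma>, R, H)) = \<Gamma>" "H_of (abs_E (\<zeta>, U, \<Gamma>, R, H)) = H"
    "AE x in lborel. R_of (abs_E (\<zeta>, U, \<Gamma>, R, H)) x = R x" "R_of (abs_E (\<zeta>, U, \<Gamma>, R, H)) \<in> borel_measurable borel"
proof -
  show "zeta_of (abs_E (\<zeta>, U, \<Gamma>, R, H)) = \<zeta>" "U_of (abs_E (\<zeta>, U, \<Gamma>, R, H)) = U"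
    "Gamma_of (abs_E (\<zeta>, U, \<Gamma>, R, H)) = \<Gamma>" "H_of (abs_E (\<zeta>, U, \<Gamma>, R, H)) = H"
    using zeta_of.abs_eq[OF assms] U_of.abs_eq[OF assms] Gamma_of.abs_eq[OF assms] H_of.abs_eq[OF assms] by simp_all
  have e0: "E_rel (\<zeta>, U, \<Gamma>, R, H) (rep_E (abs_E (\<zeta>, U, \<Gamma>, R, H)))" by (rule rep_abs_E[OF assms])
  obtain \<zeta>' U' \<Gamma>' R' H' where r: "rep_E (abs_E (\<zeta>, U, \<Gamma>, R, H)) = (\<zeta>', U', \<Gamma>', R', H')"
    by (rule prod_cases5)
  have e1: "E_rel (\<zeta>, U, \<Gamma>, R, H) (\<zeta>', U', \<Gamma>', R', H')" using e0 unfolding r .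
  have e: "AE x in lborel. R x = R' x" and L: "R' \<in> Linf" using e1 by (simp_all only: E_rel.simps Int_iff)
  have R': "R_of (abs_E (\<zeta>, U, \<Gamma>, R, H)) = R'" unfolding R_of_def r by simp
  show "AE x in lborel. R_of (abs_E (\<zeta>, U, \<Gamma>, R, H)) x = R x" unfolding R' using e by eventually_elim simp
  show "R_of (abs_E (\<zeta>, U, \<Gamma>, R, H)) \<in> borel_measurable borel" unfolding R' by (rule Linf_measurable[OF L])
qed

lemma J_accessors:
  "zeta_of (J x) = pr x 0" "U_of (J x) = pr x 2" "Gamma_of (J x) = pr x 3" "H_of (J x) = pr x 1"
  "AE t in lborel. R_of (J x) t = pr x 8 t" "R_of (J x) \<in> borel_measurable borel"
  using abs_E_accessors[OF E_rel_J[unfolded J_tuple_def]] unfolding J_def J_tuple_def by simp_all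

lemma J_add: "J (x + y) = J x + J y"
  unfolding J_def plus_E.abs_eq[OF E_rel_J E_rel_J] by (simp add: J_tuple_def pr_ops)

lemma J_scaleR: "J (c *\<^sub>R x) = c *\<^sub>R J x"
  unfolding J_def scaleR_E.abs_eq[OF E_rel_J] by (simp add: J_tuple_def pr_ops)

section \<open>Comparison of the norms of \<open>state\<close> and \<open>E\<close>\<close>

lemma wderiv_pr:
  assumes "i < 4"
  shows "AE t in lborel. wderiv (pr x i) t = pr x (i + 4) t" "L2_norm (wderiv (pr x i)) = L2_norm (pr x (i + 4))"
    "wderiv (pr x i) \<in> borel_measurable borel"
proof -
  note P = prD(3)[OF assms, of x]
  have L: "pr x (i + 4) \<in> L2" using assms by (intro prD) auto
  show "AE t in lborel. wderiv (pr x i) t = pr x (i + 4) t" by (rule primitive_wderiv_AE[OF P])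
  show "L2_norm (wderiv (pr x i)) = L2_norm (pr x (i + 4))" "wderiv (pr x i) \<in> borel_measurable borel"
    using weak_deriv_L2_wderiv[OF primitive_has_weak_deriv[OF P] L] L2_measurable by auto
qed

lemma norm_J:
  "norm (J x) = Linf_norm (pr x 0) + L2_norm (pr x 4) + sqrt ((L2_norm (pr x 2))\<^sup>2 + (L2_norm (pr x 6))\<^sup>2)
     + sqrt ((L2_norm (pr x 3))\<^sup>2 + (L2_norm (pr x 7))\<^sup>2) + Linf_norm (pr x 8) + L2_norm (pr x 8)
     + (Linf_norm (pr x 1) + L2_norm (pr x 5))"
  using norm_E.abs_eq[OF E_rel_J[of x]] wderiv_pr(2)[of 0 x] wderiv_pr(2)[of 1 x] wderiv_pr(2)[of 2 x] wderiv_pr(2)[of 3 x]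
  unfolding J_def J_tuple_def V_norm_def H1_norm_def by simp

text \<open>10 = 6 + 2 * 2: six single terms and two square roots, each at most twice C.\<close>

lemma norm_J_le:
  assumes "\<And>t. \<bar>pr x 0 t\<bar> \<le> C" "\<And>t. \<bar>pr x 1 t\<bar> \<le> C" "\<And>t. \<bar>pr x 8 t\<bar> \<le> C"
    and L: "\<And>i. 2 \<le> i \<Longrightarrow> i < 9 \<Longrightarrow> L2_norm (pr x i) \<le> C"
  shows "norm (J x) \<le> 10 * C"
proof -
  have C: "0 \<le> C" using assms(1)[of 0] by linarith
  have s: "sqrt ((L2_norm (pr x i))\<^sup>2 + (L2_norm (pr x j))\<^sup>2) \<le> 2 * C" if "2 \<le> i" "i < 9" "2 \<le> j" "j < 9" for i j
  proof -
    have "sqrt ((L2_norm (pr x i))\<^sup>2 + (L2_norm (pr x j))\<^sup>2) \<le> L2_norm (pr x i) + L2_norm (pr x j)"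
      by (rule sqrt_sum_squares_le_sum[OF L2_norm_nonneg L2_norm_nonneg])
    then show ?thesis using L[OF that(1,2)] L[OF that(3,4)] by linarith
  qed
  have n: "Linf_norm (pr x i) \<le> C" if "\<And>t. \<bar>pr x i t\<bar> \<le> C" for i
    by (rule Linf_norm_leI(2)[OF bounded_borel_measurable[OF prD(1)]]) (rule AE_I2, rule that)
  have ss: "sqrt ((L2_norm (pr x 2))\<^sup>2 + (L2_norm (pr x 6))\<^sup>2) \<le> 2 * C"
    "sqrt ((L2_norm (pr x 3))\<^sup>2 + (L2_norm (pr x 7))\<^sup>2) \<le> 2 * C" by (rule s; simp)+
  have l: "L2_norm (pr x 4) \<le> C" "L2_norm (pr x 5) \<le> C" "L2_norm (pr x 8) \<le> C" by (rule L; simp)+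
  show ?thesis unfolding norm_J using n[OF assms(1)] n[OF assms(2)] n[OF assms(3)] ss l by linarith
qed

lemma continuous_AE_le:
  fixes f :: "real \<Rightarrow> real"
  assumes c: "continuous_on UNIV f" and z: "AE x in lborel. \<bar>f x\<bar> \<le> C"
  shows "\<bar>f x\<bar> \<le> C"
proof -
  have "(\<lambda>x. max 0 (\<bar>f x\<bar> - C)) = (\<lambda>x. 0)"
    by (rule continuous_AE_zero) (intro continuous_intros c, use z in eventually_elim, simp)
  then have "max 0 (\<bar>f x\<bar> - C) = 0" by (rule fun_cong)
  then show ?thesis by simp
qed

text \<open>What the norm of \<open>E\<close> gives back; the 4 comes from the Sobolev inequality
  for U and \<Gamma>. Suprema of components 4 to 7 are not recovered, so a ball of \<open>E\<close>
  is not bounded in \<open>state\<close>.\<close>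

lemma J_bounds:
  "i < 4 \<Longrightarrow> \<bar>pr x i t\<bar> \<le> 4 * norm (J x)"
  "AE t in lborel. \<bar>pr x 8 t\<bar> \<le> norm (J x)"
  "2 \<le> i \<Longrightarrow> i < 9 \<Longrightarrow> L2_norm (pr x i) \<le> norm (J x)"
proof -
  have n: "0 \<le> Linf_norm (pr x i)" for i by (rule Linf_norm_nonneg[OF bounded_borel_Linf[OF prD(1)]])
  note l = L2_norm_nonneg[of "pr x 4"] L2_norm_nonneg[of "pr x 5"] L2_norm_nonneg[of "pr x 8"]
  note s = real_sqrt_sum_squares_ge1[of "L2_norm (pr x 2)" "L2_norm (pr x 6)"] real_sqrt_sum_squares_ge2[of "L2_norm (pr x 6)" "L2_norm (pr x 2)"]
    real_sqrt_sum_squares_ge1[of "L2_norm (pr x 3)" "L2_norm (pr x 7)"] real_sqrt_sum_squares_ge2[of "L2_norm (pr x 7)" "L2_norm (pr x 3)"]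
    L2_norm_nonneg[of "pr x 2"] L2_norm_nonneg[of "pr x 3"]
  have L: "L2_norm (pr x i) \<le> norm (J x)" if i: "2 \<le> i" "i < 9" for i
  proof -
    consider "i = 2" | "i = 3" | "i = 4" | "i = 5" | "i = 6" | "i = 7" | "i = 8" using i by linarith
    then show ?thesis unfolding norm_J using n[of 0] n[of 1] n[of 8] l s by (cases; hypsubst; linarith)
  qed
  then show "2 \<le> i \<Longrightarrow> i < 9 \<Longrightarrow> L2_norm (pr x i) \<le> norm (J x)" .
  have I: "Linf_norm (pr x 0) \<le> norm (J x)" "Linf_norm (pr x 1) \<le> norm (J x)" "Linf_norm (pr x 8) \<le> norm (J x)"
    unfolding norm_J using n[of 0] n[of 1] n[of 8] l s by linarith+
  show "AE t in lborel. \<bar>pr x 8 t\<bar> \<le> norm (J x)"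
    using Linf_AE[OF bounded_borel_Linf[OF prD(1)], of x 8] I(3) by (auto elim: eventually_mono)
  show "i < 4 \<Longrightarrow> \<bar>pr x i t\<bar> \<le> 4 * norm (J x)"
  proof -
    assume i: "i < 4"
    have P: "primitive (pr x i) (pr x (i + 4))" by (rule prD(3)[OF i])
    consider "i = 0 \<or> i = 1" | "i = 2 \<or> i = 3" using i by linarith
    then show ?thesis
    proof cases
      case 1
      have "\<bar>pr x i t\<bar> \<le> Linf_norm (pr x i)"
        by (rule continuous_AE_le[OF primitive_continuous[OF P] Linf_AE[OF bounded_borel_Linf[OF prD(1)]]])
      also have "\<dots> \<le> norm (J x)" using 1 I by auto
      also have "\<dots> \<le> 4 * norm (J x)" by simp
      finally show ?thesis .
    next
      case 2
      have "pr x i \<in> L2" "pr x (i + 4) \<in> L2" using 2 by (auto intro: prD)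
      then have S: "\<bar>pr x i t\<bar> \<le> 2 * (L2_norm (pr x i) + L2_norm (pr x (i + 4)))" by (rule primitive_sup_le[OF P])
      have "L2_norm (pr x i) \<le> norm (J x)" "L2_norm (pr x (i + 4)) \<le> norm (J x)" using 2 by (auto intro!: L)
      then have "2 * (L2_norm (pr x i) + L2_norm (pr x (i + 4))) \<le> 2 * (norm (J x) + norm (J x))"
        by (intro mult_left_mono add_mono) simp_all
      then show ?thesis using S by simp
    qed
  qed
qed

lemma J_diff: "J (x - y) = J x - J y"
  unfolding minus_state_def minus_E_def J_add J_scaleR ..

lemma bounded_linear_J: "bounded_linear J"
proof (rule bounded_linear_intro[where K=10])
  fix x
  have "norm (J x) \<le> 10 * norm x"
    by (rule norm_J_le) (rule state_sup_le state_L2_le; assumption?)+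
  then show "norm (J x) \<le> norm x * 10" by simp
qed (rule J_add J_scaleR)+

section \<open>Identification of the vector field\<close>

lemma y_of_J: "AE t in lborel. wderiv (y_of (J x)) t = 1 + pr x 4 t" "wderiv (y_of (J x)) \<in> borel_measurable borel"
proof -
  have "primitive (\<lambda>t. pr x 0 t + t) (\<lambda>t. pr x 4 t + 1)"
    using primitive_add[OF _ primitive_id, of "pr x 0" "pr x 4"] prD(3)[of 0 x] by simp
  then have P: "primitive (y_of (J x)) (\<lambda>t. pr x 4 t + 1)"
    by (simp add: y_of_def[abs_def] J_accessors)
  show "AE t in lborel. wderiv (y_of (J x)) t = 1 + pr x 4 t"
    using primitive_wderiv_AE[OF P] by (simp add: add.commute)
  show "wderiv (y_of (J x)) \<in> borel_measurable borel"
    using has_weak_deriv_wderiv[OF primitive_has_weak_deriv[OF P]] unfolding has_weak_deriv_def locally_integrable_def by blast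
qed

lemma source_J:
  "AE t in lborel. source1 (J x) t = src1 (pr x) t" "source1 (J x) \<in> borel_measurable borel"
  "AE t in lborel. R_of (J x) t * wderiv (U_of (J x)) t = src2 (pr x) t"
  "(\<lambda>t. R_of (J x) t * wderiv (U_of (J x)) t) \<in> borel_measurable borel"
  "AE t in lborel. Gamma_of (J x) t * wderiv (U_of (J x)) t = src3 (pr x) t"
  "(\<lambda>t. Gamma_of (J x) t * wderiv (U_of (J x)) t) \<in> borel_measurable borel"
proof -
  have w1: "AE t in lborel. wderiv (H_of (J x)) t = pr x 5 t" and w2: "AE t in lborel. wderiv (U_of (J x)) t = pr x 6 t"
    using wderiv_pr(1)[of 1 x] wderiv_pr(1)[of 2 x] by (simp_all add: J_accessors)
  note R = J_accessors(5)[of x]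
  show "AE t in lborel. source1 (J x) t = src1 (pr x) t"
    using y_of_J(1)[of x] w1 R
  proof eventually_elim
    case (elim t)
    show ?case unfolding source1_def elim src1_def by (simp add: J_accessors)
  qed
  show "AE t in lborel. R_of (J x) t * wderiv (U_of (J x)) t = src2 (pr x) t"
    using w2 R by eventually_elim (simp add: src2_def)
  show "AE t in lborel. Gamma_of (J x) t * wderiv (U_of (J x)) t = src3 (pr x) t"
    using w2 by eventually_elim (simp add: src3_def J_accessors)
  have "wderiv (pr x 1) \<in> borel_measurable borel" "wderiv (pr x 2) \<in> borel_measurable borel"
    by (rule wderiv_pr(3); simp)+
  note [measurable] = this y_of_J(2) J_accessors(6)
    bounded_borel_measurable[OF prD(1)[of x]]
  show "source1 (J x) \<in> borel_measurable borel"
    unfolding source1_def[abs_def] J_accessors by measurable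
  show "(\<lambda>t. R_of (J x) t * wderiv (U_of (J x)) t) \<in> borel_measurable borel"
     "(\<lambda>t. Gamma_of (J x) t * wderiv (U_of (J x)) t) \<in> borel_measurable borel"
    unfolding J_accessors by measurable
qed

lemma kernel_J: "kernel (J x) \<xi> \<eta> = ker (pr x 0) \<xi> \<eta>"
  unfolding kernel_def ker_def y_of_def J_accessors ..

lemma PQ_J:
  "P1 (J x) = pP1 (pr x)" "P2 (J x) = pP2 (pr x)" "P3 (J x) = pP3 (pr x)"
  "Q1 (J x) = pQ1 (pr x)" "Q2 (J x) = pQ2 (pr x)" "Q3 (J x) = pQ3 (pr x)"
proof -
  note b = sup_norm_upper[OF prD(1)[of x 0]]
  note k = exp_kernel_ker[OF bounded_borel_measurable[OF prD(1)] b]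
  note m = src_admissible(4-6)[OF admissible_pr[of x], THEN bounded_borel_measurable]
  note S = source_J[of x]
  note C1 = kernel_op_cong_AE[OF k(1) S(2) m(1) S(1)] kernel_op_cong_AE[OF k(2) S(2) m(1) S(1)]
  note C2 = kernel_op_cong_AE[OF k(1) S(4) m(2) S(3)] kernel_op_cong_AE[OF k(2) S(4) m(2) S(3)]
  note C3 = kernel_op_cong_AE[OF k(1) S(6) m(3) S(5)] kernel_op_cong_AE[OF k(2) S(6) m(3) S(5)]
  show "P1 (J x) = pP1 (pr x)" "P2 (J x) = pP2 (pr x)" "P3 (J x) = pP3 (pr x)"
    "Q1 (J x) = pQ1 (pr x)" "Q2 (J x) = pQ2 (pr x)" "Q3 (J x) = pQ3 (pr x)"
    unfolding fun_eq_iff P1_def P2_def P3_def Q1_def Q2_def Q3_def pP1_def pP2_def pP3_def pQ1_def pQ2_def pQ3_def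
      C1[symmetric] C2[symmetric] C3[symmetric]
    by (simp_all add: kernel_op_def kernel_J sker_def mult.assoc)
qed

lemma lagrangian_rhs_J: "lagrangian_rhs (J x) (J (vf x))"
proof -
  have "AE \<xi> in lborel. R_of (J (vf x)) \<xi> = - P2 (J x) \<xi> - Q3 (J x) \<xi>"
    using J_accessors(5)[of "vf x"] by eventually_elim (simp add: PQ_J pr_vf rhs_simps)
  then show ?thesis
    unfolding lagrangian_rhs_def by (simp add: J_accessors PQ_J pr_vf rhs_simps del: One_nat_def)
qed

text \<open>R is fixed only almost everywhere, which is equality in \<open>E\<close>. Hence the time
  derivative of any solution is forced by its current value, and uniqueness becomes a question about
  an ODE in \<open>E\<close>.\<close>

lemma lagrangian_rhs_unique:
  assumes "lagrangian_rhs X D" "lagrangian_rhs X D'"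
  shows "D = D'"
proof -
  have "\<exists>\<zeta> U \<Gamma> R H. D = abs_E (\<zeta>, U, \<Gamma>, R, H) \<and> E_rel (\<zeta>, U, \<Gamma>, R, H) (\<zeta>, U, \<Gamma>, R, H)" for D
  proof (induction D rule: E.abs_induct)
    case (1 y)
    then show ?case by (cases y) blast
  qed
  then obtain \<zeta> U \<Gamma> R H \<zeta>' U' \<Gamma>' R' H' where D: "D = abs_E (\<zeta>, U, \<Gamma>, R, H)" "E_rel (\<zeta>, U, \<Gamma>, R, H) (\<zeta>, U, \<Gamma>, R, H)"
    and D': "D' = abs_E (\<zeta>', U', \<Gamma>', R', H')" "E_rel (\<zeta>', U', \<Gamma>', R', H') (\<zeta>', U', \<Gamma>', R', H')"
    by metis
  note a = abs_E_accessors[OF D(2), folded D(1)] and a' = abs_E_accessors[OF D'(2), folded D'(1)]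
  have "\<zeta> = \<zeta>'" "U = U'" "\<Gamma> = \<Gamma>'" "H = H'"
    using assms unfolding lagrangian_rhs_def a a' by (simp_all add: fun_eq_iff)
  moreover have "AE x in lborel. R x = R' x"
  proof -
    have "AE x in lborel. R_of D x = - P2 X x - Q3 X x" "AE x in lborel. R_of D' x = - P2 X x - Q3 X x"
      using assms unfolding lagrangian_rhs_def by blast+
    then show ?thesis using a(5) a'(5) by eventually_elim simp
  qed
  ultimately show ?thesis using D D' by (auto intro!: abs_E_eqI)
qed

lemma good_J:
  assumes g: "good (pr x)"
  shows "J x \<in> G_set"
proof -
  have W: "pr x i \<in> W1inf" if "i < 4" for i
    unfolding W1inf_def
    using bounded_borel_Linf[OF prD(1)] primitive_has_weak_deriv[OF prD(3)[OF that]] by blast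
  have w: "AE t in lborel. wderiv (H_of (J x)) t = pr x 5 t" "AE t in lborel. wderiv (U_of (J x)) t = pr x 6 t"
    "AE t in lborel. wderiv (Gamma_of (J x)) t = pr x 7 t"
    using wderiv_pr(1)[of 1 x] wderiv_pr(1)[of 2 x] wderiv_pr(1)[of 3 x] by (simp_all add: J_accessors)
  note y = y_of_J(1)[of x] and R = J_accessors(5)[of x]
  have 1: "AE \<xi> in lborel. wderiv (y_of (J x)) \<xi> \<ge> 0 \<and> wderiv (H_of (J x)) \<xi> \<ge> 0 \<and>
        wderiv (y_of (J x)) \<xi> + wderiv (H_of (J x)) \<xi> > 0"
    using y w(1) by eventually_elim (use g in \<open>simp add: good_def\<close>)
  have 2: "AE \<xi> in lborel. R_of (J x) \<xi> * wderiv (y_of (J x)) \<xi> = wderiv (Gamma_of (J x)) \<xi>"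
    using y w(3) R by eventually_elim (use g in \<open>simp add: good_def\<close>)
  have 3: "AE \<xi> in lborel. wderiv (y_of (J x)) \<xi> * wderiv (H_of (J x)) \<xi> =
        (wderiv (y_of (J x)) \<xi>)\<^sup>2 * ((U_of (J x) \<xi>)\<^sup>2 + (Gamma_of (J x) \<xi>)\<^sup>2 + (R_of (J x) \<xi>)\<^sup>2)
        + (wderiv (U_of (J x)) \<xi>)\<^sup>2"
    using y w(1,2) R
  proof eventually_elim
    case (elim \<xi>)
    show ?case unfolding elim unfolding J_accessors using g by (simp add: good_def)
  qed
  show ?thesis
    unfolding G_set_def using W[of 0] W[of 1] W[of 2] W[of 3] 1 2 3 g
    by (simp add: J_accessors(1-4) good_def)
qed

text \<open>On the exceptional null set the representatives are reset to those of the trivial flow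
  \<open>y\<^sub>\<xi> = 1\<close>, \<open>U\<^sub>\<xi> = \<Gamma>\<^sub>\<xi> = R = 0\<close>, so that the constraints hold everywhere.\<close>

lemma G_set_lift:
  assumes X: "X \<in> G_set"
  shows "\<exists>x. good (pr x) \<and> J x = X \<and> (\<forall>t. \<bar>pr x 8 t\<bar> \<le> norm X)"
proof -
  have "\<exists>\<zeta> U \<Gamma> R H. X = abs_E (\<zeta>, U, \<Gamma>, R, H) \<and> E_rel (\<zeta>, U, \<Gamma>, R, H) (\<zeta>, U, \<Gamma>, R, H)"
  proof (induction X rule: E.abs_induct)
    case (1 y)
    then show ?case by (cases y) blast
  qed
  then obtain \<zeta> U \<Gamma> R H where Xe: "X = abs_E (\<zeta>, U, \<Gamma>, R, H)" and rel: "E_rel (\<zeta>, U, \<Gamma>, R, H) (\<zeta>, U, \<Gamma>, R, H)"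
    by blast
  note acc = abs_E_accessors[OF rel, folded Xe]
  have sp: "\<zeta> \<in> V" "U \<in> H1" "\<Gamma> \<in> H1" "R \<in> Linf" "R \<in> L2" "H \<in> V" using rel by auto
  have W: "\<zeta> \<in> W1inf" "U \<in> W1inf" "\<Gamma> \<in> W1inf" "H \<in> W1inf"
    using X unfolding G_set_def mem_Collect_eq acc(1-4) by blast+
  have wd: "has_weak_deriv F (wderiv F)" "\<exists>C. AE t in lborel. \<bar>wderiv F t\<bar> \<le> C" "wderiv F \<in> borel_measurable borel" "F \<in> Linf"
    if F: "F \<in> W1inf" for F
  proof -
    obtain g where g: "F \<in> Linf" "g \<in> Linf" "has_weak_deriv F g" using F unfolding W1inf_def by blast
    show "has_weak_deriv F (wderiv F)" by (rule has_weak_deriv_wderiv[OF g(3)])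
    then show "wderiv F \<in> borel_measurable borel" unfolding has_weak_deriv_def locally_integrable_def by blast
    have "AE t in lborel. \<bar>wderiv F t\<bar> \<le> Linf_norm g"
      using wderiv_AE[OF g(3)] Linf_AE[OF g(2)] by eventually_elim simp
    then show "\<exists>C. AE t in lborel. \<bar>wderiv F t\<bar> \<le> C" by blast
    show "F \<in> Linf" by (rule g(1))
  qed
  obtain C1 C2 C3 C4 where C': "AE t in lborel. \<bar>wderiv \<zeta> t\<bar> \<le> C1" "AE t in lborel. \<bar>wderiv U t\<bar> \<le> C2"
    "AE t in lborel. \<bar>wderiv \<Gamma> t\<bar> \<le> C3" "AE t in lborel. \<bar>wderiv H t\<bar> \<le> C4"
    using wd(2)[OF W(1)] wd(2)[OF W(2)] wd(2)[OF W(3)] wd(2)[OF W(4)] by blast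
  define C where "C = max C1 (max C2 (max C3 C4))"
  have Y: "has_weak_deriv (y_of X) (\<lambda>t. wderiv \<zeta> t + 1)"
    using has_weak_deriv_add[OF wd(1)[OF W(1)] primitive_has_weak_deriv[OF primitive_id]]
    unfolding y_of_def[abs_def] acc by simp
  \<comment> \<open>All almost-everywhere conditions are collected in one predicate, so that a
    single null set N serves every component.\<close>
  define \<Phi> where "\<Phi> = (\<lambda>t. \<bar>wderiv \<zeta> t\<bar> \<le> C \<and> \<bar>wderiv U t\<bar> \<le> C \<and> \<bar>wderiv \<Gamma> t\<bar> \<le> C \<and> \<bar>wderiv H t\<bar> \<le> C \<and>
      \<bar>R t\<bar> \<le> Linf_norm R \<and> 0 \<le> 1 + wderiv \<zeta> t \<and> 0 \<le> wderiv H t \<and> 0 < 1 + wderiv \<zeta> t + wderiv H t \<and>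
      R t * (1 + wderiv \<zeta> t) = wderiv \<Gamma> t \<and>
      (1 + wderiv \<zeta> t) * wderiv H t = (1 + wderiv \<zeta> t)\<^sup>2 * ((U t)\<^sup>2 + (\<Gamma> t)\<^sup>2 + (R t)\<^sup>2) + (wderiv U t)\<^sup>2)"
  have G1: "AE \<xi> in lborel. wderiv (y_of X) \<xi> \<ge> 0 \<and> wderiv H \<xi> \<ge> 0 \<and> wderiv (y_of X) \<xi> + wderiv H \<xi> > 0"
    and G0: "(H \<longlongrightarrow> 0) at_bot"
    and G2: "AE \<xi> in lborel. R_of X \<xi> * wderiv (y_of X) \<xi> = wderiv \<Gamma> \<xi>"
    and G3: "AE \<xi> in lborel. wderiv (y_of X) \<xi> * wderiv H \<xi> =
        (wderiv (y_of X) \<xi>)\<^sup>2 * ((U \<xi>)\<^sup>2 + (\<Gamma> \<xi>)\<^sup>2 + (R_of X \<xi>)\<^sup>2) + (wderiv U \<xi>)\<^sup>2"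
    using X unfolding G_set_def mem_Collect_eq acc(1-4) by blast+
  have "AE t in lborel. \<Phi> t"
    using C' G1 G2 G3 acc(5) wderiv_AE[OF Y] Linf_AE[OF sp(4)]
  proof eventually_elim
    case (elim t)
    have y: "wderiv (y_of X) t = 1 + wderiv \<zeta> t" using elim(9) by simp
    show ?case
      unfolding \<Phi>_def C_def using elim(1-4,10) elim(5-7)[unfolded y elim(8)] by (simp add: le_max_iff_disj)
  qed
  then obtain N where N: "N \<in> null_sets lborel" "{t \<in> space lborel. \<not> \<Phi> t} \<subseteq> N"
    unfolding eventually_ae_filter by blast
  have \<Phi>: "\<Phi> t" if "t \<notin> N" for t using N(2) that by auto
  have mN[measurable]: "N \<in> sets borel" using N(1) by auto
  have aeN: "AE t in lborel. t \<notin> N" by (rule AE_not_in[OF N(1)])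
  \<comment> \<open>With y_xi = 1 and U_xi = R = 0 on N, the energy identity leaves only the value
    U^2 + \<Gamma>^2 for H_xi there.\<close>
  define a :: profile where "a = (\<lambda>i t.
     if i = 0 then \<zeta> t else if i = 1 then H t else if i = 2 then U t else if i = 3 then \<Gamma> t
     else if i = 4 then (if t \<in> N then 0 else wderiv \<zeta> t)
     else if i = 5 then (if t \<in> N then (U t)\<^sup>2 + (\<Gamma> t)\<^sup>2 else wderiv H t)
     else if i = 6 then (if t \<in> N then 0 else wderiv U t)
     else if i = 7 then (if t \<in> N then 0 else wderiv \<Gamma> t)
     else if i = 8 then (if t \<in> N then 0 else R t) else 0)"
  have a: "a 0 = \<zeta>" "a 1 = H" "a 2 = U" "a 3 = \<Gamma>" "a 4 = (\<lambda>t. if t \<in> N then 0 else wderiv \<zeta> t)"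
    "a 5 = (\<lambda>t. if t \<in> N then (U t)\<^sup>2 + (\<Gamma> t)\<^sup>2 else wderiv H t)" "a 6 = (\<lambda>t. if t \<in> N then 0 else wderiv U t)"
    "a 7 = (\<lambda>t. if t \<in> N then 0 else wderiv \<Gamma> t)" "a 8 = (\<lambda>t. if t \<in> N then 0 else R t)"
    "\<And>i. 9 \<le> i \<Longrightarrow> a i = (\<lambda>t. 0)"
    unfolding a_def by (auto simp: fun_eq_iff)
  have cont: "continuous_on UNIV \<zeta>" "continuous_on UNIV H" "continuous_on UNIV U" "continuous_on UNIV \<Gamma>"
    using sp unfolding V_def H1_def by auto
  have bF: "bounded_borel F" if "F \<in> W1inf" "continuous_on UNIV F" for F
    by (rule bounded_borelI[OF Linf_measurable continuous_AE_le[OF that(2) Linf_AE]]) (rule wd(4)[OF that(1)])+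
  note b4 = bF[OF W(1) cont(1)] bF[OF W(4) cont(2)] bF[OF W(2) cont(3)] bF[OF W(3) cont(4)]
  note [measurable] = wd(3)[OF W(1)] wd(3)[OF W(2)] wd(3)[OF W(3)] wd(3)[OF W(4)] Linf_measurable[OF sp(4)]
    bounded_borel_measurable[OF b4(3)] bounded_borel_measurable[OF b4(4)]
  \<comment> \<open>The a priori bounds need R pointwise; resetting it on N makes its supremum no
    larger than the essential one, hence bounded on balls of \<open>E\<close>.\<close>
  have b8: "\<bar>a 8 t\<bar> \<le> Linf_norm R" for t
    unfolding a using \<Phi>[of t] Linf_norm_nonneg[OF sp(4)] unfolding \<Phi>_def by auto
  have b5: "bounded_borel (a 4)" "bounded_borel (a 5)" "bounded_borel (a 6)" "bounded_borel (a 7)" "bounded_borel (a 8)"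
  proof -
    have glue: "bounded_borel (\<lambda>t. if t \<in> N then g t else f t)"
      if g: "bounded_borel g" and f[measurable]: "f \<in> borel_measurable borel" and le: "\<And>t. t \<notin> N \<Longrightarrow> \<bar>f t\<bar> \<le> D" for f g D
    proof -
      obtain D' where D': "D' \<ge> 0" "\<And>t. \<bar>g t\<bar> \<le> D'" using bounded_borelE[OF g] by metis
      note [measurable] = bounded_borel_measurable[OF g]
      show ?thesis
      proof (rule bounded_borelI)
        show "(\<lambda>t. if t \<in> N then g t else f t) \<in> borel_measurable borel" by measurable
        show "\<bar>if t \<in> N then g t else f t\<bar> \<le> max D D'" for t
          using le[of t] D'(2)[of t] by (simp add: le_max_iff_disj)
      qed
    qed
    have b: "\<bar>wderiv \<zeta> t\<bar> \<le> C" "\<bar>wderiv H t\<bar> \<le> C" "\<bar>wderiv U t\<bar> \<le> C" "\<bar>wderiv \<Gamma> t\<bar> \<le> C" "\<bar>R t\<bar> \<le> Linf_norm R"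
      if "t \<notin> N" for t using \<Phi>[OF that] unfolding \<Phi>_def by blast+
    show "bounded_borel (a 4)" unfolding a by (rule glue[OF bounded_borel_const wd(3)[OF W(1)] b(1)])
    show "bounded_borel (a 5)" unfolding a
      by (rule glue[OF bounded_borel_add[OF bounded_borel_power[OF b4(3)] bounded_borel_power[OF b4(4)]] wd(3)[OF W(4)] b(2)])
    show "bounded_borel (a 6)" unfolding a by (rule glue[OF bounded_borel_const wd(3)[OF W(2)] b(3)])
    show "bounded_borel (a 7)" unfolding a by (rule glue[OF bounded_borel_const wd(3)[OF W(3)] b(4)])
    show "bounded_borel (a 8)" unfolding a by (rule glue[OF bounded_borel_const Linf_measurable[OF sp(4)] b(5)])
  qed
  have ae: "AE t in lborel. a 4 t = wderiv \<zeta> t" "AE t in lborel. a 5 t = wderiv H t" "AE t in lborel. a 6 t = wderiv U t"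
    "AE t in lborel. a 7 t = wderiv \<Gamma> t" "AE t in lborel. a 8 t = R t"
    using aeN by (eventually_elim, simp add: a)+
  have P: "primitive (a 0) (a 4)" "primitive (a 1) (a 5)" "primitive (a 2) (a 6)" "primitive (a 3) (a 7)"
    using has_weak_deriv_primitive[OF wd(1)[OF W(1)] cont(1) b5(1) ae(1)] has_weak_deriv_primitive[OF wd(1)[OF W(4)] cont(2) b5(2) ae(2)]
      has_weak_deriv_primitive[OF wd(1)[OF W(2)] cont(3) b5(3) ae(3)] has_weak_deriv_primitive[OF wd(1)[OF W(3)] cont(4) b5(4) ae(4)]
    unfolding a(1-4) by auto
  have wL: "wderiv F \<in> L2" if "F \<in> V \<or> F \<in> H1" for F
    using that weak_deriv_L2_wderiv(1) unfolding V_def H1_def by blast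
  have L: "a 4 \<in> L2" "a 5 \<in> L2" "a 6 \<in> L2" "a 7 \<in> L2" "a 8 \<in> L2" "a 2 \<in> L2" "a 3 \<in> L2"
    using L2_cong_AE(1)[OF bounded_borel_measurable[OF b5(1)] wd(3)[OF W(1)] ae(1)]
      L2_cong_AE(1)[OF bounded_borel_measurable[OF b5(2)] wd(3)[OF W(4)] ae(2)]
      L2_cong_AE(1)[OF bounded_borel_measurable[OF b5(3)] wd(3)[OF W(2)] ae(3)]
      L2_cong_AE(1)[OF bounded_borel_measurable[OF b5(4)] wd(3)[OF W(3)] ae(4)]
      L2_cong_AE(1)[OF bounded_borel_measurable[OF b5(5)] Linf_measurable[OF sp(4)] ae(5)] wL sp
    unfolding a(3,4) H1_def by blast+
  have nine: "i = 0 \<or> i = 1 \<or> i = 2 \<or> i = 3 \<or> i = 4 \<or> i = 5 \<or> i = 6 \<or> i = 7 \<or> i = 8 \<or> 9 \<le> i" for i :: nat by linarith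
  have adm: "admissible a"
    unfolding admissible_def
  proof (intro conjI allI impI)
    show "bounded_borel (a i)" for i
      using nine[of i] b4 b5 a(10)[of i] bounded_borel_const[of 0] unfolding a(1-4)[symmetric] by (elim disjE) simp_all
    show "a i \<in> L2" if "2 \<le> i \<and> i < 9" for i using nine[of i] that L by (elim disjE) simp_all
    show "primitive (a i) (a (i + 4))" if "i < 4" for i
    proof -
      have "i = 0 \<or> i = 1 \<or> i = 2 \<or> i = 3" using that by linarith
      then show ?thesis using P by (elim disjE) simp_all
    qed
    show "a i = (\<lambda>x. 0)" if "9 \<le> i" for i by (rule a(10)[OF that])
  qed
  have g: "good a"
    unfolding good_def
  proof (intro conjI allI)
    fix t
    show "0 \<le> 1 + a 4 t" "0 \<le> a 5 t" "a 8 t * (1 + a 4 t) = a 7 t"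
      "(1 + a 4 t) * a 5 t = (1 + a 4 t)\<^sup>2 * ((a 2 t)\<^sup>2 + (a 3 t)\<^sup>2 + (a 8 t)\<^sup>2) + (a 6 t)\<^sup>2"
      using \<Phi>[of t] unfolding \<Phi>_def a by auto
    show "0 < 1 + a 4 t + a 5 t"
    proof (cases "t \<in> N")
      case True
      have "0 \<le> (U t)\<^sup>2 + (\<Gamma> t)\<^sup>2" by simp
      then show ?thesis using True unfolding a by (simp add: add_pos_nonneg)
    qed (use \<Phi>[of t] in \<open>simp add: \<Phi>_def a\<close>)
    show "(a 1 \<longlongrightarrow> 0) at_bot" unfolding a by (rule G0)
  qed
  define x where "x = Abs_state a"
  have px: "pr x = a" unfolding x_def by (rule pr_Abs[OF adm])
  have "J x = X"
    unfolding J_def px J_tuple_def Xe a(1-4)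
    by (rule abs_E_eqI) (use sp ae(5) L(5) bounded_borel_Linf[OF b5(5)] in auto)
  moreover have "Linf_norm R \<le> norm X"
    unfolding Xe norm_E.abs_eq[OF rel]
    using V_norm_props(1)[OF sp(1)] V_norm_props(1)[OF sp(6)] H1_norm_props(1)[of U] H1_norm_props(1)[of \<Gamma>] L2_norm_nonneg[of R]
    by simp
  ultimately show ?thesis using g b8 by (intro exI[of _ x]) (auto simp: px intro: order_trans)
qed

section \<open>Stability in E and the flow\<close>

text \<open>An arbitrary selection, one representative per element. Two lifts are compared only
  through \<open>J\<close> of their difference, that is, in the norm of \<open>E\<close>.\<close>

definition lift :: "E \<Rightarrow> state" where
  "lift X = (SOME x. good (pr x) \<and> J x = X \<and> (\<forall>t. \<bar>pr x 8 t\<bar> \<le> norm X))"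

lemma lift:
  assumes "X \<in> G_set"
  shows "good (pr (lift X))" "J (lift X) = X" "\<bar>pr (lift X) 8 t\<bar> \<le> norm X"
  using someI_ex[OF G_set_lift[OF assms]] unfolding lift_def by blast+

lemma G_ballD: "X \<in> G_ball M \<Longrightarrow> X \<in> G_set" "X \<in> G_ball M \<Longrightarrow> norm X \<le> M"
  unfolding G_ball_def by auto

lemma lift_diff:
  assumes "X \<in> G_set" "Y \<in> G_set"
  shows "(\<lambda>t. pr (lift X) i t - pr (lift Y) i t) = pr (lift X - lift Y) i" "norm (J (lift X - lift Y)) = dist X Y"
  unfolding pr_diff J_diff lift(2)[OF assms(1)] lift(2)[OF assms(2)] dist_norm by auto

lemma lip_profiles_E: "lip_profiles (G_ball M) dist (\<lambda>X. pr (lift X))"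
proof -
  interpret lip_space "G_ball M" "dist :: E \<Rightarrow> E \<Rightarrow> real" by unfold_locales simp
  show ?thesis
  proof
    show "LB top (\<lambda>X. pr (lift X) i)" if i: "i < 4" for i
    proof (rule LB_I[of _ "4 * \<bar>M\<bar>" 4])
      fix X assume X: "X \<in> G_ball M"
      show "pr (lift X) i \<in> borel_measurable borel" by (rule bounded_borel_measurable[OF prD(1)])
      have "\<bar>pr (lift X) i t\<bar> \<le> 4 * \<bar>M\<bar>" for t
        using J_bounds(1)[OF i, of "lift X" t] lift(2)[OF G_ballD(1)[OF X]] G_ballD(2)[OF X] by simp
      then show "\<forall>\<^sub>F t in top. \<bar>pr (lift X) i t\<bar> \<le> 4 * \<bar>M\<bar>" by simp
      fix Y assume Y: "Y \<in> G_ball M"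
      note D = lift_diff[OF G_ballD(1)[OF X] G_ballD(1)[OF Y]]
      have "\<bar>pr (lift X) i t - pr (lift Y) i t\<bar> \<le> 4 * dist X Y" for t
        using J_bounds(1)[OF i, of "lift X - lift Y" t] unfolding D(2) unfolding pr_diff .
      then show "\<forall>\<^sub>F t in top. \<bar>pr (lift X) i t - pr (lift Y) i t\<bar> \<le> 4 * dist X Y" by simp
    qed simp_all
    show "LB (ae_filter lborel) (\<lambda>X. pr (lift X) 8)"
    proof (rule LB_I[of _ "\<bar>M\<bar>" 1])
      fix X assume X: "X \<in> G_ball M"
      show "pr (lift X) 8 \<in> borel_measurable borel" by (rule bounded_borel_measurable[OF prD(1)])
      have "\<bar>pr (lift X) 8 t\<bar> \<le> \<bar>M\<bar>" for t
        using lift(3)[OF G_ballD(1)[OF X], of t] G_ballD(2)[OF X] by linarith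
      then show "AE t in lborel. \<bar>pr (lift X) 8 t\<bar> \<le> \<bar>M\<bar>" by simp
      fix Y assume Y: "Y \<in> G_ball M"
      note D = lift_diff[OF G_ballD(1)[OF X] G_ballD(1)[OF Y]]
      show "AE t in lborel. \<bar>pr (lift X) 8 t - pr (lift Y) 8 t\<bar> \<le> 1 * dist X Y"
        using J_bounds(2)[of "lift X - lift Y"] unfolding D(2) unfolding pr_diff by simp
    qed simp_all
    show "LS (\<lambda>X. pr (lift X) i)" if i: "2 \<le> i" "i < 9" for i
    proof (rule LS_I[of _ "\<bar>M\<bar>" 1])
      fix X assume X: "X \<in> G_ball M"
      show "pr (lift X) i \<in> L2" by (rule prD(2)[OF i])
      show "L2_norm (pr (lift X) i) \<le> \<bar>M\<bar>"
        using J_bounds(3)[OF i, of "lift X"] lift(2)[OF G_ballD(1)[OF X]] G_ballD(2)[OF X] by simp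
      fix Y assume Y: "Y \<in> G_ball M"
      note D = lift_diff[OF G_ballD(1)[OF X] G_ballD(1)[OF Y]]
      show "L2_norm (\<lambda>t. pr (lift X) i t - pr (lift Y) i t) \<le> 1 * dist X Y"
        using J_bounds(3)[OF i, of "lift X - lift Y"] unfolding D by simp
    qed simp_all
  qed
qed

text \<open>On \<open>G_set\<close> the value does not depend on the chosen lift, by
  \<open>lagrangian_rhs_J\<close> and \<open>lagrangian_rhs_unique\<close>.\<close>

definition vfE :: "E \<Rightarrow> E" where "vfE X = J (vf (lift X))"

lemma lagrangian_rhs_vfE: "X \<in> G_set \<Longrightarrow> lagrangian_rhs X (vfE X)"
  using lagrangian_rhs_J[of "lift X"] unfolding vfE_def by (simp add: lift(2))

lemma vfE_lipschitz:
  "\<exists>L\<ge>0. \<forall>X\<in>G_ball M. \<forall>Y\<in>G_ball M. norm (vfE X - vfE Y) \<le> L * norm (X - Y)"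
proof -
  interpret lip_profiles "G_ball M" dist "\<lambda>X. pr (lift X)" by (rule lip_profiles_E)
  have "\<exists>C\<ge>0. \<forall>X\<in>G_ball M. \<forall>Y\<in>G_ball M. \<forall>t. \<bar>rhs (pr (lift X)) i t - rhs (pr (lift Y)) i t\<bar> \<le> C * dist X Y"
    if "i < 4 \<or> i = 8" for i
    using rhs_LB[OF that] unfolding LB_def by simp blast
  then obtain C where C: "\<And>i. i < 4 \<or> i = 8 \<Longrightarrow> 0 \<le> C i"
    "\<And>i X Y t. i < 4 \<or> i = 8 \<Longrightarrow> X \<in> G_ball M \<Longrightarrow> Y \<in> G_ball M \<Longrightarrow>
       \<bar>rhs (pr (lift X)) i t - rhs (pr (lift Y)) i t\<bar> \<le> C i * dist X Y"
    by metis
  have "\<exists>C\<ge>0. \<forall>X\<in>G_ball M. \<forall>Y\<in>G_ball M. L2_norm (\<lambda>t. rhs (pr (lift X)) i t - rhs (pr (lift Y)) i t) \<le> C * dist X Y"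
    if "2 \<le> i" "i < 9" for i
    using rhs_LS[OF that] unfolding LS_def by blast
  then obtain C' where C': "\<And>i. 2 \<le> i \<Longrightarrow> i < 9 \<Longrightarrow> 0 \<le> C' i"
    "\<And>i X Y. 2 \<le> i \<Longrightarrow> i < 9 \<Longrightarrow> X \<in> G_ball M \<Longrightarrow> Y \<in> G_ball M \<Longrightarrow>
       L2_norm (\<lambda>t. rhs (pr (lift X)) i t - rhs (pr (lift Y)) i t) \<le> C' i * dist X Y"
    by metis
  define K where "K = C 0 + C 1 + C 8 + (\<Sum>i=2..<9. C' i)"
  have s: "0 \<le> (\<Sum>i=2..<9. C' i)" using C'(1) by (intro sum_nonneg) auto
  have c: "0 \<le> C 0" "0 \<le> C 1" "0 \<le> C 8" by (rule C(1), simp)+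
  have K1: "C 0 \<le> K" "C 1 \<le> K" "C 8 \<le> K" using s c unfolding K_def by linarith+
  have K2: "C' i \<le> K" if "2 \<le> i" "i < 9" for i
  proof -
    have "C' i \<le> (\<Sum>i=2..<9. C' i)" using that C'(1) by (intro member_le_sum) auto
    then show ?thesis using c unfolding K_def by linarith
  qed
  show ?thesis
  proof (intro exI[of _ "10 * K"] conjI ballI)
    show "0 \<le> 10 * K" using c s unfolding K_def by simp
    fix X Y assume XY: "X \<in> G_ball M" "Y \<in> G_ball M"
    have "norm (J (vf (lift X) - vf (lift Y))) \<le> 10 * (K * dist X Y)"
    proof (rule norm_J_le)
      show "\<bar>pr (vf (lift X) - vf (lift Y)) 0 t\<bar> \<le> K * dist X Y" for t
        unfolding pr_diff pr_vf using order_trans[OF C(2)[OF _ XY, of 0 t] mult_right_mono[OF K1(1) zero_le_dist]] by simp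
      show "\<bar>pr (vf (lift X) - vf (lift Y)) 1 t\<bar> \<le> K * dist X Y" for t
        unfolding pr_diff pr_vf using order_trans[OF C(2)[OF _ XY, of 1 t] mult_right_mono[OF K1(2) zero_le_dist]] by simp
      show "\<bar>pr (vf (lift X) - vf (lift Y)) 8 t\<bar> \<le> K * dist X Y" for t
        unfolding pr_diff pr_vf using order_trans[OF C(2)[OF _ XY, of 8 t] mult_right_mono[OF K1(3) zero_le_dist]] by simp
      show "L2_norm (pr (vf (lift X) - vf (lift Y)) i) \<le> K * dist X Y" if i: "2 \<le> i" "i < 9" for i
        unfolding pr_diff pr_vf by (rule order_trans[OF C'(2)[OF i XY] mult_right_mono[OF K2[OF i] zero_le_dist]])
    qed
    then show "norm (vfE X - vfE Y) \<le> 10 * K * norm (X - Y)"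
      unfolding vfE_def J_diff dist_norm by (simp add: mult.assoc)
  qed
qed

lemma continuous_vf: "continuous_on UNIV vf"
proof -
  have "isCont vf x" for x
  proof -
    obtain L where L: "\<And>y z. norm y \<le> norm x + 1 \<Longrightarrow> norm z \<le> norm x + 1 \<Longrightarrow> norm (vf y - vf z) \<le> L * norm (y - z)"
      using vf_lipschitz[of "norm x + 1"] by blast
    have "continuous_on (ball x 1) vf"
    proof (rule lipschitz_on_continuous_on[where L="max 0 L"], rule lipschitz_onI)
      fix y z assume "y \<in> ball x 1" "z \<in> ball x 1"
      then have "norm y \<le> norm x + 1" "norm z \<le> norm x + 1"
        using norm_triangle_sub[of y x] norm_triangle_sub[of z x] by (auto simp: dist_norm norm_minus_commute)
      then have "norm (vf y - vf z) \<le> L * norm (y - z)" by (rule L)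
      also have "\<dots> \<le> max 0 L * norm (y - z)" by (rule mult_right_mono) auto
      finally show "dist (vf y) (vf z) \<le> max 0 L * dist y z" by (simp add: dist_norm)
    qed simp
    then show ?thesis by (rule continuous_on_interior) simp
  qed
  then show ?thesis by (simp add: continuous_at_imp_continuous_on)
qed

section \<open>Global solutions in \<open>E\<close>: existence, uniqueness, uniform bounds\<close>

lemma ode_on_of_global:
  assumes "\<And>t. 0 \<le> t \<Longrightarrow> (x has_vector_derivative F (x t)) (at t within {0..})"
  shows "ode_on F x T"
  unfolding ode_on_def
  using assms by (auto intro: has_vector_derivative_within_subset[of x _ _ "{0..}" "{0..T}"])

lemma global_solution_exists:
  assumes X0: "X0 \<in> G_set"
  shows "\<exists>x. x 0 = lift X0 \<and> (\<forall>t. good_solution x \<bar>t\<bar>) \<and> global_solution X0 (\<lambda>t. J (x t))"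
proof -
  obtain x where x: "x 0 = lift X0" "\<And>t. 0 \<le> t \<Longrightarrow> (x has_vector_derivative vf (x t)) (at t within {0..})"
    using state_global_solution[OF lift(1)[OF X0]] by blast
  \<comment> \<open>The locale requires a nonnegative horizon; the absolute value supplies one for
    every real t.\<close>
  have gs: "good_solution x \<bar>t\<bar>" for t
    by unfold_locales (use ode_on_of_global[of x vf, OF x(2)] lift(1)[OF X0] x(1) in auto)
  have "global_solution X0 (\<lambda>t. J (x t))"
    unfolding global_solution_def
  proof (intro conjI allI impI exI)
    show "J (x 0) = X0" unfolding x(1) by (rule lift(2)[OF X0])
    show "J (x t) \<in> G_set" if "t > 0" for t
      by (rule good_J) (use good_solution.good_preserved[OF gs, of t t] that in simp)
    have cx: "continuous_on {0..} x"
      using x(2) has_vector_derivative_continuous continuous_on_eq_continuous_within by (metis atLeast_iff)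
    show "continuous_on {0..} (\<lambda>t. J (vf (x t)))"
      by (intro bounded_linear.continuous_on[OF bounded_linear_J] continuous_on_compose2[OF continuous_vf cx]) simp
    show "((\<lambda>t. J (x t)) has_vector_derivative J (vf (x t))) (at t within {0..})" if "0 \<le> t" for t
      by (rule bounded_linear.has_vector_derivative[OF bounded_linear_J x(2)[OF that]])
    show "lagrangian_rhs (J (x t)) (J (vf (x t)))" for t by (rule lagrangian_rhs_J)
  qed
  then show ?thesis using x(1) gs by blast
qed

lemma global_solutionD:
  assumes X: "global_solution X0 X" and X0: "X0 \<in> G_set"
  shows "X 0 = X0" "0 \<le> t \<Longrightarrow> X t \<in> G_set" "0 \<le> t \<Longrightarrow> (X has_vector_derivative vfE (X t)) (at t within {0..})"
    "continuous_on {0..} X"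
proof -
  show 0: "X 0 = X0" using X unfolding global_solution_def by blast
  show G: "0 \<le> t \<Longrightarrow> X t \<in> G_set" for t
    using X X0 0 unfolding global_solution_def by (cases "t = 0") auto
  show d: "0 \<le> t \<Longrightarrow> (X has_vector_derivative vfE (X t)) (at t within {0..})" for t
  proof -
    assume t: "0 \<le> t"
    then obtain D where D: "(X has_vector_derivative D) (at t within {0..})" "lagrangian_rhs (X t) D"
      using X unfolding global_solution_def by blast
    have "D = vfE (X t)" by (rule lagrangian_rhs_unique[OF D(2) lagrangian_rhs_vfE[OF G[OF t]]])
    then show ?thesis using D(1) by simp
  qed
  show "continuous_on {0..} X"
    unfolding continuous_on_eq_continuous_within using d has_vector_derivative_continuous by blast
qed

lemma global_solution_stable:
  assumes L: "0 \<le> L" "\<And>X Y. X \<in> G_ball N \<Longrightarrow> Y \<in> G_ball N \<Longrightarrow> norm (vfE X - vfE Y) \<le> L * norm (X - Y)"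
    and X: "global_solution X0 X" "X0 \<in> G_set" and Y: "global_solution Y0 Y" "Y0 \<in> G_set"
    and b: "\<And>s. s \<in> {0..T} \<Longrightarrow> norm (X s) \<le> N" "\<And>s. s \<in> {0..T} \<Longrightarrow> norm (Y s) \<le> N"
    and t: "t \<in> {0..T}"
  shows "norm (X t - Y t) \<le> exp (L * T) * norm (X0 - Y0)"
proof -
  note XD = global_solutionD[OF X] and YD = global_solutionD[OF Y]
  have "norm (X t - Y t) \<le> (norm (X 0 - Y 0) + 0 * t) * exp (L * t)"
  proof (rule gronwall_norm[where x="\<lambda>s. X s - Y s" and x'="\<lambda>s. vfE (X s) - vfE (Y s)"])
    fix s assume s: "s \<in> {0..T}"
    have "(X has_vector_derivative vfE (X s)) (at s within {0..T})" "(Y has_vector_derivative vfE (Y s)) (at s within {0..T})"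
      by (rule has_vector_derivative_within_subset[OF XD(3)] has_vector_derivative_within_subset[OF YD(3)]; use s in auto)+
    then show "((\<lambda>s. X s - Y s) has_vector_derivative vfE (X s) - vfE (Y s)) (at s within {0..T})"
      by (rule has_vector_derivative_diff)
    have "X s \<in> G_ball N" "Y s \<in> G_ball N"
      unfolding G_ball_def using XD(2) YD(2) b[OF s] s by auto
    then show "norm (vfE (X s) - vfE (Y s)) \<le> L * norm (X s - Y s) + 0" using L(2) by simp
  qed (use L t in auto)
  also have "\<dots> = exp (L * t) * norm (X0 - Y0)" unfolding XD(1) YD(1) by simp
  also have "\<dots> \<le> exp (L * T) * norm (X0 - Y0)"
    by (rule mult_right_mono) (use t L(1) in \<open>auto intro: mult_left_mono\<close>)
  finally show ?thesis .
qed

lemma global_solution_unique: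
  assumes X: "global_solution X0 X" and Y: "global_solution X0 Y" and X0: "X0 \<in> G_set" and t: "0 \<le> t"
  shows "X t = Y t"
proof -
  have bd: "\<exists>N. \<forall>s\<in>{0..t}. norm (Z s) \<le> N" if "global_solution X0 Z" for Z
  proof -
    have "bounded (Z ` {0..t})"
      by (intro compact_imp_bounded compact_continuous_image continuous_on_subset[OF global_solutionD(4)[OF that X0]]) auto
    then show ?thesis unfolding bounded_iff by auto
  qed
  obtain N1 N2 where N: "\<forall>s\<in>{0..t}. norm (X s) \<le> N1" "\<forall>s\<in>{0..t}. norm (Y s) \<le> N2" using bd[OF X] bd[OF Y] by blast
  obtain L where L: "0 \<le> L" "\<And>X Y. X \<in> G_ball (max N1 N2) \<Longrightarrow> Y \<in> G_ball (max N1 N2) \<Longrightarrow> norm (vfE X - vfE Y) \<le> L * norm (X - Y)"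
    using vfE_lipschitz by blast
  have "norm (X t - Y t) \<le> exp (L * t) * norm (X0 - X0)"
    by (rule global_solution_stable[OF L X X0 Y X0]) (use N t in \<open>auto simp: le_max_iff_disj\<close>)
  then show ?thesis by simp
qed

text \<open>The state norm of a lift is not controlled by the norm in \<open>E\<close>, so Gronwall
  is repeated here in \<open>E\<close>. This closes because the L^2 clause of
  \<open>growth_bound\<close> contains only L^2 norms, which \<open>J_bounds\<close> dominates. The
  data size becomes 4 M by the Sobolev factor of \<open>J_bounds\<close>, and 10 * 7 counts the
  terms of the norm and the L^2 components.\<close>

lemma global_solution_bound:
  assumes M: "0 \<le> M" and T: "0 \<le> T"
  shows "\<exists>N. \<forall>X0\<in>G_ball M. \<forall>X. global_solution X0 X \<longrightarrow> (\<forall>t\<in>{0..T}. norm (X t) \<le> N)"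
proof -
  have M4: "0 \<le> 4 * M" using M by simp
  obtain B where gb: "growth_bound (4 * M) T B" using growth_bound_exists[OF M4 T] by blast
  then have B: "0 \<le> B" unfolding growth_bound_def by blast
  define K where "K = 10 * (7 * B)"
  have K: "0 \<le> K" unfolding K_def using B by simp
  have "norm (X t) \<le> (M + K * T) * exp (K * T)"
    if X0: "X0 \<in> G_ball M" and X: "global_solution X0 X" and t: "t \<in> {0..T}" for X0 X t
  proof -
    have G: "X0 \<in> G_set" by (rule G_ballD(1)[OF X0])
    obtain x where x: "x 0 = lift X0" "\<And>t. good_solution x \<bar>t\<bar>" "global_solution X0 (\<lambda>t. J (x t))"
      using global_solution_exists[OF G] by blast
    have gs: "good_solution x T" using x(2)[of T] T by simp
    have J4: "\<bar>pr (lift X0) i \<xi>\<bar> \<le> 4 * M" if "i < 4" for i \<xi>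
      using J_bounds(1)[OF that, of "lift X0" \<xi>] lift(2)[OF G] G_ballD(2)[OF X0] by simp
    have d: "\<bar>pr (x 0) 0 \<xi>\<bar> \<le> 4 * M" "pr (x 0) 1 \<xi> \<le> 4 * M" "\<bar>pr (x 0) 8 \<xi>\<bar> \<le> 4 * M" for \<xi>
      using J4[of 0 \<xi>] J4[of 1 \<xi>] lift(3)[OF G, of \<xi>] G_ballD(2)[OF X0] M unfolding x(1) by simp_all
    note g = growth_boundD[OF gb gs order_refl d]
    have growth: "norm (J (vf (x s))) \<le> K * norm (J (x s)) + K" if s: "s \<in> {0..T}" for s
    proof -
      let ?C = "7 * B * (norm (J (x s)) + 1)"
      have p: "0 \<le> B * norm (J (x s))" using B by simp
      have BC: "B \<le> ?C" "7 * B * norm (J (x s)) \<le> ?C" using p B by (simp_all add: distrib_left)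
      have "norm (J (vf (x s))) \<le> 10 * ?C"
      proof (rule norm_J_le)
        show "\<bar>pr (vf (x s)) 0 \<xi>\<bar> \<le> ?C" "\<bar>pr (vf (x s)) 1 \<xi>\<bar> \<le> ?C" "\<bar>pr (vf (x s)) 8 \<xi>\<bar> \<le> ?C" for \<xi>
          unfolding pr_vf by (rule order_trans[OF g(2)[OF s] BC(1)], simp)+
        show "L2_norm (pr (vf (x s)) i) \<le> ?C" if i: "2 \<le> i" "i < 9" for i
        proof -
          have "L2_norm (pr (vf (x s)) i) \<le> B * (\<Sum>j=2..<9. L2_norm (pr (x s) j))"
            unfolding pr_vf by (rule g(4)[OF s i])
          also have "\<dots> \<le> B * (\<Sum>j=2..<(9::nat). norm (J (x s)))"
            by (intro mult_left_mono[OF _ B] sum_mono J_bounds(3)) auto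
          also have "\<dots> = 7 * B * norm (J (x s))" by simp
          also have "\<dots> \<le> ?C" by (rule BC(2))
          finally show ?thesis .
        qed
      qed
      then show ?thesis unfolding K_def by (simp add: algebra_simps)
    qed
    have "norm (J (x t)) \<le> (norm (J (x 0)) + K * t) * exp (K * t)"
    proof (rule gronwall_norm[where x="\<lambda>s. J (x s)" and x'="\<lambda>s. J (vf (x s))"])
      fix s assume s: "s \<in> {0..T}"
      have "(x has_vector_derivative vf (x s)) (at s within {0..T})"
        using gs s unfolding good_solution_def ode_on_def by blast
      then show "((\<lambda>s. J (x s)) has_vector_derivative J (vf (x s))) (at s within {0..T})"
        by (rule bounded_linear.has_vector_derivative[OF bounded_linear_J])
      show "norm (J (vf (x s))) \<le> K * norm (J (x s)) + K" by (rule growth[OF s])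
    qed (use K t in auto)
    also have "\<dots> \<le> (M + K * T) * exp (K * T)"
    proof (rule mult_mono)
      have Kt: "K * t \<le> K * T" by (rule mult_left_mono[OF _ K]) (use t in simp)
      then show "exp (K * t) \<le> exp (K * T)" by (simp only: exp_le_cancel_iff)
      show "norm (J (x 0)) + K * t \<le> M + K * T"
        using Kt lift(2)[OF G] G_ballD(2)[OF X0] unfolding x(1) by simp
      show "0 \<le> M + K * T" using M K T by simp
    qed simp
    also have "J (x t) = X t" by (rule global_solution_unique[OF x(3) X G]) (use t in simp)
    finally show ?thesis .
  qed
  then show ?thesis by blast
qed

section \<open>The flow as a continuous semigroup\<close>

lemma flow_eq:
  assumes X: "global_solution X0 X" and X0: "X0 \<in> G_set" and t: "0 \<le> t"
  shows "flow t X0 = X t"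
proof -
  have "global_solution X0 (SOME X. global_solution X0 X)" using X by (rule someI[of "global_solution X0"])
  then show ?thesis unfolding flow_def by (rule global_solution_unique[OF _ X X0 t])
qed

lemma flow_lipschitz:
  assumes M: "0 \<le> M" and T: "0 \<le> T"
  shows "\<exists>C>0. \<forall>X0\<in>G_ball M. \<forall>Y0\<in>G_ball M. \<forall>t\<in>{0..T}. norm (flow t X0 - flow t Y0) \<le> C * norm (X0 - Y0)"
proof -
  obtain N where N: "\<And>X0 X t. X0 \<in> G_ball M \<Longrightarrow> global_solution X0 X \<Longrightarrow> t \<in> {0..T} \<Longrightarrow> norm (X t) \<le> N"
    using global_solution_bound[OF M T] by blast
  obtain L where L: "0 \<le> L" "\<And>X Y. X \<in> G_ball N \<Longrightarrow> Y \<in> G_ball N \<Longrightarrow> norm (vfE X - vfE Y) \<le> L * norm (X - Y)"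
    using vfE_lipschitz by blast
  have "norm (flow t X0 - flow t Y0) \<le> exp (L * T) * norm (X0 - Y0)"
    if X0: "X0 \<in> G_ball M" and Y0: "Y0 \<in> G_ball M" and t: "t \<in> {0..T}" for X0 Y0 t
  proof -
    note G = G_ballD(1)[OF X0] G_ballD(1)[OF Y0]
    obtain x where x: "global_solution X0 (\<lambda>t. J (x t))" using global_solution_exists[OF G(1)] by blast
    obtain y where y: "global_solution Y0 (\<lambda>t. J (y t))" using global_solution_exists[OF G(2)] by blast
    have t0: "0 \<le> t" using t by simp
    show ?thesis
      unfolding flow_eq[OF x G(1) t0] flow_eq[OF y G(2) t0]
      by (rule global_solution_stable[OF L x G(1) y G(2) N[OF X0 x] N[OF Y0 y] t])
  qed
  then show ?thesis by (intro exI[of _ "exp (L * T)"]) auto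
qed

text \<open>The system is autonomous; together with uniqueness this gives the semigroup law.\<close>

lemma global_solution_shift:
  assumes X: "global_solution X0 X" and X0: "X0 \<in> G_set" and s: "0 \<le> s"
  shows "global_solution (X s) (\<lambda>t. X (t + s))"
proof -
  obtain X' where X': "continuous_on {0..} X'" "\<And>t. 0 \<le> t \<Longrightarrow> (X has_vector_derivative X' t) (at t within {0..})"
    "\<And>t. 0 \<le> t \<Longrightarrow> lagrangian_rhs (X t) (X' t)"
    using X unfolding global_solution_def by blast
  show ?thesis
    unfolding global_solution_def
  proof (intro conjI allI impI exI)
    show "X (0 + s) = X s" by simp
    show "X (t + s) \<in> G_set" if "t > 0" for t using global_solutionD(2)[OF X X0] that s by simp
    show "continuous_on {0..} (\<lambda>t. X' (t + s))"
      by (rule continuous_on_compose2[OF X'(1)]) (use s in \<open>auto intro!: continuous_intros\<close>)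
    fix t :: real assume t: "0 \<le> t"
    show "lagrangian_rhs (X (t + s)) (X' (t + s))" using X'(3) t s by simp
    have "((\<lambda>t. t + s) has_vector_derivative 1) (at t within {0..})"
      by (auto intro!: derivative_eq_intros)
    moreover have "(X has_vector_derivative X' (t + s)) (at (t + s) within (\<lambda>t. t + s) ` {0..})"
      by (rule has_vector_derivative_within_subset[OF X'(2)]) (use t s in auto)
    ultimately have "((X \<circ> (\<lambda>t. t + s)) has_vector_derivative 1 *\<^sub>R X' (t + s)) (at t within {0..})"
      by (rule vector_diff_chain_within)
    then show "((\<lambda>t. X (t + s)) has_vector_derivative X' (t + s)) (at t within {0..})" by (simp add: o_def)
  qed
qed

lemma continuous_flow: "continuous_on (G_set \<times> {0..}) (\<lambda>(X\<^sub>0, t). flow t X\<^sub>0)"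
  unfolding continuous_on_iff
proof (intro ballI allI impI)
  fix p :: "E \<times> real" and e :: real
  assume "p \<in> G_set \<times> {0..}" and e: "0 < e"
  then obtain X0 t0 where p: "p = (X0, t0)" and G: "X0 \<in> G_set" and t0: "t0 \<in> {0..}" by blast
  obtain x where x: "global_solution X0 (\<lambda>t. J (x t))" using global_solution_exists[OF G] by blast
  \<comment> \<open>Data within distance 1 of X0 lie in this ball and times within 1 of t0 stay
    below t0 + 1, so a single Lipschitz constant serves the whole neighbourhood.\<close>
  define M where "M = norm X0 + 1"
  obtain C where C: "C > 0" "\<And>X0 Y0 t. X0 \<in> G_ball M \<Longrightarrow> Y0 \<in> G_ball M \<Longrightarrow> t \<in> {0..t0 + 1} \<Longrightarrow>
      norm (flow t X0 - flow t Y0) \<le> C * norm (X0 - Y0)"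
    using flow_lipschitz[of M "t0 + 1"] t0 unfolding M_def by auto
  obtain d where d: "d > 0" "\<And>t. t \<in> {0..} \<Longrightarrow> dist t t0 < d \<Longrightarrow> dist (J (x t)) (J (x t0)) < e / 2"
    using global_solutionD(4)[OF x G] t0 e unfolding continuous_on_iff by (meson half_gt_zero)
  \<comment> \<open>Half of e is spent on the change of data, at Lipschitz rate C, and half on the
    change of time along the single trajectory from X0.\<close>
  define \<delta> where "\<delta> = min (min 1 d) (e / (2 * C))"
  have \<delta>: "\<delta> > 0" "\<delta> \<le> 1" "\<delta> \<le> d" "\<delta> \<le> e / (2 * C)" using C(1) d(1) e unfolding \<delta>_def by auto
  have "dist (flow t Y) (flow t0 X0) < e"
    if Y: "Y \<in> G_set" and t: "t \<in> {0..}" and dist: "dist (Y, t) (X0, t0) < \<delta>" for Y t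
  proof -
    have dY: "norm (Y - X0) < \<delta>" and dt: "dist t t0 < \<delta>"
      using order.strict_trans1[OF dist_fst_le dist] order.strict_trans1[OF dist_snd_le dist] by (simp_all add: dist_norm)
    have YM: "Y \<in> G_ball M" "X0 \<in> G_ball M"
      using Y G norm_triangle_sub[of Y X0] dY \<delta>(2) unfolding G_ball_def M_def by auto
    have tt: "t \<in> {0..t0 + 1}" using t dt \<delta>(2) by (auto simp: dist_real_def)
    have "norm (flow t Y - flow t X0) \<le> C * norm (Y - X0)" by (rule C(2)[OF YM tt])
    also have "\<dots> < C * (e / (2 * C))" using dY \<delta>(4) C(1) by (intro mult_strict_left_mono) auto
    also have "\<dots> = e / 2" using C(1) by simp
    finally have 1: "dist (flow t Y) (flow t X0) < e / 2" by (simp add: dist_norm)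
    have 2: "dist (flow t X0) (flow t0 X0) < e / 2"
      using d(2)[OF t] dt \<delta>(3) flow_eq[OF x G] t t0 by simp
    show ?thesis using dist_triangle[of "flow t Y" "flow t0 X0" "flow t X0"] 1 2 by linarith
  qed
  then show "\<exists>d>0. \<forall>x'\<in>G_set \<times> {0..}. dist x' p < d \<longrightarrow>
      dist (case x' of (X\<^sub>0, t) \<Rightarrow> flow t X\<^sub>0) (case p of (X\<^sub>0, t) \<Rightarrow> flow t X\<^sub>0) < e"
    unfolding p using \<delta>(1) by (intro exI[of _ \<delta>]) auto
qed

theorem theorem2p1:
  shows "(\<forall>X\<^sub>0\<in>G_set. (\<exists>X. global_solution X\<^sub>0 X) \<and>
            (\<forall>X Y. global_solution X\<^sub>0 X \<longrightarrow> global_solution X\<^sub>0 Y \<longrightarrow> (\<forall>t\<ge>0. X t = Y t)))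
       \<and> (\<forall>X\<^sub>0\<in>G_set. \<forall>t\<ge>0. flow t X\<^sub>0 \<in> G_set)
       \<and> (\<forall>X\<^sub>0\<in>G_set. flow 0 X\<^sub>0 = X\<^sub>0)
       \<and> (\<forall>X\<^sub>0\<in>G_set. \<forall>t\<ge>0. \<forall>s\<ge>0. flow (t + s) X\<^sub>0 = flow t (flow s X\<^sub>0))
       \<and> continuous_on (G_set \<times> {0..}) (\<lambda>(X\<^sub>0, t). flow t X\<^sub>0)
       \<and> (\<forall>M>0. \<forall>T>0. \<exists>C>0. \<forall>X\<^sub>\<alpha>\<in>G_ball M. \<forall>X\<^sub>\<beta>\<in>G_ball M. \<forall>t\<in>{0..T}.
            norm (flow t X\<^sub>\<alpha> - flow t X\<^sub>\<beta>) \<le> C * norm (X\<^sub>\<alpha> - X\<^sub>\<beta>))"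
proof (intro conjI)
  have sol: "\<exists>X. global_solution X0 X" if "X0 \<in> G_set" for X0
    using global_solution_exists[OF that] by blast
  show "\<forall>X\<^sub>0\<in>G_set. (\<exists>X. global_solution X\<^sub>0 X) \<and>
      (\<forall>X Y. global_solution X\<^sub>0 X \<longrightarrow> global_solution X\<^sub>0 Y \<longrightarrow> (\<forall>t\<ge>0. X t = Y t))"
    using sol global_solution_unique by blast
  show "\<forall>X\<^sub>0\<in>G_set. \<forall>t\<ge>0. flow t X\<^sub>0 \<in> G_set"
    using sol flow_eq global_solutionD(2) by metis
  show "\<forall>X\<^sub>0\<in>G_set. flow 0 X\<^sub>0 = X\<^sub>0"
    using sol flow_eq[OF _ _ order_refl] global_solutionD(1) by metis
  show "\<forall>X\<^sub>0\<in>G_set. \<forall>t\<ge>0. \<forall>s\<ge>0. flow (t + s) X\<^sub>0 = flow t (flow s X\<^sub>0)"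
  proof (intro ballI allI impI)
    fix X0 and t s :: real assume G: "X0 \<in> G_set" and t: "0 \<le> t" and s: "0 \<le> s"
    obtain X where X: "global_solution X0 X" using sol[OF G] by blast
    have "flow t (X s) = X (t + s)"
      by (rule flow_eq[OF global_solution_shift[OF X G s] global_solutionD(2)[OF X G s] t])
    then show "flow (t + s) X0 = flow t (flow s X0)"
      using flow_eq[OF X G s] flow_eq[OF X G, of "t + s"] t s by simp
  qed
  show "continuous_on (G_set \<times> {0..}) (\<lambda>(X\<^sub>0, t). flow t X\<^sub>0)" by (rule continuous_flow)
  show "\<forall>M>0. \<forall>T>0. \<exists>C>0. \<forall>X\<^sub>\<alpha>\<in>G_ball M. \<forall>X\<^sub>\<beta>\<in>G_ball M. \<forall>t\<in>{0..T}.
      norm (flow t X\<^sub>\<alpha> - flow t X\<^sub>\<beta>) \<le> C * norm (X\<^sub>\<alpha> - X\<^sub>\<beta>)"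
    using flow_lipschitz less_imp_le by blast
qed

end
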